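(* Let $R$ be a (commutative noetherian) local ring and let $M$ and $P$ be complexes of $R$-modules. If $\operatorname{pd}_R P$ is finite and $\mathrm{H}(P)$ is nonzero and finitely generated, then $$\operatorname{depth}_R M=\operatorname{depth}_R(M\otimes^{\mathbf{L}}_R P)+\operatorname{pd}_R P .$$
   Context: Complexes are graded homologically and $M$ may be unbounded. $\mathrm{H}(P)$ finitely generated means that it is bounded and each $\mathrm{H}_i(P)$ is a finitely generated $R$-module. $M\otimes^{\mathbf L}_R P$ is the derived tensor product; here it is $M\otimes_R F$ with $F$ any finite free resolution of $P$. For a complex $P$ with homology bounded below, $\operatorname{pd}_RP$ is the infimum, over all bounded below complexes $F$ of projective modules isomorphic to $P$ in the derived category, of $\sup\{\ell\mid F_\ell\neq0\}$. For a complex $M$ over a local ring $(R,\mathfrak m,k)$, $\operatorname{depth}_R M\in\mathbb{Z}\cup\{\pm\infty\}$ is defined by any of the following equal quantities: $n-\sup\{\ell\mid \mathrm{H}_\ell(K\otimes_RM)\ne0\}$, with $K$ the Koszul complex on a sequence of $n$ generators of $\mathfrak m$; $\inf\{\ell\mid\operatorname{Ext}^\ell_R(k,M)\neq0\}$, where $\operatorname{Ext}^\ell_R(k,M)=\mathrm{H}_{-\ell}(\mathbf{R}\mathrm{Hom}_R(k,M))$; $\inf\{\ell\mid \mathrm{H}^\ell_{\mathfrak m}(M)\ne0\}$ (local cohomology). Conventions: $\sup\emptyset=-\infty$, $\inf\emptyset=\infty$. *)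

theory Defs
  imports "HOL-Algebra.Module" "HOL-Algebra.Ring_Divisibility" "HOL-Library.Extended_Real"
begin

section \<open>Modules over a commutative ring\<close>

text \<open>Modules are records of type \<open>('a, 'b) module\<close>, with \<open>module R M\<close> the module axioms. The
  multiplicative fields \<open>mult\<close> and \<open>one\<close> of such a record are not used by the axioms; where a
  module is constructed below, they are left unspecified.\<close>

definition regular_module :: "('a, 'c) ring_scheme \<Rightarrow> ('a, 'a) module" where
  "regular_module R = \<lparr>carrier = carrier R, monoid.mult = monoid.mult R, one = \<one>\<^bsub>R\<^esub>,
     zero = \<zero>\<^bsub>R\<^esub>, add = add R, smult = monoid.mult R\<rparr>"

definition linear_maps ::
    "('a, 'c) ring_scheme \<Rightarrow> ('a, 'm) module \<Rightarrow> ('a, 'n) module \<Rightarrow> ('m \<Rightarrow> 'n) set" where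
  "linear_maps R M N = {f \<in> carrier M \<rightarrow> carrier N.
     (\<forall>x\<in>carrier M. \<forall>y\<in>carrier M. f (x \<oplus>\<^bsub>M\<^esub> y) = f x \<oplus>\<^bsub>N\<^esub> f y) \<and>
     (\<forall>r\<in>carrier R. \<forall>x\<in>carrier M. f (r \<odot>\<^bsub>M\<^esub> x) = r \<odot>\<^bsub>N\<^esub> f x)}"

definition nonzero_module :: "('a, 'm) module \<Rightarrow> bool" where
  "nonzero_module M \<longleftrightarrow> carrier M \<noteq> {\<zero>\<^bsub>M\<^esub>}"

definition fin_gen_module :: "('a, 'c) ring_scheme \<Rightarrow> ('a, 'm) module \<Rightarrow> bool" where
  "fin_gen_module R M \<longleftrightarrow> module R M \<and>
     (\<exists>B \<subseteq> carrier M. finite B \<and>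
        (\<forall>x\<in>carrier M. \<exists>c \<in> B \<rightarrow> carrier R. x = (\<Oplus>\<^bsub>M\<^esub>b\<in>B. c b \<odot>\<^bsub>M\<^esub> b)))"

definition finite_free_module :: "('a, 'c) ring_scheme \<Rightarrow> ('a, 'm) module \<Rightarrow> bool" where
  "finite_free_module R M \<longleftrightarrow> module R M \<and>
     (\<exists>B \<subseteq> carrier M. finite B \<and>
        (\<forall>x\<in>carrier M. \<exists>!c. c \<in> B \<rightarrow>\<^sub>E carrier R \<and> x = (\<Oplus>\<^bsub>M\<^esub>b\<in>B. c b \<odot>\<^bsub>M\<^esub> b)))"

text \<open>Projectivity of \<open>Q\<close> is the lifting property against surjections \<open>g : N \<rightarrow> N'\<close>. The element
  types of the test modules are fixed because a definition cannot quantify over types. This is no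
  restriction: \<open>N' = Q\<close> and \<open>N\<close> the free module on the set \<open>carrier Q\<close> (functions \<open>'q \<Rightarrow> 'a\<close> of
  finite support) are among them, so \<open>Q\<close> is a direct summand of a free module and hence lifts
  against all surjections.\<close>

definition projective_module :: "('a, 'c) ring_scheme \<Rightarrow> ('a, 'q) module \<Rightarrow> bool" where
  "projective_module R Q \<longleftrightarrow> module R Q \<and>
     (\<forall>(N :: ('a, 'q \<Rightarrow> 'a) module) (N' :: ('a, 'q) module).
        module R N \<longrightarrow> module R N' \<longrightarrow>
        (\<forall>g\<in>linear_maps R N N'. \<forall>h\<in>linear_maps R Q N'. g ` carrier N = carrier N' \<longrightarrow>
           (\<exists>l\<in>linear_maps R Q N. \<forall>x\<in>carrier Q. g (l x) = h x)))"

definition quot_module :: "('a, 'm) module \<Rightarrow> 'm set \<Rightarrow> ('a, 'm set) module" where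
  "quot_module M N = \<lparr>carrier = a_rcosets\<^bsub>M\<^esub> N, monoid.mult = undefined, one = undefined,
     zero = N, add = set_add M, smult = (\<lambda>r X. \<Union>x\<in>X. N +>\<^bsub>M\<^esub> (r \<odot>\<^bsub>M\<^esub> x))\<rparr>"

definition submodule_gen ::
    "('a, 'c) ring_scheme \<Rightarrow> ('a, 'm) module \<Rightarrow> 'm set \<Rightarrow> 'm set" where
  "submodule_gen R M S = \<Inter>{N. submodule N R M \<and> S \<subseteq> N}"

definition product_module :: "('i \<Rightarrow> ('a, 'm) module) \<Rightarrow> ('a, 'i \<Rightarrow> 'm) module" where
  "product_module M = \<lparr>carrier = {z. \<forall>i. z i \<in> carrier (M i)}, monoid.mult = undefined, one = undefined,
     zero = (\<lambda>i. \<zero>\<^bsub>M i\<^esub>), add = (\<lambda>z w i. z i \<oplus>\<^bsub>M i\<^esub> w i),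
     smult = (\<lambda>r z i. r \<odot>\<^bsub>M i\<^esub> z i)\<rparr>"

definition sum_module :: "('i \<Rightarrow> ('a, 'm) module) \<Rightarrow> ('a, 'i \<Rightarrow> 'm) module" where
  "sum_module M = product_module M
     \<lparr>carrier := {z \<in> carrier (product_module M). finite {i. z i \<noteq> \<zero>\<^bsub>M i\<^esub>}}\<rparr>"

definition hom_module ::
    "('a, 'c) ring_scheme \<Rightarrow> ('a, 'm) module \<Rightarrow> ('a, 'n) module \<Rightarrow> ('a, 'm \<Rightarrow> 'n) module" where
  "hom_module R M N = \<lparr>carrier = linear_maps R M N \<inter> extensional (carrier M),
     monoid.mult = undefined, one = undefined,
     zero = (\<lambda>x\<in>carrier M. \<zero>\<^bsub>N\<^esub>), add = (\<lambda>f g. \<lambda>x\<in>carrier M. f x \<oplus>\<^bsub>N\<^esub> g x),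
     smult = (\<lambda>r f. \<lambda>x\<in>carrier M. r \<odot>\<^bsub>N\<^esub> f x)\<rparr>"


section \<open>Tensor products\<close>

definition free_module :: "('a, 'c) ring_scheme \<Rightarrow> 's set \<Rightarrow> ('a, 's \<Rightarrow> 'a) module" where
  "free_module R S = \<lparr>carrier = {\<phi>. (\<forall>s. \<phi> s \<in> carrier R) \<and> (\<forall>s. s \<notin> S \<longrightarrow> \<phi> s = \<zero>\<^bsub>R\<^esub>) \<and>
       finite {s. \<phi> s \<noteq> \<zero>\<^bsub>R\<^esub>}},
     monoid.mult = undefined, one = undefined,
     zero = (\<lambda>s. \<zero>\<^bsub>R\<^esub>), add = (\<lambda>\<phi> \<psi> s. \<phi> s \<oplus>\<^bsub>R\<^esub> \<psi> s), smult = (\<lambda>r \<phi> s. r \<otimes>\<^bsub>R\<^esub> \<phi> s)\<rparr>"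

definition free_gen :: "('a, 'c) ring_scheme \<Rightarrow> 's \<Rightarrow> 's \<Rightarrow> 'a" where
  "free_gen R s = (\<lambda>t. if t = s then \<one>\<^bsub>R\<^esub> else \<zero>\<^bsub>R\<^esub>)"

definition tensor_free ::
    "('a, 'c) ring_scheme \<Rightarrow> ('a, 'm) module \<Rightarrow> ('a, 'n) module \<Rightarrow> ('a, 'm \<times> 'n \<Rightarrow> 'a) module" where
  "tensor_free R M N = free_module R (carrier M \<times> carrier N)"

definition tensor_relations ::
    "('a, 'c) ring_scheme \<Rightarrow> ('a, 'm) module \<Rightarrow> ('a, 'n) module \<Rightarrow> ('m \<times> 'n \<Rightarrow> 'a) set" where
  "tensor_relations R M N = (let L = tensor_free R M N; e = (\<lambda>x y. free_gen R (x, y)) in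
     submodule_gen R L
      ({e (x \<oplus>\<^bsub>M\<^esub> x') y \<ominus>\<^bsub>L\<^esub> (e x y \<oplus>\<^bsub>L\<^esub> e x' y) | x x' y.
          x \<in> carrier M \<and> x' \<in> carrier M \<and> y \<in> carrier N} \<union>
       {e x (y \<oplus>\<^bsub>N\<^esub> y') \<ominus>\<^bsub>L\<^esub> (e x y \<oplus>\<^bsub>L\<^esub> e x y') | x y y'.
          x \<in> carrier M \<and> y \<in> carrier N \<and> y' \<in> carrier N} \<union>
       {e (r \<odot>\<^bsub>M\<^esub> x) y \<ominus>\<^bsub>L\<^esub> (r \<odot>\<^bsub>L\<^esub> e x y) | r x y.
          r \<in> carrier R \<and> x \<in> carrier M \<and> y \<in> carrier N} \<union>
       {e x (r \<odot>\<^bsub>N\<^esub> y) \<ominus>\<^bsub>L\<^esub> (r \<odot>\<^bsub>L\<^esub> e x y) | r x y.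
          r \<in> carrier R \<and> x \<in> carrier M \<and> y \<in> carrier N}))"

definition tensor_module ::
    "('a, 'c) ring_scheme \<Rightarrow> ('a, 'm) module \<Rightarrow> ('a, 'n) module \<Rightarrow>
     ('a, ('m \<times> 'n \<Rightarrow> 'a) set) module" where
  "tensor_module R M N = quot_module (tensor_free R M N) (tensor_relations R M N)"

text \<open>The map \<open>f \<otimes> g\<close> into \<open>M' \<otimes> N'\<close>. On formal sums it sends \<open>(x, y)\<close> to \<open>(f x, g y)\<close>; a class
  \<open>X\<close> is sent to the common class of the images of its representatives (the union below is
  over equal cosets).\<close>

definition tensor_map ::
    "('a, 'c) ring_scheme \<Rightarrow> ('a, 'm2) module \<Rightarrow> ('a, 'n2) module \<Rightarrow>
     ('m1 \<Rightarrow> 'm2) \<Rightarrow> ('n1 \<Rightarrow> 'n2) \<Rightarrow> ('m1 \<times> 'n1 \<Rightarrow> 'a) set \<Rightarrow> ('m2 \<times> 'n2 \<Rightarrow> 'a) set" where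
  "tensor_map R M' N' f g X = (\<Union>\<phi>\<in>X. tensor_relations R M' N' +>\<^bsub>tensor_free R M' N'\<^esub>
     (\<lambda>q. \<Oplus>\<^bsub>R\<^esub>p\<in>{p. \<phi> p \<noteq> \<zero>\<^bsub>R\<^esub> \<and> map_prod f g p = q}. \<phi> p))"


section \<open>Complexes\<close>

text \<open>Complexes are graded homologically; \<open>cdiff C i\<close> is the differential from degree \<open>i\<close> to
  degree \<open>i - 1\<close>.\<close>

record ('a, 'm) chain_complex =
  cobj :: "int \<Rightarrow> ('a, 'm) module"
  cdiff :: "int \<Rightarrow> 'm \<Rightarrow> 'm"

definition is_complex :: "('a, 'c) ring_scheme \<Rightarrow> ('a, 'm) chain_complex \<Rightarrow> bool" where
  "is_complex R C \<longleftrightarrow>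
     (\<forall>i. module R (cobj C i)) \<and>
     (\<forall>i. cdiff C i \<in> linear_maps R (cobj C i) (cobj C (i - 1))) \<and>
     (\<forall>i. \<forall>x\<in>carrier (cobj C i). cdiff C (i - 1) (cdiff C i x) = \<zero>\<^bsub>cobj C (i - 2)\<^esub>)"

definition cycles :: "('a, 'm) chain_complex \<Rightarrow> int \<Rightarrow> 'm set" where
  "cycles C i = {x \<in> carrier (cobj C i). cdiff C i x = \<zero>\<^bsub>cobj C (i - 1)\<^esub>}"

definition boundaries :: "('a, 'm) chain_complex \<Rightarrow> int \<Rightarrow> 'm set" where
  "boundaries C i = cdiff C (i + 1) ` carrier (cobj C (i + 1))"

definition homology :: "('a, 'm) chain_complex \<Rightarrow> int \<Rightarrow> ('a, 'm set) module" where
  "homology C i = quot_module (cobj C i\<lparr>carrier := cycles C i\<rparr>) (boundaries C i)"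

definition bounded_below_complex :: "('a, 'm) chain_complex \<Rightarrow> bool" where
  "bounded_below_complex C \<longleftrightarrow> (\<exists>b. \<forall>i<b. \<not> nonzero_module (cobj C i))"

definition bounded_complex :: "('a, 'm) chain_complex \<Rightarrow> bool" where
  "bounded_complex C \<longleftrightarrow> (\<exists>b. \<forall>i. \<bar>i\<bar> > b \<longrightarrow> \<not> nonzero_module (cobj C i))"

definition nonzero_homology :: "('a, 'm) chain_complex \<Rightarrow> bool" where
  "nonzero_homology C \<longleftrightarrow> (\<exists>i. nonzero_module (homology C i))"

definition fin_gen_homology :: "('a, 'c) ring_scheme \<Rightarrow> ('a, 'm) chain_complex \<Rightarrow> bool" where
  "fin_gen_homology R C \<longleftrightarrow>
     (\<exists>b. \<forall>i. \<bar>i\<bar> > b \<longrightarrow> \<not> nonzero_module (homology C i)) \<and>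
     (\<forall>i. fin_gen_module R (homology C i))"

definition stalk_complex :: "('a, 'm) module \<Rightarrow> ('a, 'm) chain_complex" where
  "stalk_complex N = \<lparr>cobj = (\<lambda>i. if i = 0 then N else N\<lparr>carrier := {\<zero>\<^bsub>N\<^esub>}\<rparr>),
     cdiff = (\<lambda>i x. \<zero>\<^bsub>N\<^esub>)\<rparr>"

definition chain_maps ::
    "('a, 'c) ring_scheme \<Rightarrow> ('a, 'm) chain_complex \<Rightarrow> ('a, 'n) chain_complex \<Rightarrow>
     (int \<Rightarrow> 'm \<Rightarrow> 'n) set" where
  "chain_maps R C D = {f. (\<forall>i. f i \<in> linear_maps R (cobj C i) (cobj D i)) \<and>
     (\<forall>i. \<forall>x\<in>carrier (cobj C i). f (i - 1) (cdiff C i x) = cdiff D i (f i x))}"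

definition homology_map ::
    "('a, 'n) chain_complex \<Rightarrow> (int \<Rightarrow> 'm \<Rightarrow> 'n) \<Rightarrow> int \<Rightarrow> 'm set \<Rightarrow> 'n set" where
  "homology_map D f i X = (\<Union>x\<in>X. boundaries D i +>\<^bsub>cobj D i\<^esub> f i x)"

definition quasi_isos ::
    "('a, 'c) ring_scheme \<Rightarrow> ('a, 'm) chain_complex \<Rightarrow> ('a, 'n) chain_complex \<Rightarrow>
     (int \<Rightarrow> 'm \<Rightarrow> 'n) set" where
  "quasi_isos R C D = {f \<in> chain_maps R C D.
     \<forall>i. bij_betw (homology_map D f i) (carrier (homology C i)) (carrier (homology D i))}"

text \<open>Degree \<open>n\<close> of \<open>C \<otimes> D\<close> is the direct sum over \<open>i\<close> of \<open>C\<^sub>i \<otimes> D\<^sub>n\<^sub>-\<^sub>i\<close>, and the differential is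
  \<open>d (x \<otimes> y) = d x \<otimes> y + (-1)\<^sup>i x \<otimes> d y\<close> for \<open>x\<close> of degree \<open>i\<close>.\<close>

definition tensor_complex ::
    "('a, 'c) ring_scheme \<Rightarrow> ('a, 'm) chain_complex \<Rightarrow> ('a, 'n) chain_complex \<Rightarrow>
     ('a, int \<Rightarrow> ('m \<times> 'n \<Rightarrow> 'a) set) chain_complex" where
  "tensor_complex R C D =
     \<lparr>cobj = (\<lambda>n. sum_module (\<lambda>i. tensor_module R (cobj C i) (cobj D (n - i)))),
      cdiff = (\<lambda>n z i.
        let T = tensor_module R (cobj C i) (cobj D (n - 1 - i));
            a = tensor_map R (cobj C i) (cobj D (n - 1 - i)) (cdiff C (i + 1)) id (z (i + 1));
            b = tensor_map R (cobj C i) (cobj D (n - 1 - i)) id (cdiff D (n - i)) (z i)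
        in if even i then a \<oplus>\<^bsub>T\<^esub> b else a \<ominus>\<^bsub>T\<^esub> b)\<rparr>"

text \<open>Degree \<open>n\<close> of \<open>Hom(C, D)\<close> is the product over \<open>i\<close> of \<open>Hom(C\<^sub>i, D\<^sub>i\<^sub>+\<^sub>n)\<close>, and the differential
  is \<open>d f = d \<circ> f - (-1)\<^sup>n f \<circ> d\<close> for \<open>f\<close> of degree \<open>n\<close>.\<close>

definition hom_complex ::
    "('a, 'c) ring_scheme \<Rightarrow> ('a, 'm) chain_complex \<Rightarrow> ('a, 'n) chain_complex \<Rightarrow>
     ('a, int \<Rightarrow> 'm \<Rightarrow> 'n) chain_complex" where
  "hom_complex R C D =
     \<lparr>cobj = (\<lambda>n. product_module (\<lambda>i. hom_module R (cobj C i) (cobj D (i + n)))),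
      cdiff = (\<lambda>n f i. \<lambda>x\<in>carrier (cobj C i).
        let a = cdiff D (i + n) (f i x); b = f (i - 1) (cdiff C i x)
        in if even n then a \<ominus>\<^bsub>cobj D (i + n - 1)\<^esub> b else a \<oplus>\<^bsub>cobj D (i + n - 1)\<^esub> b)\<rparr>"


section \<open>Resolutions and derived functors\<close>

text \<open>Resolutions of complexes with elements in \<open>'m\<close> over a ring with elements in \<open>'a\<close> are taken
  with elements in \<open>'m \<times> nat \<Rightarrow> 'a\<close>. If the ring is nontrivial, this type has at least
  \<open>max \<bar>'a\<bar> \<bar>'m\<bar> \<aleph>\<^sub>0\<close> elements, and so it accommodates a free resolution of every such complex with
  homology bounded below. Hence fixing it changes neither which complexes are isomorphic in the
  derived category nor the infimum in \<open>proj_dim\<close>.\<close>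

type_synonym ('a, 'm) res_complex = "('a, 'm \<times> nat \<Rightarrow> 'a) chain_complex"

definition projective_resolution ::
    "('a, 'c) ring_scheme \<Rightarrow> ('a, 'm) chain_complex \<Rightarrow> ('a, 'n) chain_complex \<Rightarrow> bool" where
  "projective_resolution R C F \<longleftrightarrow> is_complex R F \<and> bounded_below_complex F \<and>
     (\<forall>i. projective_module R (cobj F i)) \<and> quasi_isos R F C \<noteq> {}"

definition finite_free_resolution ::
    "('a, 'c) ring_scheme \<Rightarrow> ('a, 'm) chain_complex \<Rightarrow> ('a, 'n) chain_complex \<Rightarrow> bool" where
  "finite_free_resolution R C F \<longleftrightarrow> is_complex R F \<and> bounded_complex F \<and>
     (\<forall>i. finite_free_module R (cobj F i)) \<and> quasi_isos R F C \<noteq> {}"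

text \<open>Isomorphism in the derived category: morphisms there are classes of roofs \<open>C \<leftarrow> X \<rightarrow> D\<close> with
  left leg a quasi-isomorphism, and such a morphism is invertible iff the right leg is a
  quasi-isomorphism, too.\<close>

definition derived_isomorphic ::
    "('a, 'c) ring_scheme \<Rightarrow> ('a, 'm) chain_complex \<Rightarrow> ('a, 'n) chain_complex \<Rightarrow> bool" where
  "derived_isomorphic R C D \<longleftrightarrow> (\<exists>X :: ('a, 'm) res_complex.
     is_complex R X \<and> quasi_isos R X C \<noteq> {} \<and> quasi_isos R X D \<noteq> {})"

definition proj_dim :: "('a, 'c) ring_scheme \<Rightarrow> ('a, 'm) chain_complex \<Rightarrow> ereal" where
  "proj_dim R P = (INF F \<in> {F :: ('a, 'm) res_complex. is_complex R F \<and> bounded_below_complex F \<and>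
       (\<forall>i. projective_module R (cobj F i)) \<and> derived_isomorphic R P F}.
     SUP l \<in> {l. nonzero_module (cobj F l)}. ereal (of_int l))"

text \<open>\<open>derived_tensor R M P\<close> is meaningful only if \<open>P\<close> has a finite free resolution; \<open>derived_hom R N M\<close>
  only if the homology of \<open>N\<close> is bounded below. The choice of resolution is immaterial up to
  quasi-isomorphism.\<close>

definition derived_tensor ::
    "('a, 'c) ring_scheme \<Rightarrow> ('a, 'm) chain_complex \<Rightarrow> ('a, 'n) chain_complex \<Rightarrow>
     ('a, int \<Rightarrow> ('m \<times> ('n \<times> nat \<Rightarrow> 'a) \<Rightarrow> 'a) set) chain_complex" where
  "derived_tensor R M P =
     tensor_complex R M (SOME F :: ('a, 'n) res_complex. finite_free_resolution R P F)"

definition derived_hom ::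
    "('a, 'c) ring_scheme \<Rightarrow> ('a, 'n) chain_complex \<Rightarrow> ('a, 'm) chain_complex \<Rightarrow>
     ('a, int \<Rightarrow> ('n \<times> nat \<Rightarrow> 'a) \<Rightarrow> 'm) chain_complex" where
  "derived_hom R N M =
     hom_complex R (SOME G :: ('a, 'n) res_complex. projective_resolution R N G) M"

definition ext_module ::
    "('a, 'c) ring_scheme \<Rightarrow> int \<Rightarrow> ('a, 'n) module \<Rightarrow> ('a, 'm) chain_complex \<Rightarrow>
     ('a, (int \<Rightarrow> ('n \<times> nat \<Rightarrow> 'a) \<Rightarrow> 'm) set) module" where
  "ext_module R l N M = homology (derived_hom R (stalk_complex N) M) (- l)"


section \<open>Local rings and depth\<close>

definition noetherian_local_ring :: "('a, 'c) ring_scheme \<Rightarrow> bool" where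
  "noetherian_local_ring R \<longleftrightarrow> cring R \<and> noetherian_ring R \<and> (\<exists>!I. maximalideal I R)"

text \<open>The residue field as an \<open>R\<close>-module, and depth as \<open>inf {l. Ext\<^sup>l(k, M) \<noteq> 0}\<close>.\<close>

definition residue_field :: "('a, 'c) ring_scheme \<Rightarrow> ('a, 'a set) module" where
  "residue_field R = quot_module (regular_module R) (THE I. maximalideal I R)"

definition depth :: "('a, 'c) ring_scheme \<Rightarrow> ('a, 'm) chain_complex \<Rightarrow> ereal" where
  "depth R M =
     (INF l \<in> {l. nonzero_module (ext_module R l (residue_field R) M)}. ereal (of_int l))"

end

theory Submission
  imports Defs
begin

text \<open>Let \<open>F\<close> be the minimal free resolution of \<open>P\<close>, whose differential has coefficients in the maximal
  ideal. It is a retract up to homotopy of every complex of projective modules that represents \<open>P\<close>,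
  so \<open>pd P\<close> is the largest \<open>p\<close> with \<open>F\<^sub>p \<noteq> 0\<close>, and \<open>F\<close> is a finite free complex. Let \<open>G\<close> be a projective
  resolution of the residue field \<open>k\<close> and \<open>L\<close> a finite free resolution of \<open>P\<close>. Then
  \<open>Hom(G, M \<otimes> L)\<close> is isomorphic to \<open>Hom(Hom(L, G), M)\<close>. The complex \<open>Hom(L, G)\<close> is a projective
  resolution of \<open>Hom(L, k)\<close>, hence of \<open>Hom(F, k)\<close>, and the latter does not change when the
  differential of \<open>F\<close> is replaced by \<open>0\<close>. So \<open>Hom(L, G)\<close> is homotopy equivalent to a sum of shifts of \<open>G\<close>,
  and \<open>Ext\<^sup>l(k, M \<otimes> P)\<close> is nonzero iff \<open>Ext\<^sup>l\<^sup>+\<^sup>p(k, M)\<close> is nonzero for some \<open>p\<close> with \<open>F\<^sub>p \<noteq> 0\<close>.\<close>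

section \<open>Linear maps\<close>

text \<open>Two obstacles shape the proof. \<open>M\<close> may be unbounded in both directions, so
  it is never resolved: complexes are compared only in the first argument of
  \<open>Hom(-, M)\<close>, and only along homotopy equivalences between bounded below complexes of
  projectives. Moreover \<open>L\<close> is an arbitrary choice, so it need not be minimal. The
  minimal \<open>F\<close> and the complex with the same modules and zero differential are in
  general not quasi-isomorphic; they become comparable under \<open>Hom(-, k)\<close>, because maps
  to \<open>k\<close> annihilate elements with coefficients in the maximal ideal. Resolving
  \<open>Hom(L, k)\<close> carries the comparison back to complexes of projectives. What remains is
  a computation with integers. The degrees of nonzero Ext for \<open>M \<otimes> P\<close> are the
  differences of those for \<open>M\<close> and the degrees \<open>p\<close>, so their infimum drops
  by the largest \<open>p\<close>. Finite projective dimension bounds \<open>p\<close> from above,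
  bounded homology of \<open>P\<close> from below. The complexes to be compared have different
  element types. Therefore maps are plain functions between types, homotopies and quasi-isomorphisms
  are described by elements, and projectivity by a retraction from a free module.\<close>

lemma (in abelian_group) a_minus_zero: "\<ominus> \<zero> = \<zero>"
  by (rule minus_equality) simp_all

lemma (in abelian_group) minus_zero_right: "x \<in> carrier G \<Longrightarrow> x \<ominus> \<zero> = x"
  by (simp add: minus_eq a_minus_zero)

lemma module_abelian_group: "module R M \<Longrightarrow> abelian_group M"
  by (simp add: module_def)

lemma module_cring: "module R M \<Longrightarrow> cring R"
  by (simp add: module_def)

lemma linear_mapsI:
  assumes "\<And>x. x \<in> carrier M \<Longrightarrow> f x \<in> carrier N"
    and "\<And>x y. x \<in> carrier M \<Longrightarrow> y \<in> carrier M \<Longrightarrow> f (x \<oplus>\<^bsub>M\<^esub> y) = f x \<oplus>\<^bsub>N\<^esub> f y"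
    and "\<And>r x. r \<in> carrier R \<Longrightarrow> x \<in> carrier M \<Longrightarrow> f (r \<odot>\<^bsub>M\<^esub> x) = r \<odot>\<^bsub>N\<^esub> f x"
  shows "f \<in> linear_maps R M N"
  using assms by (auto simp: linear_maps_def)

lemma linear_closed: "f \<in> linear_maps R M N \<Longrightarrow> x \<in> carrier M \<Longrightarrow> f x \<in> carrier N"
  by (auto simp: linear_maps_def)

lemma linear_add: "f \<in> linear_maps R M N \<Longrightarrow> x \<in> carrier M \<Longrightarrow> y \<in> carrier M \<Longrightarrow>
    f (x \<oplus>\<^bsub>M\<^esub> y) = f x \<oplus>\<^bsub>N\<^esub> f y"
  by (auto simp: linear_maps_def)

lemma linear_smult: "f \<in> linear_maps R M N \<Longrightarrow> r \<in> carrier R \<Longrightarrow> x \<in> carrier M \<Longrightarrow>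
    f (r \<odot>\<^bsub>M\<^esub> x) = r \<odot>\<^bsub>N\<^esub> f x"
  by (auto simp: linear_maps_def)

text \<open>Maps are total functions on a type, and only their values on the carrier count. This
  permits changing a map off the carrier, for instance to make it extensional.\<close>

lemma linear_cong:
  assumes "module R M" "f \<in> linear_maps R M N" "\<And>x. x \<in> carrier M \<Longrightarrow> g x = f x"
  shows "g \<in> linear_maps R M N"
proof -
  interpret module R M by fact
  show ?thesis by (rule linear_mapsI) (simp_all add: assms(3) linear_closed[OF assms(2)]
        linear_add[OF assms(2)] linear_smult[OF assms(2)])
qed

lemma linear_comp: "f \<in> linear_maps R M N \<Longrightarrow> g \<in> linear_maps R N L \<Longrightarrow>
    (\<lambda>x. g (f x)) \<in> linear_maps R M L"
  by (auto simp: linear_maps_def Pi_iff)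

lemma linear_maps_id: "(\<lambda>x. x) \<in> linear_maps R M M" "id \<in> linear_maps R M M"
  by (auto simp: linear_maps_def)

text \<open>The locale serves only to derive these facts conveniently; they are exported below with
  the modules and the map as premises, since later proofs handle many modules at once.\<close>

locale linear_map = M: module R M + N: module R N
  for R :: "('a, 'c) ring_scheme" (structure) and M :: "('a, 'm) module" and N :: "('a, 'n) module" +
  fixes f :: "'m \<Rightarrow> 'n"
  assumes linear: "f \<in> linear_maps R M N"
begin

lemma closed: "x \<in> carrier M \<Longrightarrow> f x \<in> carrier N"
  by (rule linear_closed[OF linear])

lemma zero: "f \<zero>\<^bsub>M\<^esub> = \<zero>\<^bsub>N\<^esub>"
proof -
  have "f (\<zero> \<odot>\<^bsub>M\<^esub> \<zero>\<^bsub>M\<^esub>) = \<zero> \<odot>\<^bsub>N\<^esub> f \<zero>\<^bsub>M\<^esub>"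
    by (rule linear_smult[OF linear]) simp_all
  then show ?thesis by (simp add: closed)
qed

lemma neg:
  assumes "x \<in> carrier M"
  shows "f (\<ominus>\<^bsub>M\<^esub> x) = \<ominus>\<^bsub>N\<^esub> f x"
proof -
  have "f (\<ominus>\<^bsub>M\<^esub> x) \<oplus>\<^bsub>N\<^esub> f x = \<zero>\<^bsub>N\<^esub>"
    using linear_add[OF linear, of "\<ominus>\<^bsub>M\<^esub> x" x] assms by (simp add: M.l_neg zero)
  then show ?thesis using assms by (simp add: N.minus_equality closed)
qed

lemma minus: "x \<in> carrier M \<Longrightarrow> y \<in> carrier M \<Longrightarrow> f (x \<ominus>\<^bsub>M\<^esub> y) = f x \<ominus>\<^bsub>N\<^esub> f y"
  by (simp add: M.minus_eq N.minus_eq linear_add[OF linear] neg)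

lemma finsum:
  assumes "g \<in> A \<rightarrow> carrier M"
  shows "f (\<Oplus>\<^bsub>M\<^esub>a\<in>A. g a) = (\<Oplus>\<^bsub>N\<^esub>a\<in>A. f (g a))"
  using assms
proof (induction A rule: infinite_finite_induct)
  case (insert a A)
  then have "g \<in> A \<rightarrow> carrier M" "(\<lambda>a. f (g a)) \<in> A \<rightarrow> carrier N" by (auto intro: closed)
  with insert show ?case by (simp add: linear_add[OF linear] closed)
qed (simp_all add: zero)

end

lemma linear_mapI: "module R M \<Longrightarrow> module R N \<Longrightarrow> f \<in> linear_maps R M N \<Longrightarrow> linear_map R M N f"
  by (simp add: linear_map_def linear_map_axioms_def)

lemmas linear_zero = linear_map.zero[OF linear_mapI]
lemmas linear_neg = linear_map.neg[OF linear_mapI]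
lemmas linear_minus = linear_map.minus[OF linear_mapI]
lemmas linear_finsum = linear_map.finsum[OF linear_mapI]

lemma linear_zero_map: "module R N \<Longrightarrow> (\<lambda>x. \<zero>\<^bsub>N\<^esub>) \<in> linear_maps R M N"
proof -
  assume "module R N"
  then interpret module R N .
  show ?thesis by (rule linear_mapsI) simp_all
qed

lemma linear_plus:
  assumes "module R N" "f \<in> linear_maps R M N" "g \<in> linear_maps R M N"
  shows "(\<lambda>x. f x \<oplus>\<^bsub>N\<^esub> g x) \<in> linear_maps R M N"
proof -
  interpret module R N by fact
  note c = linear_closed[OF assms(2)] linear_closed[OF assms(3)]
  show ?thesis
    by (rule linear_mapsI) (simp_all add: c linear_add[OF assms(2)] linear_add[OF assms(3)]
        linear_smult[OF assms(2)] linear_smult[OF assms(3)] smult_r_distr M.a_ac)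
qed

lemma linear_scale:
  assumes "module R N" "f \<in> linear_maps R M N" "r \<in> carrier R"
  shows "(\<lambda>x. r \<odot>\<^bsub>N\<^esub> f x) \<in> linear_maps R M N"
proof -
  interpret module R N by fact
  note c = linear_closed[OF assms(2)]
  have "r \<odot>\<^bsub>N\<^esub> (s \<odot>\<^bsub>N\<^esub> y) = s \<odot>\<^bsub>N\<^esub> (r \<odot>\<^bsub>N\<^esub> y)" if "s \<in> carrier R" "y \<in> carrier N" for s y
    using that assms(3) by (metis R.m_comm smult_assoc1)
  then show ?thesis
    by (intro linear_mapsI) (simp_all add: c assms(3) linear_add[OF assms(2)]
        linear_smult[OF assms(2)] smult_r_distr)
qed

lemma linear_uminus:
  assumes "module R N" "f \<in> linear_maps R M N"
  shows "(\<lambda>x. \<ominus>\<^bsub>N\<^esub> f x) \<in> linear_maps R M N"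
proof -
  interpret module R N by fact
  note c = linear_closed[OF assms(2)]
  show ?thesis
    by (rule linear_mapsI) (simp_all add: c linear_add[OF assms(2)] linear_smult[OF assms(2)]
        smult_r_minus M.minus_add)
qed

lemma linear_diff:
  assumes "module R N" "f \<in> linear_maps R M N" "g \<in> linear_maps R M N"
  shows "(\<lambda>x. f x \<ominus>\<^bsub>N\<^esub> g x) \<in> linear_maps R M N"
  unfolding a_minus_def by (intro linear_plus linear_uminus assms)

lemma linear_sum:
  assumes "module R M" "module R N" "\<And>a. a \<in> A \<Longrightarrow> f a \<in> linear_maps R M N"
  shows "(\<lambda>x. \<Oplus>\<^bsub>N\<^esub>a\<in>A. f a x) \<in> linear_maps R M N"
proof -
  interpret module R N by fact
  show ?thesis using assms(3)
  proof (induction A rule: infinite_finite_induct)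
    case (insert a A)
    have "(\<lambda>x. f a x \<oplus>\<^bsub>N\<^esub> (\<Oplus>\<^bsub>N\<^esub>b\<in>A. f b x)) \<in> linear_maps R M N"
      by (rule linear_plus[OF assms(2)]) (use insert in auto)
    then show ?case
    proof (rule linear_cong[OF assms(1)])
      fix x assume "x \<in> carrier M"
      then show "(\<Oplus>\<^bsub>N\<^esub>b\<in>insert a A. f b x) = f a x \<oplus>\<^bsub>N\<^esub> (\<Oplus>\<^bsub>N\<^esub>b\<in>A. f b x)"
        using insert linear_closed by (intro M.finsum_insert) fastforce+
    qed
  qed (use linear_zero_map[OF assms(2)] in auto)
qed

section \<open>Constructions of modules\<close>

text \<open>Apart from closure and the existence of negatives the module axioms are equations, and
  all of them pass to the image of a map that respects the operations. Quotients become modules in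
  this way.\<close>

lemma linear_surj_module:
  fixes Q :: "('a, 'n) module"
  assumes M: "module R M" and carr: "carrier Q = p ` carrier M"
    and add: "\<And>x y. x \<in> carrier M \<Longrightarrow> y \<in> carrier M \<Longrightarrow> p (x \<oplus>\<^bsub>M\<^esub> y) = p x \<oplus>\<^bsub>Q\<^esub> p y"
    and smult: "\<And>r x. r \<in> carrier R \<Longrightarrow> x \<in> carrier M \<Longrightarrow> p (r \<odot>\<^bsub>M\<^esub> x) = r \<odot>\<^bsub>Q\<^esub> p x"
    and zero: "p \<zero>\<^bsub>M\<^esub> = \<zero>\<^bsub>Q\<^esub>"
  shows "module R Q"
proof -
  interpret module R M by fact
  note [simp] = add[symmetric] smult[symmetric] zero[symmetric]
  show ?thesis
  proof (intro moduleI abelian_groupI)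
    fix x assume "x \<in> carrier Q"
    then obtain z where "z \<in> carrier M" "x = p z" by (auto simp: carr)
    then show "\<exists>y\<in>carrier Q. y \<oplus>\<^bsub>Q\<^esub> x = \<zero>\<^bsub>Q\<^esub>"
      by (intro bexI[of _ "p (\<ominus>\<^bsub>M\<^esub> z)"]) (simp_all add: M.l_neg carr)
  qed (auto simp: carr M.a_ac smult_l_distr smult_r_distr smult_assoc1 R.is_cring intro!: imageI)
qed

subsection \<open>Submodules and quotients\<close>

lemma submodule_module: "module R M \<Longrightarrow> submodule N R M \<Longrightarrow> module R (M\<lparr>carrier := N\<rparr>)"
  by (rule submodule.submodule_is_module)

context
  fixes R :: "('a, 'c) ring_scheme" and M :: "('a, 'm) module" and N
  assumes module: "module R M" and sub: "submodule N R M"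
begin

interpretation module R M by (rule module)

interpretation N: abelian_subgroup N M
  by (rule abelian_subgroupI3, rule additive_subgroupI, rule submodule.axioms(1)[OF sub], rule M.abelian_group_axioms)

lemma coset_mem_iff: "x \<in> carrier M \<Longrightarrow> z \<in> N +>\<^bsub>M\<^esub> x \<longleftrightarrow> z \<in> carrier M \<and> z \<ominus>\<^bsub>M\<^esub> x \<in> N"
  using N.a_rcos_module N.a_elemrcos_carrier by (metis M.minus_eq)

lemma coset_eq_iff:
  assumes "x \<in> carrier M" "y \<in> carrier M"
  shows "N +>\<^bsub>M\<^esub> x = N +>\<^bsub>M\<^esub> y \<longleftrightarrow> x \<ominus>\<^bsub>M\<^esub> y \<in> N"
proof -
  have "N +>\<^bsub>M\<^esub> x = N +>\<^bsub>M\<^esub> y \<longleftrightarrow> x \<in> N +>\<^bsub>M\<^esub> y"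
    using assms N.a_rcos_self N.a_repr_independence' by blast
  then show ?thesis using assms by (simp add: coset_mem_iff)
qed

lemma coset_zero: "N +>\<^bsub>M\<^esub> \<zero>\<^bsub>M\<^esub> = N"
  by (simp add: N.a_subset)

lemma coset_add: "x \<in> carrier M \<Longrightarrow> y \<in> carrier M \<Longrightarrow>
    (N +>\<^bsub>M\<^esub> x) <+>\<^bsub>M\<^esub> (N +>\<^bsub>M\<^esub> y) = N +>\<^bsub>M\<^esub> (x \<oplus>\<^bsub>M\<^esub> y)"
  by (rule N.a_rcos_sum)

text \<open>Scalar multiplication on quotients, \<open>tensor_map\<close> and
  \<open>homology_map\<close> are all written as unions over representatives. If every
  representative gives the same set, the union is that set.\<close>

lemma coset_Union:
  assumes x: "x \<in> carrier M"
    and h: "\<And>z. z \<in> carrier M \<Longrightarrow> z \<ominus>\<^bsub>M\<^esub> x \<in> N \<Longrightarrow> h z = h x"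
  shows "(\<Union>z\<in>N +>\<^bsub>M\<^esub> x. h z) = h x"
proof -
  have "x \<in> N +>\<^bsub>M\<^esub> x" by (rule N.a_rcos_self[OF x])
  moreover have "h z = h x" if "z \<in> N +>\<^bsub>M\<^esub> x" for z
    using that h coset_mem_iff[OF x] by blast
  ultimately show ?thesis by blast
qed

lemma coset_smult:
  assumes "r \<in> carrier R" "x \<in> carrier M"
  shows "(\<Union>z\<in>N +>\<^bsub>M\<^esub> x. N +>\<^bsub>M\<^esub> (r \<odot>\<^bsub>M\<^esub> z)) = N +>\<^bsub>M\<^esub> (r \<odot>\<^bsub>M\<^esub> x)"
proof (rule coset_Union[OF assms(2)])
  fix z assume z: "z \<in> carrier M" "z \<ominus>\<^bsub>M\<^esub> x \<in> N"
  have "r \<odot>\<^bsub>M\<^esub> z \<ominus>\<^bsub>M\<^esub> r \<odot>\<^bsub>M\<^esub> x = r \<odot>\<^bsub>M\<^esub> (z \<ominus>\<^bsub>M\<^esub> x)"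
    using assms z by (simp add: M.minus_eq smult_r_distr smult_r_minus)
  then show "N +>\<^bsub>M\<^esub> (r \<odot>\<^bsub>M\<^esub> z) = N +>\<^bsub>M\<^esub> (r \<odot>\<^bsub>M\<^esub> x)"
    using assms z submodule.smult_closed[OF sub] by (simp add: coset_eq_iff)
qed

lemma quot_carrier: "carrier (quot_module M N) = (\<lambda>x. N +>\<^bsub>M\<^esub> x) ` carrier M"
  by (auto simp: quot_module_def A_RCOSETS_def')

lemma quot_linear: "(\<lambda>x. N +>\<^bsub>M\<^esub> x) \<in> linear_maps R M (quot_module M N)"
  by (rule linear_mapsI) (simp_all add: quot_carrier, simp_all add: quot_module_def coset_add coset_smult)

lemma quot_module_module: "module R (quot_module M N)"
proof (rule linear_surj_module[OF module quot_carrier])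
  show "N +>\<^bsub>M\<^esub> \<zero>\<^bsub>M\<^esub> = \<zero>\<^bsub>quot_module M N\<^esub>"
    by (simp add: quot_module_def coset_zero)
qed (use linear_add[OF quot_linear] linear_smult[OF quot_linear] in blast)+

lemma quot_zero: "\<zero>\<^bsub>quot_module M N\<^esub> = N"
  by (simp add: quot_module_def)

end

subsection \<open>Products, sums and Hom\<close>

lemma product_proj_linear: "(\<lambda>z. z i) \<in> linear_maps R (product_module M) (M i)"
  by (rule linear_mapsI) (simp_all add: product_module_def)

lemma product_module_module:
  assumes "\<And>i. module R (M i)"
  shows "module R (product_module M)"
proof -
  interpret module R "M i" for i by (rule assms)
  show ?thesis
  proof (intro moduleI abelian_groupI)
    fix x assume x: "x \<in> carrier (product_module M)"
    then show "\<exists>y\<in>carrier (product_module M). y \<oplus>\<^bsub>product_module M\<^esub> x = \<zero>\<^bsub>product_module M\<^esub>"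
      by (intro bexI[of _ "\<lambda>i. \<ominus>\<^bsub>M i\<^esub> x i"]) (auto simp: product_module_def M.l_neg)
  qed (auto simp: product_module_def M.a_ac smult_l_distr smult_r_distr smult_assoc1 R.is_cring)
qed

lemma sum_submodule:
  assumes "\<And>i. module R (M i)"
  shows "submodule {z \<in> carrier (product_module M). finite {i. z i \<noteq> \<zero>\<^bsub>M i\<^esub>}} R (product_module M)"
    (is "submodule ?S R ?P")
proof -
  interpret module R "M i" for i by (rule assms)
  interpret P: module R ?P by (rule product_module_module) (rule assms)
  have neg: "(\<ominus>\<^bsub>?P\<^esub> z) i = \<ominus>\<^bsub>M i\<^esub> z i" if "z \<in> carrier ?P" for z i
    using linear_neg[OF P.module_axioms assms product_proj_linear that] .
  show ?thesis
  proof (rule P.submoduleI)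
    fix z w assume z: "z \<in> ?S" and w: "w \<in> ?S"
    have "{i. (z \<oplus>\<^bsub>?P\<^esub> w) i \<noteq> \<zero>\<^bsub>M i\<^esub>} \<subseteq> {i. z i \<noteq> \<zero>\<^bsub>M i\<^esub>} \<union> {i. w i \<noteq> \<zero>\<^bsub>M i\<^esub>}"
      by (auto simp: product_module_def)
    with z w show "z \<oplus>\<^bsub>?P\<^esub> w \<in> ?S"
      by (auto intro: finite_subset)
  next
    fix z assume z: "z \<in> ?S"
    have "{i. (\<ominus>\<^bsub>?P\<^esub> z) i \<noteq> \<zero>\<^bsub>M i\<^esub>} \<subseteq> {i. z i \<noteq> \<zero>\<^bsub>M i\<^esub>}"
      using z by (auto simp: neg)
    with z show "\<ominus>\<^bsub>?P\<^esub> z \<in> ?S" by (auto intro: finite_subset)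
  next
    fix r z assume r: "r \<in> carrier R" and z: "z \<in> ?S"
    have "{i. (r \<odot>\<^bsub>?P\<^esub> z) i \<noteq> \<zero>\<^bsub>M i\<^esub>} \<subseteq> {i. z i \<noteq> \<zero>\<^bsub>M i\<^esub>}"
      using r by (auto simp: product_module_def)
    with z r show "r \<odot>\<^bsub>?P\<^esub> z \<in> ?S" by (auto intro: finite_subset)
  qed (auto simp: product_module_def)
qed

lemma sum_module_module: "(\<And>i. module R (M i)) \<Longrightarrow> module R (sum_module M)"
  unfolding sum_module_def by (rule submodule_module[OF product_module_module sum_submodule])

lemma sum_proj_linear: "(\<lambda>z. z i) \<in> linear_maps R (sum_module M) (M i)"
  by (rule linear_mapsI) (simp_all add: sum_module_def product_module_def)

lemma hom_module_module:
  assumes "module R M" "module R N"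
  shows "module R (hom_module R M N)"
proof -
  interpret M: module R M by fact
  interpret N: module R N by fact
  have lin: "(\<lambda>x\<in>carrier M. f x) \<in> linear_maps R M N" if "f \<in> linear_maps R M N" for f
    by (rule linear_cong[OF assms(1) that]) simp
  show ?thesis
  proof (intro moduleI abelian_groupI)
    fix f assume f: "f \<in> carrier (hom_module R M N)"
    then have "(\<lambda>x\<in>carrier M. \<ominus>\<^bsub>N\<^esub> f x) \<in> carrier (hom_module R M N)"
      by (auto simp: hom_module_def intro!: lin linear_uminus assms)
    with f show "\<exists>g\<in>carrier (hom_module R M N). g \<oplus>\<^bsub>hom_module R M N\<^esub> f = \<zero>\<^bsub>hom_module R M N\<^esub>"
      by (intro bexI[of _ "\<lambda>x\<in>carrier M. \<ominus>\<^bsub>N\<^esub> f x"])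
        (auto simp: hom_module_def N.M.l_neg linear_closed intro!: restrict_ext)
  qed (auto simp: hom_module_def N.M.a_ac N.smult_l_distr N.smult_r_distr N.smult_assoc1 M.R.is_cring
      linear_closed extensional_def fun_eq_iff
      intro!: lin linear_plus linear_scale linear_zero_map assms)
qed

text \<open>A binary direct sum whose summands may have different element types, as is needed for
  mapping cones; \<open>product_module\<close> has one element type for all factors.\<close>

definition pair_module :: "('a, 'm) module \<Rightarrow> ('a, 'n) module \<Rightarrow> ('a, 'm \<times> 'n) module" where
  "pair_module M N = \<lparr>carrier = carrier M \<times> carrier N, monoid.mult = undefined, one = undefined,
     zero = (\<zero>\<^bsub>M\<^esub>, \<zero>\<^bsub>N\<^esub>), add = (\<lambda>z w. (fst z \<oplus>\<^bsub>M\<^esub> fst w, snd z \<oplus>\<^bsub>N\<^esub> snd w)),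
     smult = (\<lambda>r z. (r \<odot>\<^bsub>M\<^esub> fst z, r \<odot>\<^bsub>N\<^esub> snd z))\<rparr>"

lemma pair_module_simps [simp]:
  "carrier (pair_module M N) = carrier M \<times> carrier N"
  "\<zero>\<^bsub>pair_module M N\<^esub> = (\<zero>\<^bsub>M\<^esub>, \<zero>\<^bsub>N\<^esub>)"
  "(x, y) \<oplus>\<^bsub>pair_module M N\<^esub> (x', y') = (x \<oplus>\<^bsub>M\<^esub> x', y \<oplus>\<^bsub>N\<^esub> y')"
  "r \<odot>\<^bsub>pair_module M N\<^esub> (x, y) = (r \<odot>\<^bsub>M\<^esub> x, r \<odot>\<^bsub>N\<^esub> y)"
  by (simp_all add: pair_module_def)

lemma fst_linear: "fst \<in> linear_maps R (pair_module M N) M"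
  and snd_linear: "snd \<in> linear_maps R (pair_module M N) N"
  by (auto intro!: linear_mapsI)

lemma Pair_linear: "f \<in> linear_maps R L M \<Longrightarrow> g \<in> linear_maps R L N \<Longrightarrow>
    (\<lambda>x. (f x, g x)) \<in> linear_maps R L (pair_module M N)"
  by (auto simp: linear_maps_def Pi_iff)

lemma pair_module_module:
  assumes "module R M" "module R N"
  shows "module R (pair_module M N)"
proof -
  interpret M: module R M by fact
  interpret N: module R N by fact
  show ?thesis
  proof (intro moduleI abelian_groupI)
    fix z assume "z \<in> carrier (pair_module M N)"
    then show "\<exists>y\<in>carrier (pair_module M N). y \<oplus>\<^bsub>pair_module M N\<^esub> z = \<zero>\<^bsub>pair_module M N\<^esub>"
      by (intro bexI[of _ "(\<ominus>\<^bsub>M\<^esub> fst z, \<ominus>\<^bsub>N\<^esub> snd z)"]) (auto simp: M.M.l_neg N.M.l_neg)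
  qed (auto simp: M.M.a_ac M.smult_l_distr M.smult_r_distr M.smult_assoc1
      N.M.a_ac N.smult_l_distr N.smult_r_distr N.smult_assoc1 M.R.is_cring)
qed

lemma regular_module_module:
  assumes "cring R" shows "module R (regular_module R)"
proof -
  interpret cring R by fact
  show ?thesis
  proof (intro moduleI abelian_groupI)
    fix x assume "x \<in> carrier (regular_module R)"
    then show "\<exists>y\<in>carrier (regular_module R). y \<oplus>\<^bsub>regular_module R\<^esub> x = \<zero>\<^bsub>regular_module R\<^esub>"
      by (intro bexI[of _ "\<ominus>\<^bsub>R\<^esub> x"]) (simp_all add: regular_module_def l_neg)
  qed (simp_all add: regular_module_def a_ac l_distr r_distr m_assoc is_cring)
qed

subsection \<open>Free modules\<close>

lemma regular_module_simps [simp]: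
  "carrier (regular_module R) = carrier R" "\<zero>\<^bsub>regular_module R\<^esub> = \<zero>\<^bsub>R\<^esub>"
  "x \<oplus>\<^bsub>regular_module R\<^esub> y = x \<oplus>\<^bsub>R\<^esub> y" "r \<odot>\<^bsub>regular_module R\<^esub> x = r \<otimes>\<^bsub>R\<^esub> x"
  by (simp_all add: regular_module_def)

lemma free_module_simps [simp]:
  "\<zero>\<^bsub>free_module R S\<^esub> = (\<lambda>s. \<zero>\<^bsub>R\<^esub>)"
  "\<phi> \<oplus>\<^bsub>free_module R S\<^esub> \<psi> = (\<lambda>s. \<phi> s \<oplus>\<^bsub>R\<^esub> \<psi> s)"
  "r \<odot>\<^bsub>free_module R S\<^esub> \<phi> = (\<lambda>s. r \<otimes>\<^bsub>R\<^esub> \<phi> s)"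
  by (simp_all add: free_module_def)

lemma free_carrierD:
  assumes "\<phi> \<in> carrier (free_module R S)"
  shows "\<phi> s \<in> carrier R" "s \<notin> S \<Longrightarrow> \<phi> s = \<zero>\<^bsub>R\<^esub>" "finite {s. \<phi> s \<noteq> \<zero>\<^bsub>R\<^esub>}" "{s. \<phi> s \<noteq> \<zero>\<^bsub>R\<^esub>} \<subseteq> S"
  using assms by (auto simp: free_module_def)

lemma free_module_module:
  fixes S :: "'s set"
  assumes "cring R" shows "module R (free_module R S)"
proof -
  interpret cring R by fact
  let ?C = "carrier (free_module R S)"
  let ?P = "product_module (\<lambda>s::'s. regular_module R)"
  interpret P: module R ?P by (rule product_module_module) (rule regular_module_module[OF assms])
  interpret Q: module R "regular_module R" by (rule regular_module_module[OF assms])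
  have neg: "(\<ominus>\<^bsub>?P\<^esub> z) i = \<ominus>\<^bsub>regular_module R\<^esub> z i" if "z \<in> carrier ?P" for z i
    using linear_neg[OF P.module_axioms regular_module_module[OF assms] product_proj_linear that] .
  have neg_zero: "\<ominus>\<^bsub>regular_module R\<^esub> \<zero>\<^bsub>R\<^esub> = \<zero>\<^bsub>R\<^esub>"
    using Q.M.a_minus_zero by simp
  have "submodule ?C R ?P"
  proof (rule P.submoduleI)
    fix z w assume z: "z \<in> ?C" and w: "w \<in> ?C"
    have "{i. (z \<oplus>\<^bsub>?P\<^esub> w) i \<noteq> \<zero>\<^bsub>R\<^esub>} \<subseteq> {i. z i \<noteq> \<zero>\<^bsub>R\<^esub>} \<union> {i. w i \<noteq> \<zero>\<^bsub>R\<^esub>}"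
      by (auto simp: product_module_def)
    moreover have "(z \<oplus>\<^bsub>?P\<^esub> w) i \<in> carrier R" "i \<notin> S \<Longrightarrow> (z \<oplus>\<^bsub>?P\<^esub> w) i = \<zero>\<^bsub>R\<^esub>" for i
      using z w by (auto simp: product_module_def free_module_def)
    ultimately show "z \<oplus>\<^bsub>?P\<^esub> w \<in> ?C" using z w
      by (auto simp: free_module_def intro: finite_subset)
  next
    fix z assume z: "z \<in> ?C"
    then have zP: "z \<in> carrier ?P" by (auto simp: free_module_def product_module_def)
    have "{i. (\<ominus>\<^bsub>?P\<^esub> z) i \<noteq> \<zero>\<^bsub>R\<^esub>} \<subseteq> {i. z i \<noteq> \<zero>\<^bsub>R\<^esub>}"
      using z by (auto simp: neg[OF zP] neg_zero)
    moreover have "(\<ominus>\<^bsub>?P\<^esub> z) i \<in> carrier R" "i \<notin> S \<Longrightarrow> (\<ominus>\<^bsub>?P\<^esub> z) i = \<zero>\<^bsub>R\<^esub>" for i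
      using z Q.M.a_inv_closed by (auto simp: neg[OF zP] neg_zero free_module_def)
    ultimately show "\<ominus>\<^bsub>?P\<^esub> z \<in> ?C" using z
      by (auto simp: free_module_def intro: finite_subset)
  next
    fix r z assume r: "r \<in> carrier R" and z: "z \<in> ?C"
    have "{i. (r \<odot>\<^bsub>?P\<^esub> z) i \<noteq> \<zero>\<^bsub>R\<^esub>} \<subseteq> {i. z i \<noteq> \<zero>\<^bsub>R\<^esub>}"
      using r by (auto simp: product_module_def)
    with z r show "r \<odot>\<^bsub>?P\<^esub> z \<in> ?C" by (auto simp: free_module_def product_module_def intro: finite_subset)
  qed (auto simp: free_module_def product_module_def)
  \<comment> \<open>An equation of records: \<open>mult\<close> and \<open>one\<close> agree because
    both constructions set them to \<open>undefined\<close>.\<close>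
  moreover have "?P\<lparr>carrier := ?C\<rparr> = free_module R S"
    by (simp add: free_module_def product_module_def)
  ultimately show ?thesis using submodule_module[OF P.module_axioms] by metis
qed

lemma free_eval_linear: "(\<lambda>\<phi>. \<phi> s) \<in> linear_maps R (free_module R S) (regular_module R)"
  by (rule linear_mapsI) (auto simp: free_module_def)

lemma free_gen_closed:
  assumes "cring R" "s \<in> S" shows "free_gen R s \<in> carrier (free_module R S)"
proof -
  interpret cring R by fact
  have "{t. free_gen R s t \<noteq> \<zero>\<^bsub>R\<^esub>} \<subseteq> {s}" by (auto simp: free_gen_def)
  then show ?thesis using assms(2) finite_subset[of _ "{s}"] by (auto simp: free_module_def free_gen_def)
qed

section \<open>Evaluation of formal linear combinations\<close>

definition lin_ext ::
    "('a, 'c) ring_scheme \<Rightarrow> ('a, 'm) module \<Rightarrow> ('s \<Rightarrow> 'm) \<Rightarrow> ('s \<Rightarrow> 'a) \<Rightarrow> 'm" where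
  "lin_ext R M e \<phi> = (\<Oplus>\<^bsub>M\<^esub>s\<in>{s. \<phi> s \<noteq> \<zero>\<^bsub>R\<^esub>}. \<phi> s \<odot>\<^bsub>M\<^esub> e s)"

context
  fixes R :: "('a, 'c) ring_scheme" and M :: "('a, 'm) module" and e :: "'s \<Rightarrow> 'm" and S
  assumes module: "module R M" and e: "e \<in> S \<rightarrow> carrier M"
begin

interpretation module R M by (rule module)

lemma e_closed: "s \<in> S \<Longrightarrow> e s \<in> carrier M"
  using e by auto

text \<open>The support varies with the formal combination. To compare several of them, their sums
  are first extended to a common finite index set, where the additional terms are zero.\<close>

lemma lin_ext_superset:
  assumes "\<phi> \<in> carrier (free_module R S)" "finite A" "{s. \<phi> s \<noteq> \<zero>\<^bsub>R\<^esub>} \<subseteq> A" "A \<subseteq> S"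
  shows "lin_ext R M e \<phi> = (\<Oplus>\<^bsub>M\<^esub>s\<in>A. \<phi> s \<odot>\<^bsub>M\<^esub> e s)"
  unfolding lin_ext_def
proof (rule M.add.finprod_mono_neutral_cong_left[OF assms(2,3)])
  show "\<phi> s \<odot>\<^bsub>M\<^esub> e s = \<zero>\<^bsub>M\<^esub>" if "s \<in> A - {s. \<phi> s \<noteq> \<zero>\<^bsub>R\<^esub>}" for s
    using that assms(4) by (auto simp: e_closed subset_iff)
  show "(\<lambda>s. \<phi> s \<odot>\<^bsub>M\<^esub> e s) \<in> A \<rightarrow> carrier M"
    using free_carrierD(1)[OF assms(1)] assms(4) by (auto simp: e_closed subset_iff)
qed auto

lemma lin_ext_gen:
  assumes "s \<in> S" shows "lin_ext R M e (free_gen R s) = e s"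
proof -
  have "lin_ext R M e (free_gen R s) = (\<Oplus>\<^bsub>M\<^esub>t\<in>{s}. free_gen R s t \<odot>\<^bsub>M\<^esub> e t)"
    using assms by (intro lin_ext_superset free_gen_closed R.is_cring) (auto simp: free_gen_def)
  also have "\<dots> = free_gen R s s \<odot>\<^bsub>M\<^esub> e s"
    using assms by (subst M.finsum_insert) (auto simp: free_gen_def e_closed)
  finally show ?thesis using assms by (simp add: free_gen_def e_closed)
qed

lemma lin_ext_linear: "lin_ext R M e \<in> linear_maps R (free_module R S) M"
proof (rule linear_mapsI)
  interpret F: module R "free_module R S" by (rule free_module_module[OF R.is_cring])
  fix \<phi> assume \<phi>: "\<phi> \<in> carrier (free_module R S)"
  note p = free_carrierD[OF \<phi>]
  show "lin_ext R M e \<phi> \<in> carrier M"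
    unfolding lin_ext_def using p by (intro M.finsum_closed) (auto simp: e_closed subset_iff)
  show "lin_ext R M e (r \<odot>\<^bsub>free_module R S\<^esub> \<phi>) = r \<odot>\<^bsub>M\<^esub> lin_ext R M e \<phi>" if r: "r \<in> carrier R" for r
  proof -
    have "lin_ext R M e (r \<odot>\<^bsub>free_module R S\<^esub> \<phi>) =
        (\<Oplus>\<^bsub>M\<^esub>s\<in>{s. \<phi> s \<noteq> \<zero>\<^bsub>R\<^esub>}. (r \<odot>\<^bsub>free_module R S\<^esub> \<phi>) s \<odot>\<^bsub>M\<^esub> e s)"
      using r p by (intro lin_ext_superset F.smult_closed \<phi>) auto
    also have "\<dots> = (\<Oplus>\<^bsub>M\<^esub>s\<in>{s. \<phi> s \<noteq> \<zero>\<^bsub>R\<^esub>}. r \<odot>\<^bsub>M\<^esub> (\<phi> s \<odot>\<^bsub>M\<^esub> e s))"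
      by (rule M.finsum_cong') (use r p in \<open>auto simp: e_closed subset_iff smult_assoc1\<close>)
    also have "\<dots> = r \<odot>\<^bsub>M\<^esub> lin_ext R M e \<phi>"
      unfolding lin_ext_def by (subst finsum_smult_ldistr) (use r p in \<open>auto simp: e_closed subset_iff\<close>)
    finally show ?thesis .
  qed
  fix \<psi> assume \<psi>: "\<psi> \<in> carrier (free_module R S)"
  note q = free_carrierD[OF \<psi>]
  let ?A = "{s. \<phi> s \<noteq> \<zero>\<^bsub>R\<^esub>} \<union> {s. \<psi> s \<noteq> \<zero>\<^bsub>R\<^esub>}"
  have A: "finite ?A" "?A \<subseteq> S" using p(3,4) q(3,4) by auto
  have "lin_ext R M e (\<phi> \<oplus>\<^bsub>free_module R S\<^esub> \<psi>) =
      (\<Oplus>\<^bsub>M\<^esub>s\<in>?A. (\<phi> \<oplus>\<^bsub>free_module R S\<^esub> \<psi>) s \<odot>\<^bsub>M\<^esub> e s)"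
    using A by (intro lin_ext_superset F.M.a_closed \<phi> \<psi>) auto
  also have "\<dots> = (\<Oplus>\<^bsub>M\<^esub>s\<in>?A. \<phi> s \<odot>\<^bsub>M\<^esub> e s \<oplus>\<^bsub>M\<^esub> \<psi> s \<odot>\<^bsub>M\<^esub> e s)"
    by (rule M.finsum_cong') (use p(1) q(1) A(2) in \<open>auto simp: e_closed subset_iff smult_l_distr\<close>)
  also have "\<dots> = (\<Oplus>\<^bsub>M\<^esub>s\<in>?A. \<phi> s \<odot>\<^bsub>M\<^esub> e s) \<oplus>\<^bsub>M\<^esub> (\<Oplus>\<^bsub>M\<^esub>s\<in>?A. \<psi> s \<odot>\<^bsub>M\<^esub> e s)"
    by (rule M.finsum_addf) (use p(1) q(1) A(2) in \<open>auto simp: e_closed subset_iff\<close>)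
  also have "\<dots> = lin_ext R M e \<phi> \<oplus>\<^bsub>M\<^esub> lin_ext R M e \<psi>"
    using A by (simp add: lin_ext_superset[OF \<phi>, of ?A] lin_ext_superset[OF \<psi>, of ?A])
  finally show "lin_ext R M e (\<phi> \<oplus>\<^bsub>free_module R S\<^esub> \<psi>) = lin_ext R M e \<phi> \<oplus>\<^bsub>M\<^esub> lin_ext R M e \<psi>" .
qed

lemma linear_lin_ext:
  assumes "module R N" "u \<in> linear_maps R M N" "\<phi> \<in> carrier (free_module R S)"
  shows "u (lin_ext R M e \<phi>) = lin_ext R N (\<lambda>s. u (e s)) \<phi>"
proof -
  interpret N: module R N by fact
  have "u (lin_ext R M e \<phi>) = (\<Oplus>\<^bsub>N\<^esub>s\<in>{s. \<phi> s \<noteq> \<zero>\<^bsub>R\<^esub>}. u (\<phi> s \<odot>\<^bsub>M\<^esub> e s))"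
    unfolding lin_ext_def
    by (rule linear_finsum[OF module assms(1,2)])
      (use free_carrierD[OF assms(3)] in \<open>auto simp: e_closed subset_iff\<close>)
  also have "\<dots> = (\<Oplus>\<^bsub>N\<^esub>s\<in>{s. \<phi> s \<noteq> \<zero>\<^bsub>R\<^esub>}. \<phi> s \<odot>\<^bsub>N\<^esub> u (e s))"
    by (rule N.M.finsum_cong') (use free_carrierD[OF assms(3)] in
        \<open>auto simp: e_closed subset_iff linear_smult[OF assms(2)] linear_closed[OF assms(2)]\<close>)
  finally show ?thesis by (simp add: lin_ext_def)
qed

end

text \<open>Evaluation at \<open>t\<close> is linear, so it can be moved inside the combination by
  \<open>linear_lin_ext\<close>; in the resulting sum of scalars only the term of \<open>t\<close>
  can be nonzero.\<close>

lemma lin_ext_free_gen: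
  assumes "cring R" "\<phi> \<in> carrier (free_module R S)"
  shows "lin_ext R (free_module R S) (free_gen R) \<phi> = \<phi>"
proof
  interpret cring R by fact
  interpret Q: module R "regular_module R" by (rule regular_module_module[OF assms(1)])
  have F: "module R (free_module R S)" by (rule free_module_module[OF assms(1)])
  have g: "free_gen R \<in> S \<rightarrow> carrier (free_module R S)" by (rule Pi_I, rule free_gen_closed[OF assms(1)])
  note p = free_carrierD[OF assms(2)]
  fix t
  show "lin_ext R (free_module R S) (free_gen R) \<phi> t = \<phi> t"
  proof -
    have "lin_ext R (free_module R S) (free_gen R) \<phi> t = lin_ext R (regular_module R) (\<lambda>s. free_gen R s t) \<phi>"
      by (rule linear_lin_ext[OF F g Q.module_axioms free_eval_linear assms(2)])
    also have "\<dots> = (\<Oplus>\<^bsub>regular_module R\<^esub>s\<in>{s. \<phi> s \<noteq> \<zero>\<^bsub>R\<^esub>}. if t = s then \<phi> s else \<zero>\<^bsub>regular_module R\<^esub>)"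
      unfolding lin_ext_def by (rule Q.M.finsum_cong') (use p in \<open>auto simp: free_gen_def\<close>)
    also have "\<dots> = \<phi> t"
    proof (cases "\<phi> t = \<zero>\<^bsub>R\<^esub>")
      case True
      then have "(\<Oplus>\<^bsub>regular_module R\<^esub>s\<in>{s. \<phi> s \<noteq> \<zero>\<^bsub>R\<^esub>}. if t = s then \<phi> s else \<zero>\<^bsub>regular_module R\<^esub>) =
         (\<Oplus>\<^bsub>regular_module R\<^esub>s\<in>{s. \<phi> s \<noteq> \<zero>\<^bsub>R\<^esub>}. \<zero>\<^bsub>regular_module R\<^esub>)"
        by (intro Q.M.finsum_cong') auto
      with True show ?thesis by (simp add: Q.M.finsum_zero[simplified])
    qed (use p in \<open>intro Q.M.finsum_singleton; auto\<close>)
    finally show ?thesis .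
  qed
qed

lemma free_linear_eqI:
  assumes "cring R" "module R M" "f \<in> linear_maps R (free_module R S) M"
    "g \<in> linear_maps R (free_module R S) M" "\<And>s. s \<in> S \<Longrightarrow> f (free_gen R s) = g (free_gen R s)"
    "\<phi> \<in> carrier (free_module R S)"
  shows "f \<phi> = g \<phi>"
proof -
  interpret module R M by fact
  have F: "module R (free_module R S)" by (rule free_module_module[OF assms(1)])
  have gen: "free_gen R \<in> S \<rightarrow> carrier (free_module R S)" by (rule Pi_I, rule free_gen_closed[OF assms(1)])
  have eq: "h \<phi> = lin_ext R M (\<lambda>s. h (free_gen R s)) \<phi>" if "h \<in> linear_maps R (free_module R S) M" for h
    using linear_lin_ext[OF F gen assms(2) that assms(6)] lin_ext_free_gen[OF assms(1,6)] by simp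
  have "lin_ext R M (\<lambda>s. f (free_gen R s)) \<phi> = lin_ext R M (\<lambda>s. g (free_gen R s)) \<phi>"
    unfolding lin_ext_def
  proof (rule M.finsum_cong')
    show "(\<lambda>s. \<phi> s \<odot>\<^bsub>M\<^esub> g (free_gen R s)) \<in> {s. \<phi> s \<noteq> \<zero>\<^bsub>R\<^esub>} \<rightarrow> carrier M"
      using free_carrierD[OF assms(6)] linear_closed[OF assms(4)] gen by fastforce
  qed (use free_carrierD[OF assms(6)] assms(5) in auto)
  then show ?thesis using eq assms(3,4) by simp
qed

section \<open>Maps of complexes\<close>

text \<open>Multiplication by \<open>(-1)\<^sup>n\<close>, by parity rather than by powers because
  the exponents are arbitrary integers.\<close>

definition sgn_power :: "('a, 'm) module \<Rightarrow> int \<Rightarrow> 'm \<Rightarrow> 'm" where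
  "sgn_power M n x = (if even n then x else \<ominus>\<^bsub>M\<^esub> x)"

lemma sgn_power_closed:
  "module R M \<Longrightarrow> x \<in> carrier M \<Longrightarrow> sgn_power M n x \<in> carrier M"
  by (simp add: sgn_power_def abelian_group.a_inv_closed[OF module_abelian_group])

lemma sgn_power_zero: "module R M \<Longrightarrow> sgn_power M n \<zero>\<^bsub>M\<^esub> = \<zero>\<^bsub>M\<^esub>"
  by (simp add: sgn_power_def abelian_group.a_minus_zero[OF module_abelian_group])

lemma sgn_power_sgn_power:
  "module R M \<Longrightarrow> x \<in> carrier M \<Longrightarrow> sgn_power M m (sgn_power M n x) = sgn_power M (m + n) x"
  by (simp add: sgn_power_def abelian_group.minus_minus[OF module_abelian_group])

lemma sgn_power_linear:
  "module R N \<Longrightarrow> f \<in> linear_maps R M N \<Longrightarrow> (\<lambda>x. sgn_power N n (f x)) \<in> linear_maps R M N"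
  by (cases "even n") (simp_all add: sgn_power_def linear_uminus)

lemma linear_sgn_power:
  "module R M \<Longrightarrow> module R N \<Longrightarrow> f \<in> linear_maps R M N \<Longrightarrow> x \<in> carrier M \<Longrightarrow>
    f (sgn_power M n x) = sgn_power N n (f x)"
  by (simp add: sgn_power_def linear_neg)

lemma sgn_power_minus:
  assumes "module R M" "x \<in> carrier M" "y \<in> carrier M"
  shows "sgn_power M n (x \<ominus>\<^bsub>M\<^esub> y) = sgn_power M n x \<ominus>\<^bsub>M\<^esub> sgn_power M n y"
  by (rule linear_minus[OF assms(1,1) sgn_power_linear[OF assms(1) linear_maps_id(1)] assms(2,3)])

lemma pair_module_minus:
  assumes "module R M" "module R N" "x \<in> carrier M" "x' \<in> carrier M" "y \<in> carrier N" "y' \<in> carrier N"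
  shows "(x, y) \<ominus>\<^bsub>pair_module M N\<^esub> (x', y') = (x \<ominus>\<^bsub>M\<^esub> x', y \<ominus>\<^bsub>N\<^esub> y')"
proof -
  have P: "module R (pair_module M N)" by (rule pair_module_module[OF assms(1,2)])
  have "fst ((x, y) \<ominus>\<^bsub>pair_module M N\<^esub> (x', y')) = x \<ominus>\<^bsub>M\<^esub> x'"
    using linear_minus[OF P assms(1) fst_linear] assms(3-6) by simp
  moreover have "snd ((x, y) \<ominus>\<^bsub>pair_module M N\<^esub> (x', y')) = y \<ominus>\<^bsub>N\<^esub> y'"
    using linear_minus[OF P assms(2) snd_linear] assms(3-6) by simp
  ultimately show ?thesis by (metis prod.collapse)
qed

lemma pair_sgn_power:
  assumes "module R M" "module R N" "x \<in> carrier M" "y \<in> carrier N"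
  shows "sgn_power (pair_module M N) n (x, y) = (sgn_power M n x, sgn_power N n y)"
proof -
  have P: "module R (pair_module M N)" by (rule pair_module_module[OF assms(1,2)])
  have "fst (sgn_power (pair_module M N) n (x, y)) = sgn_power M n x"
    using linear_sgn_power[OF P assms(1) fst_linear] assms(3-4) by simp
  moreover have "snd (sgn_power (pair_module M N) n (x, y)) = sgn_power N n y"
    using linear_sgn_power[OF P assms(2) snd_linear] assms(3-4) by simp
  ultimately show ?thesis by (metis prod.collapse)
qed

text \<open>The condition that the differential squares to zero is split off: most facts about
  graded maps and homotopies concern linearity alone, and for the tensor product with a finite free
  complex this weaker property is the one established.\<close>

definition precomplex :: "('a, 'c) ring_scheme \<Rightarrow> ('a, 'm) chain_complex \<Rightarrow> bool" where
  "precomplex R C \<longleftrightarrow> (\<forall>i. module R (cobj C i)) \<and>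
     (\<forall>i. cdiff C i \<in> linear_maps R (cobj C i) (cobj C (i - 1)))"

lemma precomplexD:
  assumes "precomplex R C"
  shows "module R (cobj C i)" "cdiff C i \<in> linear_maps R (cobj C i) (cobj C (i - 1))"
  using assms by (auto simp: precomplex_def)

lemma is_complexD:
  assumes "is_complex R C"
  shows "precomplex R C" "module R (cobj C i)" "cdiff C i \<in> linear_maps R (cobj C i) (cobj C (i - 1))"
    "x \<in> carrier (cobj C i) \<Longrightarrow> cdiff C i x \<in> carrier (cobj C (i - 1))"
    "x \<in> carrier (cobj C i) \<Longrightarrow> cdiff C (i - 1) (cdiff C i x) = \<zero>\<^bsub>cobj C (i - 2)\<^esub>"
  using assms by (auto simp: is_complex_def precomplex_def intro: linear_closed)

lemma chain_mapsD:
  assumes "f \<in> chain_maps R C D"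
  shows "f i \<in> linear_maps R (cobj C i) (cobj D i)"
    "x \<in> carrier (cobj C i) \<Longrightarrow> f (i - 1) (cdiff C i x) = cdiff D i (f i x)"
    "x \<in> carrier (cobj C i) \<Longrightarrow> f i x \<in> carrier (cobj D i)"
  using assms by (auto simp: chain_maps_def intro: linear_closed)

lemma chain_maps_comp:
  assumes "f \<in> chain_maps R C D" "g \<in> chain_maps R D E"
  shows "(\<lambda>i x. g i (f i x)) \<in> chain_maps R C E"
  unfolding chain_maps_def
  using linear_comp[OF chain_mapsD(1)[OF assms(1)] chain_mapsD(1)[OF assms(2)]]
    chain_mapsD(2)[OF assms(2) chain_mapsD(3)[OF assms(1)]] chain_mapsD(2)[OF assms(1)]
  by simp

lemma chain_maps_id: "(\<lambda>i x. x) \<in> chain_maps R C C"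
  by (simp add: chain_maps_def linear_maps_id)

lemma cycles_submodule:
  assumes "precomplex R C" shows "submodule (cycles C i) R (cobj C i)"
proof -
  interpret module R "cobj C i" by (rule precomplexD[OF assms])
  interpret D: linear_map R "cobj C i" "cobj C (i - 1)" "cdiff C i"
    by (rule linear_mapI) (rule precomplexD[OF assms])+
  show ?thesis
    by (rule submoduleI) (auto simp: cycles_def D.zero D.neg linear_add[OF D.linear]
        linear_smult[OF D.linear] D.N.M.a_minus_zero)
qed

lemma boundaries_submodule:
  assumes "precomplex R C" shows "submodule (boundaries C i) R (cobj C i)"
proof -
  interpret module R "cobj C i" by (rule precomplexD[OF assms])
  have "linear_map R (cobj C (i + 1)) (cobj C (i + 1 - 1)) (cdiff C (i + 1))"
    by (rule linear_mapI) (rule precomplexD[OF assms])+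
  then interpret D: linear_map R "cobj C (i + 1)" "cobj C i" "cdiff C (i + 1)" by simp
  show ?thesis unfolding boundaries_def
  proof (rule submoduleI)
    show "\<zero>\<^bsub>cobj C i\<^esub> \<in> cdiff C (i + 1) ` carrier (cobj C (i + 1))"
      by (subst D.zero[symmetric]) (rule imageI, rule D.M.M.zero_closed)
  next
    fix a assume "a \<in> cdiff C (i + 1) ` carrier (cobj C (i + 1))"
    then show "\<ominus>\<^bsub>cobj C i\<^esub> a \<in> cdiff C (i + 1) ` carrier (cobj C (i + 1))"
      by (auto simp: D.neg[symmetric] intro!: imageI)
  next
    fix a b assume "a \<in> cdiff C (i + 1) ` carrier (cobj C (i + 1))" "b \<in> cdiff C (i + 1) ` carrier (cobj C (i + 1))"
    then show "a \<oplus>\<^bsub>cobj C i\<^esub> b \<in> cdiff C (i + 1) ` carrier (cobj C (i + 1))"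
      by (auto simp: linear_add[OF D.linear, symmetric] intro!: imageI)
  next
    fix a r assume "r \<in> carrier R" "a \<in> cdiff C (i + 1) ` carrier (cobj C (i + 1))"
    then show "r \<odot>\<^bsub>cobj C i\<^esub> a \<in> cdiff C (i + 1) ` carrier (cobj C (i + 1))"
      by (auto simp: linear_smult[OF D.linear, symmetric] intro!: imageI)
  qed (auto simp: D.closed)
qed

lemma nonzero_homology_iff:
  assumes "precomplex R C"
  shows "nonzero_module (homology C i) \<longleftrightarrow> \<not> cycles C i \<subseteq> boundaries C i"
proof -
  let ?M = "cobj C i" and ?B = "boundaries C i"
  have M: "module R ?M" and B: "submodule ?B R ?M" and Z: "submodule (cycles C i) R ?M"
    using assms by (auto intro: precomplexD boundaries_submodule cycles_submodule)
  interpret module R ?M by (rule M)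
  have zero: "\<zero>\<^bsub>?M\<^esub> \<in> cycles C i"
    using subgroup.one_closed[OF submodule.axioms(1)[OF Z]] by simp
  have sub: "cycles C i \<subseteq> carrier ?M" by (auto simp: cycles_def)
  have "?B +>\<^bsub>?M\<^esub> x = ?B \<longleftrightarrow> x \<in> ?B" if "x \<in> carrier ?M" for x
    using coset_eq_iff[OF M B that M.zero_closed] that by (simp add: coset_zero[OF M B] M.minus_zero_right)
  then have "(\<forall>x\<in>cycles C i. ?B +>\<^bsub>?M\<^esub> x = ?B) \<longleftrightarrow> cycles C i \<subseteq> ?B" using sub by blast
  moreover have "(\<lambda>x. ?B +>\<^bsub>?M\<^esub> x) ` cycles C i = {?B} \<longleftrightarrow> (\<forall>x\<in>cycles C i. ?B +>\<^bsub>?M\<^esub> x = ?B)"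
    using zero by blast
  \<comment> \<open>Coset formation looks only at the addition, so restricting the carrier to the
    cycles changes which representatives occur but not the cosets themselves.\<close>
  moreover have "carrier (homology C i) = (\<lambda>x. ?B +>\<^bsub>?M\<^esub> x) ` cycles C i"
    by (auto simp: homology_def quot_module_def A_RCOSETS_def' a_r_coset_def')
  moreover have "\<zero>\<^bsub>homology C i\<^esub> = ?B"
    by (simp add: homology_def quot_module_def)
  ultimately show ?thesis
    unfolding nonzero_module_def by simp
qed

subsection \<open>Graded maps\<close>

definition graded_maps ::
    "('a, 'c) ring_scheme \<Rightarrow> ('a, 'm) chain_complex \<Rightarrow> ('a, 'n) chain_complex \<Rightarrow> int \<Rightarrow>
     (int \<Rightarrow> 'm \<Rightarrow> 'n) set" where
  "graded_maps R Q M n = {\<phi>. \<forall>i. \<phi> i \<in> linear_maps R (cobj Q i) (cobj M (i + n))}"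

text \<open>The differential of the Hom complex, for families of total functions. Without the
  restriction to carriers that \<open>hom_complex\<close> builds in, composites can be formed
  freely; \<open>hom_complex_diff\<close> makes the connection.\<close>

definition hom_diff ::
    "('a, 'm) chain_complex \<Rightarrow> ('a, 'n) chain_complex \<Rightarrow> int \<Rightarrow> (int \<Rightarrow> 'm \<Rightarrow> 'n) \<Rightarrow> int \<Rightarrow> 'm \<Rightarrow> 'n" where
  "hom_diff Q M n \<phi> i x = cdiff M (i + n) (\<phi> i x) \<ominus>\<^bsub>cobj M (i + n - 1)\<^esub>
     sgn_power (cobj M (i + n - 1)) n (\<phi> (i - 1) (cdiff Q i x))"

definition hom_cycles ::
    "('a, 'c) ring_scheme \<Rightarrow> ('a, 'm) chain_complex \<Rightarrow> ('a, 'n) chain_complex \<Rightarrow> int \<Rightarrow>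
     (int \<Rightarrow> 'm \<Rightarrow> 'n) set" where
  "hom_cycles R Q M n = {\<phi> \<in> graded_maps R Q M n.
     \<forall>i. \<forall>x\<in>carrier (cobj Q i). hom_diff Q M n \<phi> i x = \<zero>\<^bsub>cobj M (i + n - 1)\<^esub>}"

definition null_homotopic ::
    "('a, 'c) ring_scheme \<Rightarrow> ('a, 'm) chain_complex \<Rightarrow> ('a, 'n) chain_complex \<Rightarrow> int \<Rightarrow>
     (int \<Rightarrow> 'm \<Rightarrow> 'n) \<Rightarrow> bool" where
  "null_homotopic R Q M n \<phi> \<longleftrightarrow> (\<exists>H\<in>graded_maps R Q M (n + 1).
     \<forall>i. \<forall>x\<in>carrier (cobj Q i). \<phi> i x = hom_diff Q M (n + 1) H i x)"

text \<open>By \<open>nonzero_hom_homology\<close> below, this says that the homology of \<open>Hom(Q, M)\<close> vanishes in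
  degree \<open>n\<close>.\<close>

definition hom_vanishes ::
    "('a, 'c) ring_scheme \<Rightarrow> ('a, 'm) chain_complex \<Rightarrow> ('a, 'n) chain_complex \<Rightarrow> int \<Rightarrow> bool" where
  "hom_vanishes R Q M n \<longleftrightarrow> (\<forall>\<phi>\<in>hom_cycles R Q M n. null_homotopic R Q M n \<phi>)"

lemma graded_mapsD:
  assumes "\<phi> \<in> graded_maps R Q M n"
  shows "\<phi> i \<in> linear_maps R (cobj Q i) (cobj M (i + n))"
    "x \<in> carrier (cobj Q i) \<Longrightarrow> \<phi> i x \<in> carrier (cobj M (i + n))"
    "\<phi> (i - 1) \<in> linear_maps R (cobj Q (i - 1)) (cobj M (i + n - 1))"
    "x \<in> carrier (cobj Q (i - 1)) \<Longrightarrow> \<phi> (i - 1) x \<in> carrier (cobj M (i + n - 1))"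
proof -
  have *: "\<phi> i \<in> linear_maps R (cobj Q i) (cobj M (i + n))" for i
    using assms by (simp add: graded_maps_def)
  show "\<phi> i \<in> linear_maps R (cobj Q i) (cobj M (i + n))" by (rule *)
  show **: "\<phi> (i - 1) \<in> linear_maps R (cobj Q (i - 1)) (cobj M (i + n - 1))"
    using *[of "i - 1"] by (simp add: algebra_simps)
  show "x \<in> carrier (cobj Q i) \<Longrightarrow> \<phi> i x \<in> carrier (cobj M (i + n))" by (rule linear_closed[OF *])
  show "x \<in> carrier (cobj Q (i - 1)) \<Longrightarrow> \<phi> (i - 1) x \<in> carrier (cobj M (i + n - 1))"
    by (rule linear_closed[OF **])
qed

lemma hom_cyclesD:
  assumes "\<phi> \<in> hom_cycles R Q M n"
  shows "\<phi> \<in> graded_maps R Q M n"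
    "x \<in> carrier (cobj Q i) \<Longrightarrow> hom_diff Q M n \<phi> i x = \<zero>\<^bsub>cobj M (i + n - 1)\<^esub>"
  using assms by (auto simp: hom_cycles_def)

lemma (in abelian_group) minus_eq_zero_iff:
  "x \<in> carrier G \<Longrightarrow> y \<in> carrier G \<Longrightarrow> x \<ominus> y = \<zero> \<longleftrightarrow> x = y"
  by (metis add.inv_solve_right' a_minus_def l_zero r_neg zero_closed)

lemma hom_diff_linear:
  assumes "precomplex R Q" "precomplex R M" "\<phi> \<in> graded_maps R Q M n"
  shows "hom_diff Q M n \<phi> i \<in> linear_maps R (cobj Q i) (cobj M (i + n - 1))"
  unfolding hom_diff_def
  by (intro linear_diff sgn_power_linear linear_comp[OF graded_mapsD(1)[OF assms(3)]]
      linear_comp[OF precomplexD(2)[OF assms(1)]] precomplexD[OF assms(2)] graded_mapsD(3)[OF assms(3)])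

lemma hom_diff_graded:
  assumes "precomplex R Q" "precomplex R M" "\<phi> \<in> graded_maps R Q M n"
  shows "hom_diff Q M n \<phi> \<in> graded_maps R Q M (n - 1)"
  using hom_diff_linear[OF assms] by (simp add: graded_maps_def algebra_simps)

lemma hom_cycle_eq:
  assumes "precomplex R Q" "precomplex R M" "\<phi> \<in> hom_cycles R Q M n" "x \<in> carrier (cobj Q i)"
  shows "cdiff M (i + n) (\<phi> i x) = sgn_power (cobj M (i + n - 1)) n (\<phi> (i - 1) (cdiff Q i x))"
proof -
  interpret M: module R "cobj M (i + n - 1)" by (rule precomplexD[OF assms(2)])
  note g = hom_cyclesD(1)[OF assms(3)]
  have "cdiff M (i + n) (\<phi> i x) \<in> carrier (cobj M (i + n - 1))"
    by (rule linear_closed[OF precomplexD(2)[OF assms(2)] graded_mapsD(2)[OF g assms(4)]])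
  moreover have "sgn_power (cobj M (i + n - 1)) n (\<phi> (i - 1) (cdiff Q i x)) \<in> carrier (cobj M (i + n - 1))"
    by (rule sgn_power_closed[OF M.module_axioms graded_mapsD(4)[OF g linear_closed[OF precomplexD(2)[OF assms(1)] assms(4)]]])
  ultimately show ?thesis
    using hom_cyclesD(2)[OF assms(3,4)] M.minus_eq_zero_iff unfolding hom_diff_def by blast
qed

lemma hom_diff_comp:
  assumes "precomplex R Q" "precomplex R M" "precomplex R N" "\<phi> \<in> graded_maps R Q M n"
    and g: "g \<in> chain_maps R M N" and x: "x \<in> carrier (cobj Q i)"
  shows "hom_diff Q N n (\<lambda>i x. g (i + n) (\<phi> i x)) i x = g (i + n - 1) (hom_diff Q M n \<phi> i x)"
proof -
  let ?j = "i + n - 1"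
  have lin: "g ?j \<in> linear_maps R (cobj M ?j) (cobj N ?j)" by (rule chain_mapsD(1)[OF g])
  have M: "module R (cobj M ?j)" and N: "module R (cobj N ?j)" using assms precomplexD by blast+
  have c1: "cdiff M (i + n) (\<phi> i x) \<in> carrier (cobj M ?j)"
    by (rule linear_closed[OF precomplexD(2)[OF assms(2)] graded_mapsD(2)[OF assms(4) x]])
  have c2: "\<phi> (i - 1) (cdiff Q i x) \<in> carrier (cobj M ?j)"
    by (rule graded_mapsD(4)[OF assms(4) linear_closed[OF precomplexD(2)[OF assms(1)] x]])
  have e: "i - 1 + n = ?j" by simp
  show ?thesis
    unfolding hom_diff_def e
    using linear_minus[OF M N lin c1 sgn_power_closed[OF M c2], of n] linear_sgn_power[OF M N lin c2, of n]
      chain_mapsD(2)[OF g graded_mapsD(2)[OF assms(4) x]]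
    by simp
qed

lemma chain_map_hom_diff:
  assumes "precomplex R Q" "precomplex R M" "f \<in> chain_maps R Q M" "x \<in> carrier (cobj Q i)"
  shows "hom_diff Q M 0 f i x = \<zero>\<^bsub>cobj M (i - 1)\<^esub>"
proof -
  interpret M: module R "cobj M (i - 1)" by (rule precomplexD[OF assms(2)])
  have "cdiff M i (f i x) \<in> carrier (cobj M (i - 1))"
    by (rule linear_closed[OF precomplexD(2)[OF assms(2)] chain_mapsD(3)[OF assms(3,4)]])
  then show ?thesis
    by (simp add: hom_diff_def sgn_power_def chain_mapsD(2)[OF assms(3,4)] M.minus_eq M.r_neg)
qed

text \<open>In degree 0 the sign of the Hom differential is trivial. Lifting and comparing chain
  maps thereby become the degree 0 case of the corresponding facts on cycles of any degree.\<close>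

lemma chain_maps_eq_hom_cycles:
  assumes "precomplex R Q" "precomplex R M"
  shows "chain_maps R Q M = hom_cycles R Q M 0"
proof
  show "chain_maps R Q M \<subseteq> hom_cycles R Q M 0"
    using chain_map_hom_diff[OF assms] by (auto simp: hom_cycles_def graded_maps_def chain_mapsD(1))
  show "hom_cycles R Q M 0 \<subseteq> chain_maps R Q M"
  proof
    fix f assume f: "f \<in> hom_cycles R Q M 0"
    show "f \<in> chain_maps R Q M"
      using graded_mapsD(1)[OF hom_cyclesD(1)[OF f]] hom_cycle_eq[OF assms f]
      by (auto simp: chain_maps_def sgn_power_def)
  qed
qed

lemma graded_maps_comp:
  assumes "\<phi> \<in> graded_maps R Q M n" "g \<in> chain_maps R M N"
  shows "(\<lambda>i x. g (i + n) (\<phi> i x)) \<in> graded_maps R Q N n"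
  using linear_comp[OF graded_mapsD(1)[OF assms(1)] chain_mapsD(1)[OF assms(2)]]
  by (simp add: graded_maps_def)

lemma graded_maps_precomp:
  assumes "f \<in> chain_maps R Q' Q" "\<phi> \<in> graded_maps R Q M n"
  shows "(\<lambda>i x. \<phi> i (f i x)) \<in> graded_maps R Q' M n"
  using linear_comp[OF chain_mapsD(1)[OF assms(1)] graded_mapsD(1)[OF assms(2)]]
  by (simp add: graded_maps_def)

lemma hom_diff_precomp:
  assumes "f \<in> chain_maps R Q' Q" "x \<in> carrier (cobj Q' i)"
  shows "hom_diff Q' M n (\<lambda>i x. \<phi> i (f i x)) i x = hom_diff Q M n \<phi> i (f i x)"
  by (simp add: hom_diff_def chain_mapsD(2)[OF assms])

subsection \<open>Lifting along free retracts\<close>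

text \<open>Projectivity in a form that does not mention test modules.\<close>

definition free_retract :: "('a, 'c) ring_scheme \<Rightarrow> ('a, 'q) module \<Rightarrow> 's set \<Rightarrow> bool" where
  "free_retract R Q S \<longleftrightarrow> module R Q \<and> (\<exists>e\<in>S \<rightarrow> carrier Q. \<exists>l\<in>linear_maps R Q (free_module R S).
     \<forall>x\<in>carrier Q. lin_ext R Q e (l x) = x)"

lemma lin_ext_cong:
  assumes "module R M" "e \<in> S \<rightarrow> carrier M" "\<phi> \<in> carrier (free_module R S)" "\<And>s. s \<in> S \<Longrightarrow> e' s = e s"
  shows "lin_ext R M e' \<phi> = lin_ext R M e \<phi>"
proof -
  interpret module R M by fact
  show ?thesis
    unfolding lin_ext_def
    by (rule M.finsum_cong') (use free_carrierD[OF assms(3)] assms(4) e_closed[OF assms(1,2)] in \<open>auto simp: subset_iff\<close>)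
qed

text \<open>Preimages are chosen for the images of the generators and extended linearly; the section
  \<open>l\<close> then brings the result to \<open>Q\<close>. Unlike the test modules of
  \<open>projective_module\<close>, \<open>N\<close> and \<open>N'\<close> here have arbitrary
  element types, and \<open>u\<close> has to reach only the image of \<open>w\<close>.\<close>

lemma free_retract_lift:
  assumes "free_retract R Q S" and N: "module R N" and N': "module R N'"
    and u: "u \<in> linear_maps R N N'" and w: "w \<in> linear_maps R Q N'" and "w ` carrier Q \<subseteq> u ` carrier N"
  obtains v where "v \<in> linear_maps R Q N" "\<And>x. x \<in> carrier Q \<Longrightarrow> u (v x) = w x"
proof -
  obtain e l where Q: "module R Q" and e: "e \<in> S \<rightarrow> carrier Q" and l: "l \<in> linear_maps R Q (free_module R S)"
    and el: "\<And>x. x \<in> carrier Q \<Longrightarrow> lin_ext R Q e (l x) = x"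
    using assms(1) by (auto simp: free_retract_def)
  have "\<forall>s\<in>S. \<exists>n\<in>carrier N. u n = w (e s)" using assms(6) e by (fastforce simp: image_iff)
  then obtain n where n: "\<And>s. s \<in> S \<Longrightarrow> n s \<in> carrier N \<and> u (n s) = w (e s)" by metis
  then have nS: "n \<in> S \<rightarrow> carrier N" by auto
  show thesis
  proof
    show "(\<lambda>x. lin_ext R N n (l x)) \<in> linear_maps R Q N"
      by (rule linear_comp[OF l lin_ext_linear[OF N nS]])
    fix x assume x: "x \<in> carrier Q"
    note lx = linear_closed[OF l x]
    have "u (lin_ext R N n (l x)) = lin_ext R N' (\<lambda>s. u (n s)) (l x)"
      by (rule linear_lin_ext[OF N nS N' u lx])
    also have "\<dots> = lin_ext R N' (\<lambda>s. w (e s)) (l x)"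
      by (rule lin_ext_cong[OF N' _ lx]) (use n linear_closed[OF w] e in auto)
    also have "\<dots> = w (lin_ext R Q e (l x))"
      by (rule linear_lin_ext[OF Q e N' w lx, symmetric])
    finally show "u (lin_ext R N n (l x)) = w x" using el[OF x] by simp
  qed
qed

definition free_retract_complex :: "('a, 'c) ring_scheme \<Rightarrow> ('a, 'q) chain_complex \<Rightarrow> (int \<Rightarrow> 's set) \<Rightarrow> bool" where
  "free_retract_complex R Q S \<longleftrightarrow> is_complex R Q \<and> bounded_below_complex Q \<and>
     (\<forall>i. free_retract R (cobj Q i) (S i))"

text \<open>Recursion over the integers for constructions that are bounded below: the values below
  \<open>b\<close> are prescribed, \<open>P\<close> is the invariant that allows the next choice,
  and \<open>T\<close> ties each choice to the preceding one.\<close>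

lemma int_dependent_choice:
  fixes b :: int
  assumes low: "\<And>i. i < b \<Longrightarrow> P i (z i)" "\<And>i. i < b \<Longrightarrow> T i (z (i - 1)) (z i)"
    and step: "\<And>i h'. b \<le> i \<Longrightarrow> P (i - 1) h' \<Longrightarrow> \<exists>h. P i h \<and> T i h' h"
  obtains H where "\<And>i. P i (H i)" "\<And>i. T i (H (i - 1)) (H i)" "\<And>i. i < b \<Longrightarrow> H i = z i"
proof -
  \<comment> \<open>The sequence starts at degree \<open>b - 1\<close> with the prescribed value, so
    that the first genuine choice, in degree \<open>b\<close>, is already linked by \<open>T\<close>
    to \<open>z (b - 1)\<close>.\<close>
  have "\<exists>f. \<forall>k. (P (b - 1 + int k) (f k) \<and> (k = 0 \<longrightarrow> f k = z (b - 1))) \<and> T (b - 1 + int (Suc k)) (f k) (f (Suc k))"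
  proof (rule dependent_nat_choice[where P = "\<lambda>k h. P (b - 1 + int k) h \<and> (k = 0 \<longrightarrow> h = z (b - 1))"
        and Q = "\<lambda>k. T (b - 1 + int (Suc k))"])
    show "\<exists>h. P (b - 1 + int 0) h \<and> (0 = 0 \<longrightarrow> h = z (b - 1))" using low(1)[of "b - 1"] by auto
    fix h k assume "P (b - 1 + int k) h \<and> (k = 0 \<longrightarrow> h = z (b - 1))"
    then show "\<exists>h'. (P (b - 1 + int (Suc k)) h' \<and> (Suc k = 0 \<longrightarrow> h' = z (b - 1))) \<and> T (b - 1 + int (Suc k)) h h'"
      using step[of "b - 1 + int (Suc k)" h] by (auto simp: algebra_simps)
  qed
  then obtain f where f: "\<And>k. P (b - 1 + int k) (f k)" "f 0 = z (b - 1)"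
    "\<And>k. T (b - 1 + int (Suc k)) (f k) (f (Suc k))" by blast
  define H where "H i = (if i < b then z i else f (nat (i - b + 1)))" for i
  have Hf: "H (b - 1 + int k) = f k" for k using f(2) by (cases k) (auto simp: H_def nat_add_distrib)
  show thesis
  proof
    fix i
    show "P i (H i)"
      using low(1)[of i] f(1)[of "nat (i - b + 1)"] by (cases "i < b") (auto simp: H_def)
    show "T i (H (i - 1)) (H i)"
    proof (cases "i < b")
      case False
      then obtain k where k: "i = b - 1 + int (Suc k)"
        by (metis add.commute diff_add_cancel diff_diff_eq2 int_ops(4) not_less zle_iff_zadd)
      then show ?thesis using f(3)[of k] Hf[of k] Hf[of "Suc k"] by (simp add: algebra_simps)
    qed (use low(2) in \<open>simp add: H_def\<close>)
  qed (simp add: H_def)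
qed

text \<open>The null homotopy is built upwards from the degrees in which \<open>Q\<close> is zero.
  In each degree the map to be lifted has values in the cycles of \<open>E\<close>, which are
  boundaries by exactness, so projectivity provides the lift.\<close>

lemma hom_vanishes_exact:
  assumes Q: "free_retract_complex R Q S" and E: "is_complex R E"
    and exact: "\<And>i. cycles E i \<subseteq> boundaries E i"
  shows "hom_vanishes R Q E n"
  unfolding hom_vanishes_def
proof
  fix \<phi> assume \<phi>: "\<phi> \<in> hom_cycles R Q E n"
  have Qc: "is_complex R Q" and Qr: "\<And>i. free_retract R (cobj Q i) (S i)"
    using Q by (auto simp: free_retract_complex_def)
  obtain b where b: "\<And>i. i < b \<Longrightarrow> carrier (cobj Q i) = {\<zero>\<^bsub>cobj Q i\<^esub>}"
    using Q by (auto simp: free_retract_complex_def bounded_below_complex_def nonzero_module_def)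
  note pQ = is_complexD(1)[OF Qc] and pE = is_complexD(1)[OF E]
  note g = hom_cyclesD(1)[OF \<phi>]
  have e1: "i + (n + 1) - 1 = i + n" "i - 1 + (n + 1) = i + n" for i by auto
  \<comment> \<open>On cycles of \<open>Q\<close> the term of the homotopy equation with the
    preceding map vanishes, so this part of the equation speaks of \<open>h\<close> alone. It
    suffices for the next degree, since there the differential of \<open>Q\<close> has its values in
    cycles.\<close>
  define P where "P i h \<longleftrightarrow> h \<in> linear_maps R (cobj Q i) (cobj E (i + (n + 1))) \<and>
    (\<forall>y\<in>cycles Q i. cdiff E (i + (n + 1)) (h y) = \<phi> i y)" for i h
  define T where "T i h' h \<longleftrightarrow> (\<forall>x\<in>carrier (cobj Q i). \<phi> i x = cdiff E (i + (n + 1)) (h x) \<ominus>\<^bsub>cobj E (i + n)\<^esub>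
     sgn_power (cobj E (i + n)) (n + 1) (h' (cdiff Q i x)))" for i and h' h
  let ?z = "\<lambda>i x. \<zero>\<^bsub>cobj E (i + (n + 1))\<^esub>"
  have dzero: "cdiff E j \<zero>\<^bsub>cobj E j\<^esub> = \<zero>\<^bsub>cobj E (j - 1)\<^esub>" for j
    by (rule linear_zero) (rule is_complexD[OF E])+
  have "\<exists>H. (\<forall>i. P i (H i)) \<and> (\<forall>i. T i (H (i - 1)) (H i))"
  proof (rule int_dependent_choice[of b P ?z T])
    fix i assume i: "i < b"
    have \<phi>0: "\<phi> i \<zero>\<^bsub>cobj Q i\<^esub> = \<zero>\<^bsub>cobj E (i + n)\<^esub>"
      by (rule linear_zero[OF is_complexD(2)[OF Qc] is_complexD(2)[OF E] graded_mapsD(1)[OF g]])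
    show "P i (?z i)"
      using b[OF i] dzero[of "i + (n + 1)"] \<phi>0 unfolding P_def e1
      by (auto simp: cycles_def intro: linear_zero_map is_complexD[OF E])
    interpret E: module R "cobj E (i + n)" by (rule is_complexD[OF E])
    show "T i (?z (i - 1)) (?z i)"
      using b[OF i] dzero[of "i + (n + 1)"] \<phi>0 unfolding T_def e1
      by (simp add: sgn_power_zero[OF E.module_axioms] E.minus_zero_right)
  next
    fix i h' assume h': "P (i - 1) h'"
    interpret E: module R "cobj E (i + n)" by (rule is_complexD[OF E])
    have h'l: "h' \<in> linear_maps R (cobj Q (i - 1)) (cobj E (i + n))" using h' unfolding P_def e1 by blast
    \<comment> \<open>The homotopy equation \<open>T\<close>, solved for the differential of the map
      that is sought.\<close>
    define w where "w x = \<phi> i x \<oplus>\<^bsub>cobj E (i + n)\<^esub> sgn_power (cobj E (i + n)) (n + 1) (h' (cdiff Q i x))" for x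
    have wl: "w \<in> linear_maps R (cobj Q i) (cobj E (i + n))"
      unfolding w_def
      by (intro linear_plus sgn_power_linear E.module_axioms graded_mapsD(1)[OF g]
          linear_comp[OF is_complexD(3)[OF Qc] h'l])
    have im: "w x \<in> cdiff E (i + (n + 1)) ` carrier (cobj E (i + (n + 1)))" if x: "x \<in> carrier (cobj Q i)" for x
    proof -
      interpret E': module R "cobj E (i + n - 1)" by (rule is_complexD[OF E])
      have dx: "cdiff Q i x \<in> cycles Q (i - 1)"
        using is_complexD(4,5)[OF Qc x] by (simp add: cycles_def)
      then have dx': "cdiff Q i x \<in> carrier (cobj Q (i - 1))" by (simp add: cycles_def)
      have "cdiff E (i + n) (h' (cdiff Q i x)) = \<phi> (i - 1) (cdiff Q i x)"
        using h' dx unfolding P_def e1 by blast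
      moreover have "cdiff E (i + n) (\<phi> i x) = sgn_power (cobj E (i + n - 1)) n (\<phi> (i - 1) (cdiff Q i x))"
        by (rule hom_cycle_eq[OF pQ pE \<phi> x])
      moreover have "cdiff E (i + n) (w x) = cdiff E (i + n) (\<phi> i x) \<oplus>\<^bsub>cobj E (i + n - 1)\<^esub>
          sgn_power (cobj E (i + n - 1)) (n + 1) (cdiff E (i + n) (h' (cdiff Q i x)))"
        unfolding w_def
        using linear_add[OF is_complexD(3)[OF E] graded_mapsD(2)[OF g x] sgn_power_closed[OF E.module_axioms linear_closed[OF h'l dx']]]
          linear_sgn_power[OF E.module_axioms E'.module_axioms is_complexD(3)[OF E] linear_closed[OF h'l dx']]
        by simp
      ultimately have "cdiff E (i + n) (w x) = \<zero>\<^bsub>cobj E (i + n - 1)\<^esub>"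
        using graded_mapsD(4)[OF g dx'] by (simp add: sgn_power_def E'.r_neg E'.l_neg)
      then have "w x \<in> cycles E (i + n)" using linear_closed[OF wl x] by (simp add: cycles_def)
      then have "w x \<in> boundaries E (i + n)" using exact by blast
      then show ?thesis by (simp add: boundaries_def add.assoc)
    qed
    have u: "cdiff E (i + (n + 1)) \<in> linear_maps R (cobj E (i + (n + 1))) (cobj E (i + n))"
      using is_complexD(3)[OF E, of "i + (n + 1)"] unfolding e1 .
    obtain h where h: "h \<in> linear_maps R (cobj Q i) (cobj E (i + (n + 1)))"
      "\<And>x. x \<in> carrier (cobj Q i) \<Longrightarrow> cdiff E (i + (n + 1)) (h x) = w x"
      using free_retract_lift[OF Qr is_complexD(2)[OF E] is_complexD(2)[OF E] u wl] im by blast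
    have cl: "\<phi> i x \<in> carrier (cobj E (i + n))" "h' (cdiff Q i x) \<in> carrier (cobj E (i + n))"
      if "x \<in> carrier (cobj Q i)" for x
      using graded_mapsD(2)[OF g that] linear_closed[OF h'l is_complexD(4)[OF Qc that]] by auto
    have "h' \<zero>\<^bsub>cobj Q (i - 1)\<^esub> = \<zero>\<^bsub>cobj E (i + n)\<^esub>"
      by (rule linear_zero[OF is_complexD(2)[OF Qc] E.module_axioms h'l])
    then have "P i h"
      using h cl unfolding P_def w_def by (simp add: cycles_def sgn_power_zero[OF E.module_axioms])
    moreover have "T i h' h"
      using h(2) cl unfolding T_def w_def
      by (simp add: sgn_power_def E.a_assoc E.minus_eq E.r_neg E.l_neg E.minus_minus)
    ultimately show "\<exists>h. P i h \<and> T i h' h" by blast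
  qed blast
  then obtain H where H: "\<And>i. P i (H i)" "\<And>i. T i (H (i - 1)) (H i)" by blast
  show "null_homotopic R Q E n \<phi>"
    unfolding null_homotopic_def
  proof (intro bexI[of _ H] allI ballI)
    show "H \<in> graded_maps R Q E (n + 1)" using H(1) by (auto simp: graded_maps_def P_def)
    show "\<phi> i x = hom_diff Q E (n + 1) H i x" if "x \<in> carrier (cobj Q i)" for i x
      using H(2)[of i] that unfolding T_def hom_diff_def e1 by blast
  qed
qed

subsection \<open>Homotopies\<close>

lemma (in abelian_group) minus_self: "x \<in> carrier G \<Longrightarrow> x \<ominus> x = \<zero>"
  by (simp add: minus_eq r_neg)

lemma null_homotopic_cong:
  assumes "null_homotopic R Q M n \<phi>" "\<And>i x. x \<in> carrier (cobj Q i) \<Longrightarrow> \<psi> i x = \<phi> i x"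
  shows "null_homotopic R Q M n \<psi>"
  using assms by (simp add: null_homotopic_def)

lemma hom_diff_minus:
  assumes "precomplex R Q" "precomplex R M" "\<phi> \<in> graded_maps R Q M n" "\<psi> \<in> graded_maps R Q M n"
    and x: "x \<in> carrier (cobj Q i)"
  shows "hom_diff Q M n (\<lambda>i x. \<phi> i x \<ominus>\<^bsub>cobj M (i + n)\<^esub> \<psi> i x) i x =
    hom_diff Q M n \<phi> i x \<ominus>\<^bsub>cobj M (i + n - 1)\<^esub> hom_diff Q M n \<psi> i x"
proof -
  let ?N = "cobj M (i + n - 1)"
  have N: "module R ?N" and M: "module R (cobj M (i + n))" by (rule precomplexD[OF assms(2)])+
  interpret N: abelian_group ?N by (rule module_abelian_group[OF N])
  have e: "i - 1 + n = i + n - 1" by simp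
  note dx = linear_closed[OF precomplexD(2)[OF assms(1)] x]
  note c = graded_mapsD(2)[OF assms(3) x] graded_mapsD(2)[OF assms(4) x]
  note c' = graded_mapsD(4)[OF assms(3) dx] graded_mapsD(4)[OF assms(4) dx]
  note dc = linear_closed[OF precomplexD(2)[OF assms(2)] c(1)] linear_closed[OF precomplexD(2)[OF assms(2)] c(2)]
  note s = sgn_power_closed[OF N c'(1), of n] sgn_power_closed[OF N c'(2), of n]
  have *: "(a \<ominus>\<^bsub>?N\<^esub> b) \<ominus>\<^bsub>?N\<^esub> (a' \<ominus>\<^bsub>?N\<^esub> b') = (a \<ominus>\<^bsub>?N\<^esub> a') \<ominus>\<^bsub>?N\<^esub> (b \<ominus>\<^bsub>?N\<^esub> b')"
    if "a \<in> carrier ?N" "b \<in> carrier ?N" "a' \<in> carrier ?N" "b' \<in> carrier ?N" for a b a' b'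
    using that by (simp add: N.minus_eq N.minus_add N.minus_minus N.a_ac)
  show ?thesis
    unfolding hom_diff_def e
    by (simp add: linear_minus[OF M N precomplexD(2)[OF assms(2)] c] sgn_power_minus[OF N c'] * dc s)
qed

lemma graded_maps_minus:
  assumes "precomplex R M" "\<phi> \<in> graded_maps R Q M n" "\<psi> \<in> graded_maps R Q M n"
  shows "(\<lambda>i x. \<phi> i x \<ominus>\<^bsub>cobj M (i + n)\<^esub> \<psi> i x) \<in> graded_maps R Q M n"
  using assms by (auto simp: graded_maps_def intro!: linear_diff precomplexD)

lemma null_homotopic_minus:
  assumes "precomplex R Q" "precomplex R M" "null_homotopic R Q M n \<phi>" "null_homotopic R Q M n \<psi>"
  shows "null_homotopic R Q M n (\<lambda>i x. \<phi> i x \<ominus>\<^bsub>cobj M (i + n)\<^esub> \<psi> i x)"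
proof -
  obtain H K where H: "H \<in> graded_maps R Q M (n + 1)" "\<And>i x. x \<in> carrier (cobj Q i) \<Longrightarrow> \<phi> i x = hom_diff Q M (n + 1) H i x"
    and K: "K \<in> graded_maps R Q M (n + 1)" "\<And>i x. x \<in> carrier (cobj Q i) \<Longrightarrow> \<psi> i x = hom_diff Q M (n + 1) K i x"
    using assms(3,4) by (auto simp: null_homotopic_def)
  have e: "i + (n + 1) - 1 = i + n" for i by simp
  show ?thesis
    unfolding null_homotopic_def
    by (intro bexI[OF _ graded_maps_minus[OF assms(2) H(1) K(1)]] allI ballI)
      (simp add: hom_diff_minus[OF assms(1,2) H(1) K(1)] e H(2)[symmetric] K(2)[symmetric])
qed

lemma null_homotopic_zero:
  assumes "precomplex R Q" "precomplex R M" "\<And>i x. x \<in> carrier (cobj Q i) \<Longrightarrow> \<phi> i x = \<zero>\<^bsub>cobj M (i + n)\<^esub>"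
  shows "null_homotopic R Q M n \<phi>"
proof -
  have e: "i + (n + 1) - 1 = i + n" "i - 1 + (n + 1) = i + n" for i by auto
  have "hom_diff Q M (n + 1) (\<lambda>i x. \<zero>\<^bsub>cobj M (i + (n + 1))\<^esub>) i x = \<zero>\<^bsub>cobj M (i + n)\<^esub>" for i x
  proof -
    interpret M: module R "cobj M (i + n)" by (rule precomplexD[OF assms(2)])
    have "cdiff M (i + (n + 1)) \<zero>\<^bsub>cobj M (i + (n + 1))\<^esub> = \<zero>\<^bsub>cobj M (i + (n + 1) - 1)\<^esub>"
      by (rule linear_zero) (rule precomplexD[OF assms(2)])+
    then show ?thesis
      unfolding hom_diff_def e by (simp add: sgn_power_zero[OF M.module_axioms] M.minus_zero_right)
  qed
  moreover have "(\<lambda>i x. \<zero>\<^bsub>cobj M (i + (n + 1))\<^esub>) \<in> graded_maps R Q M (n + 1)"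
    by (auto simp: graded_maps_def intro!: linear_zero_map precomplexD[OF assms(2)])
  ultimately show ?thesis
    using assms(3) unfolding null_homotopic_def by (intro bexI[of _ "\<lambda>i x. \<zero>\<^bsub>cobj M (i + (n + 1))\<^esub>"]) auto
qed

lemma null_homotopic_plus:
  assumes "precomplex R Q" "precomplex R M" "null_homotopic R Q M n \<phi>" "null_homotopic R Q M n \<psi>"
    and "\<And>i x. x \<in> carrier (cobj Q i) \<Longrightarrow> \<phi> i x \<in> carrier (cobj M (i + n)) \<and> \<psi> i x \<in> carrier (cobj M (i + n))"
  shows "null_homotopic R Q M n (\<lambda>i x. \<phi> i x \<oplus>\<^bsub>cobj M (i + n)\<^esub> \<psi> i x)"
proof -
  have "null_homotopic R Q M n (\<lambda>i x. \<zero>\<^bsub>cobj M (i + n)\<^esub>)"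
    by (rule null_homotopic_zero[OF assms(1,2)]) simp
  from null_homotopic_minus[OF assms(1,2,3) null_homotopic_minus[OF assms(1,2) this assms(4)]]
  show ?thesis
  proof (rule null_homotopic_cong)
    fix i x assume x: "x \<in> carrier (cobj Q i)"
    interpret M: module R "cobj M (i + n)" by (rule precomplexD[OF assms(2)])
    show "\<phi> i x \<oplus>\<^bsub>cobj M (i + n)\<^esub> \<psi> i x = \<phi> i x \<ominus>\<^bsub>cobj M (i + n)\<^esub> (\<zero>\<^bsub>cobj M (i + n)\<^esub> \<ominus>\<^bsub>cobj M (i + n)\<^esub> \<psi> i x)"
      using assms(5)[OF x] by (simp add: M.minus_eq M.minus_add M.minus_minus M.a_minus_zero)
  qed
qed

lemma null_homotopic_postcomp:
  assumes "precomplex R Q" "precomplex R M" "precomplex R N" "g \<in> chain_maps R M N" "null_homotopic R Q M n \<phi>"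
  shows "null_homotopic R Q N n (\<lambda>i x. g (i + n) (\<phi> i x))"
proof -
  obtain H where H: "H \<in> graded_maps R Q M (n + 1)" "\<And>i x. x \<in> carrier (cobj Q i) \<Longrightarrow> \<phi> i x = hom_diff Q M (n + 1) H i x"
    using assms(5) by (auto simp: null_homotopic_def)
  have e: "i + (n + 1) - 1 = i + n" for i by simp
  show ?thesis
    unfolding null_homotopic_def
    by (intro bexI[OF _ graded_maps_comp[OF H(1) assms(4)]] allI ballI)
      (simp only: hom_diff_comp[OF assms(1-3) H(1) assms(4)] e H(2))
qed

lemma null_homotopic_precomp:
  assumes "f \<in> chain_maps R Q' Q" "null_homotopic R Q M n \<phi>"
  shows "null_homotopic R Q' M n (\<lambda>i x. \<phi> i (f i x))"
proof -
  obtain H where H: "H \<in> graded_maps R Q M (n + 1)" "\<And>i x. x \<in> carrier (cobj Q i) \<Longrightarrow> \<phi> i x = hom_diff Q M (n + 1) H i x"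
    using assms(2) by (auto simp: null_homotopic_def)
  show ?thesis
    unfolding null_homotopic_def
    by (intro bexI[OF _ graded_maps_precomp[OF assms(1) H(1)]] allI ballI)
      (simp add: hom_diff_precomp[OF assms(1)] H(2)[OF chain_mapsD(3)[OF assms(1)]])
qed

lemma hom_cycles_precomp:
  assumes "f \<in> chain_maps R Q' Q" "\<phi> \<in> hom_cycles R Q M n"
  shows "(\<lambda>i x. \<phi> i (f i x)) \<in> hom_cycles R Q' M n"
  using graded_maps_precomp[OF assms(1) hom_cyclesD(1)[OF assms(2)]]
    hom_diff_precomp[OF assms(1), where M = M and n = n and \<phi> = \<phi>]
    hom_cyclesD(2)[OF assms(2) chain_mapsD(3)[OF assms(1)]]
  by (simp add: hom_cycles_def)

lemma hom_cycles_minus: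
  assumes "precomplex R Q" "precomplex R M" "\<phi> \<in> hom_cycles R Q M n" "\<psi> \<in> hom_cycles R Q M n"
  shows "(\<lambda>i x. \<phi> i x \<ominus>\<^bsub>cobj M (i + n)\<^esub> \<psi> i x) \<in> hom_cycles R Q M n"
proof -
  note g = hom_cyclesD(1)[OF assms(3)] hom_cyclesD(1)[OF assms(4)]
  have "\<zero>\<^bsub>cobj M j\<^esub> \<ominus>\<^bsub>cobj M j\<^esub> \<zero>\<^bsub>cobj M j\<^esub> = \<zero>\<^bsub>cobj M j\<^esub>" for j
    using abelian_group.minus_zero_right[OF module_abelian_group[OF precomplexD(1)[OF assms(2)]]]
      abelian_groupE(2)[OF module_abelian_group[OF precomplexD(1)[OF assms(2)]]] by blast
  then show ?thesis
    using graded_maps_minus[OF assms(2) g] hom_diff_minus[OF assms(1,2) g]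
      hom_cyclesD(2)[OF assms(3)] hom_cyclesD(2)[OF assms(4)]
    by (simp add: hom_cycles_def)
qed

text \<open>From \<open>\<psi> = d H + H d\<close> one obtains a null homotopy of the composite by
  taking \<open>\<phi> H\<close> with the sign \<open>(-1)\<^sup>n\<close>, the sign that arises
  when \<open>d\<close> is moved past \<open>\<phi>\<close>.\<close>

lemma hom_cycle_null_comp:
  assumes "precomplex R Q'" "precomplex R Q" "precomplex R M" and \<phi>: "\<phi> \<in> hom_cycles R Q M n"
    and "null_homotopic R Q' Q 0 \<psi>"
  shows "null_homotopic R Q' M n (\<lambda>i x. \<phi> i (\<psi> i x))"
proof -
  obtain H where H: "H \<in> graded_maps R Q' Q 1"
    "\<And>i x. x \<in> carrier (cobj Q' i) \<Longrightarrow> \<psi> i x = hom_diff Q' Q 1 H i x"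
    using assms(5) by (auto simp: null_homotopic_def)
  note g = hom_cyclesD(1)[OF \<phi>]
  define K where "K i x = sgn_power (cobj M (i + (n + 1))) n (\<phi> (i + 1) (H i x))" for i x
  have e: "i + 1 + n = i + (n + 1)" "i + (n + 1) - 1 = i + n" "i - 1 + (n + 1) = i + n" for i by auto
  have g1: "\<phi> (i + 1) \<in> linear_maps R (cobj Q (i + 1)) (cobj M (i + (n + 1)))" for i
    using graded_mapsD(1)[OF g, of "i + 1"] unfolding e .
  have Kg: "K \<in> graded_maps R Q' M (n + 1)"
    unfolding K_def graded_maps_def
    by (auto intro!: sgn_power_linear precomplexD[OF assms(3)] linear_comp[OF graded_mapsD(1)[OF H(1)] g1])
  show ?thesis
    unfolding null_homotopic_def
  proof (intro bexI[OF _ Kg] allI ballI)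
    fix i x assume x: "x \<in> carrier (cobj Q' i)"
    let ?N = "cobj M (i + n)"
    interpret N: module R ?N by (rule precomplexD[OF assms(3)])
    interpret M: module R "cobj M (i + (n + 1))" by (rule precomplexD[OF assms(3)])
    interpret Q: module R "cobj Q i" by (rule precomplexD[OF assms(2)])
    have dx: "cdiff Q' i x \<in> carrier (cobj Q' (i - 1))"
      by (rule linear_closed[OF precomplexD(2)[OF assms(1)] x])
    have Hx: "H i x \<in> carrier (cobj Q (i + 1))" by (rule graded_mapsD(2)[OF H(1) x])
    have Hdx: "H (i - 1) (cdiff Q' i x) \<in> carrier (cobj Q i)"
      using graded_mapsD(4)[OF H(1) dx] by simp
    have dHx: "cdiff Q (i + 1) (H i x) \<in> carrier (cobj Q i)"
      using linear_closed[OF precomplexD(2)[OF assms(2)] Hx] by simp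
    have \<phi>Hx: "\<phi> (i + 1) (H i x) \<in> carrier (cobj M (i + (n + 1)))" by (rule linear_closed[OF g1 Hx])
    have "cdiff M (i + (n + 1)) (\<phi> (i + 1) (H i x)) = sgn_power ?N n (\<phi> i (cdiff Q (i + 1) (H i x)))"
      using hom_cycle_eq[OF assms(2,3) \<phi> Hx] by (simp add: e ac_simps)
    moreover have "cdiff M (i + (n + 1)) (K i x) = sgn_power ?N n (cdiff M (i + (n + 1)) (\<phi> (i + 1) (H i x)))"
      unfolding K_def using linear_sgn_power[OF M.module_axioms precomplexD(1)[OF assms(3)] precomplexD(2)[OF assms(3)] \<phi>Hx, of n]
      unfolding e .
    ultimately have 1: "cdiff M (i + (n + 1)) (K i x) = \<phi> i (cdiff Q (i + 1) (H i x))"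
      using graded_mapsD(2)[OF g dHx] by (simp add: sgn_power_sgn_power[OF N.module_axioms]) (simp add: sgn_power_def)
    have 2: "sgn_power ?N (n + 1) (K (i - 1) (cdiff Q' i x)) = \<ominus>\<^bsub>?N\<^esub> \<phi> i (H (i - 1) (cdiff Q' i x))"
      using graded_mapsD(2)[OF g Hdx] unfolding K_def e
      by (simp add: sgn_power_sgn_power[OF N.module_axioms]) (simp add: sgn_power_def)
    have "\<psi> i x = cdiff Q (i + 1) (H i x) \<oplus>\<^bsub>cobj Q i\<^esub> H (i - 1) (cdiff Q' i x)"
      using H(2)[OF x] Hdx by (simp add: hom_diff_def sgn_power_def Q.minus_eq Q.minus_minus)
    then have "\<phi> i (\<psi> i x) = \<phi> i (cdiff Q (i + 1) (H i x)) \<oplus>\<^bsub>?N\<^esub> \<phi> i (H (i - 1) (cdiff Q' i x))"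
      using linear_add[OF graded_mapsD(1)[OF g] dHx Hdx] by simp
    then show "\<phi> i (\<psi> i x) = hom_diff Q' M (n + 1) K i x"
      unfolding hom_diff_def e 1 2 using graded_mapsD(2)[OF g Hdx] by (simp add: N.minus_eq N.minus_minus)
  qed
qed

subsection \<open>Quasi-isomorphisms and lifting\<close>

text \<open>Quasi-isomorphisms in terms of elements, without forming homology modules.\<close>

definition quasi_iso_map ::
    "('a, 'c) ring_scheme \<Rightarrow> ('a, 'm) chain_complex \<Rightarrow> ('a, 'n) chain_complex \<Rightarrow> (int \<Rightarrow> 'm \<Rightarrow> 'n) \<Rightarrow> bool" where
  "quasi_iso_map R X Y f \<longleftrightarrow> f \<in> chain_maps R X Y \<and>
     (\<forall>i. \<forall>x\<in>cycles X i. f i x \<in> boundaries Y i \<longrightarrow> x \<in> boundaries X i) \<and>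
     (\<forall>i. \<forall>y\<in>cycles Y i. \<exists>x\<in>cycles X i. y \<ominus>\<^bsub>cobj Y i\<^esub> f i x \<in> boundaries Y i)"

text \<open>The mapping cone shifted down by one, with signs chosen such that both projections of a
  homotopy into it can be read off directly.\<close>

definition cone :: "('a, 'm) chain_complex \<Rightarrow> ('a, 'n) chain_complex \<Rightarrow> (int \<Rightarrow> 'm \<Rightarrow> 'n) \<Rightarrow> ('a, 'm \<times> 'n) chain_complex" where
  "cone X Y f = \<lparr>cobj = (\<lambda>i. pair_module (cobj X i) (cobj Y (i + 1))),
     cdiff = (\<lambda>i z. (cdiff X i (fst z), f i (fst z) \<ominus>\<^bsub>cobj Y i\<^esub> cdiff Y (i + 1) (snd z)))\<rparr>"

lemma cdiff_closed_up:
  "precomplex R C \<Longrightarrow> x \<in> carrier (cobj C (i + 1)) \<Longrightarrow> cdiff C (i + 1) x \<in> carrier (cobj C i)"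
  using linear_closed[OF precomplexD(2)[of R C "i + 1"]] by simp

lemma cdiff_linear_up:
  "precomplex R C \<Longrightarrow> cdiff C (i + 1) \<in> linear_maps R (cobj C (i + 1)) (cobj C i)"
  using precomplexD(2)[of R C "i + 1"] by simp

lemma cone_complex:
  assumes X: "is_complex R X" and Y: "is_complex R Y" and f: "f \<in> chain_maps R X Y"
  shows "is_complex R (cone X Y f)"
  unfolding is_complex_def
proof (intro conjI allI ballI)
  note pX = is_complexD(1)[OF X] and pY = is_complexD(1)[OF Y]
  fix i
  show "module R (cobj (cone X Y f) i)"
    by (simp add: cone_def pair_module_module is_complexD(2)[OF X] is_complexD(2)[OF Y])
  have "(\<lambda>z. f i (fst z) \<ominus>\<^bsub>cobj Y i\<^esub> cdiff Y (i + 1) (snd z))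
      \<in> linear_maps R (pair_module (cobj X i) (cobj Y (i + 1))) (cobj Y i)"
    by (rule linear_diff[OF is_complexD(2)[OF Y]
        linear_comp[OF fst_linear chain_mapsD(1)[OF f]] linear_comp[OF snd_linear cdiff_linear_up[OF pY]]])
  then show "cdiff (cone X Y f) i \<in> linear_maps R (cobj (cone X Y f) i) (cobj (cone X Y f) (i - 1))"
    using Pair_linear[OF linear_comp[OF fst_linear is_complexD(3)[OF X]]]
    by (simp add: cone_def)
  fix z assume "z \<in> carrier (cobj (cone X Y f) i)"
  then obtain x y where z: "z = (x, y)" "x \<in> carrier (cobj X i)" "y \<in> carrier (cobj Y (i + 1))"
    by (auto simp: cone_def)
  interpret Y: module R "cobj Y (i - 1)" by (rule is_complexD[OF Y])
  have fx: "f i x \<in> carrier (cobj Y i)" and dy: "cdiff Y (i + 1) y \<in> carrier (cobj Y i)"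
    using chain_mapsD(3)[OF f] cdiff_closed_up[OF pY] z by auto
  have "cdiff Y i (cdiff Y (i + 1) y) = \<zero>\<^bsub>cobj Y (i - 1)\<^esub>"
    using is_complexD(5)[OF Y z(3)] by simp
  then have "cdiff Y i (f i x \<ominus>\<^bsub>cobj Y i\<^esub> cdiff Y (i + 1) y) = cdiff Y i (f i x)"
    using linear_minus[OF is_complexD(2)[OF Y] Y.module_axioms is_complexD(3)[OF Y] fx dy]
      is_complexD(4)[OF Y fx] by (simp add: Y.minus_zero_right)
  then show "cdiff (cone X Y f) (i - 1) (cdiff (cone X Y f) i z) = \<zero>\<^bsub>cobj (cone X Y f) (i - 2)\<^esub>"
    using is_complexD(5)[OF X z(2)] is_complexD(4)[OF Y fx]
    by (simp add: cone_def z chain_mapsD(2)[OF f z(2)] Y.minus_eq Y.r_neg)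
qed

text \<open>For a cycle \<open>(x, y)\<close> of the cone, injectivity on homology provides some
  \<open>x1\<close> with boundary \<open>x\<close>. Surjectivity then corrects \<open>x1\<close> by
  a cycle, and the remaining discrepancy in the second coordinate is a boundary of
  \<open>Y\<close>.\<close>

lemma cone_exact:
  assumes X: "is_complex R X" and Y: "is_complex R Y" and f: "quasi_iso_map R X Y f"
  shows "cycles (cone X Y f) i \<subseteq> boundaries (cone X Y f) i"
proof
  have fc: "f \<in> chain_maps R X Y" using f by (simp add: quasi_iso_map_def)
  note pX = is_complexD(1)[OF X] and pY = is_complexD(1)[OF Y]
  fix z assume "z \<in> cycles (cone X Y f) i"
  then obtain x y where z: "z = (x, y)" "x \<in> carrier (cobj X i)" "y \<in> carrier (cobj Y (i + 1))"
    "cdiff X i x = \<zero>\<^bsub>cobj X (i - 1)\<^esub>" "f i x \<ominus>\<^bsub>cobj Y i\<^esub> cdiff Y (i + 1) y = \<zero>\<^bsub>cobj Y i\<^esub>"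
    by (auto simp: cone_def cycles_def)
  interpret Y: module R "cobj Y i" by (rule is_complexD[OF Y])
  interpret Y1: module R "cobj Y (i + 1)" by (rule is_complexD[OF Y])
  have eq: "f i x = cdiff Y (i + 1) y"
    using Y.minus_eq_zero_iff[OF chain_mapsD(3)[OF fc z(2)] cdiff_closed_up[OF pY z(3)]] z(5) by blast
  have "x \<in> cycles X i" "f i x \<in> boundaries Y i" using z eq by (auto simp: cycles_def boundaries_def)
  then have "x \<in> boundaries X i" using f by (auto simp: quasi_iso_map_def)
  then obtain x1 where x1: "x1 \<in> carrier (cobj X (i + 1))" "x = cdiff X (i + 1) x1" by (auto simp: boundaries_def)
  have fx1: "f (i + 1) x1 \<in> carrier (cobj Y (i + 1))" by (rule chain_mapsD(3)[OF fc x1(1)])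
  have dfx1: "cdiff Y (i + 1) (f (i + 1) x1) = f i x"
    using chain_mapsD(2)[OF fc x1(1)] x1(2) by simp
  \<comment> \<open>The error of \<open>x1\<close> in the second coordinate. It is a cycle of
    \<open>Y\<close>, hence equal to the image of a cycle \<open>v\<close> of \<open>X\<close> up to
    a boundary, and \<open>x1\<close> minus \<open>v\<close> still has boundary
    \<open>x\<close>.\<close>
  let ?w = "f (i + 1) x1 \<ominus>\<^bsub>cobj Y (i + 1)\<^esub> y"
  have "cdiff Y (i + 1) ?w = \<zero>\<^bsub>cobj Y i\<^esub>"
    using linear_minus[OF Y1.module_axioms Y.module_axioms cdiff_linear_up[OF pY] fx1 z(3)] z(5) dfx1 by simp
  then have "?w \<in> cycles Y (i + 1)" using fx1 z(3) by (simp add: cycles_def)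
  then obtain v where v: "v \<in> cycles X (i + 1)" "?w \<ominus>\<^bsub>cobj Y (i + 1)\<^esub> f (i + 1) v \<in> boundaries Y (i + 1)"
    using f unfolding quasi_iso_map_def by blast
  then obtain y' where y': "y' \<in> carrier (cobj Y (i + 1 + 1))" "?w \<ominus>\<^bsub>cobj Y (i + 1)\<^esub> f (i + 1) v = cdiff Y (i + 1 + 1) y'"
    unfolding boundaries_def by blast
  have vX: "v \<in> carrier (cobj X (i + 1))" and dv: "cdiff X (i + 1) v = \<zero>\<^bsub>cobj X i\<^esub>"
    using v(1) by (auto simp: cycles_def)
  interpret X: module R "cobj X i" by (rule is_complexD[OF X])
  interpret X1: module R "cobj X (i + 1)" by (rule is_complexD[OF X])
  have "cdiff X (i + 1) (x1 \<ominus>\<^bsub>cobj X (i + 1)\<^esub> v) = x"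
    using linear_minus[OF X1.module_axioms X.module_axioms cdiff_linear_up[OF pX] x1(1) vX] dv x1(2) z(2)
    by (simp add: X.minus_zero_right)
  moreover have "f (i + 1) (x1 \<ominus>\<^bsub>cobj X (i + 1)\<^esub> v) \<ominus>\<^bsub>cobj Y (i + 1)\<^esub> cdiff Y (i + 1 + 1) y' = y"
    using linear_minus[OF X1.module_axioms Y1.module_axioms chain_mapsD(1)[OF fc] x1(1) vX]
      fx1 chain_mapsD(3)[OF fc vX] z(3)
    unfolding y'(2)[symmetric]
    by (simp add: Y1.minus_eq Y1.minus_add Y1.minus_minus Y1.a_ac Y1.r_neg Y1.l_neg Y1.r_neg1 Y1.r_neg2)
  ultimately have "cdiff (cone X Y f) (i + 1) (x1 \<ominus>\<^bsub>cobj X (i + 1)\<^esub> v, y') = z"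
    by (simp add: cone_def z(1))
  moreover have "(x1 \<ominus>\<^bsub>cobj X (i + 1)\<^esub> v, y') \<in> carrier (cobj (cone X Y f) (i + 1))"
    using x1 vX y' by (simp add: cone_def)
  ultimately show "z \<in> boundaries (cone X Y f) i" unfolding boundaries_def by blast
qed

lemma cone_fst: "fst \<in> linear_maps R (cobj (cone X Y f) i) (cobj X i)"
  by (simp add: cone_def fst_linear)

lemma cone_fst_chain: "(\<lambda>i. fst) \<in> chain_maps R (cone X Y f) X"
  by (simp add: chain_maps_def cone_fst) (simp add: cone_def)

text \<open>A degree \<open>n\<close> cycle \<open>\<theta>\<close> together with a homotopy \<open>h\<close> from \<open>f \<theta>\<close> to \<open>0\<close> is a degree \<open>n\<close> cycle
  into the cone.\<close>

lemma null_homotopic_cancel: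
  assumes Q: "free_retract_complex R Q S" and X: "is_complex R X" and Y: "is_complex R Y"
    and f: "quasi_iso_map R X Y f" and \<theta>: "\<theta> \<in> hom_cycles R Q X n"
    and "null_homotopic R Q Y n (\<lambda>i x. f (i + n) (\<theta> i x))"
  shows "null_homotopic R Q X n \<theta>"
proof -
  have fc: "f \<in> chain_maps R X Y" using f by (simp add: quasi_iso_map_def)
  have Qc: "is_complex R Q" using Q by (simp add: free_retract_complex_def)
  note pX = is_complexD(1)[OF X] and pY = is_complexD(1)[OF Y] and pQ = is_complexD(1)[OF Qc]
  note C = cone_complex[OF X Y fc] and pC = is_complexD(1)[OF cone_complex[OF X Y fc]]
  note g = hom_cyclesD(1)[OF \<theta>]
  obtain h where h: "h \<in> graded_maps R Q Y (n + 1)"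
    "\<And>i x. x \<in> carrier (cobj Q i) \<Longrightarrow> f (i + n) (\<theta> i x) = hom_diff Q Y (n + 1) h i x"
    using assms(6) by (auto simp: null_homotopic_def)
  have e: "i + (n + 1) - 1 = i + n" "i - 1 + (n + 1) = i + n" "i + (n + 1) = i + n + 1" for i by auto
  have "(\<lambda>i x. (\<theta> i x, h i x)) \<in> hom_cycles R Q (cone X Y f) n"
    unfolding hom_cycles_def
  proof (intro CollectI conjI allI ballI)
    show "(\<lambda>i x. (\<theta> i x, h i x)) \<in> graded_maps R Q (cone X Y f) n"
      using Pair_linear[OF graded_mapsD(1)[OF g] graded_mapsD(1)[OF h(1)]]
      by (simp add: graded_maps_def cone_def add.assoc)
    fix i x assume x: "x \<in> carrier (cobj Q i)"
    let ?N = "cobj Y (i + n)" and ?X = "cobj X (i + n - 1)"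
    interpret N: module R ?N by (rule is_complexD[OF Y])
    interpret X: module R ?X by (rule is_complexD[OF X])
    have dx: "cdiff Q i x \<in> carrier (cobj Q (i - 1))" by (rule is_complexD(4)[OF Qc x])
    have hdx: "h (i - 1) (cdiff Q i x) \<in> carrier ?N" using graded_mapsD(4)[OF h(1) dx] by (simp add: e)
    have dhx: "cdiff Y (i + n + 1) (h i x) \<in> carrier ?N"
      using cdiff_closed_up[OF pY] graded_mapsD(2)[OF h(1) x] unfolding e by blast
    have "f (i + n) (\<theta> i x) = cdiff Y (i + n + 1) (h i x) \<ominus>\<^bsub>?N\<^esub> sgn_power ?N (n + 1) (h (i - 1) (cdiff Q i x))"
      using h(2)[OF x] by (simp add: hom_diff_def e)
    then have "f (i + n) (\<theta> i x) \<ominus>\<^bsub>?N\<^esub> cdiff Y (i + n + 1) (h i x) = sgn_power ?N n (h (i - 1) (cdiff Q i x))"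
      using hdx dhx by (simp add: sgn_power_def N.minus_eq N.minus_minus N.a_ac N.r_neg N.r_neg2)
    then show "hom_diff Q (cone X Y f) n (\<lambda>i x. (\<theta> i x, h i x)) i x = \<zero>\<^bsub>cobj (cone X Y f) (i + n - 1)\<^esub>"
      using hom_cycle_eq[OF pQ pX \<theta> x] graded_mapsD(4)[OF g dx] hdx
        sgn_power_closed[OF N.module_axioms hdx, of n] sgn_power_closed[OF X.module_axioms graded_mapsD(4)[OF g dx], of n]
      by (simp add: hom_diff_def cone_def pair_sgn_power[OF X.module_axioms N.module_axioms]
          pair_module_minus[OF X.module_axioms N.module_axioms] X.minus_eq X.r_neg N.minus_eq N.r_neg)
  qed
  then have "null_homotopic R Q (cone X Y f) n (\<lambda>i x. (\<theta> i x, h i x))"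
    using hom_vanishes_exact[OF Q C cone_exact[OF X Y f], of n] unfolding hom_vanishes_def by blast
  \<comment> \<open>The first projection of the cone is a chain map, so the first component of a
    null homotopy into the cone is a null homotopy of \<open>\<theta>\<close>.\<close>
  from null_homotopic_postcomp[OF pQ pC pX cone_fst_chain this] show ?thesis by simp
qed

text \<open>Put into the second coordinate of the cone, \<open>\<phi>\<close> becomes a cycle of
  degree \<open>n - 1\<close>, the index shift being that of the cone. As the cone is exact this
  cycle has a null homotopy, whose first component is the lift \<open>\<theta>\<close> and whose
  second component relates \<open>\<phi>\<close> to \<open>f \<theta>\<close>.\<close>

lemma hom_cycle_lift:
  assumes Q: "free_retract_complex R Q S" and X: "is_complex R X" and Y: "is_complex R Y"
    and f: "quasi_iso_map R X Y f" and \<phi>: "\<phi> \<in> hom_cycles R Q Y n"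
  obtains \<theta> where "\<theta> \<in> hom_cycles R Q X n"
    "null_homotopic R Q Y n (\<lambda>i x. \<phi> i x \<ominus>\<^bsub>cobj Y (i + n)\<^esub> f (i + n) (\<theta> i x))"
proof -
  have fc: "f \<in> chain_maps R X Y" using f by (simp add: quasi_iso_map_def)
  have Qc: "is_complex R Q" using Q by (simp add: free_retract_complex_def)
  note pX = is_complexD(1)[OF X] and pY = is_complexD(1)[OF Y] and pQ = is_complexD(1)[OF Qc]
  note C = cone_complex[OF X Y fc] and pC = is_complexD(1)[OF cone_complex[OF X Y fc]]
  note g = hom_cyclesD(1)[OF \<phi>]
  let ?\<psi> = "\<lambda>i x. (\<zero>\<^bsub>cobj X (i + (n - 1))\<^esub>, \<phi> i x)"
  have e: "i + (n - 1) + 1 = i + n" "i + (n - 1) = i + n - 1" "i + n - 1 - 1 + 1 = i + n - 1" "i - 1 + n = i + n - 1" for i by auto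
  have "?\<psi> \<in> hom_cycles R Q (cone X Y f) (n - 1)"
    unfolding hom_cycles_def
  proof (intro CollectI conjI allI ballI)
    have "(\<lambda>x. (\<zero>\<^bsub>cobj X (i + n - 1)\<^esub>, \<phi> i x)) \<in> linear_maps R (cobj Q i) (pair_module (cobj X (i + n - 1)) (cobj Y (i + n)))" for i
      by (rule Pair_linear[OF linear_zero_map[OF is_complexD(2)[OF X]] graded_mapsD(1)[OF g]])
    then show "?\<psi> \<in> graded_maps R Q (cone X Y f) (n - 1)"
      by (simp add: graded_maps_def cone_def e)
    fix i x assume x: "x \<in> carrier (cobj Q i)"
    let ?N = "cobj Y (i + n - 1)" and ?X = "cobj X (i + n - 1 - 1)"
    interpret N: module R ?N by (rule is_complexD[OF Y])
    interpret X: module R ?X by (rule is_complexD[OF X])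
    have dx: "cdiff Q i x \<in> carrier (cobj Q (i - 1))" by (rule is_complexD(4)[OF Qc x])
    have zX: "cdiff X (i + n - 1) \<zero>\<^bsub>cobj X (i + n - 1)\<^esub> = \<zero>\<^bsub>?X\<^esub>"
      by (rule linear_zero[OF is_complexD(2)[OF X] X.module_axioms is_complexD(3)[OF X]])
    have zf: "f (i + n - 1) \<zero>\<^bsub>cobj X (i + n - 1)\<^esub> = \<zero>\<^bsub>?N\<^esub>"
      by (rule linear_zero[OF is_complexD(2)[OF X] N.module_axioms chain_mapsD(1)[OF fc]])
    have c: "\<phi> (i - 1) (cdiff Q i x) \<in> carrier ?N" by (rule graded_mapsD(4)[OF g dx])
    have i2: "i + (n - 1) - 1 = i + n - 1 - 1" "i - 1 + (n - 1) = i + n - 1 - 1" by auto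
    have cN: "cobj (cone X Y f) (i + (n - 1) - 1) = pair_module ?X ?N"
      by (simp add: cone_def)
    have A: "cdiff (cone X Y f) (i + (n - 1)) (?\<psi> i x) = (\<zero>\<^bsub>?X\<^esub>, \<ominus>\<^bsub>?N\<^esub> sgn_power ?N n (\<phi> (i - 1) (cdiff Q i x)))"
      using sgn_power_closed[OF N.module_axioms c, of n]
      by (simp add: cone_def e zX zf hom_cycle_eq[OF pQ pY \<phi> x] N.minus_eq)
    have B: "sgn_power (cobj (cone X Y f) (i + (n - 1) - 1)) (n - 1) (?\<psi> (i - 1) (cdiff Q i x)) =
        (\<zero>\<^bsub>?X\<^esub>, \<ominus>\<^bsub>?N\<^esub> sgn_power ?N n (\<phi> (i - 1) (cdiff Q i x)))"
      using c unfolding cN unfolding i2 unfolding pair_sgn_power[OF X.module_axioms N.module_axioms X.M.zero_closed c]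
        sgn_power_zero[OF X.module_axioms]
      by (simp add: sgn_power_def N.minus_minus)
    interpret C: module R "cobj (cone X Y f) (i + (n - 1) - 1)" by (rule is_complexD[OF C])
    have "(\<zero>\<^bsub>?X\<^esub>, \<ominus>\<^bsub>?N\<^esub> sgn_power ?N n (\<phi> (i - 1) (cdiff Q i x))) \<in> carrier (cobj (cone X Y f) (i + (n - 1) - 1))"
      using sgn_power_closed[OF N.module_axioms c, of n] X.M.zero_closed unfolding cN by simp
    then show "hom_diff Q (cone X Y f) (n - 1) ?\<psi> i x = \<zero>\<^bsub>cobj (cone X Y f) (i + (n - 1) - 1)\<^esub>"
      unfolding hom_diff_def A B by (rule C.minus_self)
  qed
  then have "null_homotopic R Q (cone X Y f) (n - 1) ?\<psi>"
    using hom_vanishes_exact[OF Q C cone_exact[OF X Y f], of "n - 1"] unfolding hom_vanishes_def by blast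
  then obtain H where H: "H \<in> graded_maps R Q (cone X Y f) n"
    "\<And>i x. x \<in> carrier (cobj Q i) \<Longrightarrow> ?\<psi> i x = hom_diff Q (cone X Y f) n H i x"
    by (auto simp: null_homotopic_def)
  define \<theta> where "\<theta> i x = fst (H i x)" for i x
  define h where "h i x = snd (H i x)" for i x
  have \<theta>g: "\<theta> \<in> graded_maps R Q X n"
    using graded_maps_comp[OF H(1) cone_fst_chain] by (simp add: \<theta>_def[abs_def])
  have snd': "snd \<in> linear_maps R (cobj (cone X Y f) i) (cobj Y (i + 1))" for i by (simp add: cone_def snd_linear)
  have hg: "h i \<in> linear_maps R (cobj Q i) (cobj Y (i + n + 1))" for i
    using linear_comp[OF graded_mapsD(1)[OF H(1)] snd'] by (simp add: h_def[abs_def])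
  show thesis
  proof
    have "hom_diff Q X n \<theta> i x = \<zero>\<^bsub>cobj X (i + n - 1)\<^esub>" if x: "x \<in> carrier (cobj Q i)" for i x
      using hom_diff_comp[OF pQ pC pX H(1) cone_fst_chain x] H(2)[OF x, symmetric] by (simp add: \<theta>_def[abs_def] e)
    then show "\<theta> \<in> hom_cycles R Q X n" using \<theta>g by (simp add: hom_cycles_def)
    \<comment> \<open>The sign is needed because \<open>Y\<close> enters the differential of the
      cone with a minus sign.\<close>
    let ?k = "\<lambda>i x. \<ominus>\<^bsub>cobj Y (i + n + 1)\<^esub> h i x"
    have kg: "?k \<in> graded_maps R Q Y (n + 1)"
      unfolding graded_maps_def by (auto simp: add.assoc[symmetric] intro!: linear_uminus hg is_complexD[OF Y])
    show "null_homotopic R Q Y n (\<lambda>i x. \<phi> i x \<ominus>\<^bsub>cobj Y (i + n)\<^esub> f (i + n) (\<theta> i x))"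
      unfolding null_homotopic_def
    proof (intro bexI[OF _ kg] allI ballI)
      fix i x assume x: "x \<in> carrier (cobj Q i)"
      let ?N = "cobj Y (i + n)" and ?X = "cobj X (i + n - 1)"
      interpret N: module R ?N by (rule is_complexD[OF Y])
      interpret N1: module R "cobj Y (i + n + 1)" by (rule is_complexD[OF Y])
      interpret X: module R ?X by (rule is_complexD[OF X])
      have dx: "cdiff Q i x \<in> carrier (cobj Q (i - 1))" by (rule is_complexD(4)[OF Qc x])
      have hx: "h i x \<in> carrier (cobj Y (i + n + 1))" by (rule linear_closed[OF hg x])
      have e1: "i - 1 + n + 1 = i + n" "i + n - 1 + 1 = i + n" "i + (n + 1) = i + n + 1" "i + n + 1 - 1 = i + n" by auto
      have hdx: "h (i - 1) (cdiff Q i x) \<in> carrier ?N" using linear_closed[OF hg dx] unfolding e1 .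
      have \<theta>x: "f (i + n) (\<theta> i x) \<in> carrier ?N" by (rule chain_mapsD(3)[OF fc graded_mapsD(2)[OF \<theta>g x]])
      have \<theta>dx: "\<theta> (i - 1) (cdiff Q i x) \<in> carrier ?X" by (rule graded_mapsD(4)[OF \<theta>g dx])
      have dhx: "cdiff Y (i + n + 1) (h i x) \<in> carrier ?N" by (rule cdiff_closed_up[OF pY hx])
      have d\<theta>x: "cdiff X (i + n) (\<theta> i x) \<in> carrier ?X"
        by (rule is_complexD(4)[OF X graded_mapsD(2)[OF \<theta>g x]])
      have Hx: "H i x = (\<theta> i x, h i x)" "H (i - 1) (cdiff Q i x) = (\<theta> (i - 1) (cdiff Q i x), h (i - 1) (cdiff Q i x))"
        by (simp_all add: \<theta>_def h_def)
      have "snd (?\<psi> i x) = snd (hom_diff Q (cone X Y f) n H i x)" using H(2)[OF x] by simp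
      then have "\<phi> i x = (f (i + n) (\<theta> i x) \<ominus>\<^bsub>?N\<^esub> cdiff Y (i + n + 1) (h i x)) \<ominus>\<^bsub>?N\<^esub> sgn_power ?N n (h (i - 1) (cdiff Q i x))"
        using hdx \<theta>x \<theta>dx dhx d\<theta>x sgn_power_closed[OF N.module_axioms hdx, of n]
          sgn_power_closed[OF X.module_axioms \<theta>dx, of n]
        by (simp add: hom_diff_def Hx) (simp add: cone_def e1(2) pair_sgn_power[OF X.module_axioms N.module_axioms]
            pair_module_minus[OF X.module_axioms N.module_axioms])
      moreover have "cdiff Y (i + n + 1) (\<ominus>\<^bsub>cobj Y (i + n + 1)\<^esub> h i x) = \<ominus>\<^bsub>?N\<^esub> cdiff Y (i + n + 1) (h i x)"
        by (rule linear_neg[OF N1.module_axioms N.module_axioms cdiff_linear_up[OF pY] hx])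
      ultimately show "\<phi> i x \<ominus>\<^bsub>?N\<^esub> f (i + n) (\<theta> i x) = hom_diff Q Y (n + 1) ?k i x"
        using hdx \<theta>x dhx unfolding hom_diff_def e1
        by (simp add: sgn_power_def N.minus_eq N.minus_minus N.minus_add N.a_ac N.r_neg2 N.r_neg1 N.r_neg N.l_neg)
    qed
  qed
qed

subsection \<open>Hom complexes\<close>

lemma hom_complex_carrier:
  "carrier (cobj (hom_complex R Q M) n) = {\<phi> \<in> graded_maps R Q M n. \<forall>i. \<phi> i \<in> extensional (carrier (cobj Q i))}"
  by (auto simp: hom_complex_def product_module_def hom_module_def graded_maps_def)

lemma hom_complex_diff:
  assumes "precomplex R Q" "precomplex R M" "\<phi> \<in> graded_maps R Q M n"
  shows "cdiff (hom_complex R Q M) n \<phi> = (\<lambda>i. \<lambda>x\<in>carrier (cobj Q i). hom_diff Q M n \<phi> i x)"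
proof (intro ext)
  fix i x
  interpret M: module R "cobj M (i + n - 1)" by (rule precomplexD[OF assms(2)])
  have "cdiff M (i + n) (\<phi> i x) \<in> carrier (cobj M (i + n - 1))"
    "\<phi> (i - 1) (cdiff Q i x) \<in> carrier (cobj M (i + n - 1))" if "x \<in> carrier (cobj Q i)"
    using linear_closed[OF precomplexD(2)[OF assms(2)] graded_mapsD(2)[OF assms(3) that]]
      graded_mapsD(4)[OF assms(3) linear_closed[OF precomplexD(2)[OF assms(1)] that]] by auto
  then show "cdiff (hom_complex R Q M) n \<phi> i x = (\<lambda>x\<in>carrier (cobj Q i). hom_diff Q M n \<phi> i x) x"
    by (simp add: hom_complex_def hom_diff_def sgn_power_def Let_def M.minus_eq M.minus_minus)
qed

lemma hom_complex_zero: "\<zero>\<^bsub>cobj (hom_complex R Q M) n\<^esub> = (\<lambda>i. \<lambda>x\<in>carrier (cobj Q i). \<zero>\<^bsub>cobj M (i + n)\<^esub>)"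
  by (simp add: hom_complex_def product_module_def hom_module_def)

lemma hom_complex_add: "\<phi> \<oplus>\<^bsub>cobj (hom_complex R Q M) n\<^esub> \<psi> =
    (\<lambda>i. \<lambda>x\<in>carrier (cobj Q i). \<phi> i x \<oplus>\<^bsub>cobj M (i + n)\<^esub> \<psi> i x)"
  by (simp add: hom_complex_def product_module_def hom_module_def)

lemma hom_complex_smult: "r \<odot>\<^bsub>cobj (hom_complex R Q M) n\<^esub> \<phi> =
    (\<lambda>i. \<lambda>x\<in>carrier (cobj Q i). r \<odot>\<^bsub>cobj M (i + n)\<^esub> \<phi> i x)"
  by (simp add: hom_complex_def product_module_def hom_module_def)

lemma hom_complex_module:
  assumes "precomplex R Q" "precomplex R M"
  shows "module R (cobj (hom_complex R Q M) n)"
  unfolding hom_complex_def by (simp add: product_module_module hom_module_module precomplexD[OF assms(1)] precomplexD[OF assms(2)])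

lemma restrict_graded:
  assumes "precomplex R Q" "\<phi> \<in> graded_maps R Q M n"
  shows "(\<lambda>i. \<lambda>x\<in>carrier (cobj Q i). \<phi> i x) \<in> carrier (cobj (hom_complex R Q M) n)"
  unfolding hom_complex_carrier graded_maps_def
  by (auto intro!: linear_cong[OF precomplexD(1)[OF assms(1)] graded_mapsD(1)[OF assms(2)]])

lemma hom_complex_carrierD:
  assumes "\<phi> \<in> carrier (cobj (hom_complex R Q M) n)"
  shows "\<phi> \<in> graded_maps R Q M n" "\<phi> i \<in> extensional (carrier (cobj Q i))"
    "x \<in> carrier (cobj Q i) \<Longrightarrow> \<phi> i x \<in> carrier (cobj M (i + n))"
  using assms by (auto simp: hom_complex_carrier intro: graded_mapsD)

text \<open>Since evaluation is linear, differences and finite sums in the Hom complex are computed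
  by transporting them to values; they need no formulas of their own.\<close>

lemma hom_complex_eval: "x \<in> carrier (cobj Q i) \<Longrightarrow>
    (\<lambda>\<phi>. \<phi> i x) \<in> linear_maps R (cobj (hom_complex R Q M) n) (cobj M (i + n))"
  by (rule linear_mapsI) (simp_all add: hom_complex_add hom_complex_smult hom_complex_carrierD(3))

lemma hom_complex_eqI:
  assumes "\<phi> \<in> carrier (cobj (hom_complex R Q M) n)" "\<psi> \<in> carrier (cobj (hom_complex R Q M) n)"
    "\<And>i x. x \<in> carrier (cobj Q i) \<Longrightarrow> \<phi> i x = \<psi> i x"
  shows "\<phi> = \<psi>"
  using assms by (intro ext extensionalityI[OF hom_complex_carrierD(2)[OF assms(1)] hom_complex_carrierD(2)[OF assms(2)]]) auto

lemma hom_diff_cong: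
  assumes "precomplex R Q" "x \<in> carrier (cobj Q i)" "\<And>i x. x \<in> carrier (cobj Q i) \<Longrightarrow> \<phi> i x = \<psi> i x"
  shows "hom_diff Q M n \<phi> i x = hom_diff Q M n \<psi> i x"
  using assms linear_closed[OF precomplexD(2)[OF assms(1)] assms(2)] by (simp add: hom_diff_def)

lemma hom_diff_add:
  assumes "precomplex R Q" "precomplex R M" "\<phi> \<in> graded_maps R Q M n" "\<psi> \<in> graded_maps R Q M n"
    and x: "x \<in> carrier (cobj Q i)"
  shows "hom_diff Q M n (\<lambda>i x. \<phi> i x \<oplus>\<^bsub>cobj M (i + n)\<^esub> \<psi> i x) i x =
    hom_diff Q M n \<phi> i x \<oplus>\<^bsub>cobj M (i + n - 1)\<^esub> hom_diff Q M n \<psi> i x"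
proof -
  let ?N = "cobj M (i + n - 1)"
  have N: "module R ?N" and M: "module R (cobj M (i + n))" by (rule precomplexD[OF assms(2)])+
  interpret N: abelian_group ?N by (rule module_abelian_group[OF N])
  have e: "i - 1 + n = i + n - 1" by simp
  note dx = linear_closed[OF precomplexD(2)[OF assms(1)] x]
  note c = graded_mapsD(2)[OF assms(3) x] graded_mapsD(2)[OF assms(4) x]
  note c' = graded_mapsD(4)[OF assms(3) dx] graded_mapsD(4)[OF assms(4) dx]
  note dc = linear_closed[OF precomplexD(2)[OF assms(2)] c(1)] linear_closed[OF precomplexD(2)[OF assms(2)] c(2)]
  show ?thesis
    using dc c' unfolding hom_diff_def e
    by (simp add: linear_add[OF precomplexD(2)[OF assms(2)] c] sgn_power_def N.minus_eq N.minus_add N.minus_minus N.a_ac)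
qed

lemma hom_diff_smult:
  assumes "precomplex R Q" "precomplex R M" "\<phi> \<in> graded_maps R Q M n" "r \<in> carrier R"
    and x: "x \<in> carrier (cobj Q i)"
  shows "hom_diff Q M n (\<lambda>i x. r \<odot>\<^bsub>cobj M (i + n)\<^esub> \<phi> i x) i x = r \<odot>\<^bsub>cobj M (i + n - 1)\<^esub> hom_diff Q M n \<phi> i x"
proof -
  let ?N = "cobj M (i + n - 1)"
  interpret N: module R ?N by (rule precomplexD[OF assms(2)])
  have e: "i - 1 + n = i + n - 1" by simp
  note dx = linear_closed[OF precomplexD(2)[OF assms(1)] x]
  note c = graded_mapsD(2)[OF assms(3) x]
  note c' = graded_mapsD(4)[OF assms(3) dx]
  note dc = linear_closed[OF precomplexD(2)[OF assms(2)] c]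
  show ?thesis
    using dc c' assms(4) unfolding hom_diff_def e
    by (simp add: linear_smult[OF precomplexD(2)[OF assms(2)] assms(4) c] sgn_power_def N.minus_eq
        N.minus_minus N.smult_r_distr N.smult_r_minus)
qed

text \<open>Linearity of \<open>hom_diff\<close> is transferred to the Hom complex;
  \<open>hom_diff_cong\<close> absorbs the restrictions to carriers in the sums and multiples formed
  there.\<close>

lemma hom_complex_precomplex:
  assumes "precomplex R Q" "precomplex R M"
  shows "precomplex R (hom_complex R Q M)"
  unfolding precomplex_def
proof (intro conjI allI)
  fix n show "module R (cobj (hom_complex R Q M) n)" by (rule hom_complex_module[OF assms])
  show "cdiff (hom_complex R Q M) n \<in> linear_maps R (cobj (hom_complex R Q M) n) (cobj (hom_complex R Q M) (n - 1))"
  proof (rule linear_mapsI)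
    fix \<phi> assume \<phi>: "\<phi> \<in> carrier (cobj (hom_complex R Q M) n)"
    note g = hom_complex_carrierD(1)[OF \<phi>]
    show "cdiff (hom_complex R Q M) n \<phi> \<in> carrier (cobj (hom_complex R Q M) (n - 1))"
      unfolding hom_complex_diff[OF assms g] by (rule restrict_graded[OF assms(1) hom_diff_graded[OF assms g]])
    interpret H: module R "cobj (hom_complex R Q M) n" by (rule hom_complex_module[OF assms])
    have e: "i + (n - 1) = i + n - 1" for i by simp
    show "cdiff (hom_complex R Q M) n (r \<odot>\<^bsub>cobj (hom_complex R Q M) n\<^esub> \<phi>) =
        r \<odot>\<^bsub>cobj (hom_complex R Q M) (n - 1)\<^esub> cdiff (hom_complex R Q M) n \<phi>" if r: "r \<in> carrier R" for r
    proof -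
      have "hom_diff Q M n (r \<odot>\<^bsub>cobj (hom_complex R Q M) n\<^esub> \<phi>) i x = r \<odot>\<^bsub>cobj M (i + n - 1)\<^esub> hom_diff Q M n \<phi> i x"
        if x: "x \<in> carrier (cobj Q i)" for i x
        unfolding hom_diff_smult[OF assms g r x, symmetric] hom_complex_smult
        by (rule hom_diff_cong[OF assms(1) x]) simp
      then show ?thesis
        unfolding hom_complex_diff[OF assms g] hom_complex_smult[where n = "n - 1"] e
          hom_complex_diff[OF assms hom_complex_carrierD(1)[OF H.smult_closed[OF r \<phi>]]]
        by (intro ext) simp
    qed
    fix \<psi> assume \<psi>: "\<psi> \<in> carrier (cobj (hom_complex R Q M) n)"
    note g' = hom_complex_carrierD(1)[OF \<psi>]
    have "hom_diff Q M n (\<phi> \<oplus>\<^bsub>cobj (hom_complex R Q M) n\<^esub> \<psi>) i x =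
        hom_diff Q M n \<phi> i x \<oplus>\<^bsub>cobj M (i + n - 1)\<^esub> hom_diff Q M n \<psi> i x"
      if x: "x \<in> carrier (cobj Q i)" for i x
      unfolding hom_diff_add[OF assms g g' x, symmetric] hom_complex_add
      by (rule hom_diff_cong[OF assms(1) x]) simp
    then show "cdiff (hom_complex R Q M) n (\<phi> \<oplus>\<^bsub>cobj (hom_complex R Q M) n\<^esub> \<psi>) =
       cdiff (hom_complex R Q M) n \<phi> \<oplus>\<^bsub>cobj (hom_complex R Q M) (n - 1)\<^esub> cdiff (hom_complex R Q M) n \<psi>"
      unfolding hom_complex_diff[OF assms g] hom_complex_diff[OF assms g'] hom_complex_add[where n = "n - 1"] e
        hom_complex_diff[OF assms hom_complex_carrierD(1)[OF H.M.a_closed[OF \<phi> \<psi>]]]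
      by (intro ext) simp
  qed
qed

lemma hom_diff_hom_diff:
  assumes Q: "is_complex R Q" and M: "is_complex R M" and g: "\<phi> \<in> graded_maps R Q M n" and x: "x \<in> carrier (cobj Q i)"
  shows "hom_diff Q M (n - 1) (hom_diff Q M n \<phi>) i x = \<zero>\<^bsub>cobj M (i + n - 2)\<^esub>"
proof -
  let ?N = "cobj M (i + n - 1)" and ?L = "cobj M (i + n - 2)"
  interpret N: module R ?N by (rule is_complexD[OF M])
  interpret L: module R ?L by (rule is_complexD[OF M])
  note pM = is_complexD(1)[OF M] and pQ = is_complexD(1)[OF Q]
  have e: "i + (n - 1) = i + n - 1" "i - 1 + n = i + n - 1" "i - 1 + n - 1 = i + n - 2" "i + (n - 1) - 1 = i + n - 2"
    "i - 1 - 1 = i - 2" "i + n - 1 - 1 = i + n - 2" by auto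
  have dx: "cdiff Q i x \<in> carrier (cobj Q (i - 1))" by (rule is_complexD(4)[OF Q x])
  have c1: "cdiff M (i + n) (\<phi> i x) \<in> carrier ?N" by (rule is_complexD(4)[OF M graded_mapsD(2)[OF g x]])
  have c2: "\<phi> (i - 1) (cdiff Q i x) \<in> carrier ?N" by (rule graded_mapsD(4)[OF g dx])
  have c3: "cdiff M (i + n - 1) (\<phi> (i - 1) (cdiff Q i x)) \<in> carrier ?L"
    using is_complexD(4)[OF M c2] by (simp add: e)
  have d: "cdiff M (i + n - 1) \<in> linear_maps R ?N ?L" using is_complexD(3)[OF M, of "i + n - 1"] by (simp add: e)
  have "cdiff M (i + n - 1) (cdiff M (i + n) (\<phi> i x)) = \<zero>\<^bsub>?L\<^esub>"
    using is_complexD(5)[OF M graded_mapsD(2)[OF g x]] by simp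
  then have 1: "cdiff M (i + n - 1) (hom_diff Q M n \<phi> i x) = \<ominus>\<^bsub>?L\<^esub> sgn_power ?L n (cdiff M (i + n - 1) (\<phi> (i - 1) (cdiff Q i x)))"
    unfolding hom_diff_def
    using linear_minus[OF N.module_axioms L.module_axioms d c1 sgn_power_closed[OF N.module_axioms c2]]
      linear_sgn_power[OF N.module_axioms L.module_axioms d c2] sgn_power_closed[OF L.module_axioms c3]
    by (simp add: L.minus_eq)
  have z: "\<phi> (i - 2) \<zero>\<^bsub>cobj Q (i - 2)\<^esub> = \<zero>\<^bsub>?L\<^esub>"
    using linear_zero[OF is_complexD(2)[OF Q] is_complexD(2)[OF M] graded_mapsD(1)[OF g, of "i - 2"]]
    by (simp add: algebra_simps)
  have 2: "hom_diff Q M n \<phi> (i - 1) (cdiff Q i x) = cdiff M (i + n - 1) (\<phi> (i - 1) (cdiff Q i x))"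
    unfolding hom_diff_def e is_complexD(5)[OF Q x] z using c3
    by (simp add: sgn_power_zero[OF L.module_axioms] L.minus_zero_right)
  show ?thesis
    unfolding hom_diff_def[of Q M "n - 1"] e 1 2 using c3
    by (simp add: sgn_power_def L.minus_eq L.minus_minus L.r_neg L.l_neg)
qed

lemma hom_complex_complex:
  assumes "is_complex R Q" "is_complex R M"
  shows "is_complex R (hom_complex R Q M)"
proof -
  note p = is_complexD(1)[OF assms(1)] is_complexD(1)[OF assms(2)]
  have "cdiff (hom_complex R Q M) (n - 1) (cdiff (hom_complex R Q M) n \<phi>) = \<zero>\<^bsub>cobj (hom_complex R Q M) (n - 2)\<^esub>"
    if "\<phi> \<in> carrier (cobj (hom_complex R Q M) n)" for n \<phi>
  proof -
    note g = hom_complex_carrierD(1)[OF that]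
    have g': "(\<lambda>i. \<lambda>x\<in>carrier (cobj Q i). hom_diff Q M n \<phi> i x) \<in> graded_maps R Q M (n - 1)"
      using hom_complex_carrierD(1)[OF restrict_graded[OF p(1) hom_diff_graded[OF p g]]] .
    have "hom_diff Q M (n - 1) (\<lambda>i. \<lambda>x\<in>carrier (cobj Q i). hom_diff Q M n \<phi> i x) i x = \<zero>\<^bsub>cobj M (i + n - 2)\<^esub>"
      if x: "x \<in> carrier (cobj Q i)" for i x
      unfolding hom_diff_hom_diff[OF assms g x, symmetric] by (rule hom_diff_cong[OF p(1) x]) simp
    then show ?thesis
      unfolding hom_complex_diff[OF p g] hom_complex_diff[OF p g'] hom_complex_zero
      by (intro ext) (simp add: add_diff_eq)
  qed
  then show ?thesis
    using hom_complex_precomplex[OF p] unfolding is_complex_def precomplex_def by blast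
qed

lemma hom_complex_cycles:
  assumes "precomplex R Q" "precomplex R M" "\<phi> \<in> carrier (cobj (hom_complex R Q M) n)"
  shows "\<phi> \<in> cycles (hom_complex R Q M) n \<longleftrightarrow> \<phi> \<in> hom_cycles R Q M n"
proof -
  note g = hom_complex_carrierD(1)[OF assms(3)]
  have e: "i + (n - 1) = i + n - 1" for i by simp
  have "\<phi> \<in> cycles (hom_complex R Q M) n \<longleftrightarrow> (\<lambda>i. \<lambda>x\<in>carrier (cobj Q i). hom_diff Q M n \<phi> i x) =
     (\<lambda>i. \<lambda>x\<in>carrier (cobj Q i). \<zero>\<^bsub>cobj M (i + n - 1)\<^esub>)"
    using assms(3) by (simp add: cycles_def hom_complex_diff[OF assms(1,2) g] hom_complex_zero e)
  also have "\<dots> \<longleftrightarrow> \<phi> \<in> hom_cycles R Q M n"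
    using g by (auto simp: hom_cycles_def fun_eq_iff restrict_def)
  finally show ?thesis .
qed

lemma hom_complex_boundaries:
  assumes "precomplex R Q" "precomplex R M" "\<phi> \<in> carrier (cobj (hom_complex R Q M) n)"
  shows "\<phi> \<in> boundaries (hom_complex R Q M) n \<longleftrightarrow> null_homotopic R Q M n \<phi>"
proof
  assume "\<phi> \<in> boundaries (hom_complex R Q M) n"
  then obtain H where H: "H \<in> carrier (cobj (hom_complex R Q M) (n + 1))" "\<phi> = cdiff (hom_complex R Q M) (n + 1) H"
    by (auto simp: boundaries_def)
  show "null_homotopic R Q M n \<phi>"
    unfolding null_homotopic_def H(2) hom_complex_diff[OF assms(1,2) hom_complex_carrierD(1)[OF H(1)]]
    using hom_complex_carrierD(1)[OF H(1)] by (intro bexI[of _ H]) auto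
next
  assume "null_homotopic R Q M n \<phi>"
  then obtain H where H: "H \<in> graded_maps R Q M (n + 1)" "\<And>i x. x \<in> carrier (cobj Q i) \<Longrightarrow> \<phi> i x = hom_diff Q M (n + 1) H i x"
    by (auto simp: null_homotopic_def)
  let ?H = "\<lambda>i. \<lambda>x\<in>carrier (cobj Q i). H i x"
  have Hc: "?H \<in> carrier (cobj (hom_complex R Q M) (n + 1))" by (rule restrict_graded[OF assms(1) H(1)])
  have "\<phi> i = (\<lambda>x\<in>carrier (cobj Q i). hom_diff Q M (n + 1) ?H i x)" for i
  proof (rule extensionalityI[OF hom_complex_carrierD(2)[OF assms(3)] restrict_extensional])
    fix x assume x: "x \<in> carrier (cobj Q i)"
    then show "\<phi> i x = (\<lambda>x\<in>carrier (cobj Q i). hom_diff Q M (n + 1) ?H i x) x"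
      using hom_diff_cong[OF assms(1) x, of ?H H] H(2) by simp
  qed
  then have "\<phi> = cdiff (hom_complex R Q M) (n + 1) ?H"
    unfolding hom_complex_diff[OF assms(1,2) hom_complex_carrierD(1)[OF Hc]] by blast
  then show "\<phi> \<in> boundaries (hom_complex R Q M) n"
    using Hc unfolding boundaries_def by blast
qed

text \<open>Elements of \<open>hom_complex\<close> are extensional, whereas
  \<open>hom_vanishes\<close> ranges over all families of functions. Restricting a cycle to the
  carriers changes neither its being a cycle nor its being null-homotopic.\<close>

lemma nonzero_hom_homology:
  assumes "precomplex R Q" "precomplex R M"
  shows "nonzero_module (homology (hom_complex R Q M) n) \<longleftrightarrow> \<not> hom_vanishes R Q M n"
proof -
  have "cycles (hom_complex R Q M) n \<subseteq> boundaries (hom_complex R Q M) n \<longleftrightarrow> hom_vanishes R Q M n"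
  proof
    assume *: "cycles (hom_complex R Q M) n \<subseteq> boundaries (hom_complex R Q M) n"
    show "hom_vanishes R Q M n" unfolding hom_vanishes_def
    proof
      fix \<phi> assume \<phi>: "\<phi> \<in> hom_cycles R Q M n"
      let ?\<phi> = "\<lambda>i. \<lambda>x\<in>carrier (cobj Q i). \<phi> i x"
      have c: "?\<phi> \<in> carrier (cobj (hom_complex R Q M) n)" by (rule restrict_graded[OF assms(1) hom_cyclesD(1)[OF \<phi>]])
      have "hom_diff Q M n ?\<phi> i x = \<zero>\<^bsub>cobj M (i + n - 1)\<^esub>" if "x \<in> carrier (cobj Q i)" for i x
        unfolding hom_cyclesD(2)[OF \<phi> that, symmetric] by (rule hom_diff_cong[OF assms(1) that]) simp
      then have "?\<phi> \<in> hom_cycles R Q M n" using hom_complex_carrierD(1)[OF c] by (simp add: hom_cycles_def)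
      then have "null_homotopic R Q M n ?\<phi>"
        using * hom_complex_cycles[OF assms c] hom_complex_boundaries[OF assms c] by blast
      then show "null_homotopic R Q M n \<phi>" by (rule null_homotopic_cong) simp
    qed
  next
    assume *: "hom_vanishes R Q M n"
    show "cycles (hom_complex R Q M) n \<subseteq> boundaries (hom_complex R Q M) n"
    proof
      fix \<phi> assume \<phi>: "\<phi> \<in> cycles (hom_complex R Q M) n"
      then have c: "\<phi> \<in> carrier (cobj (hom_complex R Q M) n)" by (simp add: cycles_def)
      show "\<phi> \<in> boundaries (hom_complex R Q M) n"
        using * \<phi> hom_complex_cycles[OF assms c] hom_complex_boundaries[OF assms c] unfolding hom_vanishes_def by blast
    qed
  qed
  then show ?thesis using nonzero_homology_iff[OF hom_complex_precomplex[OF assms]] by simp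
qed

subsection \<open>Induced maps between Hom complexes\<close>

lemma hom_complex_minus:
  assumes "precomplex R Q" "precomplex R M" "\<phi> \<in> carrier (cobj (hom_complex R Q M) n)"
    "\<psi> \<in> carrier (cobj (hom_complex R Q M) n)" "x \<in> carrier (cobj Q i)"
  shows "(\<phi> \<ominus>\<^bsub>cobj (hom_complex R Q M) n\<^esub> \<psi>) i x = \<phi> i x \<ominus>\<^bsub>cobj M (i + n)\<^esub> \<psi> i x"
  by (rule linear_minus[OF hom_complex_module[OF assms(1,2)] precomplexD(1)[OF assms(2)]
        hom_complex_eval[OF assms(5)] assms(3,4)])

lemma hom_cycles_cong:
  assumes "precomplex R Q" "\<phi> \<in> hom_cycles R Q M n" "\<And>i x. x \<in> carrier (cobj Q i) \<Longrightarrow> \<psi> i x = \<phi> i x"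
  shows "\<psi> \<in> hom_cycles R Q M n"
proof -
  have "\<psi> \<in> graded_maps R Q M n"
    unfolding graded_maps_def
    by (auto intro!: linear_cong[OF precomplexD(1)[OF assms(1)] graded_mapsD(1)[OF hom_cyclesD(1)[OF assms(2)]]] assms(3))
  moreover have "hom_diff Q M n \<psi> i x = hom_diff Q M n \<phi> i x" if "x \<in> carrier (cobj Q i)" for i x
    by (rule hom_diff_cong[OF assms(1) that assms(3)])
  ultimately show ?thesis using hom_cyclesD(2)[OF assms(2)] by (simp add: hom_cycles_def)
qed

text \<open>Injectivity and surjectivity on the homology of Hom complexes, phrased with cycles and
  null homotopies, the form in which the lifting lemmas supply them.\<close>

lemma quasi_iso_hom_complexI:
  assumes Q: "precomplex R Q" and Q': "precomplex R Q'" and M: "precomplex R M" and M': "precomplex R M'"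
    and f: "f \<in> chain_maps R (hom_complex R Q M) (hom_complex R Q' M')"
    and inj: "\<And>n \<phi>. \<phi> \<in> hom_cycles R Q M n \<Longrightarrow> \<phi> \<in> carrier (cobj (hom_complex R Q M) n) \<Longrightarrow>
       null_homotopic R Q' M' n (f n \<phi>) \<Longrightarrow> null_homotopic R Q M n \<phi>"
    and surj: "\<And>n \<psi>. \<psi> \<in> hom_cycles R Q' M' n \<Longrightarrow> \<exists>\<phi>\<in>hom_cycles R Q M n. \<phi> \<in> carrier (cobj (hom_complex R Q M) n) \<and>
       null_homotopic R Q' M' n (\<lambda>i x. \<psi> i x \<ominus>\<^bsub>cobj M' (i + n)\<^esub> f n \<phi> i x)"
  shows "quasi_iso_map R (hom_complex R Q M) (hom_complex R Q' M') f"
  unfolding quasi_iso_map_def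
proof (intro conjI allI ballI impI f)
  fix n \<phi> assume "\<phi> \<in> cycles (hom_complex R Q M) n" and b: "f n \<phi> \<in> boundaries (hom_complex R Q' M') n"
  then have c: "\<phi> \<in> carrier (cobj (hom_complex R Q M) n)" and z: "\<phi> \<in> hom_cycles R Q M n"
    using hom_complex_cycles[OF Q M] by (auto simp: cycles_def)
  have "null_homotopic R Q' M' n (f n \<phi>)"
    using b hom_complex_boundaries[OF Q' M' chain_mapsD(3)[OF f c]] by simp
  then show "\<phi> \<in> boundaries (hom_complex R Q M) n"
    using inj[OF z c] hom_complex_boundaries[OF Q M c] by simp
next
  fix n \<psi> assume "\<psi> \<in> cycles (hom_complex R Q' M') n"
  then have c: "\<psi> \<in> carrier (cobj (hom_complex R Q' M') n)" and z: "\<psi> \<in> hom_cycles R Q' M' n"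
    using hom_complex_cycles[OF Q' M'] by (auto simp: cycles_def)
  obtain \<phi> where \<phi>: "\<phi> \<in> hom_cycles R Q M n" "\<phi> \<in> carrier (cobj (hom_complex R Q M) n)"
    "null_homotopic R Q' M' n (\<lambda>i x. \<psi> i x \<ominus>\<^bsub>cobj M' (i + n)\<^esub> f n \<phi> i x)" using surj[OF z] by blast
  note fc = chain_mapsD(3)[OF f \<phi>(2)]
  interpret H: module R "cobj (hom_complex R Q' M') n" by (rule hom_complex_module[OF Q' M'])
  have "null_homotopic R Q' M' n (\<psi> \<ominus>\<^bsub>cobj (hom_complex R Q' M') n\<^esub> f n \<phi>)"
    by (rule null_homotopic_cong[OF \<phi>(3)]) (rule hom_complex_minus[OF Q' M' c fc])
  then have "\<psi> \<ominus>\<^bsub>cobj (hom_complex R Q' M') n\<^esub> f n \<phi> \<in> boundaries (hom_complex R Q' M') n"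
    using hom_complex_boundaries[OF Q' M' H.M.minus_closed[OF c fc]] by simp
  then show "\<exists>\<phi>\<in>cycles (hom_complex R Q M) n. \<psi> \<ominus>\<^bsub>cobj (hom_complex R Q' M') n\<^esub> f n \<phi> \<in> boundaries (hom_complex R Q' M') n"
    using \<phi>(1) hom_complex_cycles[OF Q M \<phi>(2)] by blast
qed

lemma hom_post_chain:
  assumes Q: "precomplex R Q" and X: "precomplex R X" and Y: "precomplex R Y" and f: "f \<in> chain_maps R X Y"
  shows "(\<lambda>n \<phi> i. \<lambda>x\<in>carrier (cobj Q i). f (i + n) (\<phi> i x)) \<in> chain_maps R (hom_complex R Q X) (hom_complex R Q Y)"
  unfolding chain_maps_def
proof (intro CollectI conjI allI ballI)
  let ?f = "\<lambda>n \<phi> i. \<lambda>x\<in>carrier (cobj Q i). f (i + n) (\<phi> i x)"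
  fix n
  have cl: "?f n \<phi> \<in> carrier (cobj (hom_complex R Q Y) n)" if "\<phi> \<in> carrier (cobj (hom_complex R Q X) n)" for \<phi>
    by (rule restrict_graded[OF Q graded_maps_comp[OF hom_complex_carrierD(1)[OF that] f]])
  show "?f n \<in> linear_maps R (cobj (hom_complex R Q X) n) (cobj (hom_complex R Q Y) n)"
  proof (rule linear_mapsI)
    fix \<phi> assume \<phi>: "\<phi> \<in> carrier (cobj (hom_complex R Q X) n)"
    show "?f n \<phi> \<in> carrier (cobj (hom_complex R Q Y) n)" by (rule cl[OF \<phi>])
    show "?f n (r \<odot>\<^bsub>cobj (hom_complex R Q X) n\<^esub> \<phi>) = r \<odot>\<^bsub>cobj (hom_complex R Q Y) n\<^esub> ?f n \<phi>" if "r \<in> carrier R" for r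
      unfolding hom_complex_smult
      by (intro ext) (simp add: linear_smult[OF chain_mapsD(1)[OF f] that hom_complex_carrierD(3)[OF \<phi>]])
    fix \<psi> assume \<psi>: "\<psi> \<in> carrier (cobj (hom_complex R Q X) n)"
    show "?f n (\<phi> \<oplus>\<^bsub>cobj (hom_complex R Q X) n\<^esub> \<psi>) = ?f n \<phi> \<oplus>\<^bsub>cobj (hom_complex R Q Y) n\<^esub> ?f n \<psi>"
      unfolding hom_complex_add
      by (intro ext) (simp add: linear_add[OF chain_mapsD(1)[OF f] hom_complex_carrierD(3)[OF \<phi>] hom_complex_carrierD(3)[OF \<psi>]])
  qed
  fix \<phi> assume \<phi>: "\<phi> \<in> carrier (cobj (hom_complex R Q X) n)"
  note g = hom_complex_carrierD(1)[OF \<phi>]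
  have "hom_diff Q Y n (?f n \<phi>) i x = f (i + n - 1) (hom_diff Q X n \<phi> i x)" if x: "x \<in> carrier (cobj Q i)" for i x
    unfolding hom_diff_comp[OF Q X Y g f x, symmetric] by (rule hom_diff_cong[OF Q x]) simp
  then show "?f (n - 1) (cdiff (hom_complex R Q X) n \<phi>) = cdiff (hom_complex R Q Y) n (?f n \<phi>)"
    unfolding hom_complex_diff[OF Q X g] hom_complex_diff[OF Q Y hom_complex_carrierD(1)[OF cl[OF \<phi>]]]
    by (intro ext) (simp add: add_diff_eq)
qed

text \<open>On homology, injectivity is \<open>null_homotopic_cancel\<close> and surjectivity is
  \<open>hom_cycle_lift\<close>. The lift has to be made extensional to be an element of the Hom
  complex.\<close>

lemma quasi_iso_hom_post:
  assumes Q: "free_retract_complex R Q S" and X: "is_complex R X" and Y: "is_complex R Y"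
    and f: "quasi_iso_map R X Y f"
  shows "quasi_iso_map R (hom_complex R Q X) (hom_complex R Q Y) (\<lambda>n \<phi> i. \<lambda>x\<in>carrier (cobj Q i). f (i + n) (\<phi> i x))"
proof -
  have fc: "f \<in> chain_maps R X Y" using f by (simp add: quasi_iso_map_def)
  have Qc: "is_complex R Q" using Q by (simp add: free_retract_complex_def)
  note pX = is_complexD(1)[OF X] and pY = is_complexD(1)[OF Y] and pQ = is_complexD(1)[OF Qc]
  show ?thesis
  proof (rule quasi_iso_hom_complexI[OF pQ pQ pX pY hom_post_chain[OF pQ pX pY fc]])
    fix n \<phi> assume \<phi>: "\<phi> \<in> hom_cycles R Q X n"
      "null_homotopic R Q Y n (\<lambda>i. \<lambda>x\<in>carrier (cobj Q i). f (i + n) (\<phi> i x))"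
    show "null_homotopic R Q X n \<phi>"
      by (rule null_homotopic_cancel[OF Q X Y f \<phi>(1) null_homotopic_cong[OF \<phi>(2)]]) simp
  next
    fix n \<psi> assume \<psi>: "\<psi> \<in> hom_cycles R Q Y n"
    obtain \<theta> where \<theta>: "\<theta> \<in> hom_cycles R Q X n"
      "null_homotopic R Q Y n (\<lambda>i x. \<psi> i x \<ominus>\<^bsub>cobj Y (i + n)\<^esub> f (i + n) (\<theta> i x))"
      by (rule hom_cycle_lift[OF Q X Y f \<psi>])
    let ?\<theta> = "\<lambda>i. \<lambda>x\<in>carrier (cobj Q i). \<theta> i x"
    show "\<exists>\<phi>\<in>hom_cycles R Q X n. \<phi> \<in> carrier (cobj (hom_complex R Q X) n) \<and>
       null_homotopic R Q Y n (\<lambda>i x. \<psi> i x \<ominus>\<^bsub>cobj Y (i + n)\<^esub> (\<lambda>x\<in>carrier (cobj Q i). f (i + n) (\<phi> i x)) x)"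
    proof (intro bexI[of _ ?\<theta>] conjI)
      show "?\<theta> \<in> hom_cycles R Q X n" by (rule hom_cycles_cong[OF pQ \<theta>(1)]) simp
      show "?\<theta> \<in> carrier (cobj (hom_complex R Q X) n)" by (rule restrict_graded[OF pQ hom_cyclesD(1)[OF \<theta>(1)]])
      show "null_homotopic R Q Y n (\<lambda>i x. \<psi> i x \<ominus>\<^bsub>cobj Y (i + n)\<^esub> (\<lambda>x\<in>carrier (cobj Q i). f (i + n) (?\<theta> i x)) x)"
        by (rule null_homotopic_cong[OF \<theta>(2)]) simp
    qed
  qed
qed

lemma hom_pre_chain:
  assumes Q: "precomplex R Q" and Q': "precomplex R Q'" and X: "precomplex R X" and f: "f \<in> chain_maps R Q Q'"
  shows "(\<lambda>n \<phi> i. \<lambda>x\<in>carrier (cobj Q i). \<phi> i (f i x)) \<in> chain_maps R (hom_complex R Q' X) (hom_complex R Q X)"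
  unfolding chain_maps_def
proof (intro CollectI conjI allI ballI)
  let ?f = "\<lambda>n \<phi> i. \<lambda>x\<in>carrier (cobj Q i). \<phi> i (f i x)"
  fix n :: int
  have cl: "?f n \<phi> \<in> carrier (cobj (hom_complex R Q X) n)" if "\<phi> \<in> carrier (cobj (hom_complex R Q' X) n)" for \<phi>
    by (rule restrict_graded[OF Q graded_maps_precomp[OF f hom_complex_carrierD(1)[OF that]]])
  show "?f n \<in> linear_maps R (cobj (hom_complex R Q' X) n) (cobj (hom_complex R Q X) n)"
    by (rule linear_mapsI, erule cl)
      (auto simp: hom_complex_add hom_complex_smult fun_eq_iff restrict_def chain_mapsD(3)[OF f])
  fix \<phi> assume \<phi>: "\<phi> \<in> carrier (cobj (hom_complex R Q' X) n)"
  note g = hom_complex_carrierD(1)[OF \<phi>]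
  have "hom_diff Q X n (?f n \<phi>) i x = hom_diff Q' X n \<phi> i (f i x)" if x: "x \<in> carrier (cobj Q i)" for i x
    unfolding hom_diff_precomp[OF f x, symmetric] by (rule hom_diff_cong[OF Q x]) simp
  then show "?f (n - 1) (cdiff (hom_complex R Q' X) n \<phi>) = cdiff (hom_complex R Q X) n (?f n \<phi>)"
    unfolding hom_complex_diff[OF Q' X g] hom_complex_diff[OF Q X hom_complex_carrierD(1)[OF cl[OF \<phi>]]]
    by (intro ext) (simp add: chain_mapsD(3)[OF f])
qed

section \<open>Homotopic maps in the first argument of Hom\<close>

definition homotopic ::
    "('a, 'c) ring_scheme \<Rightarrow> ('a, 'm) chain_complex \<Rightarrow> ('a, 'n) chain_complex \<Rightarrow>
      (int \<Rightarrow> 'm \<Rightarrow> 'n) \<Rightarrow> (int \<Rightarrow> 'm \<Rightarrow> 'n) \<Rightarrow> bool" where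
  "homotopic R Q M f g \<longleftrightarrow> null_homotopic R Q M 0 (\<lambda>i x. f i x \<ominus>\<^bsub>cobj M i\<^esub> g i x)"

lemma hom_cycle_homotopic:
  assumes Q': "precomplex R Q'" and Q: "precomplex R Q" and M: "precomplex R M" and \<phi>: "\<phi> \<in> hom_cycles R Q M n"
    and f: "f \<in> chain_maps R Q' Q" and g: "g \<in> chain_maps R Q' Q" and "homotopic R Q' Q f g"
  shows "null_homotopic R Q' M n (\<lambda>i x. \<phi> i (f i x) \<ominus>\<^bsub>cobj M (i + n)\<^esub> \<phi> i (g i x))"
proof (rule null_homotopic_cong)
  show "null_homotopic R Q' M n (\<lambda>i x. \<phi> i (f i x \<ominus>\<^bsub>cobj Q i\<^esub> g i x))"
    by (rule hom_cycle_null_comp[OF Q' Q M \<phi>]) (use assms(7) in \<open>simp add: homotopic_def\<close>)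
  fix i x assume x: "x \<in> carrier (cobj Q' i)"
  show "\<phi> i (f i x) \<ominus>\<^bsub>cobj M (i + n)\<^esub> \<phi> i (g i x) = \<phi> i (f i x \<ominus>\<^bsub>cobj Q i\<^esub> g i x)"
    by (rule linear_minus[OF precomplexD(1)[OF Q] precomplexD(1)[OF M] graded_mapsD(1)[OF hom_cyclesD(1)[OF \<phi>]]
          chain_mapsD(3)[OF f x] chain_mapsD(3)[OF g x], symmetric])
qed

lemma null_homotopic_transfer:
  assumes Q: "precomplex R Q" and M: "precomplex R M"
    and "null_homotopic R Q M n (\<lambda>i x. \<phi> i x \<ominus>\<^bsub>cobj M (i + n)\<^esub> \<psi> i x)" "null_homotopic R Q M n \<phi>"
    and c: "\<And>i x. x \<in> carrier (cobj Q i) \<Longrightarrow> \<phi> i x \<in> carrier (cobj M (i + n))"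
      "\<And>i x. x \<in> carrier (cobj Q i) \<Longrightarrow> \<psi> i x \<in> carrier (cobj M (i + n))"
  shows "null_homotopic R Q M n \<psi>"
proof (rule null_homotopic_cong[OF null_homotopic_minus[OF Q M assms(4,3)]])
  fix i x assume x: "x \<in> carrier (cobj Q i)"
  interpret M: module R "cobj M (i + n)" by (rule precomplexD[OF M])
  show "\<psi> i x = \<phi> i x \<ominus>\<^bsub>cobj M (i + n)\<^esub> (\<phi> i x \<ominus>\<^bsub>cobj M (i + n)\<^esub> \<psi> i x)"
    using c[OF x] by (simp add: M.minus_eq M.minus_add M.minus_minus M.r_neg2)
qed

lemma null_homotopic_swap:
  assumes Q: "precomplex R Q" and M: "precomplex R M"
    and "null_homotopic R Q M n (\<lambda>i x. \<phi> i x \<ominus>\<^bsub>cobj M (i + n)\<^esub> \<psi> i x)"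
    and c: "\<And>i x. x \<in> carrier (cobj Q i) \<Longrightarrow> \<phi> i x \<in> carrier (cobj M (i + n))"
      "\<And>i x. x \<in> carrier (cobj Q i) \<Longrightarrow> \<psi> i x \<in> carrier (cobj M (i + n))"
  shows "null_homotopic R Q M n (\<lambda>i x. \<psi> i x \<ominus>\<^bsub>cobj M (i + n)\<^esub> \<phi> i x)"
proof -
  have "null_homotopic R Q M n (\<lambda>i x. \<zero>\<^bsub>cobj M (i + n)\<^esub>)" by (rule null_homotopic_zero[OF Q M]) simp
  from null_homotopic_minus[OF Q M this assms(3)] show ?thesis
  proof (rule null_homotopic_cong)
    fix i x assume x: "x \<in> carrier (cobj Q i)"
    interpret M: module R "cobj M (i + n)" by (rule precomplexD[OF M])
    show "\<psi> i x \<ominus>\<^bsub>cobj M (i + n)\<^esub> \<phi> i x = \<zero>\<^bsub>cobj M (i + n)\<^esub> \<ominus>\<^bsub>cobj M (i + n)\<^esub> (\<phi> i x \<ominus>\<^bsub>cobj M (i + n)\<^esub> \<psi> i x)"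
      using c[OF x] by (simp add: M.minus_eq M.minus_add M.minus_minus M.a_ac)
  qed
qed

text \<open>Composition with the homotopy inverse \<open>g\<close> undoes composition with
  \<open>f\<close> up to homotopy, by \<open>hom_cycle_homotopic\<close>: one of the two homotopies
  gives injectivity on homology, the other surjectivity.\<close>

lemma quasi_iso_hom_pre:
  assumes Q: "precomplex R Q" and Q': "precomplex R Q'" and X: "precomplex R X"
    and f: "f \<in> chain_maps R Q Q'" and g: "g \<in> chain_maps R Q' Q"
    and fg: "homotopic R Q' Q' (\<lambda>i x. f i (g i x)) (\<lambda>i x. x)"
    and gf: "homotopic R Q Q (\<lambda>i x. g i (f i x)) (\<lambda>i x. x)"
  shows "quasi_iso_map R (hom_complex R Q' X) (hom_complex R Q X) (\<lambda>n \<phi> i. \<lambda>x\<in>carrier (cobj Q i). \<phi> i (f i x))"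
proof (rule quasi_iso_hom_complexI[OF Q' Q X X hom_pre_chain[OF Q Q' X f]])
  fix n \<phi> assume \<phi>: "\<phi> \<in> hom_cycles R Q' X n"
    and nh: "null_homotopic R Q X n (\<lambda>i. \<lambda>x\<in>carrier (cobj Q i). \<phi> i (f i x))"
  note gr = hom_cyclesD(1)[OF \<phi>]
  have 1: "null_homotopic R Q' X n (\<lambda>i x. \<phi> i (f i (g i x)))"
    by (rule null_homotopic_cong[OF null_homotopic_precomp[OF g nh]]) (simp add: chain_mapsD(3)[OF g])
  have 2: "null_homotopic R Q' X n (\<lambda>i x. \<phi> i (f i (g i x)) \<ominus>\<^bsub>cobj X (i + n)\<^esub> \<phi> i x)"
    by (rule hom_cycle_homotopic[OF Q' Q' X \<phi> chain_maps_comp[OF g f] chain_maps_id fg])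
  show "null_homotopic R Q' X n \<phi>"
    by (rule null_homotopic_transfer[OF Q' X 2 1])
      (auto intro!: graded_mapsD(2)[OF gr] chain_mapsD(3)[OF f] chain_mapsD(3)[OF g])
next
  fix n \<psi> assume \<psi>: "\<psi> \<in> hom_cycles R Q X n"
  note gr = hom_cyclesD(1)[OF \<psi>]
  let ?\<phi> = "\<lambda>i. \<lambda>x\<in>carrier (cobj Q' i). \<psi> i (g i x)"
  have \<phi>: "(\<lambda>i x. \<psi> i (g i x)) \<in> hom_cycles R Q' X n" by (rule hom_cycles_precomp[OF g \<psi>])
  show "\<exists>\<phi>\<in>hom_cycles R Q' X n. \<phi> \<in> carrier (cobj (hom_complex R Q' X) n) \<and>
       null_homotopic R Q X n (\<lambda>i x. \<psi> i x \<ominus>\<^bsub>cobj X (i + n)\<^esub> (\<lambda>x\<in>carrier (cobj Q i). \<phi> i (f i x)) x)"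
  proof (intro bexI[of _ ?\<phi>] conjI)
    show "?\<phi> \<in> hom_cycles R Q' X n" by (rule hom_cycles_cong[OF Q' \<phi>]) simp
    show "?\<phi> \<in> carrier (cobj (hom_complex R Q' X) n)" by (rule restrict_graded[OF Q' hom_cyclesD(1)[OF \<phi>]])
    have "null_homotopic R Q X n (\<lambda>i x. \<psi> i (g i (f i x)) \<ominus>\<^bsub>cobj X (i + n)\<^esub> \<psi> i x)"
      by (rule hom_cycle_homotopic[OF Q Q X \<psi> chain_maps_comp[OF f g] chain_maps_id gf])
    then have "null_homotopic R Q X n (\<lambda>i x. \<psi> i x \<ominus>\<^bsub>cobj X (i + n)\<^esub> \<psi> i (g i (f i x)))"
      by (rule null_homotopic_swap[OF Q X])
        (auto intro!: graded_mapsD(2)[OF gr] chain_mapsD(3)[OF f] chain_mapsD(3)[OF g])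
    then show "null_homotopic R Q X n (\<lambda>i x. \<psi> i x \<ominus>\<^bsub>cobj X (i + n)\<^esub> (\<lambda>x\<in>carrier (cobj Q i). ?\<phi> i (f i x)) x)"
      by (rule null_homotopic_cong) (simp add: chain_mapsD(3)[OF f])
  qed
qed

subsection \<open>Comparison of resolutions\<close>

lemma chain_lift:
  assumes "free_retract_complex R Q S" "is_complex R X" "is_complex R Y"
    and "quasi_iso_map R X Y f" "g \<in> chain_maps R Q Y"
  obtains h where "h \<in> chain_maps R Q X" "homotopic R Q Y g (\<lambda>i x. f i (h i x))"
proof -
  have Qc: "is_complex R Q" using assms(1) by (simp add: free_retract_complex_def)
  note p = is_complexD(1)[OF Qc] is_complexD(1)[OF assms(2)] is_complexD(1)[OF assms(3)]
  show thesis
    by (rule hom_cycle_lift[OF assms(1-4), of g 0])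
      (use that assms(5) chain_maps_eq_hom_cycles[OF p(1,2)] chain_maps_eq_hom_cycles[OF p(1,3)] in \<open>auto simp: homotopic_def\<close>)
qed

lemma (in abelian_group) minus_minus_cancel:
  assumes "a \<in> carrier G" "b \<in> carrier G" "c \<in> carrier G"
  shows "(a \<ominus> c) \<ominus> (b \<ominus> c) = a \<ominus> b"
  using assms a_comm[of "\<ominus> b" c] by (simp add: minus_eq minus_add minus_minus a_assoc r_neg1)

lemma homotopic_trans':
  assumes Q: "precomplex R Q" and M: "precomplex R M" and "homotopic R Q M f h" "homotopic R Q M g h"
    and c: "f \<in> chain_maps R Q M" "g \<in> chain_maps R Q M" "h \<in> chain_maps R Q M"
  shows "homotopic R Q M f g"
proof -
  have "null_homotopic R Q M 0 (\<lambda>i x. (f i x \<ominus>\<^bsub>cobj M i\<^esub> h i x) \<ominus>\<^bsub>cobj M i\<^esub> (g i x \<ominus>\<^bsub>cobj M i\<^esub> h i x))"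
    using null_homotopic_minus[OF Q M assms(3,4)[unfolded homotopic_def]] by simp
  then show ?thesis unfolding homotopic_def
  proof (rule null_homotopic_cong)
    fix i x assume x: "x \<in> carrier (cobj Q i)"
    interpret M: module R "cobj M i" by (rule precomplexD[OF M])
    show "f i x \<ominus>\<^bsub>cobj M i\<^esub> g i x = (f i x \<ominus>\<^bsub>cobj M i\<^esub> h i x) \<ominus>\<^bsub>cobj M i\<^esub> (g i x \<ominus>\<^bsub>cobj M i\<^esub> h i x)"
      using c[THEN chain_mapsD(3), OF x] by (simp add: M.minus_minus_cancel)
  qed
qed

lemma homotopic_sym:
  assumes Q: "precomplex R Q" and M: "precomplex R M" and "homotopic R Q M f g"
    and c: "f \<in> chain_maps R Q M" "g \<in> chain_maps R Q M"
  shows "homotopic R Q M g f"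
  using null_homotopic_swap[OF Q M, of 0 f g] assms(3) chain_mapsD(3)[OF c(1)] chain_mapsD(3)[OF c(2)]
  by (simp add: homotopic_def)

lemma homotopic_precomp:
  assumes "homotopic R Q M f g" "k \<in> chain_maps R Q' Q"
  shows "homotopic R Q' M (\<lambda>i x. f i (k i x)) (\<lambda>i x. g i (k i x))"
  using null_homotopic_precomp[OF assms(2) assms(1)[unfolded homotopic_def]] by (simp add: homotopic_def)

lemma homotopic_cancel:
  assumes Q: "free_retract_complex R Q S" and X: "is_complex R X" and Y: "is_complex R Y" and k: "quasi_iso_map R X Y k"
    and fg: "f \<in> chain_maps R Q X" "g \<in> chain_maps R Q X"
    and h: "homotopic R Q Y (\<lambda>i x. k i (f i x)) (\<lambda>i x. k i (g i x))"
  shows "homotopic R Q X f g"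
proof -
  have Qc: "is_complex R Q" using Q by (simp add: free_retract_complex_def)
  have kc: "k \<in> chain_maps R X Y" using k by (simp add: quasi_iso_map_def)
  note p = is_complexD(1)[OF Qc] is_complexD(1)[OF X]
  have "(\<lambda>i x. f i x \<ominus>\<^bsub>cobj X i\<^esub> g i x) \<in> hom_cycles R Q X 0"
    using hom_cycles_minus[OF p, of f 0 g] fg chain_maps_eq_hom_cycles[OF p] by simp
  moreover have "null_homotopic R Q Y 0 (\<lambda>i x. k i (f i x \<ominus>\<^bsub>cobj X i\<^esub> g i x))"
    using h unfolding homotopic_def
  proof (rule null_homotopic_cong)
    show "k i (f i x \<ominus>\<^bsub>cobj X i\<^esub> g i x) = k i (f i x) \<ominus>\<^bsub>cobj Y i\<^esub> k i (g i x)" if "x \<in> carrier (cobj Q i)" for i x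
      using linear_minus[OF is_complexD(2)[OF X] is_complexD(2)[OF Y] chain_mapsD(1)[OF kc]
          chain_mapsD(3)[OF fg(1) that] chain_mapsD(3)[OF fg(2) that]] .
  qed
  ultimately show ?thesis
    using null_homotopic_cancel[OF Q X Y k, of _ 0] unfolding homotopic_def by simp
qed

text \<open>If \<open>f\<close> and \<open>f'\<close> are quasi-isomorphisms to the same complex, then the lift of \<open>f\<close> along \<open>f'\<close>
  is inverse up to homotopy to the lift of \<open>f'\<close> along \<open>f\<close>.\<close>

lemma resolutions_homotopy_equivalent:
  assumes Q: "free_retract_complex R Q S" and Q': "free_retract_complex R Q' S'" and Y: "is_complex R Y"
    and f: "quasi_iso_map R Q Y f" and f': "quasi_iso_map R Q' Y f'"
  obtains g h where "g \<in> chain_maps R Q Q'" "h \<in> chain_maps R Q' Q"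
    "homotopic R Q Q (\<lambda>i x. h i (g i x)) (\<lambda>i x. x)" "homotopic R Q' Q' (\<lambda>i x. g i (h i x)) (\<lambda>i x. x)"
proof -
  have c: "is_complex R Q" "is_complex R Q'" using Q Q' by (simp_all add: free_retract_complex_def)
  note p = is_complexD(1)[OF c(1)] is_complexD(1)[OF c(2)] is_complexD(1)[OF Y]
  have fc: "f \<in> chain_maps R Q Y" "f' \<in> chain_maps R Q' Y" using f f' by (simp_all add: quasi_iso_map_def)
  obtain g where g: "g \<in> chain_maps R Q Q'" "homotopic R Q Y f (\<lambda>i x. f' i (g i x))"
    by (rule chain_lift[OF Q c(2) Y f' fc(1)])
  obtain h where h: "h \<in> chain_maps R Q' Q" "homotopic R Q' Y f' (\<lambda>i x. f i (h i x))"
    by (rule chain_lift[OF Q' c(1) Y f fc(2)])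
  have "homotopic R Q Y (\<lambda>i x. f i (h i (g i x))) f"
    by (rule homotopic_trans'[OF p(1,3) homotopic_sym[OF p(1,3) homotopic_precomp[OF h(2) g(1)]] g(2)])
      (intro chain_maps_comp[OF g(1)] chain_maps_comp[OF _ fc(1)] fc h(1))+
  then have 1: "homotopic R Q Q (\<lambda>i x. h i (g i x)) (\<lambda>i x. x)"
    by (intro homotopic_cancel[OF Q c(1) Y f] chain_maps_comp[OF g(1) h(1)] chain_maps_id)
  have "homotopic R Q' Y (\<lambda>i x. f' i (g i (h i x))) f'"
    by (rule homotopic_trans'[OF p(2,3) homotopic_sym[OF p(2,3) homotopic_precomp[OF g(2) h(1)]] h(2)])
      (intro chain_maps_comp[OF h(1)] chain_maps_comp[OF _ fc(2)] fc g(1))+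
  then have 2: "homotopic R Q' Q' (\<lambda>i x. g i (h i x)) (\<lambda>i x. x)"
    by (intro homotopic_cancel[OF Q' c(2) Y f'] chain_maps_comp[OF h(1) g(1)] chain_maps_id)
  show thesis by (rule that[OF g(1) h(1) 1 2])
qed

text \<open>Two resolutions of \<open>K\<close> are homotopy equivalent, and null homotopies travel
  along a homotopy equivalence by composition. This is how resolutions are exchanged in front of an
  unbounded \<open>M\<close>.\<close>

lemma hom_vanishes_transfer:
  assumes T: "free_retract_complex R T S" and T': "free_retract_complex R T' S'" and K: "is_complex R K"
    and f: "quasi_iso_map R T K f" and f': "quasi_iso_map R T' K f'" and M: "precomplex R M"
  shows "hom_vanishes R T M n \<longleftrightarrow> hom_vanishes R T' M n"
proof -
  \<comment> \<open>Stated for arbitrary element types, so that it can be applied with the roles of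
    the two resolutions interchanged.\<close>
  have *: "hom_vanishes R T' M n"
    if T: "is_complex R T" and T': "is_complex R T'" and g: "g \<in> chain_maps R T T'" and h: "h \<in> chain_maps R T' T"
      and gh: "homotopic R T' T' (\<lambda>i x. g i (h i x)) (\<lambda>i x. x)" and van: "hom_vanishes R T M n"
    for T :: "('a, 'u) chain_complex" and T' :: "('a, 'v) chain_complex" and g h
    unfolding hom_vanishes_def
  proof
    note p = is_complexD(1)[OF T] is_complexD(1)[OF T']
    fix \<phi> assume \<phi>: "\<phi> \<in> hom_cycles R T' M n"
    note gr = hom_cyclesD(1)[OF \<phi>]
    have "null_homotopic R T M n (\<lambda>i x. \<phi> i (g i x))"
      using van hom_cycles_precomp[OF g \<phi>] unfolding hom_vanishes_def by blast
    then have 1: "null_homotopic R T' M n (\<lambda>i x. \<phi> i (g i (h i x)))"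
      by (rule null_homotopic_precomp[OF h])
    have 2: "null_homotopic R T' M n (\<lambda>i x. \<phi> i (g i (h i x)) \<ominus>\<^bsub>cobj M (i + n)\<^esub> \<phi> i x)"
      by (rule hom_cycle_homotopic[OF p(2,2) M \<phi> chain_maps_comp[OF h g] chain_maps_id gh])
    show "null_homotopic R T' M n \<phi>"
      by (rule null_homotopic_transfer[OF p(2) M 2 1])
        (auto intro!: graded_mapsD(2)[OF gr] chain_mapsD(3)[OF g] chain_mapsD(3)[OF h])
  qed
  have c: "is_complex R T" "is_complex R T'" using T T' by (simp_all add: free_retract_complex_def)
  obtain g h where gh: "g \<in> chain_maps R T T'" "h \<in> chain_maps R T' T"
    "homotopic R T T (\<lambda>i x. h i (g i x)) (\<lambda>i x. x)" "homotopic R T' T' (\<lambda>i x. g i (h i x)) (\<lambda>i x. x)"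
    by (rule resolutions_homotopy_equivalent[OF T T' K f f'])
  show ?thesis using *[OF c gh(1,2,4)] *[OF c(2,1) gh(2,1,3)] by blast
qed

section \<open>Composition and cancellation of quasi-isomorphisms\<close>

lemma boundary_homotopic:
  assumes "precomplex R X" "precomplex R Y" "homotopic R X Y f g" "x \<in> cycles X i"
  shows "f i x \<ominus>\<^bsub>cobj Y i\<^esub> g i x \<in> boundaries Y i"
proof -
  obtain H where H: "H \<in> graded_maps R X Y 1" "f i x \<ominus>\<^bsub>cobj Y i\<^esub> g i x = hom_diff X Y 1 H i x"
    using assms(3,4) by (auto simp: homotopic_def null_homotopic_def cycles_def)
  interpret Y: module R "cobj Y i" by (rule precomplexD[OF assms(2)])
  have x: "x \<in> carrier (cobj X i)" "cdiff X i x = \<zero>\<^bsub>cobj X (i - 1)\<^esub>" using assms(4) by (auto simp: cycles_def)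
  have "H (i - 1) \<zero>\<^bsub>cobj X (i - 1)\<^esub> = \<zero>\<^bsub>cobj Y i\<^esub>"
    using linear_zero[OF precomplexD(1)[OF assms(1)] precomplexD(1)[OF assms(2)] graded_mapsD(3)[OF H(1), of i]] by simp
  then have "f i x \<ominus>\<^bsub>cobj Y i\<^esub> g i x = cdiff Y (i + 1) (H i x)"
    using cdiff_closed_up[OF assms(2) graded_mapsD(2)[OF H(1) x(1)]]
    by (simp add: H(2) hom_diff_def x(2) sgn_power_zero[OF Y.module_axioms] Y.minus_zero_right)
  then show ?thesis using graded_mapsD(2)[OF H(1) x(1)] by (auto simp: boundaries_def)
qed

lemma chain_map_cycles:
  assumes "precomplex R X" "precomplex R Y" "f \<in> chain_maps R X Y" "x \<in> cycles X i"
  shows "f i x \<in> cycles Y i"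
  using assms(4) chain_mapsD(2,3)[OF assms(3)] linear_zero[OF precomplexD(1)[OF assms(1)] precomplexD(1)[OF assms(2)] chain_mapsD(1)[OF assms(3)]]
  by (fastforce simp: cycles_def)

lemma chain_map_boundaries:
  assumes "f \<in> chain_maps R X Y" "x \<in> boundaries X i"
  shows "f i x \<in> boundaries Y i"
proof -
  obtain w where w: "w \<in> carrier (cobj X (i + 1))" "x = cdiff X (i + 1) w" using assms(2) by (auto simp: boundaries_def)
  then have "f i x = cdiff Y (i + 1) (f (i + 1) w)" using chain_mapsD(2)[OF assms(1) w(1)] by simp
  then show ?thesis using chain_mapsD(3)[OF assms(1) w(1)] by (auto simp: boundaries_def)
qed

lemma boundaries_cycles:
  assumes "is_complex R X" "x \<in> boundaries X i" shows "x \<in> cycles X i"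
  using assms(2) is_complexD(5)[OF assms(1), of _ "i + 1"] cdiff_closed_up[OF is_complexD(1)[OF assms(1)]]
  by (auto simp: boundaries_def cycles_def)

lemma quasi_iso_comp:
  assumes X: "precomplex R X" and Y: "precomplex R Y" and Z: "precomplex R Z"
    and f: "quasi_iso_map R X Y f" and g: "quasi_iso_map R Y Z g"
  shows "quasi_iso_map R X Z (\<lambda>i x. g i (f i x))"
proof -
  have c: "f \<in> chain_maps R X Y" "g \<in> chain_maps R Y Z" using f g by (simp_all add: quasi_iso_map_def)
  have inj: "x \<in> boundaries X i" if "x \<in> cycles X i" "g i (f i x) \<in> boundaries Z i" for i x
    using that chain_map_cycles[OF X Y c(1) that(1)] f g unfolding quasi_iso_map_def by blast
  have surj: "\<exists>x\<in>cycles X i. z \<ominus>\<^bsub>cobj Z i\<^esub> g i (f i x) \<in> boundaries Z i" if z: "z \<in> cycles Z i" for i z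
  proof -
    obtain y where y: "y \<in> cycles Y i" "z \<ominus>\<^bsub>cobj Z i\<^esub> g i y \<in> boundaries Z i"
      using g z unfolding quasi_iso_map_def by blast
    obtain x where x: "x \<in> cycles X i" "y \<ominus>\<^bsub>cobj Y i\<^esub> f i x \<in> boundaries Y i"
      using f y unfolding quasi_iso_map_def by blast
    have cl: "z \<in> carrier (cobj Z i)" "y \<in> carrier (cobj Y i)" "f i x \<in> carrier (cobj Y i)"
      using z y x chain_mapsD(3)[OF c(1)] by (auto simp: cycles_def)
    note cl' = chain_mapsD(3)[OF c(2) cl(2)] chain_mapsD(3)[OF c(2) cl(3)]
    interpret Z: module R "cobj Z i" by (rule precomplexD[OF Z])
    have "g i y \<ominus>\<^bsub>cobj Z i\<^esub> g i (f i x) \<in> boundaries Z i"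
      using chain_map_boundaries[OF c(2) x(2)]
        linear_minus[OF precomplexD(1)[OF Y] precomplexD(1)[OF Z] chain_mapsD(1)[OF c(2)] cl(2,3)] by simp
    then have "(z \<ominus>\<^bsub>cobj Z i\<^esub> g i y) \<oplus>\<^bsub>cobj Z i\<^esub> (g i y \<ominus>\<^bsub>cobj Z i\<^esub> g i (f i x)) \<in> boundaries Z i"
      by (rule Z.submoduleE(5)[OF boundaries_submodule[OF Z] y(2)])
    moreover have "(z \<ominus>\<^bsub>cobj Z i\<^esub> g i y) \<oplus>\<^bsub>cobj Z i\<^esub> (g i y \<ominus>\<^bsub>cobj Z i\<^esub> g i (f i x)) = z \<ominus>\<^bsub>cobj Z i\<^esub> g i (f i x)"
      using cl(1) cl' by (simp add: Z.minus_eq Z.a_assoc Z.r_neg1 Z.r_neg2)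
    ultimately show ?thesis using x(1) by auto
  qed
  show ?thesis unfolding quasi_iso_map_def
    using chain_maps_comp[OF c] inj surj by simp
qed

text \<open>Two out of three, up to homotopy: homotopic maps differ by boundaries on cycles, so on
  homology \<open>f\<close> is \<open>h\<close> followed by the inverse of \<open>g\<close>.\<close>

lemma quasi_iso_cancel_left:
  assumes X: "is_complex R X" and Y: "is_complex R Y" and Z: "is_complex R Z"
    and f: "f \<in> chain_maps R X Y" and g: "quasi_iso_map R Y Z g" and h: "quasi_iso_map R X Z h"
    and hom: "homotopic R X Z h (\<lambda>i x. g i (f i x))"
  shows "quasi_iso_map R X Y f"
proof -
  note p = is_complexD(1)[OF X] is_complexD(1)[OF Y] is_complexD(1)[OF Z]
  have c: "g \<in> chain_maps R Y Z" "h \<in> chain_maps R X Z" using g h by (simp_all add: quasi_iso_map_def)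
  have inj: "x \<in> boundaries X i" if x: "x \<in> cycles X i" "f i x \<in> boundaries Y i" for i x
  proof -
    interpret Z: module R "cobj Z i" by (rule precomplexD[OF p(3)])
    have cl: "h i x \<in> carrier (cobj Z i)" "g i (f i x) \<in> carrier (cobj Z i)"
      using x chain_mapsD(3)[OF c(2)] chain_mapsD(3)[OF c(1) chain_mapsD(3)[OF f]] by (auto simp: cycles_def)
    have "(h i x \<ominus>\<^bsub>cobj Z i\<^esub> g i (f i x)) \<oplus>\<^bsub>cobj Z i\<^esub> g i (f i x) \<in> boundaries Z i"
      by (rule Z.submoduleE(5)[OF boundaries_submodule[OF p(3)] boundary_homotopic[OF p(1,3) hom x(1)]
            chain_map_boundaries[OF c(1) x(2)]])
    then have "h i x \<in> boundaries Z i" using cl by (simp add: Z.minus_eq Z.a_assoc Z.l_neg)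
    then show ?thesis using h x(1) unfolding quasi_iso_map_def by blast
  qed
  have surj: "\<exists>x\<in>cycles X i. y \<ominus>\<^bsub>cobj Y i\<^esub> f i x \<in> boundaries Y i" if y: "y \<in> cycles Y i" for i y
  proof -
    interpret Z: module R "cobj Z i" by (rule precomplexD[OF p(3)])
    interpret Y: module R "cobj Y i" by (rule precomplexD[OF p(2)])
    obtain x where x: "x \<in> cycles X i" "g i y \<ominus>\<^bsub>cobj Z i\<^esub> h i x \<in> boundaries Z i"
      using h chain_map_cycles[OF p(2,3) c(1) y] unfolding quasi_iso_map_def by blast
    have cl: "y \<in> carrier (cobj Y i)" "f i x \<in> carrier (cobj Y i)" "h i x \<in> carrier (cobj Z i)"
      using x y chain_mapsD(3)[OF f] chain_mapsD(3)[OF c(2)] by (auto simp: cycles_def)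
    note cl' = chain_mapsD(3)[OF c(1) cl(1)] chain_mapsD(3)[OF c(1) cl(2)]
    have "(g i y \<ominus>\<^bsub>cobj Z i\<^esub> h i x) \<oplus>\<^bsub>cobj Z i\<^esub> (h i x \<ominus>\<^bsub>cobj Z i\<^esub> g i (f i x)) \<in> boundaries Z i"
      by (rule Z.submoduleE(5)[OF boundaries_submodule[OF p(3)] x(2) boundary_homotopic[OF p(1,3) hom x(1)]])
    moreover have "(g i y \<ominus>\<^bsub>cobj Z i\<^esub> h i x) \<oplus>\<^bsub>cobj Z i\<^esub> (h i x \<ominus>\<^bsub>cobj Z i\<^esub> g i (f i x)) = g i (y \<ominus>\<^bsub>cobj Y i\<^esub> f i x)"
      using cl cl' linear_minus[OF precomplexD(1)[OF p(2)] precomplexD(1)[OF p(3)] chain_mapsD(1)[OF c(1)] cl(1,2)]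
      by (simp add: Z.minus_eq Z.a_assoc Z.r_neg1 Z.r_neg2)
    moreover have "y \<ominus>\<^bsub>cobj Y i\<^esub> f i x \<in> cycles Y i"
      unfolding Y.minus_eq
      by (intro Y.submoduleE(5)[OF cycles_submodule[OF p(2)]] Y.submoduleE(3)[OF cycles_submodule[OF p(2)]]
          y chain_map_cycles[OF p(1,2) f x(1)])
    ultimately have "y \<ominus>\<^bsub>cobj Y i\<^esub> f i x \<in> boundaries Y i" using g unfolding quasi_iso_map_def by simp
    then show ?thesis using x(1) by blast
  qed
  show ?thesis unfolding quasi_iso_map_def using f inj surj by simp
qed

lemma quasi_iso_id:
  assumes X: "precomplex R X" shows "quasi_iso_map R X X (\<lambda>i x. x)"
proof -
  have "\<exists>x\<in>cycles X i. y \<ominus>\<^bsub>cobj X i\<^esub> x \<in> boundaries X i" if y: "y \<in> cycles X i" for i y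
  proof -
    interpret X: module R "cobj X i" by (rule precomplexD[OF X])
    have "y \<ominus>\<^bsub>cobj X i\<^esub> y = \<zero>\<^bsub>cobj X i\<^esub>" using y by (simp add: cycles_def X.minus_self)
    then show ?thesis using subgroup.one_closed[OF submodule.axioms(1)[OF boundaries_submodule[OF X, of i]]]
      by (intro bexI[OF _ y]) simp
  qed
  then show ?thesis by (simp add: quasi_iso_map_def chain_maps_id)
qed

section \<open>Bounded complexes of finite free modules\<close>

text \<open>A finite basis together with its dual basis. Unique existence of coefficients is
  replaced by linear functionals, which can be composed with other maps.\<close>

definition has_basis ::
    "('a, 'c) ring_scheme \<Rightarrow> ('a, 'm) module \<Rightarrow> 'm set \<Rightarrow> ('m \<Rightarrow> 'm \<Rightarrow> 'a) \<Rightarrow> bool" where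
  "has_basis R M B \<beta> \<longleftrightarrow> module R M \<and> finite B \<and> B \<subseteq> carrier M \<and>
     (\<forall>b\<in>B. \<beta> b \<in> linear_maps R M (regular_module R)) \<and>
     (\<forall>b\<in>B. \<forall>b'\<in>B. \<beta> b b' = (if b = b' then \<one>\<^bsub>R\<^esub> else \<zero>\<^bsub>R\<^esub>)) \<and>
     (\<forall>x\<in>carrier M. x = (\<Oplus>\<^bsub>M\<^esub>b\<in>B. \<beta> b x \<odot>\<^bsub>M\<^esub> b))"

text \<open>Linearity and duality of the coordinate functions come from uniqueness: in each case
  both sides are coefficient families of the same element.\<close>

lemma finite_free_has_basis:
  assumes "finite_free_module R M"
  obtains B \<beta> where "has_basis R M B \<beta>"
proof -
  obtain B where M: "module R M" and B: "B \<subseteq> carrier M" "finite B"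
    and ex: "\<And>x. x \<in> carrier M \<Longrightarrow> \<exists>!c. c \<in> B \<rightarrow>\<^sub>E carrier R \<and> x = (\<Oplus>\<^bsub>M\<^esub>b\<in>B. c b \<odot>\<^bsub>M\<^esub> b)"
    using assms by (auto simp: finite_free_module_def)
  interpret module R M by (rule M)
  define c where "c x = (THE c. c \<in> B \<rightarrow>\<^sub>E carrier R \<and> x = (\<Oplus>\<^bsub>M\<^esub>b\<in>B. c b \<odot>\<^bsub>M\<^esub> b))" for x
  have c: "c x \<in> B \<rightarrow>\<^sub>E carrier R" "x = (\<Oplus>\<^bsub>M\<^esub>b\<in>B. c x b \<odot>\<^bsub>M\<^esub> b)" if "x \<in> carrier M" for x
    using theI'[OF ex[OF that]] by (auto simp: c_def)
  have bc: "b \<in> carrier M" if "b \<in> B" for b using B that by auto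
  have cc: "c x b \<in> carrier R" if "x \<in> carrier M" "b \<in> B" for x b using c(1)[OF that(1)] that(2) by auto
  \<comment> \<open>Uniqueness is given for coefficient families that are extensional on
    \<open>B\<close>; this extends it to all functions, of which only the values on \<open>B\<close>
    matter.\<close>
  have uniq: "c x b = d b" if "x \<in> carrier M" "d \<in> B \<rightarrow> carrier R" "x = (\<Oplus>\<^bsub>M\<^esub>b\<in>B. d b \<odot>\<^bsub>M\<^esub> b)" "b \<in> B" for x d b
  proof -
    have "(\<Oplus>\<^bsub>M\<^esub>b\<in>B. d b \<odot>\<^bsub>M\<^esub> b) = (\<Oplus>\<^bsub>M\<^esub>b\<in>B. restrict d B b \<odot>\<^bsub>M\<^esub> b)"
      by (rule M.finsum_cong') (use that(2) bc in \<open>auto simp: Pi_iff\<close>)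
    moreover have "restrict d B \<in> B \<rightarrow>\<^sub>E carrier R" using that(2) by auto
    ultimately have "restrict d B = c x"
      using ex[OF that(1)] c[OF that(1)] that(3) by auto
    then show ?thesis using that(4) by (auto dest: fun_cong[of _ _ b])
  qed
  have "has_basis R M B (\<lambda>b x. c x b)"
    unfolding has_basis_def
  proof (intro conjI ballI M B)
    fix b assume b: "b \<in> B"
    show "(\<lambda>x. c x b) \<in> linear_maps R M (regular_module R)"
    proof (rule linear_mapsI)
      fix x assume x: "x \<in> carrier M"
      show "c x b \<in> carrier (regular_module R)" using cc[OF x b] by simp
      show "c (r \<odot>\<^bsub>M\<^esub> x) b = r \<odot>\<^bsub>regular_module R\<^esub> c x b" if r: "r \<in> carrier R" for r
      proof -
        have "r \<odot>\<^bsub>M\<^esub> x = (\<Oplus>\<^bsub>M\<^esub>b\<in>B. r \<odot>\<^bsub>M\<^esub> (c x b \<odot>\<^bsub>M\<^esub> b))"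
          by (subst c(2)[OF x], rule finsum_smult_ldistr) (use r x B cc bc in auto)
        also have "\<dots> = (\<Oplus>\<^bsub>M\<^esub>b\<in>B. (r \<otimes>\<^bsub>R\<^esub> c x b) \<odot>\<^bsub>M\<^esub> b)"
          by (rule M.finsum_cong') (use r x cc bc smult_assoc1 in auto)
        finally have e: "r \<odot>\<^bsub>M\<^esub> x = (\<Oplus>\<^bsub>M\<^esub>b\<in>B. (r \<otimes>\<^bsub>R\<^esub> c x b) \<odot>\<^bsub>M\<^esub> b)" .
        show ?thesis using uniq[OF smult_closed[OF r x] _ e b] r cc[OF x] by auto
      qed
      fix y assume y: "y \<in> carrier M"
      have "x \<oplus>\<^bsub>M\<^esub> y = (\<Oplus>\<^bsub>M\<^esub>b\<in>B. c x b \<odot>\<^bsub>M\<^esub> b \<oplus>\<^bsub>M\<^esub> c y b \<odot>\<^bsub>M\<^esub> b)"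
        by (subst M.finsum_addf) (use x y cc bc c(2)[OF x] c(2)[OF y] in auto)
      also have "\<dots> = (\<Oplus>\<^bsub>M\<^esub>b\<in>B. (c x b \<oplus>\<^bsub>R\<^esub> c y b) \<odot>\<^bsub>M\<^esub> b)"
        by (rule M.finsum_cong') (use x y cc bc smult_l_distr in auto)
      finally have e: "x \<oplus>\<^bsub>M\<^esub> y = (\<Oplus>\<^bsub>M\<^esub>b\<in>B. (c x b \<oplus>\<^bsub>R\<^esub> c y b) \<odot>\<^bsub>M\<^esub> b)" .
      show "c (x \<oplus>\<^bsub>M\<^esub> y) b = c x b \<oplus>\<^bsub>regular_module R\<^esub> c y b"
        using uniq[OF M.a_closed[OF x y] _ e b] cc[OF x] cc[OF y] by auto
    qed
    fix b' assume b': "b' \<in> B"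
    have "b' = (\<Oplus>\<^bsub>M\<^esub>b\<in>B. if b' = b then b else \<zero>\<^bsub>M\<^esub>)"
      by (rule M.finsum_singleton[symmetric]) (use b' B bc in auto)
    also have "\<dots> = (\<Oplus>\<^bsub>M\<^esub>b\<in>B. (if b = b' then \<one>\<^bsub>R\<^esub> else \<zero>\<^bsub>R\<^esub>) \<odot>\<^bsub>M\<^esub> b)"
      by (rule M.finsum_cong') (use bc in auto)
    finally show "c b' b = (if b = b' then \<one>\<^bsub>R\<^esub> else \<zero>\<^bsub>R\<^esub>)"
      using uniq[OF bc[OF b'], of "\<lambda>b. if b = b' then \<one>\<^bsub>R\<^esub> else \<zero>\<^bsub>R\<^esub>" b] b by auto
  qed (rule c(2))
  then show thesis by (rule that)
qed

lemma has_basisD: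
  assumes "has_basis R M B \<beta>"
  shows "module R M" "finite B" "b \<in> B \<Longrightarrow> b \<in> carrier M" "b \<in> B \<Longrightarrow> \<beta> b \<in> linear_maps R M (regular_module R)"
    "b \<in> B \<Longrightarrow> b' \<in> B \<Longrightarrow> \<beta> b b' = (if b = b' then \<one>\<^bsub>R\<^esub> else \<zero>\<^bsub>R\<^esub>)"
    "x \<in> carrier M \<Longrightarrow> (\<Oplus>\<^bsub>M\<^esub>b\<in>B. \<beta> b x \<odot>\<^bsub>M\<^esub> b) = x"
    "b \<in> B \<Longrightarrow> x \<in> carrier M \<Longrightarrow> \<beta> b x \<in> carrier R"
  using assms linear_closed[of "\<beta> b" R M "regular_module R" x] by (auto simp: has_basis_def)

lemma linear_basis:
  assumes "has_basis R M B \<beta>" "module R N" "f \<in> linear_maps R M N" "x \<in> carrier M"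
  shows "f x = (\<Oplus>\<^bsub>N\<^esub>b\<in>B. \<beta> b x \<odot>\<^bsub>N\<^esub> f b)"
proof -
  note b = has_basisD[OF assms(1)]
  interpret M: module R M by (rule b)
  interpret N: module R N by fact
  have "f (\<Oplus>\<^bsub>M\<^esub>b\<in>B. \<beta> b x \<odot>\<^bsub>M\<^esub> b) = (\<Oplus>\<^bsub>N\<^esub>b\<in>B. f (\<beta> b x \<odot>\<^bsub>M\<^esub> b))"
    by (rule linear_finsum[OF b(1) assms(2,3)]) (use b(3,7) assms(4) in auto)
  also have "\<dots> = (\<Oplus>\<^bsub>N\<^esub>b\<in>B. \<beta> b x \<odot>\<^bsub>N\<^esub> f b)"
    by (rule N.M.finsum_cong') (use b(3,7) assms(4) linear_closed[OF assms(3)] linear_smult[OF assms(3)] in auto)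
  finally show ?thesis using b(6)[OF assms(4)] by simp
qed

lemma has_basis_free_retract:
  assumes "has_basis R M B \<beta>" shows "free_retract R M B"
  unfolding free_retract_def
proof (intro conjI bexI[of _ "\<lambda>b. b"] bexI[of _ "\<lambda>x b. if b \<in> B then \<beta> b x else \<zero>\<^bsub>R\<^esub>"] ballI)
  note b = has_basisD[OF assms]
  interpret module R M by (rule b)
  show "module R M" by (rule b)
  show id: "(\<lambda>b. b) \<in> B \<rightarrow> carrier M" using b by auto
  let ?l = "\<lambda>x b. if b \<in> B then \<beta> b x else \<zero>\<^bsub>R\<^esub>"
  have cl: "?l x \<in> carrier (free_module R B)" if x: "x \<in> carrier M" for x
  proof -
    have "{s. ?l x s \<noteq> \<zero>\<^bsub>R\<^esub>} \<subseteq> B" by auto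
    then show ?thesis using b(2,7) x by (auto simp: free_module_def intro: finite_subset)
  qed
  show "?l \<in> linear_maps R M (free_module R B)"
    by (rule linear_mapsI) (auto simp: fun_eq_iff linear_add[OF b(4)] linear_smult[OF b(4)] intro: cl)
  fix x assume x: "x \<in> carrier M"
  have "lin_ext R M (\<lambda>b. b) (?l x) = (\<Oplus>\<^bsub>M\<^esub>s\<in>B. ?l x s \<odot>\<^bsub>M\<^esub> s)"
    by (rule lin_ext_superset[OF b(1) id cl[OF x]]) (use b(2) in auto)
  also have "\<dots> = (\<Oplus>\<^bsub>M\<^esub>b\<in>B. \<beta> b x \<odot>\<^bsub>M\<^esub> b)"
    by (rule M.finsum_cong') (use b(3,7) x in auto)
  finally show "lin_ext R M (\<lambda>b. b) (?l x) = x" using b(6)[OF x] by simp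
qed

text \<open>The sections of the summands together form a section over the disjoint union of their
  index sets. Of the direct sum decomposition, only the formula for the identity of \<open>T\<close>
  enters.\<close>

lemma free_retract_finite_sum:
  assumes T: "module R T" and K: "finite K"
    and i: "\<And>k. k \<in> K \<Longrightarrow> i k \<in> linear_maps R (G k) T" and p: "\<And>k. k \<in> K \<Longrightarrow> p k \<in> linear_maps R T (G k)"
    and ip: "\<And>t. t \<in> carrier T \<Longrightarrow> t = (\<Oplus>\<^bsub>T\<^esub>k\<in>K. i k (p k t))"
    and G: "\<And>k. k \<in> K \<Longrightarrow> free_retract R (G k) (S k)"
  shows "free_retract R T (Sigma K S)"
proof -
  interpret T: module R T by (rule T)
  have R: "cring R" by (rule T.R.is_cring)
  have "\<forall>k\<in>K. \<exists>e l. e \<in> S k \<rightarrow> carrier (G k) \<and> l \<in> linear_maps R (G k) (free_module R (S k)) \<and>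
      (\<forall>x\<in>carrier (G k). lin_ext R (G k) e (l x) = x)"
    using G by (auto simp: free_retract_def Bex_def)
  then obtain e l where e: "\<And>k. k \<in> K \<Longrightarrow> e k \<in> S k \<rightarrow> carrier (G k)"
    and l: "\<And>k. k \<in> K \<Longrightarrow> l k \<in> linear_maps R (G k) (free_module R (S k))"
    and el: "\<And>k x. k \<in> K \<Longrightarrow> x \<in> carrier (G k) \<Longrightarrow> lin_ext R (G k) (e k) (l k x) = x" by metis
  have Gm: "module R (G k)" if "k \<in> K" for k using G[OF that] by (simp add: free_retract_def)
  let ?e = "\<lambda>(k, s). i k (e k s)"
  let ?l = "\<lambda>t (k, s). if k \<in> K then l k (p k t) s else \<zero>\<^bsub>R\<^esub>"
  have lp: "l k (p k t) \<in> carrier (free_module R (S k))" if "k \<in> K" "t \<in> carrier T" for k t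
    using that by (intro linear_closed[OF l] linear_closed[OF p])
  have e': "?e \<in> Sigma K S \<rightarrow> carrier T"
    using e i linear_closed by fastforce
  have cl: "?l t \<in> carrier (free_module R (Sigma K S))" if t: "t \<in> carrier T" for t
  proof -
    have "{ks. ?l t ks \<noteq> \<zero>\<^bsub>R\<^esub>} \<subseteq> Sigma K (\<lambda>k. {s. l k (p k t) s \<noteq> \<zero>\<^bsub>R\<^esub>})" by (auto split: if_splits)
    moreover have "finite (Sigma K (\<lambda>k. {s. l k (p k t) s \<noteq> \<zero>\<^bsub>R\<^esub>}))"
      using K free_carrierD(3)[OF lp[OF _ t]] by auto
    ultimately have "finite {ks. ?l t ks \<noteq> \<zero>\<^bsub>R\<^esub>}" by (rule finite_subset)
    then show ?thesis
      using free_carrierD(1,2)[OF lp[OF _ t]] by (auto simp: free_module_def)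
  qed
  have l': "?l \<in> linear_maps R T (free_module R (Sigma K S))"
    by (rule linear_mapsI) (auto simp: fun_eq_iff linear_add[OF p] linear_smult[OF p]
        linear_add[OF l] linear_smult[OF l] linear_closed[OF p] intro: cl)
  have slice: "(\<lambda>\<phi> s. \<phi> (k, s)) \<in> linear_maps R (free_module R (Sigma K S)) (free_module R (S k))" if k: "k \<in> K" for k
  proof (rule linear_mapsI)
    fix \<phi> assume \<phi>: "\<phi> \<in> carrier (free_module R (Sigma K S))"
    have "finite (Pair k -` {ks. \<phi> ks \<noteq> \<zero>\<^bsub>R\<^esub>})"
      by (rule finite_vimageI[OF free_carrierD(3)[OF \<phi>]]) (simp add: inj_on_def)
    then have "finite {s. \<phi> (k, s) \<noteq> \<zero>\<^bsub>R\<^esub>}" by (simp add: vimage_def)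
    then show "(\<lambda>s. \<phi> (k, s)) \<in> carrier (free_module R (S k))"
      using free_carrierD(1,2)[OF \<phi>] k by (auto simp: free_module_def)
  qed auto
  \<comment> \<open>Both sides are linear in \<open>\<phi>\<close>, so it is enough to compare them
    on a generator, where all summands but its own contribute zero.\<close>
  have main: "lin_ext R T ?e \<phi> = (\<Oplus>\<^bsub>T\<^esub>k\<in>K. i k (lin_ext R (G k) (e k) (\<lambda>s. \<phi> (k, s))))"
    if \<phi>: "\<phi> \<in> carrier (free_module R (Sigma K S))" for \<phi>
  proof (rule free_linear_eqI[OF R T lin_ext_linear[OF T e'] _ _ \<phi>])
    show "(\<lambda>\<phi>. \<Oplus>\<^bsub>T\<^esub>k\<in>K. i k (lin_ext R (G k) (e k) (\<lambda>s. \<phi> (k, s)))) \<in> linear_maps R (free_module R (Sigma K S)) T"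
      by (rule linear_sum[OF free_module_module[OF R] T])
        (rule linear_comp[OF linear_comp[OF slice lin_ext_linear[OF Gm e]] i])
    fix ks assume ks: "ks \<in> Sigma K S"
    obtain k0 s0 where k0: "ks = (k0, s0)" "k0 \<in> K" "s0 \<in> S k0" using ks by auto
    have c0: "i k0 (e k0 s0) \<in> carrier T" using Pi_mem[OF e' ks] k0(1) by simp
    have z: "lin_ext R (G k) (e k) (\<lambda>s. free_gen R ks (k, s)) = (if k0 = k then e k0 s0 else \<zero>\<^bsub>G k\<^esub>)" if k: "k \<in> K" for k
    proof (cases "k0 = k")
      case True
      then have "(\<lambda>s. free_gen R ks (k, s)) = free_gen R s0" by (auto simp: free_gen_def k0(1))
      then show ?thesis using lin_ext_gen[OF Gm e k0(3)] k0(2) True by simp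
    next
      case False
      then have "(\<lambda>s. free_gen R ks (k, s)) = \<zero>\<^bsub>free_module R (S k)\<^esub>" by (auto simp: free_gen_def k0(1))
      then show ?thesis
        using linear_zero[OF free_module_module[OF R] Gm lin_ext_linear[OF Gm e]] k False by simp
    qed
    have "(\<Oplus>\<^bsub>T\<^esub>k\<in>K. i k (lin_ext R (G k) (e k) (\<lambda>s. free_gen R ks (k, s)))) =
        (\<Oplus>\<^bsub>T\<^esub>k\<in>K. if k0 = k then i k0 (e k0 s0) else \<zero>\<^bsub>T\<^esub>)"
    proof (rule T.M.finsum_cong')
      show "(\<lambda>k. if k0 = k then i k0 (e k0 s0) else \<zero>\<^bsub>T\<^esub>) \<in> K \<rightarrow> carrier T"
        using c0 by auto
    qed (use z linear_zero[OF Gm T i] in auto)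
    also have "\<dots> = i k0 (e k0 s0)"
      by (rule T.M.finsum_singleton) (use K k0 c0 in auto)
    finally show "lin_ext R T ?e (free_gen R ks) = (\<Oplus>\<^bsub>T\<^esub>k\<in>K. i k (lin_ext R (G k) (e k) (\<lambda>s. free_gen R ks (k, s))))"
      using lin_ext_gen[OF T e' ks] k0(1) by simp
  qed
  show ?thesis
    unfolding free_retract_def
  proof (intro conjI bexI[OF _ e'] bexI[OF _ l'] ballI T)
    fix t assume t: "t \<in> carrier T"
    have "lin_ext R T ?e (?l t) = (\<Oplus>\<^bsub>T\<^esub>k\<in>K. i k (p k t))"
      unfolding main[OF cl[OF t]]
    proof (rule T.M.finsum_cong')
      show "(\<lambda>k. i k (p k t)) \<in> K \<rightarrow> carrier T"
        using t linear_closed[OF i linear_closed[OF p]] by auto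
    qed (use el linear_closed[OF p] t in auto)
    then show "lin_ext R T ?e (?l t) = t" using ip[OF t] by simp
  qed
qed

section \<open>Decomposition of \<open>Hom(F, G)\<close> along a basis of \<open>F\<close>\<close>

locale basis_complex =
  fixes R :: "('a, 'c) ring_scheme" and F :: "('a, 'f) chain_complex" and N :: int
    and B :: "int \<Rightarrow> 'f set" and \<beta> :: "int \<Rightarrow> 'f \<Rightarrow> 'f \<Rightarrow> 'a"
  assumes complex: "is_complex R F" and basis: "\<And>i. has_basis R (cobj F i) (B i) (\<beta> i)"
    and bounded: "\<And>i. \<bar>i\<bar> > N \<Longrightarrow> carrier (cobj F i) = {\<zero>\<^bsub>cobj F i\<^esub>}"
begin

text \<open>The basis elements of all degrees, tagged with their degree because the same element may
  occur in several degrees. A sum over this finite set replaces a double sum over degrees and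
  bases.\<close>

definition K :: "(int \<times> 'f) set" where "K = (SIGMA i:{-N..N}. B i)"

lemma finite_K: "finite K"
  using has_basisD(2)[OF basis] by (auto simp: K_def)

lemma K_D: "k \<in> K \<Longrightarrow> snd k \<in> B (fst k)" "k \<in> K \<Longrightarrow> snd k \<in> carrier (cobj F (fst k))"
  using has_basisD(3)[OF basis] by (auto simp: K_def)

lemma pre: "precomplex R F"
  by (rule is_complexD[OF complex])

lemma F_retract: "free_retract_complex R F B"
  unfolding free_retract_complex_def bounded_below_complex_def nonzero_module_def
  using complex has_basis_free_retract[OF basis] bounded by (auto intro!: exI[of _ "- N"])

text \<open>The map \<open>x \<mapsto> b\<^sup>*(x) g\<close> on \<open>F\<^sub>i\<close>, for the basis element \<open>b\<close> in degree \<open>i\<close> with \<open>k = (i, b)\<close>, as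
  an element of degree \<open>m\<close> of \<open>Hom(F, G)\<close>.\<close>

definition basis_hom :: "('a, 'g) chain_complex \<Rightarrow> int \<Rightarrow> int \<times> 'f \<Rightarrow> 'g \<Rightarrow> int \<Rightarrow> 'f \<Rightarrow> 'g" where
  "basis_hom G m k g = (\<lambda>j. \<lambda>x\<in>carrier (cobj F j).
     if j = fst k then \<beta> j (snd k) x \<odot>\<^bsub>cobj G (j + m)\<^esub> g else \<zero>\<^bsub>cobj G (j + m)\<^esub>)"

context
  fixes G :: "('a, 'g) chain_complex"
  assumes G: "precomplex R G"
begin

abbreviation "T \<equiv> hom_complex R F G"

lemma T_module: "module R (cobj T m)"
  by (rule hom_complex_module[OF pre G])

lemma basis_hom_carrier:
  assumes k: "k \<in> K" and g: "g \<in> carrier (cobj G (fst k + m))"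
  shows "basis_hom G m k g \<in> carrier (cobj T m)"
proof -
  have "(\<lambda>x. \<beta> (fst k) (snd k) x \<odot>\<^bsub>cobj G (fst k + m)\<^esub> g) \<in> linear_maps R (cobj F (fst k)) (cobj G (fst k + m))"
  proof -
    interpret module R "cobj G (fst k + m)" by (rule precomplexD[OF G])
    note l = has_basisD(4)[OF basis K_D(1)[OF k]]
    show ?thesis
      by (rule linear_mapsI) (use g linear_closed[OF l] in
          \<open>auto simp: linear_add[OF l] linear_smult[OF l] smult_l_distr smult_assoc1\<close>)
  qed
  then have "(\<lambda>j x. if j = fst k then \<beta> j (snd k) x \<odot>\<^bsub>cobj G (j + m)\<^esub> g else \<zero>\<^bsub>cobj G (j + m)\<^esub>) \<in> graded_maps R F G m"
    unfolding graded_maps_def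
  proof (intro CollectI allI)
    fix j
    show "(\<lambda>x. if j = fst k then \<beta> j (snd k) x \<odot>\<^bsub>cobj G (j + m)\<^esub> g else \<zero>\<^bsub>cobj G (j + m)\<^esub>)
        \<in> linear_maps R (cobj F j) (cobj G (j + m))" if *: "(\<lambda>x. \<beta> (fst k) (snd k) x \<odot>\<^bsub>cobj G (fst k + m)\<^esub> g)
        \<in> linear_maps R (cobj F (fst k)) (cobj G (fst k + m))"
      using * linear_zero_map[OF precomplexD(1)[OF G]] by (cases "j = fst k") simp_all
  qed
  from restrict_graded[OF pre this] show ?thesis by (simp add: basis_hom_def)
qed

lemma basis_hom_linear:
  assumes k: "k \<in> K"
  shows "basis_hom G m k \<in> linear_maps R (cobj G (fst k + m)) (cobj T m)"
proof (rule linear_mapsI)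
  interpret module R "cobj G i" for i by (rule precomplexD[OF G])
  note l = linear_closed[OF has_basisD(4)[OF basis K_D(1)[OF k]]]
  fix g assume g: "g \<in> carrier (cobj G (fst k + m))"
  show "basis_hom G m k g \<in> carrier (cobj T m)" by (rule basis_hom_carrier[OF k g])
  show "basis_hom G m k (r \<odot>\<^bsub>cobj G (fst k + m)\<^esub> g) = r \<odot>\<^bsub>cobj T m\<^esub> basis_hom G m k g" if r: "r \<in> carrier R" for r
    unfolding hom_complex_smult basis_hom_def using g r l
    by (intro ext) (auto simp: linear_smult[OF linear_scale[OF module_axioms linear_maps_id(1)] r g])
  fix h assume h: "h \<in> carrier (cobj G (fst k + m))"
  show "basis_hom G m k (g \<oplus>\<^bsub>cobj G (fst k + m)\<^esub> h) = basis_hom G m k g \<oplus>\<^bsub>cobj T m\<^esub> basis_hom G m k h"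
    unfolding hom_complex_add basis_hom_def using g h l by (intro ext) (auto simp: smult_r_distr)
qed

lemma basis_hom_eval:
  assumes "k \<in> K" "k' \<in> K" "g \<in> carrier (cobj G (fst k + m))"
  shows "basis_hom G m k g (fst k') (snd k') = (if k' = k then g else \<zero>\<^bsub>cobj G (fst k' + m)\<^esub>)"
proof -
  interpret module R "cobj G i" for i by (rule precomplexD[OF G])
  show ?thesis
    using assms has_basisD(5)[OF basis K_D(1)[OF assms(1)], of "snd k'"] K_D[OF assms(2)]
    by (auto simp: basis_hom_def prod_eq_iff)
qed

lemma eval_linear: "k \<in> K \<Longrightarrow> (\<lambda>t. t (fst k) (snd k)) \<in> linear_maps R (cobj T m) (cobj G (fst k + m))"
  by (rule hom_complex_eval[OF K_D(2)])

text \<open>Evaluated at an element of \<open>F\<^sub>j\<close>, only the basis elements of degree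
  \<open>j\<close> contribute, and what remains is the expansion of that element in the basis. In
  degrees beyond \<open>N\<close> everything is zero.\<close>

lemma basis_hom_sum:
  assumes t: "t \<in> carrier (cobj T m)"
  shows "t = (\<Oplus>\<^bsub>cobj T m\<^esub>k\<in>K. basis_hom G m k (t (fst k) (snd k)))"
proof (rule hom_complex_eqI[OF t])
  interpret T: module R "cobj T m" by (rule T_module)
  have tk: "t (fst k) (snd k) \<in> carrier (cobj G (fst k + m))" if "k \<in> K" for k
    by (rule linear_closed[OF eval_linear[OF that] t])
  have PiK: "(\<lambda>k. basis_hom G m k (t (fst k) (snd k))) \<in> K \<rightarrow> carrier (cobj T m)"
    using basis_hom_carrier tk by auto
  show "(\<Oplus>\<^bsub>cobj T m\<^esub>k\<in>K. basis_hom G m k (t (fst k) (snd k))) \<in> carrier (cobj T m)"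
    by (rule T.M.finsum_closed[OF PiK])
  fix j x assume x: "x \<in> carrier (cobj F j)"
  let ?G = "cobj G (j + m)"
  interpret G: module R ?G by (rule precomplexD[OF G])
  note tj = graded_mapsD(1)[OF hom_complex_carrierD(1)[OF t]]
  have "(\<Oplus>\<^bsub>cobj T m\<^esub>k\<in>K. basis_hom G m k (t (fst k) (snd k))) j x = (\<Oplus>\<^bsub>?G\<^esub>k\<in>K. basis_hom G m k (t (fst k) (snd k)) j x)"
    by (rule linear_finsum[OF T_module G.module_axioms hom_complex_eval[OF x] PiK])
  also have "\<dots> = t j x"
  proof (cases "\<bar>j\<bar> > N")
    case True
    then have "(\<Oplus>\<^bsub>?G\<^esub>k\<in>K. basis_hom G m k (t (fst k) (snd k)) j x) = (\<Oplus>\<^bsub>?G\<^esub>k\<in>K. \<zero>\<^bsub>?G\<^esub>)"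
      by (intro G.M.finsum_cong') (use x in \<open>auto simp: basis_hom_def K_def\<close>)
    moreover have "t j x = \<zero>\<^bsub>?G\<^esub>"
      using linear_zero[OF precomplexD(1)[OF pre] G.module_axioms tj] bounded[OF True] x by simp
    ultimately show ?thesis by (simp add: G.M.finsum_zero)
  next
    case False
    have sub: "Pair j ` B j \<subseteq> K" using False by (auto simp: K_def)
    have cl: "\<beta> j b x \<odot>\<^bsub>?G\<^esub> t j b \<in> carrier ?G" if "b \<in> B j" for b
      using has_basisD(7)[OF basis that x] linear_closed[OF tj has_basisD(3)[OF basis that]] by simp
    have "(\<Oplus>\<^bsub>?G\<^esub>k\<in>K. basis_hom G m k (t (fst k) (snd k)) j x) = (\<Oplus>\<^bsub>?G\<^esub>k\<in>Pair j ` B j. \<beta> j (snd k) x \<odot>\<^bsub>?G\<^esub> t j (snd k))"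
    proof (rule G.M.add.finprod_mono_neutral_cong_right[OF finite_K sub])
      show "basis_hom G m k (t (fst k) (snd k)) j x = \<zero>\<^bsub>?G\<^esub>" if "k \<in> K - Pair j ` B j" for k
        using that x by (auto simp: basis_hom_def K_def)
      show "(\<lambda>k. basis_hom G m k (t (fst k) (snd k)) j x) \<in> K \<rightarrow> carrier ?G"
        by (rule Pi_I, rule linear_closed[OF hom_complex_eval[OF x] basis_hom_carrier[OF _ tk]])
    qed (use x in \<open>auto simp: basis_hom_def\<close>)
    also have "\<dots> = (\<Oplus>\<^bsub>?G\<^esub>b\<in>B j. \<beta> j b x \<odot>\<^bsub>?G\<^esub> t j b)"
      by (subst G.M.finsum_reindex) (use cl in \<open>auto intro: inj_onI\<close>)
    also have "\<dots> = t j x" by (rule linear_basis[OF basis G.module_axioms tj x, symmetric])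
    finally show ?thesis .
  qed
  finally show "t j x = (\<Oplus>\<^bsub>cobj T m\<^esub>k\<in>K. basis_hom G m k (t (fst k) (snd k))) j x" by simp
qed

end

text \<open>In each degree \<open>Hom(F, G)\<close> is a finite direct sum of modules of
  \<open>G\<close>, hence projective. Together with boundedness below, this is what makes
  \<open>Hom(F, G)\<close> a candidate for a resolution.\<close>

lemma hom_complex_retract:
  assumes G: "free_retract_complex R G S"
  shows "free_retract_complex R (hom_complex R F G) (\<lambda>m. SIGMA k:K. S (fst k + m))"
proof -
  have Gc: "is_complex R G" and GS: "\<And>i. free_retract R (cobj G i) (S i)"
    using G by (auto simp: free_retract_complex_def)
  note pG = is_complexD(1)[OF Gc]
  obtain b where b: "\<And>i. i < b \<Longrightarrow> carrier (cobj G i) = {\<zero>\<^bsub>cobj G i\<^esub>}"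
    using G by (auto simp: free_retract_complex_def bounded_below_complex_def nonzero_module_def)
  \<comment> \<open>A map of degree \<open>m\<close> takes \<open>F\<^sub>i\<close> to degree
    \<open>i + m\<close> of \<open>G\<close>. As \<open>F\<close> is zero above \<open>N\<close> and
    \<open>G\<close> is zero below \<open>b\<close>, there is no room for a nonzero map if
    \<open>m < b - N\<close>.\<close>
  have "carrier (cobj (hom_complex R F G) m) = {\<zero>\<^bsub>cobj (hom_complex R F G) m\<^esub>}" if m: "m < b - N" for m
  proof -
    interpret T: module R "cobj (hom_complex R F G) m" by (rule T_module[OF pG])
    have "t = \<zero>\<^bsub>cobj (hom_complex R F G) m\<^esub>" if t: "t \<in> carrier (cobj (hom_complex R F G) m)" for t
    proof (rule hom_complex_eqI[OF t T.M.zero_closed])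
      fix i x assume x: "x \<in> carrier (cobj F i)"
      have "t i x = \<zero>\<^bsub>cobj G (i + m)\<^esub>"
      proof (cases "\<bar>i\<bar> > N")
        case True
        then show ?thesis
          using linear_zero[OF precomplexD(1)[OF pre] precomplexD(1)[OF pG]
            graded_mapsD(1)[OF hom_complex_carrierD(1)[OF t]]] bounded[OF True] x by simp
      next
        case False
        then show ?thesis using b[of "i + m"] m hom_complex_carrierD(3)[OF t x] by auto
      qed
      then show "t i x = \<zero>\<^bsub>cobj (hom_complex R F G) m\<^esub> i x" using x by (simp add: hom_complex_zero)
    qed
    then show ?thesis using T.M.zero_closed by auto
  qed
  then have "bounded_below_complex (hom_complex R F G)"
    by (auto simp: bounded_below_complex_def nonzero_module_def)
  moreover have "free_retract R (cobj (hom_complex R F G) m) (SIGMA k:K. S (fst k + m))" for m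
    by (rule free_retract_finite_sum[OF T_module[OF pG] finite_K basis_hom_linear[OF pG] eval_linear[OF pG] basis_hom_sum[OF pG] GS])
  ultimately show ?thesis
    using hom_complex_complex[OF complex Gc] by (simp add: free_retract_complex_def)
qed

end

lemma sgn_power_cong: "even m = even n \<Longrightarrow> sgn_power M m x = sgn_power M n x"
  by (simp add: sgn_power_def)

lemma sgn_power_self: "module R M \<Longrightarrow> x \<in> carrier M \<Longrightarrow> sgn_power M n (sgn_power M n x) = x"
  by (simp add: sgn_power_def abelian_group.minus_minus[OF module_abelian_group])

lemma (in abelian_monoid) finsum_swap:
  assumes "finite A" "finite B" "\<And>a b. a \<in> A \<Longrightarrow> b \<in> B \<Longrightarrow> f a b \<in> carrier G"
  shows "(\<Oplus>a\<in>A. \<Oplus>b\<in>B. f a b) = (\<Oplus>b\<in>B. \<Oplus>a\<in>A. f a b)"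
  using assms(1,3)
proof (induction A rule: finite_induct)
  case empty
  then show ?case by (simp add: finsum_zero)
next
  case (insert a A)
  have "(\<Oplus>a\<in>insert a A. \<Oplus>b\<in>B. f a b) = (\<Oplus>b\<in>B. f a b) \<oplus> (\<Oplus>a\<in>A. \<Oplus>b\<in>B. f a b)"
    by (rule finsum_insert) (use insert in \<open>auto intro!: finsum_closed\<close>)
  also have "\<dots> = (\<Oplus>b\<in>B. f a b \<oplus> (\<Oplus>a\<in>A. f a b))"
    by (subst finsum_addf) (use insert in \<open>auto intro!: finsum_closed\<close>)
  also have "\<dots> = (\<Oplus>b\<in>B. \<Oplus>a\<in>insert a A. f a b)"
    by (rule finsum_cong') (use insert in \<open>auto intro!: finsum_closed finsum_insert[symmetric]\<close>)
  finally show ?case .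
qed

lemma null_homotopic_sum:
  assumes "precomplex R Q" "precomplex R M" "finite K" "\<And>k. k \<in> K \<Longrightarrow> null_homotopic R Q M n (\<phi> k)"
    and "\<And>k i x. k \<in> K \<Longrightarrow> x \<in> carrier (cobj Q i) \<Longrightarrow> \<phi> k i x \<in> carrier (cobj M (i + n))"
  shows "null_homotopic R Q M n (\<lambda>i x. \<Oplus>\<^bsub>cobj M (i + n)\<^esub>k\<in>K. \<phi> k i x)"
  using assms(3-5)
proof (induction K rule: finite_induct)
  case empty
  interpret M: module R "cobj M i" for i by (rule precomplexD[OF assms(2)])
  show ?case by (rule null_homotopic_zero[OF assms(1,2)]) simp
next
  case (insert k K)
  interpret M: module R "cobj M i" for i by (rule precomplexD[OF assms(2)])
  have "null_homotopic R Q M n (\<lambda>i x. \<phi> k i x \<oplus>\<^bsub>cobj M (i + n)\<^esub> (\<Oplus>\<^bsub>cobj M (i + n)\<^esub>k\<in>K. \<phi> k i x))"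
    by (rule null_homotopic_plus[OF assms(1,2)]) (use insert in \<open>auto intro!: M.M.finsum_closed\<close>)
  then show ?case
    by (rule null_homotopic_cong) (use insert in \<open>auto intro!: M.M.finsum_insert\<close>)
qed

context basis_complex
begin

subsection \<open>Hom out of a complex with zero differential\<close>

text \<open>Composition with the projection of \<open>Hom(F, G)\<close> to the copy of
  \<open>G\<close> that belongs to \<open>k\<close>. The degree drops from \<open>n\<close> to
  \<open>n - fst k\<close> under this identification; the sign compensates the effect on the sign of
  the Hom differential.\<close>

definition extend_map :: "('a, 'm) chain_complex \<Rightarrow> int \<times> 'f \<Rightarrow> int \<Rightarrow> (int \<Rightarrow> 'g \<Rightarrow> 'm) \<Rightarrow> int \<Rightarrow> (int \<Rightarrow> 'f \<Rightarrow> 'g) \<Rightarrow> 'm" where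
  "extend_map M k n \<phi> m t = sgn_power (cobj M (m + n)) (fst k * m) (\<phi> (fst k + m) (t (fst k) (snd k)))"

text \<open>Composition with the inclusion \<open>basis_hom\<close> of the same summand. The
  exponent is that of \<open>extend_map\<close> for \<open>m = j - fst k\<close>, so the signs
  cancel in the composites.\<close>

definition restrict_map :: "('a, 'g) chain_complex \<Rightarrow> ('a, 'm) chain_complex \<Rightarrow> int \<times> 'f \<Rightarrow> int \<Rightarrow> (int \<Rightarrow> (int \<Rightarrow> 'f \<Rightarrow> 'g) \<Rightarrow> 'm) \<Rightarrow> int \<Rightarrow> 'g \<Rightarrow> 'm" where
  "restrict_map G M k n \<phi> j g = sgn_power (cobj M (j - fst k + n)) (fst k * (j - fst k)) (\<phi> (j - fst k) (basis_hom G (j - fst k) k g))"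

context
  fixes G :: "('a, 'g) chain_complex" and M :: "('a, 'm) chain_complex" and k
  assumes G: "precomplex R G" and M: "precomplex R M" and k: "k \<in> K"
    and flat: "\<And>i x. x \<in> carrier (cobj F i) \<Longrightarrow> cdiff F i x = \<zero>\<^bsub>cobj F (i - 1)\<^esub>"
begin

abbreviation "T' \<equiv> hom_complex R F G"

lemma preT: "precomplex R T'"
  by (rule hom_complex_precomplex[OF pre G])

lemma extend_map_graded:
  assumes "\<phi> \<in> graded_maps R G M (n - fst k)"
  shows "extend_map M k n \<phi> \<in> graded_maps R T' M n"
proof -
  have e: "fst k + m + (n - fst k) = m + n" for m by simp
  have "\<phi> (fst k + m) \<in> linear_maps R (cobj G (fst k + m)) (cobj M (m + n))" for m
    using graded_mapsD(1)[OF assms, of "fst k + m"] unfolding e .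
  then show ?thesis unfolding graded_maps_def extend_map_def
    using linear_comp[OF eval_linear[OF G k]] sgn_power_linear[OF precomplexD(1)[OF M]] by blast
qed

lemma basis_hom_linear':
  "basis_hom G (j - fst k) k \<in> linear_maps R (cobj G j) (cobj T' (j - fst k))"
  using basis_hom_linear[OF G k, of "j - fst k"] by simp

lemma restrict_map_graded:
  assumes "\<phi> \<in> graded_maps R T' M n"
  shows "restrict_map G M k n \<phi> \<in> graded_maps R G M (n - fst k)"
proof -
  have e: "j + (n - fst k) = j - fst k + n" for j by simp
  show ?thesis unfolding graded_maps_def restrict_map_def e
    using linear_comp[OF basis_hom_linear' graded_mapsD(1)[OF assms]] sgn_power_linear[OF precomplexD(1)[OF M]] by blast
qed

lemma flat_hom_diff:
  assumes t: "t \<in> carrier (cobj T' m)" and x: "x \<in> carrier (cobj F j)"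
  shows "cdiff T' m t j x = cdiff G (j + m) (t j x)"
proof -
  note g = hom_complex_carrierD(1)[OF t]
  interpret G: module R "cobj G (j + m - 1)" by (rule precomplexD[OF G])
  have "t (j - 1) \<zero>\<^bsub>cobj F (j - 1)\<^esub> = \<zero>\<^bsub>cobj G (j + m - 1)\<^esub>"
    by (rule linear_zero[OF precomplexD(1)[OF pre] G.module_axioms graded_mapsD(3)[OF g]])
  then show ?thesis
    using x linear_closed[OF precomplexD(2)[OF G] graded_mapsD(2)[OF g x]]
    by (simp add: hom_complex_diff[OF pre G g] hom_diff_def flat sgn_power_zero[OF G.module_axioms] G.minus_zero_right)
qed

text \<open>Here the zero differential of \<open>F\<close> makes the decomposition one of complexes:
  the copy of \<open>G\<close> that belongs to \<open>k\<close> is stable under the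
  differential.\<close>

lemma flat_basis_hom_diff:
  assumes g: "g \<in> carrier (cobj G (fst k + m))"
  shows "cdiff T' m (basis_hom G m k g) = basis_hom G (m - 1) k (cdiff G (fst k + m) g)"
proof (rule hom_complex_eqI)
  have dg: "cdiff G (fst k + m) g \<in> carrier (cobj G (fst k + (m - 1)))"
    using linear_closed[OF precomplexD(2)[OF G] g] by (simp add: add_diff_eq)
  show "cdiff T' m (basis_hom G m k g) \<in> carrier (cobj T' (m - 1))"
    by (rule linear_closed[OF precomplexD(2)[OF preT] basis_hom_carrier[OF G k g]])
  show "basis_hom G (m - 1) k (cdiff G (fst k + m) g) \<in> carrier (cobj T' (m - 1))"
    by (rule basis_hom_carrier[OF G k dg])
  fix j x assume x: "x \<in> carrier (cobj F j)"
  have "cdiff G (j + m) \<zero>\<^bsub>cobj G (j + m)\<^esub> = \<zero>\<^bsub>cobj G (j + m - 1)\<^esub>"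
    by (rule linear_zero[OF precomplexD(1)[OF G] precomplexD(1)[OF G] precomplexD(2)[OF G]])
  then show "cdiff T' m (basis_hom G m k g) j x = basis_hom G (m - 1) k (cdiff G (fst k + m) g) j x"
    unfolding flat_hom_diff[OF basis_hom_carrier[OF G k g] x] unfolding basis_hom_def
    using x g has_basisD(7)[OF basis K_D(1)[OF k], of x]
    by (auto simp: add_diff_eq linear_smult[OF precomplexD(2)[OF G]])
qed

lemma extend_map_diff:
  assumes \<phi>: "\<phi> \<in> graded_maps R G M (n - fst k)" and t: "t \<in> carrier (cobj T' m)"
  shows "hom_diff T' M n (extend_map M k n \<phi>) m t = extend_map M k (n - 1) (hom_diff G M (n - fst k) \<phi>) m t"
proof -
  let ?X = "cobj M (m + n - 1)" and ?p = "fst k"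
  let ?g = "t (fst k) (snd k)"
  have X: "module R ?X" and X': "module R (cobj M (m + n))" by (rule precomplexD[OF M])+
  have e: "?p + m + (n - ?p) = m + n" "m - 1 + n = m + n - 1" "?p + (m - 1) = ?p + m - 1" "m + (n - 1) = m + n - 1" by auto
  have g: "?g \<in> carrier (cobj G (?p + m))" by (rule linear_closed[OF eval_linear[OF G k] t])
  have dg: "cdiff G (?p + m) ?g \<in> carrier (cobj G (?p + m - 1))" by (rule linear_closed[OF precomplexD(2)[OF G] g])
  have c1: "\<phi> (?p + m) ?g \<in> carrier (cobj M (m + n))" using graded_mapsD(2)[OF \<phi> g] unfolding e .
  have c2: "\<phi> (?p + m - 1) (cdiff G (?p + m) ?g) \<in> carrier ?X" using graded_mapsD(4)[OF \<phi> dg] unfolding e .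
  have c3: "cdiff M (m + n) (\<phi> (?p + m) ?g) \<in> carrier ?X" by (rule linear_closed[OF precomplexD(2)[OF M] c1])
  \<comment> \<open>The two exponents differ by twice \<open>fst k\<close>.\<close>
  have par: "sgn_power ?X (n + ?p * (m - 1)) y = sgn_power ?X (?p * m + (n - ?p)) y" for y
    by (rule sgn_power_cong) (auto simp: algebra_simps)
  show ?thesis
    unfolding hom_diff_def extend_map_def e flat_hom_diff[OF t K_D(2)[OF k]]
    by (simp add: linear_sgn_power[OF X' X precomplexD(2)[OF M] c1] sgn_power_minus[OF X c3 sgn_power_closed[OF X c2]]
        sgn_power_sgn_power[OF X c2] par)
qed

lemma restrict_map_diff:
  assumes \<phi>: "\<phi> \<in> graded_maps R T' M n" and g: "g \<in> carrier (cobj G j)"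
  shows "hom_diff G M (n - fst k) (restrict_map G M k n \<phi>) j g = restrict_map G M k (n - 1) (hom_diff T' M n \<phi>) j g"
proof -
  let ?p = "fst k"
  let ?X = "cobj M (j - ?p + n - 1)" and ?m = "j - ?p"
  let ?t = "basis_hom G ?m k g"
  have X: "module R ?X" and X': "module R (cobj M (?m + n))" by (rule precomplexD[OF M])+
  have e: "j + (n - ?p) = ?m + n" "?m + (n - 1) = ?m + n - 1" "j - 1 - ?p = ?m - 1" "?m - 1 + n = ?m + n - 1" by auto
  have g': "g \<in> carrier (cobj G (?p + ?m))" using g by simp
  have t: "?t \<in> carrier (cobj T' ?m)" by (rule basis_hom_carrier[OF G k g'])
  have d: "basis_hom G (?m - 1) k (cdiff G j g) = cdiff T' ?m ?t" using flat_basis_hom_diff[OF g'] by simp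
  have dt: "cdiff T' ?m ?t \<in> carrier (cobj T' (?m - 1))" by (rule linear_closed[OF precomplexD(2)[OF preT] t])
  have c1: "\<phi> ?m ?t \<in> carrier (cobj M (?m + n))" by (rule graded_mapsD(2)[OF \<phi> t])
  have c2: "\<phi> (?m - 1) (cdiff T' ?m ?t) \<in> carrier ?X" by (rule graded_mapsD(4)[OF \<phi> dt])
  have c3: "cdiff M (?m + n) (\<phi> ?m ?t) \<in> carrier ?X" by (rule linear_closed[OF precomplexD(2)[OF M] c1])
  have par: "sgn_power ?X (n - ?p + ?p * (?m - 1)) y = sgn_power ?X (?p * ?m + n) y" for y
    by (rule sgn_power_cong) (auto simp: algebra_simps)
  show ?thesis
    unfolding hom_diff_def restrict_map_def e d
    by (simp add: linear_sgn_power[OF X' X precomplexD(2)[OF M] c1] sgn_power_minus[OF X c3 sgn_power_closed[OF X c2]]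
        sgn_power_sgn_power[OF X c2] par)
qed

lemma restrict_extend:
  assumes \<phi>: "\<phi> \<in> graded_maps R G M (n - fst k)" and g: "g \<in> carrier (cobj G j)"
  shows "restrict_map G M k n (extend_map M k n \<phi>) j g = \<phi> j g"
proof -
  have g': "g \<in> carrier (cobj G (fst k + (j - fst k)))" using g by simp
  have e: "j + (n - fst k) = j - fst k + n" by simp
  have c: "\<phi> j g \<in> carrier (cobj M (j - fst k + n))" using graded_mapsD(2)[OF \<phi> g] unfolding e .
  show ?thesis
    unfolding restrict_map_def extend_map_def basis_hom_eval[OF G k k g']
    using sgn_power_self[OF precomplexD(1)[OF M] c] by simp
qed

lemma extend_restrict:
  assumes \<phi>: "\<phi> \<in> graded_maps R T' M n" and t: "t \<in> carrier (cobj T' m)"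
  shows "extend_map M k n (restrict_map G M k n \<phi>) m t = \<phi> m (basis_hom G m k (t (fst k) (snd k)))"
proof -
  have g: "t (fst k) (snd k) \<in> carrier (cobj G (fst k + m))" by (rule linear_closed[OF eval_linear[OF G k] t])
  have c: "\<phi> m (basis_hom G m k (t (fst k) (snd k))) \<in> carrier (cobj M (m + n))"
    by (rule graded_mapsD(2)[OF \<phi> basis_hom_carrier[OF G k g]])
  have e: "fst k + m - fst k = m" by simp
  show ?thesis
    unfolding restrict_map_def extend_map_def e
    using sgn_power_self[OF precomplexD(1)[OF M] c] by simp
qed

text \<open>A cycle on \<open>G\<close> is extended to \<open>Hom(F, G)\<close>, and a null homotopy
  of the extension restricts to one of the given cycle.\<close>

lemma hom_vanishes_summand:
  assumes "hom_vanishes R T' M n" shows "hom_vanishes R G M (n - fst k)"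
  unfolding hom_vanishes_def
proof
  fix \<phi> assume \<phi>: "\<phi> \<in> hom_cycles R G M (n - fst k)"
  note g = hom_cyclesD(1)[OF \<phi>]
  have "hom_diff T' M n (extend_map M k n \<phi>) m t = \<zero>\<^bsub>cobj M (m + n - 1)\<^esub>" if t: "t \<in> carrier (cobj T' m)" for m t
  proof -
    have e: "fst k + m + (n - fst k) - 1 = m + n - 1" by simp
    have "hom_diff G M (n - fst k) \<phi> (fst k + m) (t (fst k) (snd k)) = \<zero>\<^bsub>cobj M (m + n - 1)\<^esub>"
      using hom_cyclesD(2)[OF \<phi> linear_closed[OF eval_linear[OF G k] t]] unfolding e .
    then show ?thesis
      unfolding extend_map_diff[OF g t] unfolding extend_map_def
      by (simp add: sgn_power_zero[OF precomplexD(1)[OF M]] add_diff_eq)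
  qed
  then have "extend_map M k n \<phi> \<in> hom_cycles R T' M n"
    using extend_map_graded[OF g] by (simp add: hom_cycles_def)
  then obtain H where H: "H \<in> graded_maps R T' M (n + 1)"
    "\<And>m t. t \<in> carrier (cobj T' m) \<Longrightarrow> extend_map M k n \<phi> m t = hom_diff T' M (n + 1) H m t"
    using assms by (auto simp: hom_vanishes_def null_homotopic_def)
  have e: "n + 1 - fst k = n - fst k + 1" by simp
  show "null_homotopic R G M (n - fst k) \<phi>"
    unfolding null_homotopic_def
  proof (intro bexI allI ballI)
    show "restrict_map G M k (n + 1) H \<in> graded_maps R G M (n - fst k + 1)"
      using restrict_map_graded[OF H(1)] unfolding e .
    fix j g assume g': "g \<in> carrier (cobj G j)"
    have "\<phi> j g = restrict_map G M k n (extend_map M k n \<phi>) j g" by (rule restrict_extend[OF g g', symmetric])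
    also have "\<dots> = restrict_map G M k n (hom_diff T' M (n + 1) H) j g"
      unfolding restrict_map_def by (simp add: H(2)[OF linear_closed[OF basis_hom_linear' g']])
    also have "\<dots> = hom_diff G M (n - fst k + 1) (restrict_map G M k (n + 1) H) j g"
      using restrict_map_diff[OF H(1) g'] unfolding e by simp
    finally show "\<phi> j g = hom_diff G M (n - fst k + 1) (restrict_map G M k (n + 1) H) j g" .
  qed
qed

text \<open>Composing \<open>\<phi>\<close> with the idempotent of one summand amounts to
  restricting and extending again, so a null homotopy of the restriction extends.\<close>

lemma null_homotopic_summand:
  assumes "hom_vanishes R G M (n - fst k)" and \<phi>: "\<phi> \<in> hom_cycles R T' M n"
  shows "null_homotopic R T' M n (\<lambda>m t. \<phi> m (basis_hom G m k (t (fst k) (snd k))))"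
proof -
  note g = hom_cyclesD(1)[OF \<phi>]
  let ?\<psi> = "restrict_map G M k n \<phi>"
  have "hom_diff G M (n - fst k) ?\<psi> j g = \<zero>\<^bsub>cobj M (j + (n - fst k) - 1)\<^esub>" if g': "g \<in> carrier (cobj G j)" for j g
  proof -
    have e: "j + (n - fst k) - 1 = j - fst k + n - 1" "j - fst k + (n - 1) = j - fst k + n - 1" by auto
    show ?thesis
      unfolding restrict_map_diff[OF g g'] unfolding restrict_map_def e
      by (simp add: hom_cyclesD(2)[OF \<phi> linear_closed[OF basis_hom_linear' g']] sgn_power_zero[OF precomplexD(1)[OF M]])
  qed
  then have "?\<psi> \<in> hom_cycles R G M (n - fst k)" using restrict_map_graded[OF g] by (simp add: hom_cycles_def)
  then obtain H where H: "H \<in> graded_maps R G M (n - fst k + 1)"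
    "\<And>j g. g \<in> carrier (cobj G j) \<Longrightarrow> ?\<psi> j g = hom_diff G M (n - fst k + 1) H j g"
    using assms(1) by (auto simp: hom_vanishes_def null_homotopic_def)
  have e: "n - fst k + 1 = n + 1 - fst k" by simp
  note H' = H[unfolded e]
  show ?thesis
    unfolding null_homotopic_def
  proof (intro bexI allI ballI)
    show "extend_map M k (n + 1) H \<in> graded_maps R T' M (n + 1)" by (rule extend_map_graded[OF H'(1)])
    fix m t assume t: "t \<in> carrier (cobj T' m)"
    have "\<phi> m (basis_hom G m k (t (fst k) (snd k))) = extend_map M k n ?\<psi> m t"
      by (rule extend_restrict[OF g t, symmetric])
    also have "\<dots> = extend_map M k n (hom_diff G M (n + 1 - fst k) H) m t"
      unfolding extend_map_def by (simp add: H'(2)[OF linear_closed[OF eval_linear[OF G k] t]])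
    also have "\<dots> = hom_diff T' M (n + 1) (extend_map M k (n + 1) H) m t"
      using extend_map_diff[OF H'(1) t] by simp
    finally show "\<phi> m (basis_hom G m k (t (fst k) (snd k))) = hom_diff T' M (n + 1) (extend_map M k (n + 1) H) m t" .
  qed
qed

end

text \<open>The identity of \<open>Hom(F, G)\<close> is the sum of the idempotents of its finitely
  many summands. A cycle therefore is the sum of its composites with them, each of which is treated
  separately.\<close>

lemma hom_vanishes_flat_iff:
  assumes G: "precomplex R G" and M: "precomplex R M"
    and flat: "\<And>i x. x \<in> carrier (cobj F i) \<Longrightarrow> cdiff F i x = \<zero>\<^bsub>cobj F (i - 1)\<^esub>"
  shows "hom_vanishes R (hom_complex R F G) M n \<longleftrightarrow> (\<forall>k\<in>K. hom_vanishes R G M (n - fst k))"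
proof
  assume *: "\<forall>k\<in>K. hom_vanishes R G M (n - fst k)"
  show "hom_vanishes R (hom_complex R F G) M n"
    unfolding hom_vanishes_def
  proof
    fix \<phi> assume \<phi>: "\<phi> \<in> hom_cycles R (hom_complex R F G) M n"
    note g = hom_cyclesD(1)[OF \<phi>]
    have p: "precomplex R (hom_complex R F G)" by (rule hom_complex_precomplex[OF pre G])
    have c: "basis_hom G m k (t (fst k) (snd k)) \<in> carrier (cobj (hom_complex R F G) m)"
      if "k \<in> K" "t \<in> carrier (cobj (hom_complex R F G) m)" for k t m
      by (rule basis_hom_carrier[OF G that(1) linear_closed[OF eval_linear[OF G that(1)] that(2)]])
    have "null_homotopic R (hom_complex R F G) M n
        (\<lambda>m t. \<Oplus>\<^bsub>cobj M (m + n)\<^esub>k\<in>K. \<phi> m (basis_hom G m k (t (fst k) (snd k))))"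
      by (rule null_homotopic_sum[OF p M finite_K])
        (use * null_homotopic_summand[OF G M _ flat _ \<phi>] graded_mapsD(2)[OF g] c in auto)
    then show "null_homotopic R (hom_complex R F G) M n \<phi>"
    proof (rule null_homotopic_cong)
      fix m t assume t: "t \<in> carrier (cobj (hom_complex R F G) m)"
      have "\<phi> m (\<Oplus>\<^bsub>cobj (hom_complex R F G) m\<^esub>k\<in>K. basis_hom G m k (t (fst k) (snd k))) =
          (\<Oplus>\<^bsub>cobj M (m + n)\<^esub>k\<in>K. \<phi> m (basis_hom G m k (t (fst k) (snd k))))"
        by (rule linear_finsum[OF T_module[OF G] precomplexD(1)[OF M] graded_mapsD(1)[OF g]]) (use c t in auto)
      then show "\<phi> m t = (\<Oplus>\<^bsub>cobj M (m + n)\<^esub>k\<in>K. \<phi> m (basis_hom G m k (t (fst k) (snd k))))"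
        using basis_hom_sum[OF G t] by simp
    qed
  qed
qed (use hom_vanishes_summand[OF G M _ flat] in blast)

end

section \<open>Hom into a tensor product with a finite free complex\<close>

text \<open>The assumptions on \<open>Y\<close> describe \<open>M \<otimes> F\<close> in coordinates: \<open>inc (i, b)\<close> is \<open>x \<mapsto> x \<otimes> b\<close> and
  \<open>coord (i, b)\<close> is \<open>x \<otimes> y \<mapsto> b\<^sup>*(y) x\<close>.\<close>

locale tensor_coordinates = basis_complex R F N B \<beta>
  for R :: "('a, 'c) ring_scheme" and F :: "('a, 'f) chain_complex" and N B \<beta> +
  fixes M :: "('a, 'm) chain_complex" and Y :: "('a, 'y) chain_complex"
    and inc :: "int \<times> 'f \<Rightarrow> int \<Rightarrow> 'm \<Rightarrow> 'y" and coord :: "int \<times> 'f \<Rightarrow> int \<Rightarrow> 'y \<Rightarrow> 'm"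
  assumes M: "precomplex R M" and Y: "precomplex R Y"
    and inc: "\<And>k i. k \<in> K \<Longrightarrow> inc k i \<in> linear_maps R (cobj M i) (cobj Y (i + fst k))"
    and coord: "\<And>k i. k \<in> K \<Longrightarrow> coord k i \<in> linear_maps R (cobj Y (i + fst k)) (cobj M i)"
    and inc_coord: "\<And>m y. y \<in> carrier (cobj Y m) \<Longrightarrow>
      (\<Oplus>\<^bsub>cobj Y m\<^esub>k\<in>K. inc k (m - fst k) (coord k (m - fst k) y)) = y"
    and coord_inc: "\<And>k k' i i' x. k \<in> K \<Longrightarrow> k' \<in> K \<Longrightarrow> i + fst k = i' + fst k' \<Longrightarrow> x \<in> carrier (cobj M i') \<Longrightarrow>
      coord k i (inc k' i' x) = (if k = k' then x else \<zero>\<^bsub>cobj M i\<^esub>)"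
    and coord_diff: "\<And>k i y. k \<in> K \<Longrightarrow> y \<in> carrier (cobj Y (i + fst k)) \<Longrightarrow>
      coord k (i - 1) (cdiff Y (i + fst k) y) = cdiff M i (coord k i y) \<oplus>\<^bsub>cobj M (i - 1)\<^esub>
        sgn_power (cobj M (i - 1)) (i - 1) (\<Oplus>\<^bsub>cobj M (i - 1)\<^esub>c\<in>K. if fst c = fst k + 1
          then \<beta> (fst k) (snd k) (cdiff F (fst c) (snd c)) \<odot>\<^bsub>cobj M (i - 1)\<^esub> coord c (i - 1) y else \<zero>\<^bsub>cobj M (i - 1)\<^esub>)"
begin

text \<open>Up to signs, \<open>trace_map\<close> sends \<open>\<phi> : G \<rightarrow> M \<otimes> F\<close> to the map taking \<open>t : F \<rightarrow> G\<close> to the trace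
  of \<open>\<phi> \<circ> t\<close>, and \<open>cotrace_map\<close> is its inverse.\<close>

definition trace_map :: "int \<Rightarrow> (int \<Rightarrow> 'g \<Rightarrow> 'y) \<Rightarrow> int \<Rightarrow> (int \<Rightarrow> 'f \<Rightarrow> 'g) \<Rightarrow> 'm" where
  "trace_map n \<phi> m t = (\<Oplus>\<^bsub>cobj M (m + n)\<^esub>k\<in>K. sgn_power (cobj M (m + n)) (fst k)
     (coord k (m + n) (\<phi> (fst k + m) (t (fst k) (snd k)))))"

definition cotrace_map :: "('a, 'g) chain_complex \<Rightarrow> int \<Rightarrow> (int \<Rightarrow> (int \<Rightarrow> 'f \<Rightarrow> 'g) \<Rightarrow> 'm) \<Rightarrow> int \<Rightarrow> 'g \<Rightarrow> 'y" where
  "cotrace_map G n \<psi> j g = (\<Oplus>\<^bsub>cobj Y (j + n)\<^esub>k\<in>K. sgn_power (cobj Y (j + n)) (fst k)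
     (inc k (j + n - fst k) (\<psi> (j - fst k) (basis_hom G (j - fst k) k g))))"

context
  fixes G :: "('a, 'g) chain_complex"
  assumes G: "precomplex R G"
begin

abbreviation "TG \<equiv> hom_complex R F G"

lemma preTG: "precomplex R TG"
  by (rule hom_complex_precomplex[OF pre G])

interpretation M: module R "cobj M i" for i by (rule precomplexD[OF M])
interpretation Y: module R "cobj Y i" for i by (rule precomplexD[OF Y])

lemma graded_Y:
  assumes "\<phi> \<in> graded_maps R G Y n" "k \<in> K"
  shows "\<phi> (fst k + m) \<in> linear_maps R (cobj G (fst k + m)) (cobj Y (m + n + fst k))"
  using graded_mapsD(1)[OF assms(1), of "fst k + m"] by (simp add: ac_simps)

lemma basis_hom_lin: "k \<in> K \<Longrightarrow> basis_hom G (j - fst k) k \<in> linear_maps R (cobj G j) (cobj TG (j - fst k))"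
  using basis_hom_linear[OF G, of k "j - fst k"] by simp

lemma inc_lin: "k \<in> K \<Longrightarrow> inc k (j - fst k) \<in> linear_maps R (cobj M (j - fst k)) (cobj Y j)"
  using inc[of k "j - fst k"] by simp

lemma coord_lin: "k \<in> K \<Longrightarrow> coord k (j - fst k) \<in> linear_maps R (cobj Y j) (cobj M (j - fst k))"
  using coord[of k "j - fst k"] by simp

lemma trace_map_graded:
  assumes "\<phi> \<in> graded_maps R G Y n"
  shows "trace_map n \<phi> \<in> graded_maps R TG M n"
  unfolding graded_maps_def trace_map_def
  by (intro CollectI allI linear_sum precomplexD[OF preTG] M.module_axioms sgn_power_linear
      linear_comp[OF linear_comp[OF eval_linear[OF G] graded_Y[OF assms]] coord])

lemma cotrace_map_graded:
  assumes "\<psi> \<in> graded_maps R TG M n"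
  shows "cotrace_map G n \<psi> \<in> graded_maps R G Y n"
proof -
  have "\<psi> (j - p) \<in> linear_maps R (cobj TG (j - p)) (cobj M (j + n - p))" for j p
    using graded_mapsD(1)[OF assms, of "j - p"] by (simp add: algebra_simps)
  then show ?thesis
    unfolding graded_maps_def cotrace_map_def
    by (intro CollectI allI linear_sum precomplexD[OF G] Y.module_axioms sgn_power_linear
      linear_comp[OF linear_comp[OF basis_hom_lin] inc_lin])
qed

text \<open>The trace on \<open>basis_hom G (j - fst k) k g\<close> is, up to sign, the coordinate
  of \<open>\<phi> j g\<close> at \<open>k\<close>; \<open>cotrace_map\<close> reassembles the
  element from its coordinates. The sign of \<open>k\<close> occurs twice and cancels.\<close>

lemma cotrace_trace:
  assumes \<phi>: "\<phi> \<in> graded_maps R G Y n" and g: "g \<in> carrier (cobj G j)"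
  shows "cotrace_map G n (trace_map n \<phi>) j g = \<phi> j g"
proof -
  have y: "\<phi> j g \<in> carrier (cobj Y (j + n))" by (rule graded_mapsD(2)[OF \<phi> g])
  have cy: "coord k (j + n - fst k) (\<phi> j g) \<in> carrier (cobj M (j + n - fst k))" if "k \<in> K" for k
    by (rule linear_closed[OF coord_lin[OF that] y])
  have tr: "trace_map n \<phi> (j - fst k) (basis_hom G (j - fst k) k g) =
      sgn_power (cobj M (j + n - fst k)) (fst k) (coord k (j + n - fst k) (\<phi> j g))" if k: "k \<in> K" for k
  proof -
    let ?X = "cobj M (j + n - fst k)" and ?m = "j - fst k"
    have g': "g \<in> carrier (cobj G (fst k + ?m))" using g by simp
    have e: "?m + n = j + n - fst k" "fst k + ?m = j" by auto
    have "trace_map n \<phi> ?m (basis_hom G ?m k g) =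
      (\<Oplus>\<^bsub>?X\<^esub>k'\<in>K. if k = k' then sgn_power ?X (fst k) (coord k (j + n - fst k) (\<phi> j g)) else \<zero>\<^bsub>?X\<^esub>)"
      unfolding trace_map_def e
    proof (rule M.M.finsum_cong')
      show "(\<lambda>k'. if k = k' then sgn_power ?X (fst k) (coord k (j + n - fst k) (\<phi> j g)) else \<zero>\<^bsub>?X\<^esub>) \<in> K \<rightarrow> carrier ?X"
        using sgn_power_closed[OF M.module_axioms cy[OF k]] by auto
      fix k' assume k': "k' \<in> K"
      have "coord k' (j + n - fst k) (\<phi> (fst k' + ?m) \<zero>\<^bsub>cobj G (fst k' + ?m)\<^esub>) = \<zero>\<^bsub>?X\<^esub>"
        using linear_zero[OF precomplexD(1)[OF G] M.module_axioms linear_comp[OF graded_Y[OF \<phi> k'] coord[OF k']], of ?m]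
        unfolding e .
      then show "sgn_power ?X (fst k') (coord k' (j + n - fst k) (\<phi> (fst k' + ?m) (basis_hom G ?m k g (fst k') (snd k')))) =
          (if k = k' then sgn_power ?X (fst k) (coord k (j + n - fst k) (\<phi> j g)) else \<zero>\<^bsub>?X\<^esub>)"
        by (simp add: basis_hom_eval[OF G k k' g'] sgn_power_zero[OF M.module_axioms])
    qed simp
    also have "\<dots> = sgn_power ?X (fst k) (coord k (j + n - fst k) (\<phi> j g))"
      by (rule M.M.finsum_singleton[OF k finite_K]) (use sgn_power_closed[OF M.module_axioms cy[OF k]] in auto)
    finally show ?thesis .
  qed
  have "cotrace_map G n (trace_map n \<phi>) j g = (\<Oplus>\<^bsub>cobj Y (j + n)\<^esub>k\<in>K. inc k (j + n - fst k) (coord k (j + n - fst k) (\<phi> j g)))"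
    unfolding cotrace_map_def
  proof (rule Y.M.finsum_cong')
    show "(\<lambda>k. inc k (j + n - fst k) (coord k (j + n - fst k) (\<phi> j g))) \<in> K \<rightarrow> carrier (cobj Y (j + n))"
      using linear_closed[OF inc_lin cy] by auto
    fix k assume k: "k \<in> K"
    show "sgn_power (cobj Y (j + n)) (fst k) (inc k (j + n - fst k) (trace_map n \<phi> (j - fst k) (basis_hom G (j - fst k) k g)))
        = inc k (j + n - fst k) (coord k (j + n - fst k) (\<phi> j g))"
      unfolding tr[OF k] linear_sgn_power[OF M.module_axioms Y.module_axioms inc_lin[OF k] cy[OF k]]
      by (rule sgn_power_self[OF Y.module_axioms linear_closed[OF inc_lin[OF k] cy[OF k]]])
  qed simp
  then show ?thesis using inc_coord[OF y] by simp
qed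

text \<open>By \<open>coord_inc\<close>, the coordinate at \<open>k\<close> picks exactly the term
  of \<open>k\<close> from the sum in \<open>cotrace_map\<close>. The outer sum is then
  \<open>\<psi>\<close> applied to the expansion \<open>basis_hom_sum\<close> of
  \<open>t\<close>.\<close>

lemma trace_cotrace:
  assumes \<psi>: "\<psi> \<in> graded_maps R TG M n" and t: "t \<in> carrier (cobj TG m)"
  shows "trace_map n (cotrace_map G n \<psi>) m t = \<psi> m t"
proof -
  have tk: "t (fst k) (snd k) \<in> carrier (cobj G (fst k + m))" if "k \<in> K" for k
    by (rule linear_closed[OF eval_linear[OF G that] t])
  have c: "\<psi> m (basis_hom G m k (t (fst k) (snd k))) \<in> carrier (cobj M (m + n))" if "k \<in> K" for k
    by (rule graded_mapsD(2)[OF \<psi> basis_hom_carrier[OF G that tk[OF that]]])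
  have "trace_map n (cotrace_map G n \<psi>) m t = (\<Oplus>\<^bsub>cobj M (m + n)\<^esub>k\<in>K. \<psi> m (basis_hom G m k (t (fst k) (snd k))))"
    unfolding trace_map_def
  proof (rule M.M.finsum_cong')
    show "(\<lambda>k. \<psi> m (basis_hom G m k (t (fst k) (snd k)))) \<in> K \<rightarrow> carrier (cobj M (m + n))" using c by auto
    fix k assume k: "k \<in> K"
    let ?g = "t (fst k) (snd k)" and ?j = "fst k + m"
    let ?x = "\<lambda>k'. \<psi> (?j - fst k') (basis_hom G (?j - fst k') k' ?g)"
    have e: "?j + n = m + n + fst k" "?j - fst k = m" by auto
    have x: "?x k' \<in> carrier (cobj M (m + n + fst k - fst k'))" if k': "k' \<in> K" for k'
    proof -
      have e: "?j - fst k' + n = m + n + fst k - fst k'" by simp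
      show ?thesis
        using graded_mapsD(2)[OF \<psi> linear_closed[OF basis_hom_lin[OF k'] tk[OF k]]] unfolding e .
    qed
    have ix: "inc k' (m + n + fst k - fst k') (?x k') \<in> carrier (cobj Y (m + n + fst k))" if k': "k' \<in> K" for k'
      by (rule linear_closed[OF inc_lin[OF k'] x[OF k']])
    have "coord k (m + n) (cotrace_map G n \<psi> ?j ?g) = (\<Oplus>\<^bsub>cobj M (m + n)\<^esub>k'\<in>K.
       coord k (m + n) (sgn_power (cobj Y (m + n + fst k)) (fst k') (inc k' (m + n + fst k - fst k') (?x k'))))"
      unfolding cotrace_map_def e
      by (rule linear_finsum[OF Y.module_axioms M.module_axioms coord[OF k]])
        (use sgn_power_closed[OF Y.module_axioms ix] in auto)
    also have "\<dots> = (\<Oplus>\<^bsub>cobj M (m + n)\<^esub>k'\<in>K. if k = k' then sgn_power (cobj M (m + n)) (fst k) (?x k) else \<zero>\<^bsub>cobj M (m + n)\<^esub>)"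
    proof (rule M.M.finsum_cong')
      show "(\<lambda>k'. if k = k' then sgn_power (cobj M (m + n)) (fst k) (?x k) else \<zero>\<^bsub>cobj M (m + n)\<^esub>) \<in> K \<rightarrow> carrier (cobj M (m + n))"
        using sgn_power_closed[OF M.module_axioms c[OF k]] by (auto simp: e)
      fix k' assume k': "k' \<in> K"
      show "coord k (m + n) (sgn_power (cobj Y (m + n + fst k)) (fst k') (inc k' (m + n + fst k - fst k') (?x k'))) =
          (if k = k' then sgn_power (cobj M (m + n)) (fst k) (?x k) else \<zero>\<^bsub>cobj M (m + n)\<^esub>)"
        unfolding linear_sgn_power[OF Y.module_axioms M.module_axioms coord[OF k] ix[OF k']]
        by (subst coord_inc[OF k k' _ x[OF k']]) (auto simp: sgn_power_zero[OF M.module_axioms])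
    qed simp
    also have "\<dots> = sgn_power (cobj M (m + n)) (fst k) (?x k)"
      by (rule M.M.finsum_singleton[OF k finite_K]) (use sgn_power_closed[OF M.module_axioms c[OF k]] in \<open>auto simp: e\<close>)
    finally show "sgn_power (cobj M (m + n)) (fst k) (coord k (m + n) (cotrace_map G n \<psi> ?j ?g)) = \<psi> m (basis_hom G m k ?g)"
      using sgn_power_self[OF M.module_axioms c[OF k]] by (simp add: e)
  qed simp
  also have "\<dots> = \<psi> m (\<Oplus>\<^bsub>cobj TG m\<^esub>k\<in>K. basis_hom G m k (t (fst k) (snd k)))"
    by (rule linear_finsum[OF T_module[OF G] M.module_axioms graded_mapsD(1)[OF \<psi>], symmetric])
      (use basis_hom_carrier[OF G _ tk] in auto)
  finally show ?thesis using basis_hom_sum[OF G t] by simp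
qed

text \<open>The two double sums in the proof below express that the trace is invariant under cyclic
  permutation of \<open>\<phi> \<circ> t\<close> and the differential of \<open>F\<close>.\<close>

lemma trace_map_diff:
  assumes \<phi>: "\<phi> \<in> graded_maps R G Y n" and t: "t \<in> carrier (cobj TG m)"
  shows "trace_map (n - 1) (hom_diff G Y n \<phi>) m t = hom_diff TG M n (trace_map n \<phi>) m t"
proof -
  let ?X = "cobj M (m + n - 1)"
  note tg = hom_complex_carrierD(1)[OF t]
  have eX: "m + (n - 1) = m + n - 1" "m - 1 + n = m + n - 1" by auto
  define y where "y k = \<phi> (fst k + m) (t (fst k) (snd k))" for k
  define z where "z k = \<phi> (fst k + m - 1) (cdiff G (fst k + m) (t (fst k) (snd k)))" for k
  define v where "v k = \<phi> (fst k + m - 1) (t (fst k - 1) (cdiff F (fst k) (snd k)))" for k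
  \<comment> \<open>The terms of both double sums. For fixed \<open>k\<close>, their sum over
    \<open>c\<close> is the contribution of the differential of \<open>F\<close> to the coordinate
    at \<open>k\<close>; for fixed \<open>c\<close>, their sum over \<open>k\<close> is
    \<open>w c\<close>, in which that differential acts before \<open>t\<close>.\<close>
  define A where "A k c = (if fst c = fst k + 1 then \<beta> (fst k) (snd k) (cdiff F (fst c) (snd c)) \<odot>\<^bsub>?X\<^esub>
      coord c (m + n - 1) (y k) else \<zero>\<^bsub>?X\<^esub>)" for k c
  have tk: "t (fst k) (snd k) \<in> carrier (cobj G (fst k + m))" if "k \<in> K" for k
    by (rule linear_closed[OF eval_linear[OF G that] t])
  have y: "y k \<in> carrier (cobj Y (m + n + fst k))" if "k \<in> K" for k
    unfolding y_def by (rule linear_closed[OF graded_Y[OF \<phi> that] tk[OF that]])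
  have dk: "cdiff F (fst k) (snd k) \<in> carrier (cobj F (fst k - 1))" if "k \<in> K" for k
    by (rule is_complexD(4)[OF complex K_D(2)[OF that]])
  have lin1: "\<phi> (fst k + m - 1) \<in> linear_maps R (cobj G (fst k + m - 1)) (cobj Y (m + n - 1 + fst k))" if "k \<in> K" for k
    using graded_Y[OF \<phi> that, of "m - 1"] by (simp add: eX add_diff_eq)
  have tdk: "t (fst k - 1) (cdiff F (fst k) (snd k)) \<in> carrier (cobj G (fst k + m - 1))" if "k \<in> K" for k
    by (rule graded_mapsD(4)[OF tg dk[OF that]])
  have dtk: "cdiff G (fst k + m) (t (fst k) (snd k)) \<in> carrier (cobj G (fst k + m - 1))" if "k \<in> K" for k
    by (rule linear_closed[OF precomplexD(2)[OF G] tk[OF that]])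
  have z: "z k \<in> carrier (cobj Y (m + n - 1 + fst k))" and v: "v k \<in> carrier (cobj Y (m + n - 1 + fst k))" if "k \<in> K" for k
    unfolding z_def v_def by (rule linear_closed[OF lin1[OF that]], rule dtk[OF that] tdk[OF that])+
  define a where "a k = cdiff M (m + n) (coord k (m + n) (y k))" for k
  define b where "b k = coord k (m + n - 1) (z k)" for k
  define w where "w k = coord k (m + n - 1) (v k)" for k
  have cy: "coord k (m + n) (y k) \<in> carrier (cobj M (m + n))" if "k \<in> K" for k
    by (rule linear_closed[OF coord[OF that] y[OF that]])
  have aX: "a k \<in> carrier ?X" and bX: "b k \<in> carrier ?X" and wX: "w k \<in> carrier ?X" if "k \<in> K" for k
    unfolding a_def b_def w_def
    using linear_closed[OF precomplexD(2)[OF M] cy[OF that]] linear_closed[OF coord[OF that] z[OF that]]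
      linear_closed[OF coord[OF that] v[OF that]] by auto
  have AX: "A k c \<in> carrier ?X" if "k \<in> K" "c \<in> K" for k c
  proof (cases "fst c = fst k + 1")
    case True
    have e: "m + n + fst k = m + n - 1 + fst c" using True by simp
    have "coord c (m + n - 1) (y k) \<in> carrier ?X"
      using y[OF that(1)] unfolding e by (rule linear_closed[OF coord[OF that(2)]])
    moreover have "\<beta> (fst k) (snd k) (cdiff F (fst c) (snd c)) \<in> carrier R"
      using has_basisD(7)[OF basis K_D(1)[OF that(1)]] dk[OF that(2)] True by simp
    ultimately show ?thesis unfolding A_def if_P[OF True] by (rule M.smult_closed[rotated])
  qed (simp add: A_def)
  have sumA: "(\<Oplus>\<^bsub>?X\<^esub>c\<in>K. A k c) \<in> carrier ?X" if "k \<in> K" for k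
    using AX[OF that] by (auto intro: M.M.finsum_closed)
  \<comment> \<open>The boundary of the basis element \<open>c\<close> is expanded in the basis of
    degree \<open>q\<close>. If \<open>q\<close> is out of range, that module is zero and no index
    of \<open>K\<close> has this degree.\<close>
  have w_eq: "w c = (\<Oplus>\<^bsub>?X\<^esub>k\<in>K. A k c)" if c: "c \<in> K" for c
  proof -
    define q where "q = fst c - 1"
    have lin: "(\<lambda>x. coord c (m + n - 1) (\<phi> (fst c + m - 1) (t q x))) \<in> linear_maps R (cobj F q) ?X"
      using linear_comp[OF linear_comp[OF graded_mapsD(3)[OF tg] lin1[OF c]] coord[OF c]] by (simp add: q_def)
    have dq: "cdiff F (fst c) (snd c) \<in> carrier (cobj F q)" using dk[OF c] by (simp add: q_def)
    show ?thesis
    proof (cases "\<bar>q\<bar> > N")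
      case True
      then have "w c = \<zero>\<^bsub>?X\<^esub>"
        using linear_zero[OF precomplexD(1)[OF pre] M.module_axioms lin] bounded[OF True] dq by (simp add: w_def v_def q_def)
      moreover have "(\<Oplus>\<^bsub>?X\<^esub>k\<in>K. A k c) = (\<Oplus>\<^bsub>?X\<^esub>k\<in>K. \<zero>\<^bsub>?X\<^esub>)"
        by (rule M.M.finsum_cong') (use True in \<open>auto simp: A_def K_def q_def\<close>)
      ultimately show ?thesis by (simp add: M.M.finsum_zero)
    next
      case False
      have sub: "Pair q ` B q \<subseteq> K" using False by (auto simp: K_def)
      have "(\<Oplus>\<^bsub>?X\<^esub>k\<in>K. A k c) = (\<Oplus>\<^bsub>?X\<^esub>k\<in>Pair q ` B q. A k c)"
      proof (rule M.M.add.finprod_mono_neutral_cong_right[OF finite_K sub])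
        show "A k c = \<zero>\<^bsub>?X\<^esub>" if "k \<in> K - Pair q ` B q" for k
          using that by (auto simp: A_def K_def q_def)
      qed (use AX[OF _ c] in auto)
      also have "\<dots> = (\<Oplus>\<^bsub>?X\<^esub>b\<in>B q. A (q, b) c)"
        by (subst M.M.finsum_reindex) (use AX[OF _ c] sub in \<open>auto intro: inj_onI\<close>)
      also have "\<dots> = (\<Oplus>\<^bsub>?X\<^esub>b\<in>B q. \<beta> q b (cdiff F (fst c) (snd c)) \<odot>\<^bsub>?X\<^esub> coord c (m + n - 1) (\<phi> (fst c + m - 1) (t q b)))"
      proof (rule M.M.finsum_cong')
        show "(\<lambda>b. \<beta> q b (cdiff F (fst c) (snd c)) \<odot>\<^bsub>?X\<^esub> coord c (m + n - 1) (\<phi> (fst c + m - 1) (t q b))) \<in> B q \<rightarrow> carrier ?X"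
          using has_basisD(7)[OF basis _ dq] linear_closed[OF lin has_basisD(3)[OF basis]] by auto
        have e: "fst c - 1 + m = fst c + m - 1" by simp
        show "A (q, b) c = \<beta> q b (cdiff F (fst c) (snd c)) \<odot>\<^bsub>?X\<^esub> coord c (m + n - 1) (\<phi> (fst c + m - 1) (t q b))"
          if "b \<in> B q" for b by (simp add: A_def q_def y_def e)
      qed simp
      also have "\<dots> = w c"
        unfolding w_def v_def q_def[symmetric] by (rule linear_basis[OF basis M.module_axioms lin dq, symmetric])
      finally show ?thesis by simp
    qed
  qed
  have hd: "hom_diff G Y n \<phi> (fst k + m) (t (fst k) (snd k)) =
      cdiff Y (m + n + fst k) (y k) \<ominus>\<^bsub>cobj Y (m + n - 1 + fst k)\<^esub> sgn_power (cobj Y (m + n - 1 + fst k)) n (z k)" for k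
  proof -
    have e: "fst k + m + n = m + n + fst k" "m + n + fst k - 1 = m + n - 1 + fst k" by auto
    show ?thesis unfolding hom_diff_def y_def z_def e by (rule refl)
  qed
  have lhs: "coord k (m + n - 1) (hom_diff G Y n \<phi> (fst k + m) (t (fst k) (snd k))) =
      (a k \<oplus>\<^bsub>?X\<^esub> sgn_power ?X (m + n - 1) (\<Oplus>\<^bsub>?X\<^esub>c\<in>K. A k c)) \<ominus>\<^bsub>?X\<^esub> sgn_power ?X n (b k)" if k: "k \<in> K" for k
  proof -
    have e: "m + n + fst k - 1 = m + n - 1 + fst k" by simp
    have dy: "cdiff Y (m + n + fst k) (y k) \<in> carrier (cobj Y (m + n - 1 + fst k))"
      using linear_closed[OF precomplexD(2)[OF Y] y[OF k]] unfolding e .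
    show ?thesis
      unfolding hd linear_minus[OF Y.module_axioms M.module_axioms coord[OF k] dy sgn_power_closed[OF Y.module_axioms z[OF k]]]
        linear_sgn_power[OF Y.module_axioms M.module_axioms coord[OF k] z[OF k]] coord_diff[OF k y[OF k]]
      by (simp add: a_def b_def A_def)
  qed
  have gr: "trace_map n \<phi> \<in> graded_maps R TG M n" by (rule trace_map_graded[OF \<phi>])
  have d1: "cdiff M (m + n) (trace_map n \<phi> m t) = (\<Oplus>\<^bsub>?X\<^esub>k\<in>K. sgn_power ?X (fst k) (a k))"
  proof -
    have "cdiff M (m + n) (trace_map n \<phi> m t) = (\<Oplus>\<^bsub>?X\<^esub>k\<in>K. cdiff M (m + n) (sgn_power (cobj M (m + n)) (fst k) (coord k (m + n) (y k))))"
      unfolding trace_map_def y_def[symmetric]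
      by (rule linear_finsum[OF M.module_axioms M.module_axioms precomplexD(2)[OF M]])
        (use sgn_power_closed[OF M.module_axioms cy] in auto)
    also have "\<dots> = (\<Oplus>\<^bsub>?X\<^esub>k\<in>K. sgn_power ?X (fst k) (a k))"
      by (rule M.M.finsum_cong') (use sgn_power_closed[OF M.module_axioms aX] in
          \<open>auto simp: a_def linear_sgn_power[OF M.module_axioms M.module_axioms precomplexD(2)[OF M] cy]\<close>)
    finally show ?thesis .
  qed
  have d2: "trace_map n \<phi> (m - 1) (cdiff TG m t) = (\<Oplus>\<^bsub>?X\<^esub>k\<in>K. sgn_power ?X (fst k) (b k \<ominus>\<^bsub>?X\<^esub> sgn_power ?X m (w k)))"
    unfolding trace_map_def eX
  proof (rule M.M.finsum_cong')
    show "(\<lambda>k. sgn_power ?X (fst k) (b k \<ominus>\<^bsub>?X\<^esub> sgn_power ?X m (w k))) \<in> K \<rightarrow> carrier ?X"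
      using sgn_power_closed[OF M.module_axioms M.M.minus_closed[OF bX sgn_power_closed[OF M.module_axioms wX]]] by auto
    fix k assume k: "k \<in> K"
    have e: "fst k + (m - 1) = fst k + m - 1" by simp
    have Dt: "cdiff TG m t (fst k) (snd k) = cdiff G (fst k + m) (t (fst k) (snd k)) \<ominus>\<^bsub>cobj G (fst k + m - 1)\<^esub>
        sgn_power (cobj G (fst k + m - 1)) m (t (fst k - 1) (cdiff F (fst k) (snd k)))"
      using K_D(2)[OF k] by (simp add: hom_complex_diff[OF pre G tg] hom_diff_def)
    note l = linear_comp[OF lin1[OF k] coord[OF k]]
    have "coord k (m + n - 1) (\<phi> (fst k + m - 1) (cdiff TG m t (fst k) (snd k))) = b k \<ominus>\<^bsub>?X\<^esub> sgn_power ?X m (w k)"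
      unfolding Dt linear_minus[OF precomplexD(1)[OF G] M.module_axioms l dtk[OF k] sgn_power_closed[OF precomplexD(1)[OF G] tdk[OF k]]]
        linear_sgn_power[OF precomplexD(1)[OF G] M.module_axioms l tdk[OF k]]
      by (simp add: b_def w_def z_def v_def)
    then show "sgn_power ?X (fst k) (coord k (m + n - 1) (\<phi> (fst k + (m - 1)) (cdiff TG m t (fst k) (snd k)))) =
        sgn_power ?X (fst k) (b k \<ominus>\<^bsub>?X\<^esub> sgn_power ?X m (w k))" unfolding e by simp
  qed simp
  define s where "s = (\<lambda>l x. sgn_power ?X l x)"
  have s: "s l x \<in> carrier ?X" if "x \<in> carrier ?X" for l x
    unfolding s_def by (rule sgn_power_closed[OF M.module_axioms that])
  have ssum: "s l (\<Oplus>\<^bsub>?X\<^esub>k\<in>K. f k) = (\<Oplus>\<^bsub>?X\<^esub>k\<in>K. s l (f k))" if "\<And>k. k \<in> K \<Longrightarrow> f k \<in> carrier ?X" for l and f :: "int \<times> 'f \<Rightarrow> 'm"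
    unfolding s_def
    by (rule linear_finsum[OF M.module_axioms M.module_axioms sgn_power_linear[OF M.module_axioms linear_maps_id(1)]]) (use that in auto)
  have ss: "s l (s l' x) = s (l + l') x" if "x \<in> carrier ?X" for l l' x
    unfolding s_def by (rule sgn_power_sgn_power[OF M.module_axioms that])
  have sadd: "s l (x \<oplus>\<^bsub>?X\<^esub> y) = s l x \<oplus>\<^bsub>?X\<^esub> s l y" "s l (x \<ominus>\<^bsub>?X\<^esub> y) = s l x \<ominus>\<^bsub>?X\<^esub> s l y"
    if "x \<in> carrier ?X" "y \<in> carrier ?X" for l x y
    unfolding s_def using linear_add[OF sgn_power_linear[OF M.module_axioms linear_maps_id(1)] that]
      sgn_power_minus[OF M.module_axioms that] by auto
  have sneg: "s l (\<ominus>\<^bsub>?X\<^esub> x) = \<ominus>\<^bsub>?X\<^esub> s l x" for l x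
    by (simp add: s_def sgn_power_def)
  have sminus: "\<ominus>\<^bsub>?X\<^esub> s l x = s (l + 1) x" if "x \<in> carrier ?X" for l x
    unfolding s_def sgn_power_def using that by (auto simp: M.M.minus_minus)
  have scong: "s l x = s l' x" if "even l = even l'" for l l' x
    unfolding s_def by (rule sgn_power_cong[OF that])
  have "trace_map (n - 1) (hom_diff G Y n \<phi>) m t =
      (\<Oplus>\<^bsub>?X\<^esub>k\<in>K. (s (fst k) (a k) \<ominus>\<^bsub>?X\<^esub> s (fst k + n) (b k)) \<oplus>\<^bsub>?X\<^esub> (\<Oplus>\<^bsub>?X\<^esub>c\<in>K. s (fst k + (m + n - 1)) (A k c)))"
    unfolding trace_map_def eX
  proof (rule M.M.finsum_cong')
    show "(\<lambda>k. (s (fst k) (a k) \<ominus>\<^bsub>?X\<^esub> s (fst k + n) (b k)) \<oplus>\<^bsub>?X\<^esub> (\<Oplus>\<^bsub>?X\<^esub>c\<in>K. s (fst k + (m + n - 1)) (A k c))) \<in> K \<rightarrow> carrier ?X"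
      using aX bX AX s by (auto intro!: M.M.a_closed M.M.minus_closed M.M.finsum_closed)
    fix k assume k: "k \<in> K"
    have "s (fst k) ((a k \<oplus>\<^bsub>?X\<^esub> s (m + n - 1) (\<Oplus>\<^bsub>?X\<^esub>c\<in>K. A k c)) \<ominus>\<^bsub>?X\<^esub> s n (b k)) =
       (s (fst k) (a k) \<ominus>\<^bsub>?X\<^esub> s (fst k + n) (b k)) \<oplus>\<^bsub>?X\<^esub> s (fst k + (m + n - 1)) (\<Oplus>\<^bsub>?X\<^esub>c\<in>K. A k c)"
      using aX[OF k] bX[OF k] sumA[OF k] s by (simp add: sadd sneg ss M.M.minus_eq M.M.a_ac)
    then show "sgn_power ?X (fst k) (coord k (m + n - 1) (hom_diff G Y n \<phi> (fst k + m) (t (fst k) (snd k)))) =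
        (s (fst k) (a k) \<ominus>\<^bsub>?X\<^esub> s (fst k + n) (b k)) \<oplus>\<^bsub>?X\<^esub> (\<Oplus>\<^bsub>?X\<^esub>c\<in>K. s (fst k + (m + n - 1)) (A k c))"
      unfolding lhs[OF k] s_def[symmetric] using ssum[of "A k"] AX[OF k] by (simp add: s_def)
  qed simp
  also have "\<dots> = (\<Oplus>\<^bsub>?X\<^esub>k\<in>K. s (fst k) (a k) \<ominus>\<^bsub>?X\<^esub> s (fst k + n) (b k)) \<oplus>\<^bsub>?X\<^esub>
      (\<Oplus>\<^bsub>?X\<^esub>k\<in>K. \<Oplus>\<^bsub>?X\<^esub>c\<in>K. s (fst k + (m + n - 1)) (A k c))"
    by (rule M.M.finsum_addf) (use aX bX AX s in \<open>auto intro!: M.M.finsum_closed\<close>)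
  also have "(\<Oplus>\<^bsub>?X\<^esub>k\<in>K. \<Oplus>\<^bsub>?X\<^esub>c\<in>K. s (fst k + (m + n - 1)) (A k c)) = (\<Oplus>\<^bsub>?X\<^esub>c\<in>K. \<Oplus>\<^bsub>?X\<^esub>k\<in>K. s (fst k + (m + n - 1)) (A k c))"
    by (rule M.M.finsum_swap[OF finite_K finite_K]) (use AX s in auto)
  also have "\<dots> = (\<Oplus>\<^bsub>?X\<^esub>c\<in>K. s (fst c + m + n) (w c))"
  proof (rule M.M.finsum_cong')
    fix c assume c: "c \<in> K"
    have "(\<Oplus>\<^bsub>?X\<^esub>k\<in>K. s (fst k + (m + n - 1)) (A k c)) = (\<Oplus>\<^bsub>?X\<^esub>k\<in>K. s (fst c + m + n) (A k c))"
    proof (rule M.M.finsum_cong')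
      fix k assume "k \<in> K"
      \<comment> \<open>A nonzero term requires \<open>fst c = fst k + 1\<close>, and then the
        exponents differ by two. This is where the sign stops depending on \<open>k\<close>, so that
        the inner sum can be evaluated by \<open>w_eq\<close>.\<close>
      show "s (fst k + (m + n - 1)) (A k c) = s (fst c + m + n) (A k c)"
      proof (cases "fst c = fst k + 1")
        case True then show ?thesis by (intro scong) auto
      qed (simp add: A_def s_def sgn_power_zero[OF M.module_axioms])
    qed (use AX[OF _ c] s in auto)
    then show "(\<Oplus>\<^bsub>?X\<^esub>k\<in>K. s (fst k + (m + n - 1)) (A k c)) = s (fst c + m + n) (w c)"
      unfolding w_eq[OF c] using ssum[of "\<lambda>k. A k c"] AX[OF _ c] by simp
  qed (use wX s in auto)
  also have "(\<Oplus>\<^bsub>?X\<^esub>k\<in>K. s (fst k) (a k) \<ominus>\<^bsub>?X\<^esub> s (fst k + n) (b k)) \<oplus>\<^bsub>?X\<^esub> (\<Oplus>\<^bsub>?X\<^esub>c\<in>K. s (fst c + m + n) (w c)) =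
      (\<Oplus>\<^bsub>?X\<^esub>k\<in>K. (s (fst k) (a k) \<ominus>\<^bsub>?X\<^esub> s (fst k + n) (b k)) \<oplus>\<^bsub>?X\<^esub> s (fst k + m + n) (w k))"
    by (rule M.M.finsum_addf[symmetric]) (use aX bX wX s in auto)
  also have "\<dots> = (\<Oplus>\<^bsub>?X\<^esub>k\<in>K. s (fst k) (a k) \<oplus>\<^bsub>?X\<^esub> s (n + 1) (s (fst k) (b k \<ominus>\<^bsub>?X\<^esub> s m (w k))))"
  proof (rule M.M.finsum_cong')
    fix k assume k: "k \<in> K"
    have "s (fst k + n + 1) (b k) = s (n + 1 + fst k) (b k)" "s (fst k + m + n) (w k) = s (n + 1 + (fst k + m) + 1) (w k)"
      by (auto intro!: scong)
    then show "(s (fst k) (a k) \<ominus>\<^bsub>?X\<^esub> s (fst k + n) (b k)) \<oplus>\<^bsub>?X\<^esub> s (fst k + m + n) (w k) =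
        s (fst k) (a k) \<oplus>\<^bsub>?X\<^esub> s (n + 1) (s (fst k) (b k \<ominus>\<^bsub>?X\<^esub> s m (w k)))"
      using aX[OF k] bX[OF k] wX[OF k] s by (simp add: sadd sneg ss M.M.minus_eq sminus M.M.a_assoc)
  qed (use aX bX wX s in auto)
  also have "\<dots> = (\<Oplus>\<^bsub>?X\<^esub>k\<in>K. s (fst k) (a k)) \<oplus>\<^bsub>?X\<^esub> (\<Oplus>\<^bsub>?X\<^esub>k\<in>K. s (n + 1) (s (fst k) (b k \<ominus>\<^bsub>?X\<^esub> s m (w k))))"
    by (rule M.M.finsum_addf) (use aX bX wX s in auto)
  also have "(\<Oplus>\<^bsub>?X\<^esub>k\<in>K. s (n + 1) (s (fst k) (b k \<ominus>\<^bsub>?X\<^esub> s m (w k)))) = s (n + 1) (\<Oplus>\<^bsub>?X\<^esub>k\<in>K. s (fst k) (b k \<ominus>\<^bsub>?X\<^esub> s m (w k)))"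
    by (rule ssum[symmetric]) (use bX wX s in auto)
  also have "\<dots> = \<ominus>\<^bsub>?X\<^esub> s n (\<Oplus>\<^bsub>?X\<^esub>k\<in>K. s (fst k) (b k \<ominus>\<^bsub>?X\<^esub> s m (w k)))"
    by (rule sminus[symmetric]) (use bX wX s in \<open>auto intro!: M.M.finsum_closed\<close>)
  finally show ?thesis
    unfolding hom_diff_def d1 d2 unfolding s_def M.M.minus_eq .
qed

text \<open>Formal from \<open>trace_map_diff\<close>: the inverse of a bijection that commutes with
  the differentials commutes with them as well.\<close>

lemma cotrace_map_diff:
  assumes \<psi>: "\<psi> \<in> graded_maps R TG M n" and g: "g \<in> carrier (cobj G j)"
  shows "cotrace_map G (n - 1) (hom_diff TG M n \<psi>) j g = hom_diff G Y n (cotrace_map G n \<psi>) j g"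
proof -
  define \<chi> where "\<chi> = cotrace_map G n \<psi>"
  have gr: "\<chi> \<in> graded_maps R G Y n" unfolding \<chi>_def by (rule cotrace_map_graded[OF \<psi>])
  have bg: "basis_hom G (j - fst k) k g \<in> carrier (cobj TG (j - fst k))" if "k \<in> K" for k
    by (rule linear_closed[OF basis_hom_lin[OF that] g])
  have eq: "hom_diff TG M n \<psi> m t = trace_map (n - 1) (hom_diff G Y n \<chi>) m t"
    if t: "t \<in> carrier (cobj TG m)" for m t
    unfolding trace_map_diff[OF gr t]
    by (rule hom_diff_cong[OF preTG t]) (simp add: \<chi>_def trace_cotrace[OF \<psi>])
  have "cotrace_map G (n - 1) (hom_diff TG M n \<psi>) j g =
      cotrace_map G (n - 1) (trace_map (n - 1) (hom_diff G Y n \<chi>)) j g"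
    unfolding cotrace_map_def
  proof (rule Y.M.finsum_cong')
    let ?\<theta> = "trace_map (n - 1) (hom_diff G Y n \<chi>)"
    have \<theta>: "?\<theta> \<in> graded_maps R TG M (n - 1)" by (rule trace_map_graded[OF hom_diff_graded[OF G Y gr]])
    have "?\<theta> (j - fst k) (basis_hom G (j - fst k) k g) \<in> carrier (cobj M (j + (n - 1) - fst k))" if "k \<in> K" for k
      using graded_mapsD(2)[OF \<theta> bg[OF that]] by (simp add: algebra_simps)
    then show "(\<lambda>k. sgn_power (cobj Y (j + (n - 1))) (fst k) (inc k (j + (n - 1) - fst k) (?\<theta> (j - fst k) (basis_hom G (j - fst k) k g))))
        \<in> K \<rightarrow> carrier (cobj Y (j + (n - 1)))"
      using sgn_power_closed[OF Y.module_axioms linear_closed[OF inc_lin]] by auto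
  qed (simp_all add: eq[OF bg])
  then show ?thesis using cotrace_trace[OF hom_diff_graded[OF G Y gr] g] by (simp add: \<chi>_def)
qed

text \<open>\<open>trace_map\<close> and \<open>cotrace_map\<close> carry cycles to cycles and null
  homotopies to null homotopies, one degree higher, because they are mutually inverse and respect
  \<open>hom_diff\<close>.\<close>

lemma hom_vanishes_adjoint: "hom_vanishes R G Y n \<longleftrightarrow> hom_vanishes R TG M n"
proof
  assume van: "hom_vanishes R TG M n"
  show "hom_vanishes R G Y n" unfolding hom_vanishes_def
  proof
    fix \<phi> assume \<phi>: "\<phi> \<in> hom_cycles R G Y n"
    note gr = hom_cyclesD(1)[OF \<phi>]
    have "trace_map (n - 1) (hom_diff G Y n \<phi>) m t = \<zero>\<^bsub>cobj M (m + n - 1)\<^esub>" if t: "t \<in> carrier (cobj TG m)" for m t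
    proof -
      have e: "m + (n - 1) = m + n - 1" by simp
      have "hom_diff G Y n \<phi> (fst k + m) (t (fst k) (snd k)) = \<zero>\<^bsub>cobj Y (m + n - 1 + fst k)\<^esub>" if "k \<in> K" for k
        using hom_cyclesD(2)[OF \<phi> linear_closed[OF eval_linear[OF G that] t]] by (simp add: algebra_simps)
      then have "trace_map (n - 1) (hom_diff G Y n \<phi>) m t = (\<Oplus>\<^bsub>cobj M (m + n - 1)\<^esub>k\<in>K. \<zero>\<^bsub>cobj M (m + n - 1)\<^esub>)"
        unfolding trace_map_def e
        by (intro M.M.finsum_cong') (auto simp: linear_zero[OF Y.module_axioms M.module_axioms coord] sgn_power_zero[OF M.module_axioms])
      then show ?thesis by (simp add: M.M.finsum_zero)
    qed
    then have "trace_map n \<phi> \<in> hom_cycles R TG M n"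
      using trace_map_graded[OF gr] trace_map_diff[OF gr] by (simp add: hom_cycles_def)
    then obtain H where H: "H \<in> graded_maps R TG M (n + 1)"
      "\<And>m t. t \<in> carrier (cobj TG m) \<Longrightarrow> trace_map n \<phi> m t = hom_diff TG M (n + 1) H m t"
      using van by (auto simp: hom_vanishes_def null_homotopic_def)
    show "null_homotopic R G Y n \<phi>" unfolding null_homotopic_def
    proof (intro bexI[OF _ cotrace_map_graded[OF H(1)]] allI ballI)
      fix j g assume g: "g \<in> carrier (cobj G j)"
      have "\<phi> j g = cotrace_map G n (trace_map n \<phi>) j g" by (rule cotrace_trace[OF gr g, symmetric])
      also have "\<dots> = cotrace_map G n (hom_diff TG M (n + 1) H) j g"
        unfolding cotrace_map_def
      proof (rule Y.M.finsum_cong')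
        have "hom_diff TG M (n + 1) H \<in> graded_maps R TG M n" using hom_diff_graded[OF preTG M H(1)] by simp
        from graded_mapsD(2)[OF this linear_closed[OF basis_hom_lin g]]
        have "hom_diff TG M (n + 1) H (j - fst k) (basis_hom G (j - fst k) k g) \<in> carrier (cobj M (j + n - fst k))" if "k \<in> K" for k
          using that by (simp add: algebra_simps)
        then show "(\<lambda>k. sgn_power (cobj Y (j + n)) (fst k) (inc k (j + n - fst k) (hom_diff TG M (n + 1) H (j - fst k) (basis_hom G (j - fst k) k g))))
            \<in> K \<rightarrow> carrier (cobj Y (j + n))"
          using sgn_power_closed[OF Y.module_axioms linear_closed[OF inc_lin]] by auto
      qed (simp_all add: H(2)[OF linear_closed[OF basis_hom_lin g]])
      also have "\<dots> = hom_diff G Y (n + 1) (cotrace_map G (n + 1) H) j g"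
        using cotrace_map_diff[OF H(1) g] by simp
      finally show "\<phi> j g = hom_diff G Y (n + 1) (cotrace_map G (n + 1) H) j g" .
    qed
  qed
next
  assume van: "hom_vanishes R G Y n"
  show "hom_vanishes R TG M n" unfolding hom_vanishes_def
  proof
    fix \<psi> assume \<psi>: "\<psi> \<in> hom_cycles R TG M n"
    note gr = hom_cyclesD(1)[OF \<psi>]
    have "cotrace_map G (n - 1) (hom_diff TG M n \<psi>) j g = \<zero>\<^bsub>cobj Y (j + n - 1)\<^esub>" if g: "g \<in> carrier (cobj G j)" for j g
    proof -
      have e: "j + (n - 1) = j + n - 1" by simp
      have "hom_diff TG M n \<psi> (j - fst k) (basis_hom G (j - fst k) k g) = \<zero>\<^bsub>cobj M (j + n - 1 - fst k)\<^esub>" if "k \<in> K" for k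
        using hom_cyclesD(2)[OF \<psi> linear_closed[OF basis_hom_lin[OF that] g]] by (simp add: algebra_simps)
      then have "cotrace_map G (n - 1) (hom_diff TG M n \<psi>) j g = (\<Oplus>\<^bsub>cobj Y (j + n - 1)\<^esub>k\<in>K. \<zero>\<^bsub>cobj Y (j + n - 1)\<^esub>)"
        unfolding cotrace_map_def e
        by (intro Y.M.finsum_cong') (auto simp: linear_zero[OF M.module_axioms Y.module_axioms inc_lin] sgn_power_zero[OF Y.module_axioms])
      then show ?thesis by (simp add: Y.M.finsum_zero)
    qed
    then have "cotrace_map G n \<psi> \<in> hom_cycles R G Y n"
      using cotrace_map_graded[OF gr] cotrace_map_diff[OF gr] by (simp add: hom_cycles_def)
    then obtain H where H: "H \<in> graded_maps R G Y (n + 1)"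
      "\<And>j g. g \<in> carrier (cobj G j) \<Longrightarrow> cotrace_map G n \<psi> j g = hom_diff G Y (n + 1) H j g"
      using van by (auto simp: hom_vanishes_def null_homotopic_def)
    show "null_homotopic R TG M n \<psi>" unfolding null_homotopic_def
    proof (intro bexI[OF _ trace_map_graded[OF H(1)]] allI ballI)
      fix m t assume t: "t \<in> carrier (cobj TG m)"
      have tk: "t (fst k) (snd k) \<in> carrier (cobj G (fst k + m))" if "k \<in> K" for k
        by (rule linear_closed[OF eval_linear[OF G that] t])
      have "\<psi> m t = trace_map n (cotrace_map G n \<psi>) m t" by (rule trace_cotrace[OF gr t, symmetric])
      also have "\<dots> = trace_map n (hom_diff G Y (n + 1) H) m t"
        unfolding trace_map_def
      proof (rule M.M.finsum_cong')
        have "hom_diff G Y (n + 1) H \<in> graded_maps R G Y n" using hom_diff_graded[OF G Y H(1)] by simp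
        then show "(\<lambda>k. sgn_power (cobj M (m + n)) (fst k) (coord k (m + n) (hom_diff G Y (n + 1) H (fst k + m) (t (fst k) (snd k)))))
            \<in> K \<rightarrow> carrier (cobj M (m + n))"
          using sgn_power_closed[OF M.module_axioms linear_closed[OF coord linear_closed[OF graded_Y tk]]] by auto
      qed (simp_all add: H(2)[OF tk])
      also have "\<dots> = hom_diff TG M (n + 1) (trace_map (n + 1) H) m t"
        using trace_map_diff[OF H(1) t] by simp
      finally show "\<psi> m t = hom_diff TG M (n + 1) (trace_map (n + 1) H) m t" .
    qed
  qed
qed

end

end

section \<open>Tensor products\<close>

lemma kernel_submodule:
  assumes "module R M" "module R N" "f \<in> linear_maps R M N"
  shows "submodule {x \<in> carrier M. f x = \<zero>\<^bsub>N\<^esub>} R M"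
proof -
  interpret M: module R M by fact
  interpret N: module R N by fact
  show ?thesis
    by (rule M.submoduleI) (auto simp: linear_zero[OF assms] linear_neg[OF assms] linear_add[OF assms(3)]
        linear_smult[OF assms(3)] N.a_minus_zero)
qed

lemma submodule_gen_submodule:
  assumes "module R M" "S \<subseteq> carrier M"
  shows "submodule (submodule_gen R M S) R M"
proof -
  interpret module R M by fact
  have car: "submodule (carrier M) R M" by (rule carrier_is_submodule)
  show ?thesis unfolding submodule_gen_def
  proof (rule submoduleI)
    show "\<Inter>{N. submodule N R M \<and> S \<subseteq> N} \<subseteq> carrier M" using car assms(2) by blast
    show "\<zero>\<^bsub>M\<^esub> \<in> \<Inter>{N. submodule N R M \<and> S \<subseteq> N}"
      using subgroup.one_closed[OF submodule.axioms(1)] by fastforce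
  qed (auto dest: submoduleE(3) submoduleE(4) submoduleE(5))
qed

lemma submodule_gen_least: "submodule N R M \<Longrightarrow> S \<subseteq> N \<Longrightarrow> submodule_gen R M S \<subseteq> N"
  by (auto simp: submodule_gen_def)

lemma submodule_gen_incl: "x \<in> S \<Longrightarrow> x \<in> submodule_gen R M S"
  by (auto simp: submodule_gen_def)

section \<open>The universal property of the tensor product\<close>

definition pure_tensor ::
    "('a, 'c) ring_scheme \<Rightarrow> ('a, 'm) module \<Rightarrow> ('a, 'n) module \<Rightarrow> 'm \<Rightarrow> 'n \<Rightarrow> ('m \<times> 'n \<Rightarrow> 'a) set" where
  "pure_tensor R M N x y = tensor_relations R M N +>\<^bsub>tensor_free R M N\<^esub> free_gen R (x, y)"

definition bilinear_map ::
    "('a, 'c) ring_scheme \<Rightarrow> ('a, 'm) module \<Rightarrow> ('a, 'n) module \<Rightarrow> ('a, 'l) module \<Rightarrow> ('m \<Rightarrow> 'n \<Rightarrow> 'l) \<Rightarrow> bool" where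
  "bilinear_map R M N X u \<longleftrightarrow> (\<forall>y\<in>carrier N. (\<lambda>x. u x y) \<in> linear_maps R M X) \<and> (\<forall>x\<in>carrier M. u x \<in> linear_maps R N X)"

text \<open>The map induced on classes by a bilinear \<open>u\<close>. For bilinear \<open>u\<close>
  all representatives yield the same value, so the choice is harmless; see
  \<open>tensor_lift_coset\<close>.\<close>

definition tensor_lift ::
    "('a, 'c) ring_scheme \<Rightarrow> ('a, 'l) module \<Rightarrow> ('m \<Rightarrow> 'n \<Rightarrow> 'l) \<Rightarrow> ('m \<times> 'n \<Rightarrow> 'a) set \<Rightarrow> 'l" where
  "tensor_lift R X u C = (SOME v. \<exists>\<phi>\<in>C. v = lin_ext R X (\<lambda>(x, y). u x y) \<phi>)"

context
  fixes R :: "('a, 'c) ring_scheme" and M :: "('a, 'm) module" and N :: "('a, 'n) module"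
  assumes M: "module R M" and N: "module R N"
begin

abbreviation (input) "L \<equiv> tensor_free R M N"
abbreviation (input) "Rel \<equiv> tensor_relations R M N"

interpretation M: module R M by (rule M)
interpretation N: module R N by (rule N)

lemma L_module: "module R L"
  unfolding tensor_free_def by (rule free_module_module[OF M.R.is_cring])

lemma free_gen_L: "x \<in> carrier M \<Longrightarrow> y \<in> carrier N \<Longrightarrow> free_gen R (x, y) \<in> carrier L"
  unfolding tensor_free_def by (rule free_gen_closed[OF M.R.is_cring]) simp

interpretation L: module R L by (rule L_module)

lemma relations_submodule: "submodule Rel R L"
  unfolding tensor_relations_def Let_def
  by (rule submodule_gen_submodule[OF L_module])
    (auto intro!: L.M.minus_closed L.M.a_closed L.smult_closed free_gen_L)

text \<open>The kernel of \<open>h\<close> is a submodule, and bilinearity puts the four families of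
  defining relations into it; the submodule they generate follows.\<close>

lemma relations_in_kernel:
  assumes X: "module R X" and h: "h \<in> linear_maps R L X"
    and bil: "bilinear_map R M N X (\<lambda>x y. h (free_gen R (x, y)))" and r: "\<phi> \<in> Rel"
  shows "h \<phi> = \<zero>\<^bsub>X\<^esub>"
proof -
  interpret X: module R X by (rule X)
  have l1: "(\<lambda>x. h (free_gen R (x, y))) \<in> linear_maps R M X" if "y \<in> carrier N" for y
    using bil that by (simp add: bilinear_map_def)
  have l2: "(\<lambda>y. h (free_gen R (x, y))) \<in> linear_maps R N X" if "x \<in> carrier M" for x
    using bil that by (simp add: bilinear_map_def)
  have c: "h (free_gen R (x, y)) \<in> carrier X" if "x \<in> carrier M" "y \<in> carrier N" for x y
    by (rule linear_closed[OF h free_gen_L[OF that]])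
  have "Rel \<subseteq> {\<phi> \<in> carrier L. h \<phi> = \<zero>\<^bsub>X\<^esub>}"
    unfolding tensor_relations_def Let_def
    by (rule submodule_gen_least[OF kernel_submodule[OF L_module X h]])
      (auto simp: linear_minus[OF L_module X h] linear_add[OF h] linear_smult[OF h] free_gen_L
        L.M.a_closed L.M.minus_closed L.smult_closed linear_add[OF l1] linear_add[OF l2] linear_smult[OF l1]
        linear_smult[OF l2] c X.M.minus_self)
  then show ?thesis using r by auto
qed

lemma tensor_module_module: "module R (tensor_module R M N)"
  unfolding tensor_module_def by (rule quot_module_module[OF L_module relations_submodule])

lemma tensor_proj_linear: "(\<lambda>\<phi>. Rel +>\<^bsub>L\<^esub> \<phi>) \<in> linear_maps R L (tensor_module R M N)"
  unfolding tensor_module_def by (rule quot_linear[OF L_module relations_submodule])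

lemma tensor_carrierE:
  assumes "C \<in> carrier (tensor_module R M N)"
  obtains \<phi> where "\<phi> \<in> carrier L" "C = Rel +>\<^bsub>L\<^esub> \<phi>"
  using assms unfolding tensor_module_def quot_carrier[OF L_module relations_submodule] by auto

lemma tensor_linear_eqI:
  assumes X: "module R X" and f: "f \<in> linear_maps R (tensor_module R M N) X" and g: "g \<in> linear_maps R (tensor_module R M N) X"
    and eq: "\<And>x y. x \<in> carrier M \<Longrightarrow> y \<in> carrier N \<Longrightarrow> f (pure_tensor R M N x y) = g (pure_tensor R M N x y)"
    and C: "C \<in> carrier (tensor_module R M N)"
  shows "f C = g C"
proof -
  obtain \<phi> where \<phi>: "\<phi> \<in> carrier L" "C = Rel +>\<^bsub>L\<^esub> \<phi>" by (rule tensor_carrierE[OF C])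
  have l: "(\<lambda>\<phi>. h (Rel +>\<^bsub>L\<^esub> \<phi>)) \<in> linear_maps R (free_module R (carrier M \<times> carrier N)) X"
    if "h \<in> linear_maps R (tensor_module R M N) X" for h
    unfolding tensor_free_def[symmetric] by (rule linear_comp[OF tensor_proj_linear that])
  have "f (Rel +>\<^bsub>L\<^esub> \<phi>) = g (Rel +>\<^bsub>L\<^esub> \<phi>)"
  proof (rule free_linear_eqI[OF M.R.is_cring X l[OF f] l[OF g]])
    show "\<phi> \<in> carrier (free_module R (carrier M \<times> carrier N))" using \<phi>(1) by (simp add: tensor_free_def)
    show "f (Rel +>\<^bsub>L\<^esub> free_gen R s) = g (Rel +>\<^bsub>L\<^esub> free_gen R s)" if "s \<in> carrier M \<times> carrier N" for s
      using that eq by (auto simp: pure_tensor_def)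
  qed
  then show ?thesis using \<phi>(2) by simp
qed

lemma tensor_rel_eq: "\<phi> \<in> carrier L \<Longrightarrow> \<psi> \<in> carrier L \<Longrightarrow> \<phi> \<ominus>\<^bsub>L\<^esub> \<psi> \<in> Rel \<Longrightarrow> Rel +>\<^bsub>L\<^esub> \<phi> = Rel +>\<^bsub>L\<^esub> \<psi>"
  using coset_eq_iff[OF L_module relations_submodule] by blast

lemma rel_gen1:
  "x \<in> carrier M \<Longrightarrow> x' \<in> carrier M \<Longrightarrow> y \<in> carrier N \<Longrightarrow>
    free_gen R (x \<oplus>\<^bsub>M\<^esub> x', y) \<ominus>\<^bsub>L\<^esub> (free_gen R (x, y) \<oplus>\<^bsub>L\<^esub> free_gen R (x', y)) \<in> Rel"
  "x \<in> carrier M \<Longrightarrow> y \<in> carrier N \<Longrightarrow> y' \<in> carrier N \<Longrightarrow>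
    free_gen R (x, y \<oplus>\<^bsub>N\<^esub> y') \<ominus>\<^bsub>L\<^esub> (free_gen R (x, y) \<oplus>\<^bsub>L\<^esub> free_gen R (x, y')) \<in> Rel"
  "r \<in> carrier R \<Longrightarrow> x \<in> carrier M \<Longrightarrow> y \<in> carrier N \<Longrightarrow>
    free_gen R (r \<odot>\<^bsub>M\<^esub> x, y) \<ominus>\<^bsub>L\<^esub> (r \<odot>\<^bsub>L\<^esub> free_gen R (x, y)) \<in> Rel"
  "r \<in> carrier R \<Longrightarrow> x \<in> carrier M \<Longrightarrow> y \<in> carrier N \<Longrightarrow>
    free_gen R (x, r \<odot>\<^bsub>N\<^esub> y) \<ominus>\<^bsub>L\<^esub> (r \<odot>\<^bsub>L\<^esub> free_gen R (x, y)) \<in> Rel"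
  unfolding tensor_relations_def Let_def by (rule submodule_gen_incl, blast)+

lemma pure_tensor_closed: "x \<in> carrier M \<Longrightarrow> y \<in> carrier N \<Longrightarrow> pure_tensor R M N x y \<in> carrier (tensor_module R M N)"
  unfolding pure_tensor_def by (rule linear_closed[OF tensor_proj_linear free_gen_L])

lemma pure_tensor_bilinear: "bilinear_map R M N (tensor_module R M N) (pure_tensor R M N)"
  unfolding bilinear_map_def
proof (intro conjI ballI linear_mapsI)
  note l = tensor_proj_linear
  fix x y assume xy: "x \<in> carrier M" "y \<in> carrier N"
  show "pure_tensor R M N x y \<in> carrier (tensor_module R M N)" "pure_tensor R M N x y \<in> carrier (tensor_module R M N)"
    by (rule pure_tensor_closed[OF xy])+
  show "pure_tensor R M N (x \<oplus>\<^bsub>M\<^esub> x') y = pure_tensor R M N x y \<oplus>\<^bsub>tensor_module R M N\<^esub> pure_tensor R M N x' y" if "x' \<in> carrier M" for x'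
    unfolding pure_tensor_def linear_add[OF l free_gen_L[OF xy] free_gen_L[OF that xy(2)], symmetric]
    by (rule tensor_rel_eq[OF _ _ rel_gen1(1)]) (use xy that free_gen_L in auto)
  show "pure_tensor R M N x (y \<oplus>\<^bsub>N\<^esub> y') = pure_tensor R M N x y \<oplus>\<^bsub>tensor_module R M N\<^esub> pure_tensor R M N x y'" if "y' \<in> carrier N" for y'
    unfolding pure_tensor_def linear_add[OF l free_gen_L[OF xy] free_gen_L[OF xy(1) that], symmetric]
    by (rule tensor_rel_eq[OF _ _ rel_gen1(2)]) (use xy that free_gen_L in auto)
  show "pure_tensor R M N (r \<odot>\<^bsub>M\<^esub> x) y = r \<odot>\<^bsub>tensor_module R M N\<^esub> pure_tensor R M N x y" if "r \<in> carrier R" for r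
    unfolding pure_tensor_def linear_smult[OF l that free_gen_L[OF xy], symmetric]
    by (rule tensor_rel_eq[OF _ _ rel_gen1(3)]) (use xy that free_gen_L in auto)
  show "pure_tensor R M N x (r \<odot>\<^bsub>N\<^esub> y) = r \<odot>\<^bsub>tensor_module R M N\<^esub> pure_tensor R M N x y" if "r \<in> carrier R" for r
    unfolding pure_tensor_def linear_smult[OF l that free_gen_L[OF xy], symmetric]
    by (rule tensor_rel_eq[OF _ _ rel_gen1(4)]) (use xy that free_gen_L in auto)
qed

lemma pure_tensor_linear: "x \<in> carrier M \<Longrightarrow> pure_tensor R M N x \<in> linear_maps R N (tensor_module R M N)"
  "y \<in> carrier N \<Longrightarrow> (\<lambda>x. pure_tensor R M N x y) \<in> linear_maps R M (tensor_module R M N)"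
  using pure_tensor_bilinear by (simp_all add: bilinear_map_def)

context
  fixes X :: "('a, 'l) module" and u
  assumes X: "module R X" and bil: "bilinear_map R M N X u"
begin

interpretation X: module R X by (rule X)

lemma u_closed: "(\<lambda>(x, y). u x y) \<in> carrier M \<times> carrier N \<rightarrow> carrier X"
  using bil linear_closed unfolding bilinear_map_def by fastforce

lemma ext_linear: "lin_ext R X (\<lambda>(x, y). u x y) \<in> linear_maps R L X"
  unfolding tensor_free_def by (rule lin_ext_linear[OF X u_closed])

lemma ext_gen: "x \<in> carrier M \<Longrightarrow> y \<in> carrier N \<Longrightarrow> lin_ext R X (\<lambda>(x, y). u x y) (free_gen R (x, y)) = u x y"
  using lin_ext_gen[OF X u_closed, of "(x, y)"] by simp

lemma ext_rel:
  assumes "\<phi> \<in> Rel" shows "lin_ext R X (\<lambda>(x, y). u x y) \<phi> = \<zero>\<^bsub>X\<^esub>"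
proof (rule relations_in_kernel[OF X ext_linear _ assms])
  have "(\<lambda>x. lin_ext R X (\<lambda>(x, y). u x y) (free_gen R (x, y))) \<in> linear_maps R M X" if "y \<in> carrier N" for y
    by (rule linear_cong[OF M, of "\<lambda>x. u x y"]) (use bil that ext_gen in \<open>auto simp: bilinear_map_def\<close>)
  moreover have "(\<lambda>y. lin_ext R X (\<lambda>(x, y). u x y) (free_gen R (x, y))) \<in> linear_maps R N X" if "x \<in> carrier M" for x
    by (rule linear_cong[OF N, of "u x"]) (use bil that ext_gen in \<open>auto simp: bilinear_map_def\<close>)
  ultimately show "bilinear_map R M N X (\<lambda>x y. lin_ext R X (\<lambda>(x, y). u x y) (free_gen R (x, y)))"
    by (simp add: bilinear_map_def)
qed

lemma tensor_lift_coset: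
  assumes "\<phi> \<in> carrier L"
  shows "tensor_lift R X u (Rel +>\<^bsub>L\<^esub> \<phi>) = lin_ext R X (\<lambda>(x, y). u x y) \<phi>"
proof -
  have eq: "lin_ext R X (\<lambda>(x, y). u x y) \<psi> = lin_ext R X (\<lambda>(x, y). u x y) \<phi>" if "\<psi> \<in> Rel +>\<^bsub>L\<^esub> \<phi>" for \<psi>
  proof -
    have \<psi>: "\<psi> \<in> carrier L" "\<psi> \<ominus>\<^bsub>L\<^esub> \<phi> \<in> Rel" using that coset_mem_iff[OF L_module relations_submodule assms] by auto
    then show ?thesis
      using ext_rel[OF \<psi>(2)] linear_minus[OF L_module X ext_linear \<psi>(1) assms]
        X.M.minus_eq_zero_iff[OF linear_closed[OF ext_linear \<psi>(1)] linear_closed[OF ext_linear assms]] by simp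
  qed
  have "\<phi> \<ominus>\<^bsub>L\<^esub> \<phi> \<in> Rel"
    using subgroup.one_closed[OF submodule.axioms(1)[OF relations_submodule]] assms by (simp add: L.M.minus_self)
  then have self: "\<phi> \<in> Rel +>\<^bsub>L\<^esub> \<phi>" using coset_mem_iff[OF L_module relations_submodule assms] assms by simp
  show ?thesis unfolding tensor_lift_def
  proof (rule some_equality)
    show "\<exists>\<psi>\<in>Rel +>\<^bsub>L\<^esub> \<phi>. lin_ext R X (\<lambda>(x, y). u x y) \<phi> = lin_ext R X (\<lambda>(x, y). u x y) \<psi>"
      by (rule bexI[OF refl self])
    show "v = lin_ext R X (\<lambda>(x, y). u x y) \<phi>" if "\<exists>\<psi>\<in>Rel +>\<^bsub>L\<^esub> \<phi>. v = lin_ext R X (\<lambda>(x, y). u x y) \<psi>" for v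
      using that by (elim bexE) (simp only: eq)
  qed
qed

lemma tensor_lift_linear: "tensor_lift R X u \<in> linear_maps R (tensor_module R M N) X"
proof (rule linear_mapsI)
  note l = tensor_proj_linear
  fix C assume C: "C \<in> carrier (tensor_module R M N)"
  obtain \<phi> where \<phi>: "\<phi> \<in> carrier L" "C = Rel +>\<^bsub>L\<^esub> \<phi>" by (rule tensor_carrierE[OF C])
  show "tensor_lift R X u C \<in> carrier X"
    unfolding \<phi>(2) tensor_lift_coset[OF \<phi>(1)] by (rule linear_closed[OF ext_linear \<phi>(1)])
  show "tensor_lift R X u (r \<odot>\<^bsub>tensor_module R M N\<^esub> C) = r \<odot>\<^bsub>X\<^esub> tensor_lift R X u C" if "r \<in> carrier R" for r
    unfolding \<phi>(2) linear_smult[OF l that \<phi>(1), symmetric] tensor_lift_coset[OF \<phi>(1)]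
      tensor_lift_coset[OF L.smult_closed[OF that \<phi>(1)]] by (rule linear_smult[OF ext_linear that \<phi>(1)])
  fix D assume D: "D \<in> carrier (tensor_module R M N)"
  obtain \<psi> where \<psi>: "\<psi> \<in> carrier L" "D = Rel +>\<^bsub>L\<^esub> \<psi>" by (rule tensor_carrierE[OF D])
  show "tensor_lift R X u (C \<oplus>\<^bsub>tensor_module R M N\<^esub> D) = tensor_lift R X u C \<oplus>\<^bsub>X\<^esub> tensor_lift R X u D"
    unfolding \<phi>(2) \<psi>(2) linear_add[OF l \<phi>(1) \<psi>(1), symmetric] tensor_lift_coset[OF \<phi>(1)] tensor_lift_coset[OF \<psi>(1)]
      tensor_lift_coset[OF L.M.a_closed[OF \<phi>(1) \<psi>(1)]] by (rule linear_add[OF ext_linear \<phi>(1) \<psi>(1)])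
qed

lemma tensor_lift_pure: "x \<in> carrier M \<Longrightarrow> y \<in> carrier N \<Longrightarrow> tensor_lift R X u (pure_tensor R M N x y) = u x y"
  unfolding pure_tensor_def by (simp add: tensor_lift_coset free_gen_L ext_gen)

end

end

lemma finsum_regular:
  assumes "cring R" "f \<in> A \<rightarrow> carrier R"
  shows "finsum (regular_module R) f A = finsum R f A"
proof -
  interpret cring R by fact
  interpret Q: module R "regular_module R" by (rule regular_module_module[OF assms(1)])
  show ?thesis using assms(2)
    by (induction A rule: infinite_finite_induct) (simp_all add: Pi_iff)
qed

text \<open>\<open>tensor_map\<close> is identified with the map that the universal property assigns
  to the bilinear map \<open>(x, y) \<mapsto> f x \<otimes> g y\<close>. Its well-definedness on
  classes, linearity and values on pure tensors are inherited.\<close>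

lemma tensor_map_linear_pure:
  assumes M: "module R M" and N: "module R N" and M': "module R M'" and N': "module R N'"
    and f: "f \<in> linear_maps R M M'" and g: "g \<in> linear_maps R N N'"
  shows "tensor_map R M' N' f g \<in> linear_maps R (tensor_module R M N) (tensor_module R M' N')"
    and "x \<in> carrier M \<Longrightarrow> y \<in> carrier N \<Longrightarrow>
      tensor_map R M' N' f g (pure_tensor R M N x y) = pure_tensor R M' N' (f x) (g y)"
proof -
  interpret M: module R M by (rule M)
  let ?T = "tensor_module R M N" and ?T' = "tensor_module R M' N'"
  let ?L = "tensor_free R M N" and ?L' = "tensor_free R M' N'"
  let ?u = "\<lambda>x y. pure_tensor R M' N' (f x) (g y)"
  have T: "module R ?T" and T': "module R ?T'" and L': "module R ?L'"
    by (rule tensor_module_module[OF M N] tensor_module_module[OF M' N'] L_module[OF M' N'])+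
  note R = M.R.is_cring
  have bil: "bilinear_map R M N ?T' ?u"
    unfolding bilinear_map_def
    by (auto intro!: linear_comp[OF f pure_tensor_linear(2)[OF M' N']] linear_comp[OF g pure_tensor_linear(1)[OF M' N']]
        linear_closed[OF f] linear_closed[OF g])
  define push where "push \<phi> = (\<lambda>q. \<Oplus>\<^bsub>R\<^esub>p\<in>{p. \<phi> p \<noteq> \<zero>\<^bsub>R\<^esub> \<and> map_prod f g p = q}. \<phi> p)" for \<phi>
  have e: "(\<lambda>p. free_gen R (map_prod f g p)) \<in> carrier M \<times> carrier N \<rightarrow> carrier ?L'"
    using free_gen_L[OF M' N'] linear_closed[OF f] linear_closed[OF g] by auto
  \<comment> \<open>Collecting coefficients over the fibres of \<open>map_prod f g\<close> is the
    linear extension of the map on generators, as one sees at each position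
    \<open>q\<close>.\<close>
  have push: "push \<phi> = lin_ext R ?L' (\<lambda>p. free_gen R (map_prod f g p)) \<phi>" if \<phi>: "\<phi> \<in> carrier ?L" for \<phi>
  proof
    fix q
    interpret Q: module R "regular_module R" by (rule regular_module_module[OF R])
    have \<phi>': "\<phi> \<in> carrier (free_module R (carrier M \<times> carrier N))" using \<phi> by (simp add: tensor_free_def)
    note p = free_carrierD[OF \<phi>']
    have ev: "(\<lambda>\<phi>. \<phi> q) \<in> linear_maps R ?L' (regular_module R)"
      unfolding tensor_free_def by (rule free_eval_linear)
    have "lin_ext R ?L' (\<lambda>p. free_gen R (map_prod f g p)) \<phi> q = lin_ext R (regular_module R) (\<lambda>p. free_gen R (map_prod f g p) q) \<phi>"
      by (rule linear_lin_ext[OF L' e Q.module_axioms ev \<phi>'])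
    also have "\<dots> = (\<Oplus>\<^bsub>regular_module R\<^esub>p\<in>{p. \<phi> p \<noteq> \<zero>\<^bsub>R\<^esub> \<and> map_prod f g p = q}. \<phi> p)"
      unfolding lin_ext_def
      by (rule Q.M.add.finprod_mono_neutral_cong_right[OF p(3)]) (use p(1) in \<open>auto simp: free_gen_def\<close>)
    also have "\<dots> = push \<phi> q"
      unfolding push_def by (rule finsum_regular[OF R]) (use p(1) in auto)
    finally show "push \<phi> q = lin_ext R ?L' (\<lambda>p. free_gen R (map_prod f g p)) \<phi> q" by simp
  qed
  have lift: "tensor_relations R M' N' +>\<^bsub>?L'\<^esub> push \<phi> = lin_ext R ?T' (\<lambda>(x, y). ?u x y) \<phi>" if \<phi>: "\<phi> \<in> carrier ?L" for \<phi>
  proof -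
    have \<phi>': "\<phi> \<in> carrier (free_module R (carrier M \<times> carrier N))" using \<phi> by (simp add: tensor_free_def)
    have "(\<lambda>p. tensor_relations R M' N' +>\<^bsub>?L'\<^esub> free_gen R (map_prod f g p)) = (\<lambda>(x, y). ?u x y)"
      by (auto simp: fun_eq_iff pure_tensor_def)
    then show ?thesis
      unfolding push[OF \<phi>] using linear_lin_ext[OF L' e T' tensor_proj_linear[OF M' N'] \<phi>'] by simp
  qed
  have eq: "tensor_map R M' N' f g C = tensor_lift R ?T' ?u C" if C: "C \<in> carrier ?T" for C
  proof -
    obtain \<phi> where \<phi>: "\<phi> \<in> carrier ?L" "C = tensor_relations R M N +>\<^bsub>?L\<^esub> \<phi>" by (rule tensor_carrierE[OF M N C])
    have "tensor_map R M' N' f g C = tensor_relations R M' N' +>\<^bsub>?L'\<^esub> push \<phi>"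
      unfolding tensor_map_def \<phi>(2) push_def[symmetric]
    proof (rule coset_Union[OF L_module[OF M N] relations_submodule[OF M N] \<phi>(1)])
      fix \<psi> assume \<psi>: "\<psi> \<in> carrier ?L" "\<psi> \<ominus>\<^bsub>?L\<^esub> \<phi> \<in> tensor_relations R M N"
      show "tensor_relations R M' N' +>\<^bsub>?L'\<^esub> push \<psi> = tensor_relations R M' N' +>\<^bsub>?L'\<^esub> push \<phi>"
        using tensor_rel_eq[OF M N \<psi>(1) \<phi>(1) \<psi>(2)]
        unfolding lift[OF \<psi>(1)] lift[OF \<phi>(1)] tensor_lift_coset[OF M N T' bil \<psi>(1), symmetric] tensor_lift_coset[OF M N T' bil \<phi>(1), symmetric] by simp
    qed
    then show ?thesis using lift[OF \<phi>(1)] \<phi> tensor_lift_coset[OF M N T' bil \<phi>(1)] by simp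
  qed
  show "tensor_map R M' N' f g \<in> linear_maps R ?T ?T'"
    by (rule linear_cong[OF T tensor_lift_linear[OF M N T' bil] eq])
  show "tensor_map R M' N' f g (pure_tensor R M N x y) = pure_tensor R M' N' (f x) (g y)" if "x \<in> carrier M" "y \<in> carrier N"
    using eq[OF pure_tensor_closed[OF M N that]] tensor_lift_pure[OF M N T' bil that] by simp
qed

lemma sum_module_simps:
  "z \<in> carrier (sum_module A) \<longleftrightarrow> (\<forall>i. z i \<in> carrier (A i)) \<and> finite {i. z i \<noteq> \<zero>\<^bsub>A i\<^esub>}"
  "\<zero>\<^bsub>sum_module A\<^esub> = (\<lambda>i. \<zero>\<^bsub>A i\<^esub>)" "z \<oplus>\<^bsub>sum_module A\<^esub> w = (\<lambda>i. z i \<oplus>\<^bsub>A i\<^esub> w i)"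
  "r \<odot>\<^bsub>sum_module A\<^esub> z = (\<lambda>i. r \<odot>\<^bsub>A i\<^esub> z i)"
  by (auto simp: sum_module_def product_module_def)

lemma sum_module_linear:
  assumes "\<And>i. (\<lambda>x. g x i) \<in> linear_maps R X (A i)" "\<And>x. x \<in> carrier X \<Longrightarrow> finite {i. g x i \<noteq> \<zero>\<^bsub>A i\<^esub>}"
  shows "g \<in> linear_maps R X (sum_module A)"
  by (rule linear_mapsI) (auto simp: sum_module_simps fun_eq_iff linear_add[OF assms(1)] linear_smult[OF assms(1)]
      assms(2) linear_closed[OF assms(1)])

section \<open>Coordinates on the tensor product with a finite free complex\<close>

context basis_complex
begin

lemma K_sum:
  assumes X: "module R X" and q: "\<bar>q\<bar> \<le> N" and f: "\<And>b. b \<in> B q \<Longrightarrow> f (q, b) \<in> carrier X"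
  shows "(\<Oplus>\<^bsub>X\<^esub>c\<in>K. if fst c = q then f c else \<zero>\<^bsub>X\<^esub>) = (\<Oplus>\<^bsub>X\<^esub>b\<in>B q. f (q, b))"
proof -
  interpret X: module R X by (rule X)
  have sub: "Pair q ` B q \<subseteq> K" using q by (auto simp: K_def)
  have "(\<Oplus>\<^bsub>X\<^esub>c\<in>K. if fst c = q then f c else \<zero>\<^bsub>X\<^esub>) = (\<Oplus>\<^bsub>X\<^esub>c\<in>Pair q ` B q. f c)"
    by (rule X.M.add.finprod_mono_neutral_cong_right[OF finite_K sub]) (use f in \<open>auto simp: K_def\<close>)
  also have "\<dots> = (\<Oplus>\<^bsub>X\<^esub>b\<in>B q. f (q, b))"
    by (subst X.M.finsum_reindex) (use f in \<open>auto intro: inj_onI\<close>)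
  finally show ?thesis .
qed

context
  fixes M :: "('a, 'm) chain_complex"
  assumes M: "precomplex R M"
begin

abbreviation "TM n i \<equiv> tensor_module R (cobj M i) (cobj F (n - i))"
abbreviation "Y \<equiv> tensor_complex R M F"

lemma TM_module: "module R (TM n i)"
  by (rule tensor_module_module[OF precomplexD(1)[OF M] precomplexD(1)[OF pre]])

lemma Y_obj: "cobj Y n = sum_module (TM n)"
  by (simp add: tensor_complex_def)

text \<open>Indexed by the target: \<open>diff_left n i\<close> and \<open>diff_right n i\<close>
  both land in the summand \<open>i\<close> of degree \<open>n - 1\<close>, coming from the summands
  \<open>i + 1\<close> and \<open>i\<close> of degree \<open>n\<close>.\<close>

definition diff_left :: "int \<Rightarrow> int \<Rightarrow> ('m \<times> 'f \<Rightarrow> 'a) set \<Rightarrow> ('m \<times> 'f \<Rightarrow> 'a) set" where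
  "diff_left n i = tensor_map R (cobj M i) (cobj F (n - 1 - i)) (cdiff M (i + 1)) id"

definition diff_right :: "int \<Rightarrow> int \<Rightarrow> ('m \<times> 'f \<Rightarrow> 'a) set \<Rightarrow> ('m \<times> 'f \<Rightarrow> 'a) set" where
  "diff_right n i = tensor_map R (cobj M i) (cobj F (n - 1 - i)) id (cdiff F (n - i))"

lemma diff_left:
  "diff_left n i \<in> linear_maps R (TM n (i + 1)) (TM (n - 1) i)"
  "x \<in> carrier (cobj M (i + 1)) \<Longrightarrow> y \<in> carrier (cobj F (n - 1 - i)) \<Longrightarrow>
    diff_left n i (pure_tensor R (cobj M (i + 1)) (cobj F (n - 1 - i)) x y) = pure_tensor R (cobj M i) (cobj F (n - 1 - i)) (cdiff M (i + 1) x) y"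
proof -
  have e: "n - (i + 1) = n - 1 - i" by simp
  note t = tensor_map_linear_pure[OF precomplexD(1)[OF M] precomplexD(1)[OF pre, of "n - 1 - i"] precomplexD(1)[OF M]
      precomplexD(1)[OF pre, of "n - 1 - i"] cdiff_linear_up[OF M, of i] linear_maps_id(2)]
  show "diff_left n i \<in> linear_maps R (TM n (i + 1)) (TM (n - 1) i)"
    unfolding diff_left_def e by (rule t)
  show "diff_left n i (pure_tensor R (cobj M (i + 1)) (cobj F (n - 1 - i)) x y) = pure_tensor R (cobj M i) (cobj F (n - 1 - i)) (cdiff M (i + 1) x) y"
    if "x \<in> carrier (cobj M (i + 1))" "y \<in> carrier (cobj F (n - 1 - i))"
    using t(2)[OF that] unfolding diff_left_def by simp
qed

lemma diff_right:
  "diff_right n i \<in> linear_maps R (TM n i) (TM (n - 1) i)"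
  "x \<in> carrier (cobj M i) \<Longrightarrow> y \<in> carrier (cobj F (n - i)) \<Longrightarrow>
    diff_right n i (pure_tensor R (cobj M i) (cobj F (n - i)) x y) = pure_tensor R (cobj M i) (cobj F (n - 1 - i)) x (cdiff F (n - i) y)"
proof -
  have e: "n - i - 1 = n - 1 - i" by simp
  have d: "cdiff F (n - i) \<in> linear_maps R (cobj F (n - i)) (cobj F (n - 1 - i))"
    using precomplexD(2)[OF pre, of "n - i"] unfolding e .
  note t = tensor_map_linear_pure[OF precomplexD(1)[OF M] precomplexD(1)[OF pre] precomplexD(1)[OF M] precomplexD(1)[OF pre]
      linear_maps_id(2) d]
  show "diff_right n i \<in> linear_maps R (TM n i) (TM (n - 1) i)"
    unfolding diff_right_def by (rule t)
  show "diff_right n i (pure_tensor R (cobj M i) (cobj F (n - i)) x y) = pure_tensor R (cobj M i) (cobj F (n - 1 - i)) x (cdiff F (n - i) y)"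
    if "x \<in> carrier (cobj M i)" "y \<in> carrier (cobj F (n - i))"
    using t(2)[OF that] unfolding diff_right_def by simp
qed

lemma Y_diff:
  assumes z: "z \<in> carrier (cobj Y n)"
  shows "cdiff Y n z = (\<lambda>i. diff_left n i (z (i + 1)) \<oplus>\<^bsub>TM (n - 1) i\<^esub> sgn_power (TM (n - 1) i) i (diff_right n i (z i)))"
  unfolding tensor_complex_def Let_def diff_left_def diff_right_def sgn_power_def
  by (auto simp: fun_eq_iff a_minus_def)

lemma Y_precomplex: "precomplex R Y"
  unfolding precomplex_def
proof (intro conjI allI)
  fix n
  show Ym: "module R (cobj Y n)" unfolding Y_obj by (rule sum_module_module) (rule TM_module)
  let ?g = "\<lambda>z i. diff_left n i (z (i + 1)) \<oplus>\<^bsub>TM (n - 1) i\<^esub> sgn_power (TM (n - 1) i) i (diff_right n i (z i))"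
  have "?g \<in> linear_maps R (cobj Y n) (cobj Y (n - 1))"
    unfolding Y_obj
  proof (rule sum_module_linear)
    fix i
    show "(\<lambda>z. ?g z i) \<in> linear_maps R (sum_module (TM n)) (TM (n - 1) i)"
      by (intro linear_plus TM_module linear_comp[OF sum_proj_linear[of "i + 1" R "TM n"] diff_left(1)] sgn_power_linear
          linear_comp[OF sum_proj_linear[of i R "TM n"] diff_right(1)])
  next
    fix z assume z: "z \<in> carrier (sum_module (TM n))"
    have zero: "?g z i = \<zero>\<^bsub>TM (n - 1) i\<^esub>" if "z i = \<zero>\<^bsub>TM n i\<^esub>" "z (i + 1) = \<zero>\<^bsub>TM n (i + 1)\<^esub>" for i
    proof -
      interpret T: module R "TM (n - 1) i" by (rule TM_module)
      show ?thesis
        unfolding that linear_zero[OF TM_module TM_module diff_left(1)] linear_zero[OF TM_module TM_module diff_right(1)]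
        by (simp add: sgn_power_zero[OF TM_module])
    qed
    \<comment> \<open>The component \<open>i\<close> of the differential depends on the components
      \<open>i\<close> and \<open>i + 1\<close> of \<open>z\<close> only, so finite support is
      preserved.\<close>
    have "{i. ?g z i \<noteq> \<zero>\<^bsub>TM (n - 1) i\<^esub>} \<subseteq> {i. z i \<noteq> \<zero>\<^bsub>TM n i\<^esub>} \<union> (\<lambda>i. i + 1) -` {i. z i \<noteq> \<zero>\<^bsub>TM n i\<^esub>}"
      using zero by fastforce
    moreover have "finite {i. z i \<noteq> \<zero>\<^bsub>TM n i\<^esub>}" using z by (simp add: sum_module_simps)
    ultimately show "finite {i. ?g z i \<noteq> \<zero>\<^bsub>TM (n - 1) i\<^esub>}"
      using finite_vimageI[of "{i. z i \<noteq> \<zero>\<^bsub>TM n i\<^esub>}" "\<lambda>i. i + 1"] by (elim finite_subset) (simp add: inj_on_def)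
  qed
  then show "cdiff Y n \<in> linear_maps R (cobj Y n) (cobj Y (n - 1))"
    by (rule linear_cong[OF Ym]) (rule Y_diff)
qed

definition tensor_inc :: "int \<times> 'f \<Rightarrow> int \<Rightarrow> 'm \<Rightarrow> int \<Rightarrow> ('m \<times> 'f \<Rightarrow> 'a) set" where
  "tensor_inc k i x = (\<lambda>j. if j = i then pure_tensor R (cobj M i) (cobj F (fst k)) x (snd k) else \<zero>\<^bsub>TM (i + fst k) j\<^esub>)"

abbreviation "contract k i \<equiv> tensor_lift R (cobj M i) (\<lambda>x y. \<beta> (fst k) (snd k) y \<odot>\<^bsub>cobj M i\<^esub> x)"

definition tensor_coord :: "int \<times> 'f \<Rightarrow> int \<Rightarrow> (int \<Rightarrow> ('m \<times> 'f \<Rightarrow> 'a) set) \<Rightarrow> 'm" where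
  "tensor_coord k i z = contract k i (z i)"

lemma contract:
  assumes "snd k \<in> B (fst k)"
  shows "contract k i \<in> linear_maps R (tensor_module R (cobj M i) (cobj F (fst k))) (cobj M i)"
    and "x \<in> carrier (cobj M i) \<Longrightarrow> y \<in> carrier (cobj F (fst k)) \<Longrightarrow>
      contract k i (pure_tensor R (cobj M i) (cobj F (fst k)) x y) = \<beta> (fst k) (snd k) y \<odot>\<^bsub>cobj M i\<^esub> x"
proof -
  interpret M: module R "cobj M i" by (rule precomplexD[OF M])
  note l = has_basisD(4)[OF basis assms]
  have "bilinear_map R (cobj M i) (cobj F (fst k)) (cobj M i) (\<lambda>x y. \<beta> (fst k) (snd k) y \<odot>\<^bsub>cobj M i\<^esub> x)"
    unfolding bilinear_map_def
  proof (intro conjI ballI)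
    fix y assume "y \<in> carrier (cobj F (fst k))"
    then show "(\<lambda>x. \<beta> (fst k) (snd k) y \<odot>\<^bsub>cobj M i\<^esub> x) \<in> linear_maps R (cobj M i) (cobj M i)"
      using linear_scale[OF M.module_axioms linear_maps_id(1)] linear_closed[OF l] by simp
  next
    fix x assume "x \<in> carrier (cobj M i)"
    then show "(\<lambda>y. \<beta> (fst k) (snd k) y \<odot>\<^bsub>cobj M i\<^esub> x) \<in> linear_maps R (cobj F (fst k)) (cobj M i)"
      using linear_closed[OF l]
      by (intro linear_mapsI) (auto simp: linear_add[OF l] linear_smult[OF l] M.smult_l_distr M.smult_assoc1)
  qed
  note t = tensor_lift_linear[OF precomplexD(1)[OF M] precomplexD(1)[OF pre] M.module_axioms this]
    tensor_lift_pure[OF precomplexD(1)[OF M] precomplexD(1)[OF pre] M.module_axioms this]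
  show "contract k i \<in> linear_maps R (tensor_module R (cobj M i) (cobj F (fst k))) (cobj M i)" by (rule t)
  show "x \<in> carrier (cobj M i) \<Longrightarrow> y \<in> carrier (cobj F (fst k)) \<Longrightarrow>
      contract k i (pure_tensor R (cobj M i) (cobj F (fst k)) x y) = \<beta> (fst k) (snd k) y \<odot>\<^bsub>cobj M i\<^esub> x"
    by (rule t)
qed

text \<open>Both sides are linear in \<open>u\<close>, so pure tensors suffice. For
  \<open>x \<otimes> y\<close> the formula is the basis expansion of the linear map
  \<open>y \<mapsto> x \<otimes> y\<close>.\<close>

lemma tensor_expand:
  assumes u: "u \<in> carrier (tensor_module R (cobj M i) (cobj F q))"
  shows "(\<Oplus>\<^bsub>tensor_module R (cobj M i) (cobj F q)\<^esub>b\<in>B q. pure_tensor R (cobj M i) (cobj F q) (contract (q, b) i u) b) = u"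
proof -
  let ?T = "tensor_module R (cobj M i) (cobj F q)"
  note MF = precomplexD(1)[OF M, of i] precomplexD(1)[OF pre, of q]
  have T: "module R ?T" by (rule tensor_module_module[OF MF])
  interpret T: module R ?T by (rule T)
  note b = has_basisD[OF basis[of q]]
  have c: "contract (q, b) i \<in> linear_maps R ?T (cobj M i)" "\<And>x y. x \<in> carrier (cobj M i) \<Longrightarrow> y \<in> carrier (cobj F q) \<Longrightarrow>
      contract (q, b) i (pure_tensor R (cobj M i) (cobj F q) x y) = \<beta> q b y \<odot>\<^bsub>cobj M i\<^esub> x" if "b \<in> B q" for b
    using contract[of "(q, b)"] that by auto
  show ?thesis
  proof (rule tensor_linear_eqI[OF MF T _ linear_maps_id(1) _ u])
    show "(\<lambda>u. \<Oplus>\<^bsub>?T\<^esub>b\<in>B q. pure_tensor R (cobj M i) (cobj F q) (contract (q, b) i u) b) \<in> linear_maps R ?T ?T"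
      by (rule linear_sum[OF T T]) (rule linear_comp[OF c(1) pure_tensor_linear(2)[OF MF b(3)]])
    fix x y assume x: "x \<in> carrier (cobj M i)" and y: "y \<in> carrier (cobj F q)"
    note l = pure_tensor_linear(1)[OF MF x]
    have "(\<Oplus>\<^bsub>?T\<^esub>b\<in>B q. pure_tensor R (cobj M i) (cobj F q) (contract (q, b) i (pure_tensor R (cobj M i) (cobj F q) x y)) b)
       = (\<Oplus>\<^bsub>?T\<^esub>b\<in>B q. \<beta> q b y \<odot>\<^bsub>?T\<^esub> pure_tensor R (cobj M i) (cobj F q) x b)"
      by (rule T.M.finsum_cong') (use b(3,7) x y pure_tensor_closed[OF MF] in
          \<open>auto simp: c(2)[simplified] linear_smult[OF pure_tensor_linear(2)[OF MF b(3)]]\<close>)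
    also have "\<dots> = pure_tensor R (cobj M i) (cobj F q) x y"
      by (rule linear_basis[OF basis T l y, symmetric])
    finally show "(\<Oplus>\<^bsub>?T\<^esub>b\<in>B q. pure_tensor R (cobj M i) (cobj F q) (contract (q, b) i (pure_tensor R (cobj M i) (cobj F q) x y)) b)
       = pure_tensor R (cobj M i) (cobj F q) x y" .
  qed
qed

lemma tensor_trivial:
  assumes q: "\<bar>q\<bar> > N" and u: "u \<in> carrier (tensor_module R (cobj M i) (cobj F q))"
  shows "u = \<zero>\<^bsub>tensor_module R (cobj M i) (cobj F q)\<^esub>"
proof -
  note MF = precomplexD(1)[OF M, of i] precomplexD(1)[OF pre, of q]
  note T = tensor_module_module[OF MF]
  show ?thesis
    by (rule tensor_linear_eqI[OF MF T linear_maps_id(1) linear_zero_map[OF T] _ u])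
      (use bounded[OF q] linear_zero[OF MF(2) T pure_tensor_linear(1)[OF MF]] in auto)
qed

lemma contract_diff_left:
  assumes k: "snd k \<in> B (fst k)" and u: "u \<in> carrier (tensor_module R (cobj M i) (cobj F (fst k)))"
  shows "contract k (i - 1) (diff_left (i + fst k) (i - 1) u) = cdiff M i (contract k i u)"
proof -
  note MF = precomplexD(1)[OF M, of i] precomplexD(1)[OF pre, of "fst k"]
  have e: "i - 1 + 1 = i" "i + fst k - i = fst k" "i + fst k - 1 - (i - 1) = fst k" by auto
  note dl = diff_left[where n = "i + fst k" and i = "i - 1", unfolded e]
  have d: "cdiff M i (r \<odot>\<^bsub>cobj M i\<^esub> x) = r \<odot>\<^bsub>cobj M (i - 1)\<^esub> cdiff M i x" if "r \<in> carrier R" "x \<in> carrier (cobj M i)" for r x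
    by (rule linear_smult[OF precomplexD(2)[OF M] that])
  show ?thesis
    by (rule tensor_linear_eqI[OF MF precomplexD(1)[OF M] linear_comp[OF dl(1) contract(1)[OF k]]
          linear_comp[OF contract(1)[OF k] precomplexD(2)[OF M]] _ u])
      (simp add: dl(2) contract(2)[OF k] linear_closed[OF precomplexD(2)[OF M]] d has_basisD(7)[OF basis k])
qed

text \<open>On \<open>x \<otimes> y\<close> the left side is the coordinate of \<open>d y\<close> at
  \<open>k\<close> times \<open>x\<close>. This is linear in \<open>y\<close>, and expanding
  \<open>y\<close> in the basis gives the matrix entries of the differential of
  \<open>F\<close>.\<close>

lemma contract_diff_right:
  assumes k: "snd k \<in> B (fst k)" and u: "u \<in> carrier (tensor_module R (cobj M i) (cobj F (fst k + 1)))"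
  shows "contract k i (diff_right (i + 1 + fst k) i u) = (\<Oplus>\<^bsub>cobj M i\<^esub>c\<in>B (fst k + 1).
    \<beta> (fst k) (snd k) (cdiff F (fst k + 1) c) \<odot>\<^bsub>cobj M i\<^esub> contract (fst k + 1, c) i u)"
proof -
  note MF = precomplexD(1)[OF M, of i] precomplexD(1)[OF pre, of "fst k + 1"]
  interpret M: module R "cobj M i" by (rule MF)
  have e: "i + 1 + fst k - i = fst k + 1" "i + 1 + fst k - 1 - i = fst k" by auto
  note dr = diff_right[where n = "i + 1 + fst k" and i = i, unfolded e]
  note b = has_basisD[OF basis[of "fst k + 1"]]
  have c: "contract (fst k + 1, b) i \<in> linear_maps R (tensor_module R (cobj M i) (cobj F (fst k + 1))) (cobj M i)"
    "\<And>x y. x \<in> carrier (cobj M i) \<Longrightarrow> y \<in> carrier (cobj F (fst k + 1)) \<Longrightarrow>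
      contract (fst k + 1, b) i (pure_tensor R (cobj M i) (cobj F (fst k + 1)) x y) = \<beta> (fst k + 1) b y \<odot>\<^bsub>cobj M i\<^esub> x"
    if "b \<in> B (fst k + 1)" for b
    using contract[of "(fst k + 1, b)"] that by auto
  have dF: "cdiff F (fst k + 1) \<in> linear_maps R (cobj F (fst k + 1)) (cobj F (fst k))"
    by (rule cdiff_linear_up[OF pre])
  have \<beta>d: "\<beta> (fst k) (snd k) (cdiff F (fst k + 1) y) \<in> carrier R" if "y \<in> carrier (cobj F (fst k + 1))" for y
    by (rule has_basisD(7)[OF basis k linear_closed[OF dF that]])
  show ?thesis
  proof (rule tensor_linear_eqI[OF MF M.module_axioms linear_comp[OF dr(1) contract(1)[OF k]] _ _ u])
    show "(\<lambda>u. \<Oplus>\<^bsub>cobj M i\<^esub>c\<in>B (fst k + 1). \<beta> (fst k) (snd k) (cdiff F (fst k + 1) c) \<odot>\<^bsub>cobj M i\<^esub> contract (fst k + 1, c) i u)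
        \<in> linear_maps R (tensor_module R (cobj M i) (cobj F (fst k + 1))) (cobj M i)"
      by (rule linear_sum[OF tensor_module_module[OF MF] M.module_axioms]) (rule linear_scale[OF M.module_axioms c(1) \<beta>d[OF b(3)]])
    fix x y assume x: "x \<in> carrier (cobj M i)" and y: "y \<in> carrier (cobj F (fst k + 1))"
    have lx: "(\<lambda>y. \<beta> (fst k) (snd k) (cdiff F (fst k + 1) y) \<odot>\<^bsub>cobj M i\<^esub> x) \<in> linear_maps R (cobj F (fst k + 1)) (cobj M i)"
      using \<beta>d x by (intro linear_mapsI) (auto simp: linear_add[OF linear_comp[OF dF has_basisD(4)[OF basis k]]]
          linear_smult[OF linear_comp[OF dF has_basisD(4)[OF basis k]]] M.smult_l_distr M.smult_assoc1)
    have "contract k i (diff_right (i + 1 + fst k) i (pure_tensor R (cobj M i) (cobj F (fst k + 1)) x y)) =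
        \<beta> (fst k) (snd k) (cdiff F (fst k + 1) y) \<odot>\<^bsub>cobj M i\<^esub> x"
      by (simp add: dr(2)[OF x y] contract(2)[OF k x linear_closed[OF dF y]])
    also have "\<dots> = (\<Oplus>\<^bsub>cobj M i\<^esub>c\<in>B (fst k + 1). \<beta> (fst k + 1) c y \<odot>\<^bsub>cobj M i\<^esub> (\<beta> (fst k) (snd k) (cdiff F (fst k + 1) c) \<odot>\<^bsub>cobj M i\<^esub> x))"
      by (rule linear_basis[OF basis M.module_axioms lx y])
    also have "\<dots> = (\<Oplus>\<^bsub>cobj M i\<^esub>c\<in>B (fst k + 1). \<beta> (fst k) (snd k) (cdiff F (fst k + 1) c) \<odot>\<^bsub>cobj M i\<^esub>
        contract (fst k + 1, c) i (pure_tensor R (cobj M i) (cobj F (fst k + 1)) x y))"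
      by (rule M.M.finsum_cong') (use x y b(3,7) \<beta>d in
          \<open>auto simp: c(2)[simplified] linear_smult[OF linear_scale[OF M.module_axioms linear_maps_id(1)]]\<close>)
    finally show "contract k i (diff_right (i + 1 + fst k) i (pure_tensor R (cobj M i) (cobj F (fst k + 1)) x y)) =
      (\<Oplus>\<^bsub>cobj M i\<^esub>c\<in>B (fst k + 1). \<beta> (fst k) (snd k) (cdiff F (fst k + 1) c) \<odot>\<^bsub>cobj M i\<^esub>
        contract (fst k + 1, c) i (pure_tensor R (cobj M i) (cobj F (fst k + 1)) x y))" .
  qed
qed

text \<open>Connects the concrete tensor product with the axioms of
  \<open>tensor_coordinates\<close>, so that all computation with classes of formal sums ends
  here.\<close>

lemma tensor_complex_coordinates: "tensor_coordinates R F N B \<beta> M Y tensor_inc tensor_coord"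
proof (intro tensor_coordinates.intro tensor_coordinates_axioms.intro basis_complex_axioms M Y_precomplex)
  fix k i assume k: "k \<in> K"
  note MF = precomplexD(1)[OF M] precomplexD(1)[OF pre]
  have e: "i + fst k - i = fst k" by simp
  show "tensor_inc k i \<in> linear_maps R (cobj M i) (cobj Y (i + fst k))"
    unfolding Y_obj
  proof (rule sum_module_linear)
    fix j
    have "(\<lambda>x. pure_tensor R (cobj M i) (cobj F (fst k)) x (snd k)) \<in> linear_maps R (cobj M i) (TM (i + fst k) i)"
      using pure_tensor_linear(2)[OF MF K_D(2)[OF k], of i] by simp
    then show "(\<lambda>x. tensor_inc k i x j) \<in> linear_maps R (cobj M i) (TM (i + fst k) j)"
      using linear_zero_map[OF TM_module] by (cases "j = i") (auto simp: tensor_inc_def)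
    fix x
    have "{j. tensor_inc k i x j \<noteq> \<zero>\<^bsub>TM (i + fst k) j\<^esub>} \<subseteq> {i}" by (auto simp: tensor_inc_def)
    then show "finite {j. tensor_inc k i x j \<noteq> \<zero>\<^bsub>TM (i + fst k) j\<^esub>}" by (rule finite_subset) simp
  qed
  have "(\<lambda>z. z i) \<in> linear_maps R (cobj Y (i + fst k)) (tensor_module R (cobj M i) (cobj F (fst k)))"
    using sum_proj_linear[of i R "TM (i + fst k)"] by (simp add: Y_obj)
  from linear_comp[OF this contract(1)[OF K_D(1)[OF k]]]
  show "tensor_coord k i \<in> linear_maps R (cobj Y (i + fst k)) (cobj M i)"
    unfolding tensor_coord_def[abs_def] .
  show "tensor_coord k i (tensor_inc k' i' x) = (if k = k' then x else \<zero>\<^bsub>cobj M i\<^esub>)"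
    if k': "k' \<in> K" and ii: "i + fst k = i' + fst k'" and x: "x \<in> carrier (cobj M i')" for k' i' x
  proof (cases "i = i'")
    case True
    interpret M: module R "cobj M i'" by (rule MF)
    have f: "fst k = fst k'" using ii True by simp
    have "tensor_coord k i (tensor_inc k' i' x) = \<beta> (fst k) (snd k) (snd k') \<odot>\<^bsub>cobj M i\<^esub> x"
      using contract(2)[OF K_D(1)[OF k], of x i "snd k'"] K_D(2)[OF k'] x True f by (simp add: tensor_coord_def tensor_inc_def)
    then show ?thesis
      using has_basisD(5)[OF basis K_D(1)[OF k], of "snd k'"] K_D(1)[OF k'] f x True by (auto simp: prod_eq_iff)
  next
    case False
    then have "tensor_coord k i (tensor_inc k' i' x) = contract k i \<zero>\<^bsub>tensor_module R (cobj M i) (cobj F (fst k))\<^esub>"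
      using ii[symmetric] by (simp add: tensor_coord_def tensor_inc_def)
    also have "\<dots> = \<zero>\<^bsub>cobj M i\<^esub>"
      by (rule linear_zero[OF tensor_module_module[OF MF] MF(1) contract(1)[OF K_D(1)[OF k]]])
    finally show ?thesis using False ii by auto
  qed
  fix y assume y: "y \<in> carrier (cobj Y (i + fst k))"
  let ?X = "cobj M (i - 1)"
  interpret X: module R ?X by (rule MF)
  have yi: "y i \<in> carrier (tensor_module R (cobj M i) (cobj F (fst k)))"
    using y[unfolded Y_obj sum_module_simps] e by metis
  have e1: "i - 1 + 1 + fst k = i + fst k" "i - 1 + 1 = i" "i + fst k - (i - 1) = fst k + 1" "i + fst k - 1 - (i - 1) = fst k" by auto
  have yi': "y (i - 1) \<in> carrier (tensor_module R ?X (cobj F (fst k + 1)))"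
    using y[unfolded Y_obj sum_module_simps] e1(3) by metis
  note cl = linear_closed[OF diff_left(1)[where n = "i + fst k" and i = "i - 1"], unfolded e1 e, OF yi]
    and cr = linear_closed[OF diff_right(1)[where n = "i + fst k" and i = "i - 1"], unfolded e1, OF yi']
  have cr': "sgn_power (tensor_module R ?X (cobj F (fst k))) (i - 1) (diff_right (i + fst k) (i - 1) (y (i - 1))) \<in> carrier (tensor_module R ?X (cobj F (fst k)))"
    by (rule sgn_power_closed[OF tensor_module_module[OF MF] cr])
  \<comment> \<open>If the degree \<open>fst k + 1\<close> lies outside the range, the relevant
    summand of the tensor product is zero and \<open>K\<close> has no index of that degree;
    otherwise the sum over \<open>K\<close> reduces to the basis in that degree.\<close>
  have sum: "contract k (i - 1) (diff_right (i + fst k) (i - 1) (y (i - 1))) =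
     (\<Oplus>\<^bsub>?X\<^esub>c\<in>K. if fst c = fst k + 1 then \<beta> (fst k) (snd k) (cdiff F (fst c) (snd c)) \<odot>\<^bsub>?X\<^esub> tensor_coord c (i - 1) y else \<zero>\<^bsub>?X\<^esub>)"
  proof (cases "\<bar>fst k + 1\<bar> > N")
    case True
    have "y (i - 1) = \<zero>\<^bsub>tensor_module R ?X (cobj F (fst k + 1))\<^esub>" by (rule tensor_trivial[OF True yi'])
    then have "diff_right (i + fst k) (i - 1) (y (i - 1)) = \<zero>\<^bsub>tensor_module R ?X (cobj F (fst k))\<^esub>"
      using linear_zero[OF tensor_module_module[OF MF] tensor_module_module[OF MF] diff_right(1)[where n = "i + fst k" and i = "i - 1", unfolded e1]] by simp
    moreover have "(\<Oplus>\<^bsub>?X\<^esub>c\<in>K. if fst c = fst k + 1 then \<beta> (fst k) (snd k) (cdiff F (fst c) (snd c)) \<odot>\<^bsub>?X\<^esub> tensor_coord c (i - 1) y else \<zero>\<^bsub>?X\<^esub>)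
       = (\<Oplus>\<^bsub>?X\<^esub>c\<in>K. \<zero>\<^bsub>?X\<^esub>)"
      by (rule X.M.finsum_cong') (use True in \<open>auto simp: K_def\<close>)
    ultimately show ?thesis
      using linear_zero[OF tensor_module_module[OF MF] MF(1) contract(1)[OF K_D(1)[OF k]]] by (simp add: X.M.finsum_zero)
  next
    case False
    let ?f = "\<lambda>c. \<beta> (fst k) (snd k) (cdiff F (fst c) (snd c)) \<odot>\<^bsub>?X\<^esub> tensor_coord c (i - 1) y"
    have f: "?f (fst k + 1, b) \<in> carrier ?X" if b: "b \<in> B (fst k + 1)" for b
      using linear_closed[OF contract(1)[of "(fst k + 1, b)" "i - 1"]] b yi'
        has_basisD(7)[OF basis K_D(1)[OF k] linear_closed[OF cdiff_linear_up[OF pre] has_basisD(3)[OF basis b]]]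
      by (simp add: tensor_coord_def)
    have "contract k (i - 1) (diff_right (i + fst k) (i - 1) (y (i - 1))) = (\<Oplus>\<^bsub>?X\<^esub>b\<in>B (fst k + 1). ?f (fst k + 1, b))"
      using contract_diff_right[OF K_D(1)[OF k] yi'] unfolding e1 by (simp add: tensor_coord_def)
    also have "\<dots> = (\<Oplus>\<^bsub>?X\<^esub>c\<in>K. if fst c = fst k + 1 then ?f c else \<zero>\<^bsub>?X\<^esub>)"
      by (rule K_sum[symmetric, where q = "fst k + 1" and f = ?f, OF MF(1) _ f]) (use False in auto)
    finally show ?thesis .
  qed
  have "tensor_coord k (i - 1) (cdiff Y (i + fst k) y) =
      contract k (i - 1) (diff_left (i + fst k) (i - 1) (y i) \<oplus>\<^bsub>tensor_module R ?X (cobj F (fst k))\<^esub>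
        sgn_power (tensor_module R ?X (cobj F (fst k))) (i - 1) (diff_right (i + fst k) (i - 1) (y (i - 1))))"
    unfolding tensor_coord_def Y_diff[OF y] e1 by (rule refl)
  also have "\<dots> = cdiff M i (contract k i (y i)) \<oplus>\<^bsub>?X\<^esub> sgn_power ?X (i - 1) (contract k (i - 1) (diff_right (i + fst k) (i - 1) (y (i - 1))))"
    unfolding linear_add[OF contract(1)[OF K_D(1)[OF k]] cl cr'] contract_diff_left[OF K_D(1)[OF k] yi]
      linear_sgn_power[OF tensor_module_module[OF MF] MF(1) contract(1)[OF K_D(1)[OF k]] cr] by (rule refl)
  finally show "tensor_coord k (i - 1) (cdiff Y (i + fst k) y) = cdiff M i (tensor_coord k i y) \<oplus>\<^bsub>?X\<^esub>
      sgn_power ?X (i - 1) (\<Oplus>\<^bsub>?X\<^esub>c\<in>K. if fst c = fst k + 1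
        then \<beta> (fst k) (snd k) (cdiff F (fst c) (snd c)) \<odot>\<^bsub>?X\<^esub> tensor_coord c (i - 1) y else \<zero>\<^bsub>?X\<^esub>)"
    unfolding sum by (simp add: tensor_coord_def)
next
  fix m y assume y: "y \<in> carrier (cobj Y m)"
  note MF = precomplexD(1)[OF M] precomplexD(1)[OF pre]
  interpret Y: module R "cobj Y m" by (rule precomplexD[OF Y_precomplex])
  have yj: "y j \<in> carrier (TM m j)" for j using y[unfolded Y_obj sum_module_simps] by blast
  have inc_closed: "tensor_inc k (m - fst k) x \<in> carrier (cobj Y m)" if "k \<in> K" "x \<in> carrier (cobj M (m - fst k))" for k x
  proof -
    have "\<forall>j. tensor_inc k (m - fst k) x j \<in> carrier (TM m j)"
      using pure_tensor_closed[OF MF that(2) K_D(2)[OF that(1)]] abelian_groupE(2)[OF module_abelian_group[OF TM_module]]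
      by (auto simp: tensor_inc_def)
    moreover have "{j. tensor_inc k (m - fst k) x j \<noteq> \<zero>\<^bsub>TM m j\<^esub>} \<subseteq> {m - fst k}" by (auto simp: tensor_inc_def)
    ultimately show ?thesis unfolding Y_obj sum_module_simps by (auto intro: finite_subset)
  qed
  have c: "tensor_coord k (m - fst k) y \<in> carrier (cobj M (m - fst k))" if "k \<in> K" for k
    using linear_closed[OF contract(1)[OF K_D(1)[OF that]], of "y (m - fst k)" "m - fst k"] yj[of "m - fst k"] by (simp add: tensor_coord_def)
  have Pi: "(\<lambda>k. tensor_inc k (m - fst k) (tensor_coord k (m - fst k) y)) \<in> K \<rightarrow> carrier (cobj Y m)"
    using inc_closed c by auto
  show "(\<Oplus>\<^bsub>cobj Y m\<^esub>k\<in>K. tensor_inc k (m - fst k) (tensor_coord k (m - fst k) y)) = y"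
  proof
    fix j
    let ?q = "m - j"
    let ?f = "\<lambda>k. pure_tensor R (cobj M j) (cobj F ?q) (contract k j (y j)) (snd k)"
    interpret T: module R "TM m j" by (rule TM_module)
    have pj: "(\<lambda>z. z j) \<in> linear_maps R (cobj Y m) (TM m j)" unfolding Y_obj by (rule sum_proj_linear)
    have f: "?f (?q, b) \<in> carrier (TM m j)" if b: "b \<in> B ?q" for b
      using pure_tensor_closed[OF MF linear_closed[OF contract(1)[of "(?q, b)" j]] has_basisD(3)[OF basis b]] b yj by simp
    have "(\<Oplus>\<^bsub>cobj Y m\<^esub>k\<in>K. tensor_inc k (m - fst k) (tensor_coord k (m - fst k) y)) j =
        (\<Oplus>\<^bsub>TM m j\<^esub>k\<in>K. tensor_inc k (m - fst k) (tensor_coord k (m - fst k) y) j)"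
      by (rule linear_finsum[OF Y.module_axioms T.module_axioms pj Pi])
    \<comment> \<open>The component \<open>j\<close> in total degree \<open>m\<close> sees only the
      basis elements of degree \<open>m - j\<close>.\<close>
    also have "\<dots> = (\<Oplus>\<^bsub>TM m j\<^esub>k\<in>K. if fst k = ?q then ?f k else \<zero>\<^bsub>TM m j\<^esub>)"
    proof (rule T.M.finsum_cong')
      show "(\<lambda>k. if fst k = ?q then ?f k else \<zero>\<^bsub>TM m j\<^esub>) \<in> K \<rightarrow> carrier (TM m j)"
        using f by (auto simp: K_def)
      show "tensor_inc k (m - fst k) (tensor_coord k (m - fst k) y) j = (if fst k = ?q then ?f k else \<zero>\<^bsub>TM m j\<^esub>)" if "k \<in> K" for k
        by (auto simp: tensor_inc_def tensor_coord_def)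
    qed simp
    also have "\<dots> = y j"
    proof (cases "\<bar>?q\<bar> > N")
      case True
      have "(\<Oplus>\<^bsub>TM m j\<^esub>k\<in>K. if fst k = ?q then ?f k else \<zero>\<^bsub>TM m j\<^esub>) = (\<Oplus>\<^bsub>TM m j\<^esub>k\<in>K. \<zero>\<^bsub>TM m j\<^esub>)"
        by (rule T.M.finsum_cong') (use True in \<open>auto simp: K_def\<close>)
      then show ?thesis using tensor_trivial[OF True yj] by (simp add: T.M.finsum_zero)
    next
      case False
      then show ?thesis using K_sum[where q = ?q and f = ?f, OF TM_module _ f] tensor_expand[OF yj] by simp
    qed
    finally show "(\<Oplus>\<^bsub>cobj Y m\<^esub>k\<in>K. tensor_inc k (m - fst k) (tensor_coord k (m - fst k) y)) j = y j" .
  qed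
qed

lemma hom_vanishes_tensor:
  assumes "precomplex R G"
  shows "hom_vanishes R G (tensor_complex R M F) n \<longleftrightarrow> hom_vanishes R (hom_complex R F G) M n"
  by (rule tensor_coordinates.hom_vanishes_adjoint[OF tensor_complex_coordinates assms])

end

end

section \<open>Minimal free resolutions over a noetherian local ring\<close>

subsection \<open>Finite generation\<close>

lemma image_submodule:
  assumes "module R M" "module R N" "f \<in> linear_maps R M N" "submodule S R M"
  shows "submodule (f ` S) R N"
proof -
  interpret M: module R M by fact
  interpret N: module R N by fact
  note S = M.submoduleE[OF assms(4)]
  have Sc: "x \<in> carrier M" if "x \<in> S" for x using S(1) that by blast
  have "\<zero>\<^bsub>M\<^esub> \<in> S" using subgroup.one_closed[OF submodule.axioms(1)[OF assms(4)]] by simp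
  then have "f \<zero>\<^bsub>M\<^esub> \<in> f ` S" by (rule imageI)
  then show ?thesis
    by (intro N.submoduleI)
      (auto simp: linear_zero[OF assms(1-3)] linear_closed[OF assms(3) Sc] Sc linear_neg[OF assms(1-3), symmetric]
        linear_add[OF assms(3), symmetric] linear_smult[OF assms(3), symmetric] S intro!: imageI)
qed

lemma vimage_submodule:
  assumes "module R M" "module R N" "f \<in> linear_maps R M N" "submodule S R N"
  shows "submodule {x \<in> carrier M. f x \<in> S} R M"
proof -
  interpret M: module R M by fact
  interpret N: module R N by fact
  have "\<zero>\<^bsub>N\<^esub> \<in> S" using subgroup.one_closed[OF submodule.axioms(1)[OF assms(4)]] by simp
  then show ?thesis
    by (intro M.submoduleI) (auto simp: linear_zero[OF assms(1-3)] linear_neg[OF assms(1-3)]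
        linear_add[OF assms(3)] linear_smult[OF assms(3)] N.submoduleE[OF assms(4)])
qed

lemma submodule_closed:
  assumes "module R M" "submodule S R M"
  shows "x \<in> S \<Longrightarrow> x \<in> carrier M" "\<zero>\<^bsub>M\<^esub> \<in> S" "x \<in> S \<Longrightarrow> y \<in> S \<Longrightarrow> x \<oplus>\<^bsub>M\<^esub> y \<in> S"
    "x \<in> S \<Longrightarrow> y \<in> S \<Longrightarrow> x \<ominus>\<^bsub>M\<^esub> y \<in> S" "r \<in> carrier R \<Longrightarrow> x \<in> S \<Longrightarrow> r \<odot>\<^bsub>M\<^esub> x \<in> S"
proof -
  interpret M: module R M by fact
  note S = M.submoduleE[OF assms(2)]
  show "x \<in> S \<Longrightarrow> x \<in> carrier M" using S(1) by blast
  show "\<zero>\<^bsub>M\<^esub> \<in> S" using subgroup.one_closed[OF submodule.axioms(1)[OF assms(2)]] by simp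
  show "x \<in> S \<Longrightarrow> y \<in> S \<Longrightarrow> x \<oplus>\<^bsub>M\<^esub> y \<in> S" by (rule S)
  show "x \<in> S \<Longrightarrow> y \<in> S \<Longrightarrow> x \<ominus>\<^bsub>M\<^esub> y \<in> S" unfolding M.minus_eq by (intro S)
  show "r \<in> carrier R \<Longrightarrow> x \<in> S \<Longrightarrow> r \<odot>\<^bsub>M\<^esub> x \<in> S" by (rule S)
qed

lemma submodule_Int: "module R M \<Longrightarrow> submodule S R M \<Longrightarrow> submodule T R M \<Longrightarrow> submodule (S \<inter> T) R M"
proof -
  assume a: "module R M" "submodule S R M" "submodule T R M"
  interpret M: module R M by fact
  show ?thesis
    by (rule M.submoduleI) (use submodule_closed[OF a(1,2)] submodule_closed[OF a(1,3)] M.submoduleE(3)[OF a(2)] M.submoduleE(3)[OF a(3)] in auto)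
qed

lemma submodule_gen_image:
  assumes W: "module R W" and w: "w \<in> J \<rightarrow> carrier W" and x: "x \<in> submodule_gen R W (w ` J)"
  obtains \<phi> where "\<phi> \<in> carrier (free_module R J)" "x = lin_ext R W w \<phi>"
proof -
  have R: "cring R" by (rule module_cring[OF W])
  note F = free_module_module[OF R]
  interpret F: module R "free_module R J" by (rule F)
  have "submodule (lin_ext R W w ` carrier (free_module R J)) R W"
    by (rule image_submodule[OF F W lin_ext_linear[OF W w] F.carrier_is_submodule])
  moreover have "w ` J \<subseteq> lin_ext R W w ` carrier (free_module R J)"
  proof
    fix v assume "v \<in> w ` J"
    then obtain j where "j \<in> J" "v = w j" by blast
    then show "v \<in> lin_ext R W w ` carrier (free_module R J)"
      using lin_ext_gen[OF W w] free_gen_closed[OF R] by (metis image_eqI)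
  qed
  ultimately show thesis using submodule_gen_least x that by blast
qed

lemma lin_ext_in_submodule:
  assumes W: "module R W" and S: "submodule S R W" and w: "w \<in> J \<rightarrow> S" and y: "y \<in> carrier (free_module R J)"
  shows "lin_ext R W w y \<in> S"
proof -
  interpret W: module R W by (rule W)
  note c = submodule_closed[OF W S]
  have yw: "y b \<odot>\<^bsub>W\<^esub> w b \<in> S" if "b \<in> J" for b
    by (rule c(5)[OF free_carrierD(1)[OF y] Pi_mem[OF w that]])
  have "(\<Oplus>\<^bsub>W\<^esub>s\<in>B. y s \<odot>\<^bsub>W\<^esub> w s) \<in> S" if "finite B" "B \<subseteq> J" for B
    using that
  proof (induction B rule: finite_induct)
    case (insert b B)
    have "(\<Oplus>\<^bsub>W\<^esub>s\<in>insert b B. y s \<odot>\<^bsub>W\<^esub> w s) = y b \<odot>\<^bsub>W\<^esub> w b \<oplus>\<^bsub>W\<^esub> (\<Oplus>\<^bsub>W\<^esub>s\<in>B. y s \<odot>\<^bsub>W\<^esub> w s)"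
      by (rule W.M.finsum_insert[OF insert.hyps]) (use insert.prems c(1)[OF yw] in auto)
    then show ?case using c(3)[OF yw] insert by simp
  qed (use c(2) in simp)
  then show ?thesis unfolding lin_ext_def using free_carrierD(3,4)[OF y] by blast
qed

lemma regular_submodule_ideal:
  assumes R: "cring R" and J: "submodule J R (regular_module R)"
  shows "ideal J R"
proof -
  interpret R: cring R by (rule R)
  note Q = regular_module_module[OF R]
  note c = submodule_closed[OF Q J, simplified]
  have neg: "\<ominus>\<^bsub>R\<^esub> x \<in> J" if "x \<in> J" for x
    using c(5)[of "\<ominus>\<^bsub>R\<^esub> \<one>\<^bsub>R\<^esub>" x] that c(1) by (simp add: R.l_minus)
  show ?thesis
  proof (rule idealI[OF R.ring_axioms])
    show "subgroup J (add_monoid R)"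
      by (rule R.add.subgroupI) (use c neg in auto)
    show "x \<otimes>\<^bsub>R\<^esub> a \<in> J" "a \<otimes>\<^bsub>R\<^esub> x \<in> J" if "a \<in> J" "x \<in> carrier R" for a x
      using c(5)[OF that(2,1)] R.m_comm[OF that(2) c(1)[OF that(1)]] by simp_all
  qed
qed

text \<open>Induction on the rank. The coordinates at \<open>a\<close> of the elements of
  \<open>U\<close> form an ideal, finitely generated because \<open>R\<close> is noetherian, and the
  elements with vanishing coordinate form a submodule of the free module on
  \<open>J\<close>.\<close>

lemma free_submodule_fg:
  assumes R: "cring R" "noetherian_ring R" and "finite J" and "submodule U R (free_module R J)"
  shows "\<exists>D. finite D \<and> D \<subseteq> U \<and> U \<subseteq> submodule_gen R (free_module R J) D"
  using assms(3,4)
proof (induction J arbitrary: U rule: finite_induct)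
  case empty
  have "U \<subseteq> carrier (free_module R {})" using submodule_closed(1)[OF free_module_module[OF R(1)] empty] by blast
  then have "U \<subseteq> {\<lambda>s. \<zero>\<^bsub>R\<^esub>}" using free_carrierD(2) by fastforce
  moreover have "(\<lambda>s. \<zero>\<^bsub>R\<^esub>) \<in> submodule_gen R (free_module R {}) {}"
    using submodule_closed(2)[OF free_module_module[OF R(1)] submodule_gen_submodule[OF free_module_module[OF R(1)] empty_subsetI]] by simp
  ultimately show ?case by (intro exI[of _ "{}"]) auto
next
  case (insert a J U)
  interpret R: noetherian_ring R by (rule R)
  let ?W = "free_module R (insert a J)" and ?W' = "free_module R J"
  note W = free_module_module[OF R(1), of "insert a J"] and W' = free_module_module[OF R(1), of J]
  note Q = regular_module_module[OF R(1)]
  note Uc = submodule_closed[OF W insert.prems]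
  note ev = free_eval_linear[of a R "insert a J"]
  have "ideal ((\<lambda>u. u a) ` U) R"
    by (rule regular_submodule_ideal[OF R(1) image_submodule[OF W Q ev insert.prems]])
  then obtain X where X: "X \<subseteq> carrier R" "finite X" "(\<lambda>u. u a) ` U = genideal R X"
    using R.finetely_gen by blast
  have "X \<subseteq> (\<lambda>u. u a) ` U" using R.genideal_self[OF X(1)] X(3) by blast
  \<comment> \<open>Each generator of the ideal is the coordinate of some element of
    \<open>U\<close>; such elements form \<open>D1\<close>, while \<open>D2\<close> will generate
    the part of \<open>U\<close> with coordinate zero at \<open>a\<close>.\<close>
  then obtain D1 where D1: "D1 \<subseteq> U" "finite D1" "X = (\<lambda>u. u a) ` D1" by (metis X(2) finite_subset_image)
  have incl: "?W' = ?W\<lparr>carrier := carrier ?W'\<rparr>" by (simp add: free_module_def)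
  \<comment> \<open>Elements of a free module are functions on the whole type that vanish off the
    index set. The free module on \<open>J\<close> is thus literally a subset of the larger
    one.\<close>
  have sub: "carrier ?W' = {u \<in> carrier ?W. u a = \<zero>\<^bsub>R\<^esub>}"
    using insert.hyps(2) by (auto simp: free_module_def)
  let ?U' = "{u \<in> U. u a = \<zero>\<^bsub>R\<^esub>}"
  have idl: "(\<lambda>u. u) \<in> linear_maps R ?W' ?W"
    by (rule linear_mapsI) (auto simp: sub)
  have "?U' = {u \<in> carrier ?W'. u \<in> U}" using Uc(1) by (auto simp: sub)
  then have "submodule ?U' R ?W'" using vimage_submodule[OF W' W idl insert.prems] by simp
  from insert.IH[OF this] obtain D2 where D2: "finite D2" "D2 \<subseteq> ?U'" "?U' \<subseteq> submodule_gen R ?W' D2" by (elim exE conjE)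
  let ?D = "D1 \<union> D2"
  have DW: "?D \<subseteq> carrier ?W" using D1 D2 Uc(1) by blast
  note gen = submodule_gen_submodule[OF W DW]
  note gc = submodule_closed[OF W gen]
  have DU: "submodule_gen R ?W ?D \<subseteq> U" by (rule submodule_gen_least[OF insert.prems]) (use D1 D2 in blast)
  have D2': "submodule_gen R ?W' D2 \<subseteq> submodule_gen R ?W ?D"
  proof -
    have "D2 \<subseteq> carrier ?W'" using D2(2) Uc(1) by (auto simp: sub)
    then have "D2 \<subseteq> {x \<in> carrier ?W'. x \<in> submodule_gen R ?W ?D}"
      using submodule_gen_incl[of _ ?D R ?W] by blast
    then have "submodule_gen R ?W' D2 \<subseteq> {x \<in> carrier ?W'. x \<in> submodule_gen R ?W ?D}"
      by (rule submodule_gen_least[OF vimage_submodule[OF W' W idl gen]])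
    then show ?thesis by blast
  qed
  have "genideal R X \<subseteq> (\<lambda>u. u a) ` submodule_gen R ?W ?D"
  proof (rule R.genideal_minimal[OF regular_submodule_ideal[OF R(1) image_submodule[OF W Q ev gen]]])
    show "X \<subseteq> (\<lambda>u. u a) ` submodule_gen R ?W ?D"
      unfolding D1(3) using submodule_gen_incl[of _ ?D R ?W] by blast
  qed
  \<comment> \<open>Subtracting such a \<open>v\<close> from \<open>u\<close> removes the coordinate
    at \<open>a\<close> and leads to the submodule generated by \<open>D2\<close>.\<close>
  then have *: "\<exists>v\<in>submodule_gen R ?W ?D. u a = v a" if "u \<in> U" for u using X(3) that by blast
  have "U \<subseteq> submodule_gen R ?W ?D"
  proof
    fix u assume u: "u \<in> U"
    obtain v where v: "v \<in> submodule_gen R ?W ?D" "u a = v a" using *[OF u] by blast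
    have vU: "v \<in> U" using v DU by blast
    interpret W: module R ?W by (rule W)
    have "(u \<ominus>\<^bsub>?W\<^esub> v) a = u a \<ominus>\<^bsub>regular_module R\<^esub> v a"
      by (rule linear_minus[OF W Q ev Uc(1)[OF u] Uc(1)[OF vU]])
    also have "\<dots> = \<zero>\<^bsub>R\<^esub>"
      using abelian_group.minus_self[OF module_abelian_group[OF Q]] free_carrierD(1)[OF Uc(1)[OF vU]] v(2) by simp
    finally have "u \<ominus>\<^bsub>?W\<^esub> v \<in> ?U'" using Uc(4)[OF u vU] by simp
    then have "u \<ominus>\<^bsub>?W\<^esub> v \<in> submodule_gen R ?W ?D" using D2(3) D2' by blast
    then have "(u \<ominus>\<^bsub>?W\<^esub> v) \<oplus>\<^bsub>?W\<^esub> v \<in> submodule_gen R ?W ?D" by (rule gc(3)[OF _ v(1)])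
    moreover have "(u \<ominus>\<^bsub>?W\<^esub> v) \<oplus>\<^bsub>?W\<^esub> v = u"
      using Uc(1)[OF u] Uc(1)[OF vU] by (simp add: W.minus_eq W.M.a_assoc W.M.l_neg del: free_module_simps)
    ultimately show "u \<in> submodule_gen R ?W ?D" by simp
  qed
  then show ?case using D1 D2 by (intro exI[of _ ?D]) auto
qed

subsection \<open>Minimal generating sets\<close>

definition max_ideal :: "('a, 'c) ring_scheme \<Rightarrow> 'a set" where
  "max_ideal R = (THE I. maximalideal I R)"

text \<open>Generation of \<open>S\<close> modulo \<open>N\<close> without forming the quotient.
  Generators are a family rather than a set so that the index type can be prescribed: the
  resolutions compared in \<open>proj_dim\<close> have a fixed element type.\<close>

definition generates :: "('a, 'c) ring_scheme \<Rightarrow> ('a, 'w) module \<Rightarrow> 'w set \<Rightarrow> 'w set \<Rightarrow> 'i set \<Rightarrow> ('i \<Rightarrow> 'w) \<Rightarrow> bool" where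
  "generates R W S N J w \<longleftrightarrow> finite J \<and> w \<in> J \<rightarrow> S \<and> (\<forall>s\<in>S. \<exists>\<phi>\<in>carrier (free_module R J). s \<ominus>\<^bsub>W\<^esub> lin_ext R W w \<phi> \<in> N)"

text \<open>Finite generation of homology in terms of cycles, the form in which the generators enter
  the mapping cone.\<close>

definition fg_homology :: "('a, 'c) ring_scheme \<Rightarrow> ('a, 'p) chain_complex \<Rightarrow> int \<Rightarrow> bool" where
  "fg_homology R P i \<longleftrightarrow> (\<exists>C\<subseteq>cycles P i. finite C \<and>
     (\<forall>z\<in>cycles P i. \<exists>c\<in>submodule_gen R (cobj P i) C. z \<ominus>\<^bsub>cobj P i\<^esub> c \<in> boundaries P i))"

context
  fixes R :: "('a, 'c) ring_scheme"
  assumes local: "noetherian_local_ring R"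
begin

lemma R_cring: "cring R" and R_noetherian: "noetherian_ring R"
  using local by (auto simp: noetherian_local_ring_def)

interpretation R: cring R by (rule R_cring)

lemma max_ideal: "maximalideal (max_ideal R) R"
  unfolding max_ideal_def by (rule theI') (use local in \<open>simp add: noetherian_local_ring_def\<close>)

lemma max_ideal_unique: "maximalideal I R \<Longrightarrow> I = max_ideal R"
  using max_ideal local by (auto simp: noetherian_local_ring_def)

lemma max_ideal_ideal: "ideal (max_ideal R) R"
  by (rule maximalideal.axioms(1)[OF max_ideal])

lemma zero_in_max_ideal: "\<zero>\<^bsub>R\<^esub> \<in> max_ideal R"
  using additive_subgroup.zero_closed[OF ideal.axioms(1)[OF max_ideal_ideal]] .

lemma one_notin_max_ideal: "\<one>\<^bsub>R\<^esub> \<notin> max_ideal R"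
  using ideal.one_imp_carrier[OF max_ideal_ideal] maximalideal.I_notcarr[OF max_ideal] by blast

lemma one_not_zero: "\<one>\<^bsub>R\<^esub> \<noteq> \<zero>\<^bsub>R\<^esub>"
  using one_notin_max_ideal zero_in_max_ideal by metis

text \<open>A nonunit generates a proper ideal. By Zorn's lemma this is contained in a maximal
  ideal, and the ring has only one.\<close>

lemma unit_outside_max_ideal:
  assumes c: "c \<in> carrier R" "c \<notin> max_ideal R"
  shows "c \<in> Units R"
proof (rule ccontr)
  assume nu: "c \<notin> Units R"
  interpret N: noetherian_ring R by (rule R_noetherian)
  let ?A = "{I. ideal I R \<and> c \<in> I \<and> I \<noteq> carrier R}"
  have "PIdl\<^bsub>R\<^esub> c \<noteq> carrier R"
  proof
    assume "PIdl\<^bsub>R\<^esub> c = carrier R"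
    then obtain x where "x \<in> carrier R" "\<one>\<^bsub>R\<^esub> = x \<otimes>\<^bsub>R\<^esub> c"
      using R.one_closed unfolding cgenideal_def by blast
    then show False using nu c(1) R.m_comm[OF c(1)] by (auto simp: Units_def)
  qed
  then have ne: "?A \<noteq> {}" using R.cgenideal_ideal[OF c(1)] R.cgenideal_self[OF c(1)] by blast
  have "\<exists>I\<in>?A. \<forall>X\<in>?A. I \<subseteq> X \<longrightarrow> X = I"
  proof (rule subset_Zorn_nonempty[OF ne])
    fix C assume C: "C \<noteq> {}" "subset.chain ?A C"
    then have "subset.chain {I. ideal I R} C" by (auto simp: pred_on.chain_def)
    \<comment> \<open>In a noetherian ring a nonempty chain of ideals contains its own union, so the
      upper bound is proper simply by being a member of the chain.\<close>
    then have "\<Union>C \<in> C" by (rule N.ideal_chain_is_trivial[OF C(1)])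
    then show "\<Union>C \<in> ?A" using C(2) by (auto simp: pred_on.chain_def)
  qed
  then obtain I where I: "ideal I R" "c \<in> I" "I \<noteq> carrier R" and max: "\<And>X. X \<in> ?A \<Longrightarrow> I \<subseteq> X \<Longrightarrow> X = I" by blast
  have "maximalideal I R"
    by (rule maximalidealI[OF I(1)]) (use I max in auto)
  then show False using max_ideal_unique I(2) c(2) by blast
qed

text \<open>A generator with a unit coefficient in a relation is redundant, so the coefficients of the
  relations between the elements of a generating set of minimal size lie in the maximal ideal.\<close>

lemma minimal_generators:
  fixes J0 :: "'i set"
  assumes W: "module R W" and S: "submodule S R W" and N: "submodule N R W" "N \<subseteq> S"
    and ex: "generates R W S N J0 w0"
  obtains J :: "'i set" and w where "generates R W S N J w"
    "\<And>\<phi> j. \<phi> \<in> carrier (free_module R J) \<Longrightarrow> lin_ext R W w \<phi> \<in> N \<Longrightarrow> \<phi> j \<in> max_ideal R"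
proof -
  obtain J :: "'i set" and w where g: "generates R W S N J w"
    and min: "\<And>J' w'. generates R W S N (J' :: 'i set) w' \<Longrightarrow> card J \<le> card J'"
  proof -
    let ?P = "\<lambda>Jw. generates R W S N (fst Jw :: 'i set) (snd Jw)"
    have "?P (J0, w0)" using ex by simp
    from ex_has_least_nat[of ?P, OF this, of "\<lambda>Jw. card (fst Jw)"]
    obtain Jw where "?P Jw" "\<forall>y. ?P y \<longrightarrow> card (fst Jw) \<le> card (fst y)" by auto
    then show thesis by (intro that[of "fst Jw" "snd Jw"]) auto
  qed
  interpret W: module R W by (rule W)
  note Sc = submodule_closed[OF W S] and Nc = submodule_closed[OF W N(1)]
  have wS: "w \<in> J \<rightarrow> S" and fin: "finite J" using g by (auto simp: generates_def)
  then have wW: "w \<in> J \<rightarrow> carrier W" using Sc(1) by auto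
  let ?F = "free_module R J"
  interpret F: module R ?F by (rule free_module_module[OF R_cring])
  note le = lin_ext_linear[OF W wW]
  have "\<phi> j \<in> max_ideal R" if \<phi>: "\<phi> \<in> carrier ?F" "lin_ext R W w \<phi> \<in> N" for \<phi> j
  proof (rule ccontr)
    assume nm: "\<phi> j \<notin> max_ideal R"
    note \<phi>c = free_carrierD[OF \<phi>(1)]
    have j: "j \<in> J" using nm \<phi>c(2) zero_in_max_ideal by metis
    have u: "\<phi> j \<in> Units R" by (rule unit_outside_max_ideal[OF \<phi>c(1) nm])
    have "generates R W S N (J - {j}) w"
      unfolding generates_def
    proof (intro conjI ballI)
      fix s assume s: "s \<in> S"
      obtain \<psi> where \<psi>: "\<psi> \<in> carrier ?F" "s \<ominus>\<^bsub>W\<^esub> lin_ext R W w \<psi> \<in> N" using g s unfolding generates_def by blast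
      note \<psi>c = free_carrierD[OF \<psi>(1)]
      \<comment> \<open>Chosen so that subtracting \<open>c\<close> times the relation
        \<open>\<phi>\<close> from \<open>\<psi>\<close> clears the coefficient at \<open>j\<close>.
        The relation evaluates into \<open>N\<close>, so the element represented modulo
        \<open>N\<close> does not change.\<close>
      define c where "c = \<psi> j \<otimes>\<^bsub>R\<^esub> inv\<^bsub>R\<^esub> (\<phi> j)"
      have c: "c \<in> carrier R" "c \<otimes>\<^bsub>R\<^esub> \<phi> j = \<psi> j"
        using \<psi>c(1) \<phi>c(1) u by (simp_all add: c_def R.m_assoc)
      define \<chi> where "\<chi> = \<psi> \<ominus>\<^bsub>?F\<^esub> (c \<odot>\<^bsub>?F\<^esub> \<phi>)"
      have c\<phi>: "c \<odot>\<^bsub>?F\<^esub> \<phi> \<in> carrier ?F" by (rule F.smult_closed[OF c(1) \<phi>(1)])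
      have \<chi>: "\<chi> \<in> carrier ?F" unfolding \<chi>_def by (rule F.M.minus_closed[OF \<psi>(1) c\<phi>])
      have "\<chi> j = \<psi> j \<ominus>\<^bsub>regular_module R\<^esub> (c \<odot>\<^bsub>?F\<^esub> \<phi>) j"
        unfolding \<chi>_def by (rule linear_minus[OF F.module_axioms regular_module_module[OF R_cring] free_eval_linear \<psi>(1) c\<phi>])
      also have "\<dots> = \<zero>\<^bsub>R\<^esub>"
        using abelian_group.minus_self[OF module_abelian_group[OF regular_module_module[OF R_cring]]] \<psi>c(1) c by simp
      finally have "\<chi> \<in> carrier (free_module R (J - {j}))" using \<chi> by (auto simp: free_module_def)
      moreover have "s \<ominus>\<^bsub>W\<^esub> lin_ext R W w \<chi> \<in> N"
      proof -
        have l: "lin_ext R W w \<phi> \<in> carrier W" "lin_ext R W w \<psi> \<in> carrier W" using linear_closed[OF le] \<phi>(1) \<psi>(1) by auto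
        have "lin_ext R W w \<chi> = lin_ext R W w \<psi> \<ominus>\<^bsub>W\<^esub> c \<odot>\<^bsub>W\<^esub> lin_ext R W w \<phi>"
          unfolding \<chi>_def linear_minus[OF F.module_axioms W le \<psi>(1) c\<phi>] linear_smult[OF le c(1) \<phi>(1)] by (rule refl)
        then have "s \<ominus>\<^bsub>W\<^esub> lin_ext R W w \<chi> = (s \<ominus>\<^bsub>W\<^esub> lin_ext R W w \<psi>) \<oplus>\<^bsub>W\<^esub> c \<odot>\<^bsub>W\<^esub> lin_ext R W w \<phi>"
          using Sc(1)[OF s] l c(1) by (simp add: W.minus_eq W.M.minus_add W.M.minus_minus W.M.a_assoc)
        then show ?thesis using Nc(3)[OF \<psi>(2) Nc(5)[OF c(1) \<phi>(2)]] by simp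
      qed
      ultimately show "\<exists>\<phi>\<in>carrier (free_module R (J - {j})). s \<ominus>\<^bsub>W\<^esub> lin_ext R W w \<phi> \<in> N" by blast
    qed (use fin wS in auto)
    then show False using min card_Diff1_less[OF fin j] by fastforce
  qed
  then show thesis using that g by blast
qed

text \<open>The inductive step: given \<open>D' : F\<^sub>n\<^sub>-\<^sub>1 \<rightarrow> F\<^sub>n\<^sub>-\<^sub>2\<close> and \<open>\<phi>' : F\<^sub>n\<^sub>-\<^sub>1 \<rightarrow> P\<^sub>n\<^sub>-\<^sub>1\<close>, the module
  \<open>F\<^sub>n\<close> is free on a minimal generating set of the homology of the mapping cone.\<close>

lemma resolution_step:
  fixes J' :: "'i set" and P :: "('a, 'p) chain_complex"
  assumes inf: "infinite (UNIV :: 'i set)" and P: "is_complex R P" and J': "finite J'"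
    and D': "D' \<in> linear_maps R (free_module R J') (free_module R J'')"
    and \<phi>': "\<phi>' \<in> linear_maps R (free_module R J') (cobj P (n - 1))"
    and fg: "fg_homology R P n"
  obtains J :: "'i set" and D \<phi> where "finite J" "D \<in> linear_maps R (free_module R J) (free_module R J')"
    "\<phi> \<in> linear_maps R (free_module R J) (cobj P n)"
    "\<And>y. y \<in> carrier (free_module R J) \<Longrightarrow> D' (D y) = (\<lambda>s. \<zero>\<^bsub>R\<^esub>) \<and> \<phi>' (D y) = cdiff P n (\<phi> y)"
    "\<And>x p. x \<in> carrier (free_module R J') \<Longrightarrow> p \<in> carrier (cobj P n) \<Longrightarrow> D' x = (\<lambda>s. \<zero>\<^bsub>R\<^esub>) \<Longrightarrow> \<phi>' x = cdiff P n p \<Longrightarrow>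
      \<exists>y\<in>carrier (free_module R J). D y = x \<and> p \<ominus>\<^bsub>cobj P n\<^esub> \<phi> y \<in> boundaries P n"
    "\<And>y s. y \<in> carrier (free_module R J) \<Longrightarrow> D y = (\<lambda>s. \<zero>\<^bsub>R\<^esub>) \<Longrightarrow> \<phi> y \<in> boundaries P n \<Longrightarrow> y s \<in> max_ideal R"
proof -
  let ?F' = "free_module R J'" and ?Pn = "cobj P n"
  note F' = free_module_module[OF R_cring, of J'] and F'' = free_module_module[OF R_cring, of J'']
  note pP = is_complexD(1)[OF P]
  note Pn = is_complexD(2)[OF P, of n] and Pn' = is_complexD(2)[OF P, of "n - 1"]
  interpret F': module R ?F' by (rule F')
  interpret Pn: module R ?Pn by (rule Pn)
  interpret Pn': module R "cobj P (n - 1)" by (rule Pn')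
  let ?W = "pair_module ?F' ?Pn"
  have W: "module R ?W" by (rule pair_module_module[OF F' Pn])
  interpret W: module R ?W by (rule W)
  note d = is_complexD(3)[OF P, of n]
  \<comment> \<open>\<open>S\<close> consists of the cycles of the mapping cone and
    \<open>Nn\<close>, defined below, of its boundaries so far. These come from \<open>P\<close>
    alone, because \<open>F\<^sub>n\<close> is yet to be constructed.\<close>
  define S where "S = {z \<in> carrier ?W. D' (fst z) = \<zero>\<^bsub>free_module R J''\<^esub>} \<inter>
    {z \<in> carrier ?W. \<phi>' (fst z) \<ominus>\<^bsub>cobj P (n - 1)\<^esub> cdiff P n (snd z) = \<zero>\<^bsub>cobj P (n - 1)\<^esub>}"
  have S: "submodule S R ?W"
    unfolding S_def
    by (intro submodule_Int[OF W] kernel_submodule[OF W F''] kernel_submodule[OF W Pn'] linear_diff[OF Pn']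
        linear_comp[OF fst_linear D'] linear_comp[OF fst_linear \<phi>'] linear_comp[OF snd_linear d])
  have S_iff: "(x, p) \<in> S \<longleftrightarrow> x \<in> carrier ?F' \<and> p \<in> carrier ?Pn \<and> D' x = (\<lambda>s. \<zero>\<^bsub>R\<^esub>) \<and> \<phi>' x = cdiff P n p" for x p
    using Pn'.M.minus_eq_zero_iff linear_closed[OF \<phi>'] linear_closed[OF d] by (auto simp: S_def)
  define Nn where "Nn = {z \<in> carrier ?W. snd z \<in> boundaries P n} \<inter> {z \<in> carrier ?W. fst z = \<zero>\<^bsub>?F'\<^esub>}"
  have N: "submodule Nn R ?W"
    unfolding Nn_def
    by (intro submodule_Int[OF W] vimage_submodule[OF W Pn snd_linear boundaries_submodule[OF pP]] kernel_submodule[OF W F' fst_linear])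
  have N_iff: "(x, p) \<in> Nn \<longleftrightarrow> x = (\<lambda>s. \<zero>\<^bsub>R\<^esub>) \<and> p \<in> boundaries P n" for x p
    using submodule_closed(1)[OF Pn boundaries_submodule[OF pP]] F'.M.zero_closed by (auto simp: Nn_def)
  have NS: "Nn \<subseteq> S"
  proof
    fix z assume "z \<in> Nn"
    then obtain p where z: "z = (\<lambda>s. \<zero>\<^bsub>R\<^esub>, p)" "p \<in> boundaries P n" using N_iff by (cases z) auto
    have "p \<in> cycles P n" by (rule boundaries_cycles[OF P z(2)])
    then show "z \<in> S"
      using linear_zero[OF F' F'' D'] linear_zero[OF F' Pn' \<phi>'] F'.M.zero_closed unfolding z(1) S_iff by (auto simp: cycles_def)
  qed
  \<comment> \<open>\<open>S\<close> modulo \<open>Nn\<close> is finitely generated: its first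
    projection is a submodule of a finite free module, and the elements with first coordinate zero
    are the cycles of \<open>P\<close>, whose classes are those of the homology of
    \<open>P\<close>.\<close>
  have "\<exists>A. finite A \<and> A \<subseteq> S \<and> (\<forall>s\<in>S. \<exists>a\<in>submodule_gen R ?W A. s \<ominus>\<^bsub>?W\<^esub> a \<in> Nn)"
  proof -
    have "submodule (fst ` S) R ?F'" by (rule image_submodule[OF W F' fst_linear S])
    then obtain D1 where "finite D1" "D1 \<subseteq> fst ` S" and D1: "fst ` S \<subseteq> submodule_gen R ?F' D1"
      using free_submodule_fg[OF R_cring R_noetherian J'] by blast
    then obtain A1 where A1: "finite A1" "A1 \<subseteq> S" "D1 = fst ` A1" by (metis finite_subset_image)
    obtain C where C: "C \<subseteq> cycles P n" "finite C"
      "\<And>z. z \<in> cycles P n \<Longrightarrow> \<exists>c\<in>submodule_gen R ?Pn C. z \<ominus>\<^bsub>?Pn\<^esub> c \<in> boundaries P n"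
      using fg unfolding fg_homology_def by blast
    let ?A2 = "Pair (\<lambda>s. \<zero>\<^bsub>R\<^esub>) ` C" and ?A = "A1 \<union> Pair (\<lambda>s. \<zero>\<^bsub>R\<^esub>) ` C"
    have z0: "((\<lambda>s. \<zero>\<^bsub>R\<^esub>), z) \<in> S \<longleftrightarrow> z \<in> cycles P n" for z
      using linear_zero[OF F' F'' D'] linear_zero[OF F' Pn' \<phi>'] F'.M.zero_closed unfolding S_iff by (auto simp: cycles_def)
    have AS: "?A \<subseteq> S" using A1(2) C(1) z0 by blast
    have AW: "?A \<subseteq> carrier ?W" using AS submodule_closed(1)[OF W S] by blast
    note gen = submodule_gen_submodule[OF W AW]
    note gc = submodule_closed[OF W gen]
    have "submodule_gen R ?F' D1 \<subseteq> fst ` submodule_gen R ?W ?A"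
      by (rule submodule_gen_least[OF image_submodule[OF W F' fst_linear gen]])
        (use submodule_gen_incl[of _ ?A R ?W] A1(3) in blast)
    then have g1: "\<exists>p. (x, p) \<in> submodule_gen R ?W ?A" if "x \<in> fst ` S" for x using D1 that by fastforce
    have inr: "Pair (\<lambda>s. \<zero>\<^bsub>R\<^esub>) \<in> linear_maps R ?Pn ?W"
      using Pair_linear[OF linear_zero_map[OF F', of ?Pn] linear_maps_id(1)] by simp
    have CP: "C \<subseteq> carrier ?Pn" using C(1) by (auto simp: cycles_def)
    have "C \<subseteq> {c \<in> carrier ?Pn. (\<lambda>s. \<zero>\<^bsub>R\<^esub>, c) \<in> submodule_gen R ?W ?A}"
      using CP submodule_gen_incl[of _ ?A R ?W] by blast
    then have g2: "submodule_gen R ?Pn C \<subseteq> {c \<in> carrier ?Pn. (\<lambda>s. \<zero>\<^bsub>R\<^esub>, c) \<in> submodule_gen R ?W ?A}"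
      by (rule submodule_gen_least[OF vimage_submodule[OF Pn W inr gen]])
    have genS: "submodule_gen R ?W ?A \<subseteq> S" by (rule submodule_gen_least[OF S AS])
    have "\<exists>a\<in>submodule_gen R ?W ?A. s \<ominus>\<^bsub>?W\<^esub> a \<in> Nn" if s: "s \<in> S" for s
    proof -
      obtain x p where xp: "s = (x, p)" by (cases s)
      obtain p1 where p1: "(x, p1) \<in> submodule_gen R ?W ?A" using g1[of x] s xp by force
      have xc: "x \<in> carrier ?F'" "p \<in> carrier ?Pn" "p1 \<in> carrier ?Pn" using s xp p1 genS S_iff by blast+
      have "(x, p) \<ominus>\<^bsub>?W\<^esub> (x, p1) \<in> S" using submodule_closed(4)[OF W S] s xp p1 genS by blast
      then have "(\<lambda>s. \<zero>\<^bsub>R\<^esub>, p \<ominus>\<^bsub>?Pn\<^esub> p1) \<in> S"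
        using pair_module_minus[OF F' Pn xc(1,1,2,3)] F'.M.minus_self[OF xc(1)] by simp
      then obtain c where c: "c \<in> submodule_gen R ?Pn C" "(p \<ominus>\<^bsub>?Pn\<^esub> p1) \<ominus>\<^bsub>?Pn\<^esub> c \<in> boundaries P n" using C(3) z0 by blast
      have cc: "c \<in> carrier ?Pn" "(\<lambda>s. \<zero>\<^bsub>R\<^esub>, c) \<in> submodule_gen R ?W ?A" using g2 c(1) by auto
      have a: "(x, p1 \<oplus>\<^bsub>?Pn\<^esub> c) \<in> submodule_gen R ?W ?A"
      proof -
        have "x \<oplus>\<^bsub>?F'\<^esub> (\<lambda>s. \<zero>\<^bsub>R\<^esub>) = x" using F'.M.r_zero[OF xc(1)] by (simp only: free_module_simps(1))
        then show ?thesis using gc(3)[OF p1 cc(2)] by (simp del: free_module_simps(2))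
      qed
      have "s \<ominus>\<^bsub>?W\<^esub> (x, p1 \<oplus>\<^bsub>?Pn\<^esub> c) = (\<lambda>s. \<zero>\<^bsub>R\<^esub>, (p \<ominus>\<^bsub>?Pn\<^esub> p1) \<ominus>\<^bsub>?Pn\<^esub> c)"
        using pair_module_minus[OF F' Pn xc(1,1,2) Pn.M.a_closed[OF xc(3) cc(1)]] F'.M.minus_self[OF xc(1)] xc cc(1)
        by (simp add: xp Pn.minus_eq Pn.M.minus_add Pn.M.a_ac)
      then show ?thesis using a c(2) N_iff by (intro bexI[OF _ a]) simp
    qed
    then show ?thesis using A1(1) C(2) AS by (intro exI[of _ ?A]) auto
  qed
  then obtain A where A: "finite A" "A \<subseteq> S" "\<And>s. s \<in> S \<Longrightarrow> \<exists>a\<in>submodule_gen R ?W A. s \<ominus>\<^bsub>?W\<^esub> a \<in> Nn" by blast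
  \<comment> \<open>The infinite index type has subsets of every finite size.\<close>
  obtain J0 :: "'i set" where "finite J0" "card J0 = card A"
    using infinite_arbitrarily_large[OF inf] by blast
  then obtain w0 where w0: "w0 ` J0 = A" using finite_same_card_bij[OF _ A(1)] by (metis bij_betw_imp_surj_on)
  have w0W: "w0 \<in> J0 \<rightarrow> carrier ?W" using w0 A(2) submodule_closed(1)[OF W S] by blast
  have "generates R ?W S Nn J0 w0"
    unfolding generates_def
  proof (intro conjI ballI)
    show "w0 \<in> J0 \<rightarrow> S" using w0 A(2) by blast
    fix s assume "s \<in> S"
    then obtain a where a: "a \<in> submodule_gen R ?W (w0 ` J0)" "s \<ominus>\<^bsub>?W\<^esub> a \<in> Nn" using A(3) w0 by blast
    obtain \<phi> where "\<phi> \<in> carrier (free_module R J0)" "a = lin_ext R ?W w0 \<phi>" by (rule submodule_gen_image[OF W w0W a(1)])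
    then show "\<exists>\<phi>\<in>carrier (free_module R J0). s \<ominus>\<^bsub>?W\<^esub> lin_ext R ?W w0 \<phi> \<in> Nn" using a(2) by blast
  qed fact
  then obtain J :: "'i set" and w where g: "generates R ?W S Nn J w"
    and min: "\<And>\<phi> j. \<phi> \<in> carrier (free_module R J) \<Longrightarrow> lin_ext R ?W w \<phi> \<in> Nn \<Longrightarrow> \<phi> j \<in> max_ideal R"
    using minimal_generators[OF W S N NS, of J0 w0] by metis
  have wS: "w \<in> J \<rightarrow> S" and finJ: "finite J" using g by (auto simp: generates_def)
  have wW: "w \<in> J \<rightarrow> carrier ?W" by (rule Pi_I, rule submodule_closed(1)[OF W S], rule Pi_mem[OF wS])
  note le = lin_ext_linear[OF W wW]
  let ?D = "\<lambda>y. fst (lin_ext R ?W w y)" and ?\<phi> = "\<lambda>y. snd (lin_ext R ?W w y)"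
  have leS: "lin_ext R ?W w y \<in> S" if y: "y \<in> carrier (free_module R J)" for y
    by (rule lin_ext_in_submodule[OF W S wS y])
  show thesis
  proof
    show "finite J" by fact
    show "?D \<in> linear_maps R (free_module R J) ?F'" by (rule linear_comp[OF le fst_linear])
    show "?\<phi> \<in> linear_maps R (free_module R J) ?Pn" by (rule linear_comp[OF le snd_linear])
    show "D' (?D y) = (\<lambda>s. \<zero>\<^bsub>R\<^esub>) \<and> \<phi>' (?D y) = cdiff P n (?\<phi> y)" if "y \<in> carrier (free_module R J)" for y
      using leS[OF that] S_iff[of "?D y" "?\<phi> y"] by simp
    show "y s \<in> max_ideal R" if "y \<in> carrier (free_module R J)" "?D y = (\<lambda>s. \<zero>\<^bsub>R\<^esub>)" "?\<phi> y \<in> boundaries P n" for y s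
      using min[OF that(1)] N_iff[of "?D y" "?\<phi> y", unfolded prod.collapse] that(2,3) by blast
    fix x p assume xp: "x \<in> carrier ?F'" "p \<in> carrier ?Pn" "D' x = (\<lambda>s. \<zero>\<^bsub>R\<^esub>)" "\<phi>' x = cdiff P n p"
    then have "(x, p) \<in> S" using S_iff by blast
    then obtain y where y: "y \<in> carrier (free_module R J)" "(x, p) \<ominus>\<^bsub>?W\<^esub> lin_ext R ?W w y \<in> Nn"
      using g unfolding generates_def by blast
    have c: "?D y \<in> carrier ?F'" "?\<phi> y \<in> carrier ?Pn" using linear_closed[OF le y(1)] by auto
    have "(x, p) \<ominus>\<^bsub>?W\<^esub> (?D y, ?\<phi> y) = (x \<ominus>\<^bsub>?F'\<^esub> ?D y, p \<ominus>\<^bsub>?Pn\<^esub> ?\<phi> y)"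
      by (rule pair_module_minus[OF F' Pn xp(1) c(1) xp(2) c(2)])
    then have "x \<ominus>\<^bsub>?F'\<^esub> ?D y = \<zero>\<^bsub>?F'\<^esub>" "p \<ominus>\<^bsub>?Pn\<^esub> ?\<phi> y \<in> boundaries P n" using y(2) N_iff by auto
    then show "\<exists>y\<in>carrier (free_module R J). ?D y = x \<and> p \<ominus>\<^bsub>?Pn\<^esub> ?\<phi> y \<in> boundaries P n"
      using y(1) F'.M.minus_eq_zero_iff[OF xp(1) c(1)] by blast
  qed
qed

end

context
  fixes R :: "('a, 'c) ring_scheme"
  assumes local: "noetherian_local_ring R"
begin

text \<open>\<open>resolution_step\<close> is iterated upwards from degree \<open>b\<close>. Killing
  the homology of the mapping cone in every degree is what makes \<open>f\<close> a
  quasi-isomorphism; minimality of the generators controls the differential one degree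
  above.\<close>

lemma minimal_resolution:
  fixes P :: "('a, 'p) chain_complex"
  assumes inf: "infinite (UNIV :: 'i set)" and P: "is_complex R P"
    and b: "\<And>i. i < b \<Longrightarrow> cycles P i \<subseteq> boundaries P i" and fg: "\<And>i. fg_homology R P i"
  obtains J :: "int \<Rightarrow> 'i set" and F f where "is_complex R F" "\<And>i. cobj F i = free_module R (J i)" "\<And>i. finite (J i)"
    "\<And>i. i < b \<Longrightarrow> J i = {}" "quasi_iso_map R F P f"
    "\<And>i y s. y \<in> carrier (cobj F i) \<Longrightarrow> cdiff F i y s \<in> max_ideal R"
proof -
  interpret R: cring R by (rule R_cring[OF local])
  let ?F = "\<lambda>J :: 'i set. free_module R J"
  let ?z0 = "\<lambda>s :: 'i. \<zero>\<^bsub>R\<^esub>"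
  note Fm = free_module_module[OF R_cring[OF local]] and pP = is_complexD(1)[OF P]
  \<comment> \<open>A state consists of an index set, a differential and a map to \<open>P\<close>.
    The codomain of the differential is left open in \<open>Q\<close>, as it is the free module of
    the preceding state, which only \<open>T\<close> mentions.\<close>
  define Q where "Q n st \<longleftrightarrow> finite (fst st) \<and> (\<exists>J''. fst (snd st) \<in> linear_maps R (?F (fst st)) (?F J'')) \<and>
    snd (snd st) \<in> linear_maps R (?F (fst st)) (cobj P n)"
    for n and st :: "'i set \<times> (('i \<Rightarrow> 'a) \<Rightarrow> 'i \<Rightarrow> 'a) \<times> (('i \<Rightarrow> 'a) \<Rightarrow> 'p)"
  define T where "T n st' st \<longleftrightarrow> fst (snd st) \<in> linear_maps R (?F (fst st)) (?F (fst st')) \<and>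
    (\<forall>y\<in>carrier (?F (fst st)). fst (snd st') (fst (snd st) y) = ?z0 \<and> snd (snd st') (fst (snd st) y) = cdiff P n (snd (snd st) y)) \<and>
    (\<forall>x\<in>carrier (?F (fst st')). \<forall>p\<in>carrier (cobj P n). fst (snd st') x = ?z0 \<longrightarrow> snd (snd st') x = cdiff P n p \<longrightarrow>
      (\<exists>y\<in>carrier (?F (fst st)). fst (snd st) y = x \<and> p \<ominus>\<^bsub>cobj P n\<^esub> snd (snd st) y \<in> boundaries P n)) \<and>
    (\<forall>y\<in>carrier (?F (fst st)). fst (snd st) y = ?z0 \<longrightarrow> snd (snd st) y \<in> boundaries P n \<longrightarrow> (\<forall>s. y s \<in> max_ideal R))"
    for n and st' st :: "'i set \<times> (('i \<Rightarrow> 'a) \<Rightarrow> 'i \<Rightarrow> 'a) \<times> (('i \<Rightarrow> 'a) \<Rightarrow> 'p)"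
  define z where "z i = ({} :: 'i set, \<lambda>y :: 'i \<Rightarrow> 'a. ?z0, \<lambda>y :: 'i \<Rightarrow> 'a. \<zero>\<^bsub>cobj P i\<^esub>)" for i
  have F0: "carrier (?F {}) = {?z0}" by (auto simp: free_module_def fun_eq_iff)
  have lin0: "(\<lambda>y. ?z0) \<in> linear_maps R (?F J1) (?F J2)" for J1 J2
    using linear_zero_map[OF Fm] by simp
  obtain H where H: "\<And>i. Q i (H i)" "\<And>i. T i (H (i - 1)) (H i)" "\<And>i. i < b \<Longrightarrow> H i = z i"
  proof (rule int_dependent_choice[of b Q z T])
    fix i assume i: "i < b"
    interpret Pi: module R "cobj P i" by (rule precomplexD[OF pP])
    show "Q i (z i)" using lin0 linear_zero_map[OF Pi.module_axioms] by (auto simp: Q_def z_def)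
    have d0: "cdiff P i \<zero>\<^bsub>cobj P i\<^esub> = \<zero>\<^bsub>cobj P (i - 1)\<^esub>"
      by (rule linear_zero[OF Pi.module_axioms precomplexD(1)[OF pP] precomplexD(2)[OF pP]])
    \<comment> \<open>Below \<open>b\<close> every cycle of \<open>P\<close> is a boundary, so the
      zero module already meets the exactness condition in \<open>T\<close>.\<close>
    have "p \<ominus>\<^bsub>cobj P i\<^esub> \<zero>\<^bsub>cobj P i\<^esub> \<in> boundaries P i" if "p \<in> carrier (cobj P i)" "\<zero>\<^bsub>cobj P (i - 1)\<^esub> = cdiff P i p" for p
      using b[OF i] that by (auto simp: cycles_def Pi.minus_zero_right)
    then show "T i (z (i - 1)) (z i)"
      unfolding T_def z_def using lin0 d0 zero_in_max_ideal[OF local] by (auto simp: F0)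
  next
    fix i st assume "Q (i - 1) st"
    then obtain J'' where st: "finite (fst st)" "fst (snd st) \<in> linear_maps R (?F (fst st)) (?F J'')"
      "snd (snd st) \<in> linear_maps R (?F (fst st)) (cobj P (i - 1))" by (auto simp: Q_def)
    show "\<exists>st'. Q i st' \<and> T i st st'"
    proof (rule resolution_step[OF local inf P st fg])
      fix J :: "'i set" and D \<phi>
      assume "finite J" "D \<in> linear_maps R (?F J) (?F (fst st))"
        "\<phi> \<in> linear_maps R (?F J) (cobj P i)"
        "\<And>y. y \<in> carrier (?F J) \<Longrightarrow> fst (snd st) (D y) = ?z0 \<and> snd (snd st) (D y) = cdiff P i (\<phi> y)"
        "\<And>x p. x \<in> carrier (?F (fst st)) \<Longrightarrow> p \<in> carrier (cobj P i) \<Longrightarrow> fst (snd st) x = ?z0 \<Longrightarrow> snd (snd st) x = cdiff P i p \<Longrightarrow>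
          \<exists>y\<in>carrier (?F J). D y = x \<and> p \<ominus>\<^bsub>cobj P i\<^esub> \<phi> y \<in> boundaries P i"
        "\<And>y s. y \<in> carrier (?F J) \<Longrightarrow> D y = ?z0 \<Longrightarrow> \<phi> y \<in> boundaries P i \<Longrightarrow> y s \<in> max_ideal R"
      then show "\<exists>st'. Q i st' \<and> T i st st'"
        by (intro exI[of _ "(J, D, \<phi>)"]) (auto simp: Q_def T_def)
    qed
  qed blast
  define J where "J i = fst (H i)" for i
  define D where "D i = fst (snd (H i))" for i
  define f where "f i = snd (snd (H i))" for i
  define F :: "('a, 'i \<Rightarrow> 'a) chain_complex" where "F = \<lparr>cobj = (\<lambda>i. ?F (J i)), cdiff = D\<rparr>"
  have D: "D i \<in> linear_maps R (?F (J i)) (?F (J (i - 1)))" for i using H(2)[of i] by (simp add: T_def D_def J_def)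
  have f: "f i \<in> linear_maps R (?F (J i)) (cobj P i)" for i using H(1)[of i] by (simp add: Q_def f_def J_def)
  have DD: "D (i - 1) (D i y) = ?z0" "f (i - 1) (D i y) = cdiff P i (f i y)" if "y \<in> carrier (?F (J i))" for i y
    using H(2)[of i] that by (simp_all add: T_def D_def J_def f_def)
  have ex: "\<exists>y\<in>carrier (?F (J i)). D i y = x \<and> p \<ominus>\<^bsub>cobj P i\<^esub> f i y \<in> boundaries P i"
    if "x \<in> carrier (?F (J (i - 1)))" "p \<in> carrier (cobj P i)" "D (i - 1) x = ?z0" "f (i - 1) x = cdiff P i p" for i x p
    using H(2)[of i] that by (simp add: T_def D_def J_def f_def)
  have min: "y s \<in> max_ideal R" if "y \<in> carrier (?F (J i))" "D i y = ?z0" "f i y \<in> boundaries P i" for i y s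
    using H(2)[of i] that by (simp add: T_def D_def J_def f_def)
  show thesis
  proof
    show "cobj F i = free_module R (J i)" for i by (simp add: F_def)
    show "finite (J i)" for i using H(1)[of i] by (simp add: Q_def J_def)
    show "J i = {}" if "i < b" for i using H(3)[OF that] by (simp add: J_def z_def)
    show "is_complex R F"
      using D DD Fm by (auto simp: is_complex_def F_def)
    have fc: "f \<in> chain_maps R F P" using f DD(2) by (auto simp: chain_maps_def F_def)
    have "x \<in> boundaries F i" if x: "x \<in> cycles F i" "f i x \<in> boundaries P i" for i x
    proof -
      obtain p where p: "p \<in> carrier (cobj P (i + 1))" "f i x = cdiff P (i + 1) p" using x(2) by (auto simp: boundaries_def)
      \<comment> \<open>Injectivity on homology: \<open>(x, p)\<close> is a cycle of the cone, and
        its first coordinate is hit by the differential of \<open>F\<close>.\<close>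
      have "\<exists>y\<in>carrier (?F (J (i + 1))). D (i + 1) y = x \<and> p \<ominus>\<^bsub>cobj P (i + 1)\<^esub> f (i + 1) y \<in> boundaries P (i + 1)"
        by (rule ex) (use x p in \<open>auto simp: cycles_def F_def\<close>)
      then show ?thesis by (auto simp: boundaries_def F_def)
    qed
    moreover have "\<exists>x\<in>cycles F i. y \<ominus>\<^bsub>cobj P i\<^esub> f i x \<in> boundaries P i" if y: "y \<in> cycles P i" for i y
    proof -
      have "?z0 \<in> carrier (?F (J (i - 1)))" using linear_closed[OF lin0] F0 by blast
      \<comment> \<open>Surjectivity on homology: the same property for the cycle of the cone with
        first coordinate zero.\<close>
      then have "\<exists>v\<in>carrier (?F (J i)). D i v = ?z0 \<and> y \<ominus>\<^bsub>cobj P i\<^esub> f i v \<in> boundaries P i"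
        using y linear_zero[OF Fm Fm D] linear_zero[OF Fm precomplexD(1)[OF pP] f]
        by (intro ex) (auto simp: cycles_def)
      then show ?thesis by (auto simp: cycles_def F_def)
    qed
    ultimately show "quasi_iso_map R F P f" using fc by (simp add: quasi_iso_map_def)
    show "cdiff F i y s \<in> max_ideal R" if "y \<in> carrier (cobj F i)" for i y s
    proof -
      have y: "y \<in> carrier (?F (J i))" using that by (simp add: F_def)
      have "cdiff P i (f i y) \<in> boundaries P (i - 1)"
        using linear_closed[OF f y] by (auto simp: boundaries_def)
      \<comment> \<open>A boundary \<open>D i y\<close> is a relation between the minimal generators
        of the preceding degree: its differential is zero and its image in \<open>P\<close> is a
        boundary.\<close>
      then have "D i y s \<in> max_ideal R"
        using min[OF linear_closed[OF D y]] DD[OF y] by simp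
      then show ?thesis by (simp add: F_def)
    qed
  qed
qed

end

section \<open>Quasi-isomorphisms and finitely generated homology\<close>

context
  fixes R :: "('a, 'c) ring_scheme" and C :: "('a, 'm) chain_complex"
  assumes C: "precomplex R C"
begin

lemma homology_carrier: "carrier (homology C i) = (\<lambda>x. boundaries C i +>\<^bsub>cobj C i\<^esub> x) ` cycles C i"
  by (auto simp: homology_def quot_module_def A_RCOSETS_def' a_r_coset_def')

lemma homology_coset_eq_iff: "x \<in> carrier (cobj C i) \<Longrightarrow> y \<in> carrier (cobj C i) \<Longrightarrow>
    boundaries C i +>\<^bsub>cobj C i\<^esub> x = boundaries C i +>\<^bsub>cobj C i\<^esub> y \<longleftrightarrow> x \<ominus>\<^bsub>cobj C i\<^esub> y \<in> boundaries C i"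
  by (rule coset_eq_iff[OF precomplexD(1)[OF C] boundaries_submodule[OF C]])

lemma homology_coset_add: "x \<in> carrier (cobj C i) \<Longrightarrow> y \<in> carrier (cobj C i) \<Longrightarrow>
    (boundaries C i +>\<^bsub>cobj C i\<^esub> x) \<oplus>\<^bsub>homology C i\<^esub> (boundaries C i +>\<^bsub>cobj C i\<^esub> y) = boundaries C i +>\<^bsub>cobj C i\<^esub> (x \<oplus>\<^bsub>cobj C i\<^esub> y)"
  using coset_add[OF precomplexD(1)[OF C] boundaries_submodule[OF C], of x i y]
  by (simp add: homology_def quot_module_def set_add_def set_mult_def)

lemma homology_coset_smult: "r \<in> carrier R \<Longrightarrow> x \<in> carrier (cobj C i) \<Longrightarrow>
    r \<odot>\<^bsub>homology C i\<^esub> (boundaries C i +>\<^bsub>cobj C i\<^esub> x) = boundaries C i +>\<^bsub>cobj C i\<^esub> (r \<odot>\<^bsub>cobj C i\<^esub> x)"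
  using coset_smult[OF precomplexD(1)[OF C] boundaries_submodule[OF C], of r x i]
  by (simp add: homology_def quot_module_def a_r_coset_def r_coset_def)

lemma homology_zero: "\<zero>\<^bsub>homology C i\<^esub> = boundaries C i +>\<^bsub>cobj C i\<^esub> \<zero>\<^bsub>cobj C i\<^esub>"
  using coset_zero[OF precomplexD(1)[OF C] boundaries_submodule[OF C]] by (simp add: homology_def quot_module_def)

text \<open>Generators of the homology are represented by cycles. A combination of classes is the
  class of the combination of representatives, so every cycle agrees with such a combination up to a
  boundary.\<close>

lemma fin_gen_fg_homology:
  assumes "fin_gen_module R (homology C i)"
  shows "fg_homology R C i"
proof -
  let ?H = "homology C i" and ?M = "cobj C i" and ?B = "boundaries C i"
  obtain G where H: "module R ?H" and G: "G \<subseteq> carrier ?H" "finite G"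
    and gen: "\<And>x. x \<in> carrier ?H \<Longrightarrow> \<exists>c\<in>G \<rightarrow> carrier R. x = (\<Oplus>\<^bsub>?H\<^esub>b\<in>G. c b \<odot>\<^bsub>?H\<^esub> b)"
    using assms by (auto simp: fin_gen_module_def)
  have "\<forall>b\<in>G. \<exists>x. x \<in> cycles C i \<and> b = ?B +>\<^bsub>?M\<^esub> x" using G(1) homology_carrier by blast
  then obtain r where r: "\<And>b. b \<in> G \<Longrightarrow> r b \<in> cycles C i" "\<And>b. b \<in> G \<Longrightarrow> b = ?B +>\<^bsub>?M\<^esub> r b" by metis
  interpret H: module R ?H by (rule H)
  have M: "module R ?M" by (rule precomplexD[OF C])
  have rM: "r b \<in> carrier ?M" if "b \<in> G" for b using r(1)[OF that] by (simp add: cycles_def)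
  let ?S = "submodule_gen R ?M (r ` G)"
  have S: "submodule ?S R ?M" by (rule submodule_gen_submodule[OF M]) (use rM in auto)
  note Sc = submodule_closed[OF M S]
  \<comment> \<open>Only the existence of a representative in the generated submodule is claimed,
    which makes the induction over the finite sum immediate.\<close>
  have sum: "\<exists>v\<in>?S. (\<Oplus>\<^bsub>?H\<^esub>b\<in>A. c b \<odot>\<^bsub>?H\<^esub> b) = ?B +>\<^bsub>?M\<^esub> v" if "finite A" "A \<subseteq> G" "c \<in> G \<rightarrow> carrier R" for A c
    using that(1,2)
  proof (induction A rule: finite_induct)
    case empty
    then show ?case using Sc(2) homology_zero by (intro bexI[of _ "\<zero>\<^bsub>?M\<^esub>"]) auto
  next
    case (insert b A)
    then obtain v where v: "v \<in> ?S" "(\<Oplus>\<^bsub>?H\<^esub>b\<in>A. c b \<odot>\<^bsub>?H\<^esub> b) = ?B +>\<^bsub>?M\<^esub> v" by auto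
    have b: "b \<in> G" "c b \<in> carrier R" using insert.prems that(3) by auto
    have rb: "r b \<in> ?S" by (rule submodule_gen_incl) (use b in blast)
    have cb: "c b \<odot>\<^bsub>?H\<^esub> b = ?B +>\<^bsub>?M\<^esub> (c b \<odot>\<^bsub>?M\<^esub> r b)"
      using homology_coset_smult[OF b(2) rM[OF b(1)]] r(2)[OF b(1)] by simp
    have "(\<Oplus>\<^bsub>?H\<^esub>b\<in>insert b A. c b \<odot>\<^bsub>?H\<^esub> b) = c b \<odot>\<^bsub>?H\<^esub> b \<oplus>\<^bsub>?H\<^esub> (\<Oplus>\<^bsub>?H\<^esub>b\<in>A. c b \<odot>\<^bsub>?H\<^esub> b)"
      by (rule H.M.finsum_insert) (use insert that(3) G(1) in \<open>auto intro!: H.smult_closed\<close>)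
    also have "\<dots> = ?B +>\<^bsub>?M\<^esub> (c b \<odot>\<^bsub>?M\<^esub> r b \<oplus>\<^bsub>?M\<^esub> v)"
      unfolding v(2) cb by (rule homology_coset_add[OF Sc(1)[OF Sc(5)[OF b(2) rb]] Sc(1)[OF v(1)]])
    finally show ?case using Sc(3)[OF Sc(5)[OF b(2) rb] v(1)] by blast
  qed
  show ?thesis
    unfolding fg_homology_def
  proof (intro exI[of _ "r ` G"] conjI ballI)
    fix z assume z: "z \<in> cycles C i"
    then have "?B +>\<^bsub>?M\<^esub> z \<in> carrier ?H" using homology_carrier by blast
    then obtain c where c: "c \<in> G \<rightarrow> carrier R" "?B +>\<^bsub>?M\<^esub> z = (\<Oplus>\<^bsub>?H\<^esub>b\<in>G. c b \<odot>\<^bsub>?H\<^esub> b)" using gen by blast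
    obtain v where v: "v \<in> ?S" "(\<Oplus>\<^bsub>?H\<^esub>b\<in>G. c b \<odot>\<^bsub>?H\<^esub> b) = ?B +>\<^bsub>?M\<^esub> v" using sum[OF G(2) order_refl c(1)] by blast
    show "\<exists>c\<in>?S. z \<ominus>\<^bsub>?M\<^esub> c \<in> ?B"
      using v c(2) homology_coset_eq_iff[of z i v] Sc(1)[OF v(1)] z by (intro bexI[OF _ v(1)]) (simp add: cycles_def)
  qed (use G r in auto)
qed

end

lemma homology_map_coset:
  assumes C: "precomplex R C" and D: "precomplex R D" and f: "f \<in> chain_maps R C D" and z: "z \<in> carrier (cobj C i)"
  shows "homology_map D f i (boundaries C i +>\<^bsub>cobj C i\<^esub> z) = boundaries D i +>\<^bsub>cobj D i\<^esub> f i z"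
  unfolding homology_map_def
proof (rule coset_Union[OF precomplexD(1)[OF C] boundaries_submodule[OF C] z])
  fix w assume w: "w \<in> carrier (cobj C i)" "w \<ominus>\<^bsub>cobj C i\<^esub> z \<in> boundaries C i"
  have "f i w \<ominus>\<^bsub>cobj D i\<^esub> f i z \<in> boundaries D i"
    using chain_map_boundaries[OF f w(2)] linear_minus[OF precomplexD(1)[OF C] precomplexD(1)[OF D] chain_mapsD(1)[OF f] w(1) z] by simp
  then show "boundaries D i +>\<^bsub>cobj D i\<^esub> f i w = boundaries D i +>\<^bsub>cobj D i\<^esub> f i z"
    using homology_coset_eq_iff[OF D] chain_mapsD(3)[OF f] w(1) z by blast
qed

text \<open>Links the definition by bijections on homology with the element form: for a map induced
  by a linear one, injectivity is the triviality of the kernel, and equality of cosets means that a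
  difference is a boundary.\<close>

lemma quasi_isos_iff:
  assumes C: "precomplex R C" and D: "precomplex R D"
  shows "f \<in> quasi_isos R C D \<longleftrightarrow> quasi_iso_map R C D f"
proof -
  have "bij_betw (homology_map D f i) (carrier (homology C i)) (carrier (homology D i)) \<longleftrightarrow>
      (\<forall>x\<in>cycles C i. f i x \<in> boundaries D i \<longrightarrow> x \<in> boundaries C i) \<and>
      (\<forall>y\<in>cycles D i. \<exists>x\<in>cycles C i. y \<ominus>\<^bsub>cobj D i\<^esub> f i x \<in> boundaries D i)" (is "_ \<longleftrightarrow> ?I \<and> ?S")
    if f: "f \<in> chain_maps R C D" for i
  proof -
    let ?B = "boundaries C i" and ?B' = "boundaries D i" and ?M = "cobj C i" and ?N = "cobj D i"
    interpret M: module R ?M by (rule precomplexD[OF C])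
    interpret N: module R ?N by (rule precomplexD[OF D])
    note map = homology_map_coset[OF C D f]
    note Z = submodule_closed[OF M.module_axioms cycles_submodule[OF C, of i]]
    note f0 = linear_zero[OF M.module_axioms N.module_axioms chain_mapsD(1)[OF f]]
    have cl: "x \<in> carrier ?M \<Longrightarrow> f i x \<in> carrier ?N" for x by (rule chain_mapsD(3)[OF f])
    have eq: "?B' +>\<^bsub>?N\<^esub> f i x = ?B' +>\<^bsub>?N\<^esub> f i y \<longleftrightarrow> f i (x \<ominus>\<^bsub>?M\<^esub> y) \<in> ?B'" if "x \<in> cycles C i" "y \<in> cycles C i" for x y
      using homology_coset_eq_iff[OF D cl cl] Z(1)[OF that(1)] Z(1)[OF that(2)]
        linear_minus[OF M.module_axioms N.module_axioms chain_mapsD(1)[OF f]] by simp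
    have "inj_on (homology_map D f i) (carrier (homology C i)) \<longleftrightarrow> ?I"
    proof
      assume inj: "inj_on (homology_map D f i) (carrier (homology C i))"
      show ?I
      proof (intro ballI impI)
        fix x assume x: "x \<in> cycles C i" "f i x \<in> ?B'"
        have "?B' +>\<^bsub>?N\<^esub> f i x = ?B' +>\<^bsub>?N\<^esub> f i \<zero>\<^bsub>?M\<^esub>"
          using eq[OF x(1) Z(2)] x(2) Z(1)[OF x(1)] by (simp add: M.minus_zero_right)
        then have "homology_map D f i (?B +>\<^bsub>?M\<^esub> x) = homology_map D f i (?B +>\<^bsub>?M\<^esub> \<zero>\<^bsub>?M\<^esub>)"
          using map Z(1)[OF x(1)] M.M.zero_closed by simp
        then have "?B +>\<^bsub>?M\<^esub> x = ?B +>\<^bsub>?M\<^esub> \<zero>\<^bsub>?M\<^esub>"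
          by (rule inj_onD[OF inj]) (use homology_carrier[OF C] x(1) Z(2) in auto)
        then show "x \<in> ?B"
          using homology_coset_eq_iff[OF C Z(1)[OF x(1)] M.M.zero_closed] Z(1)[OF x(1)] by (simp add: M.minus_zero_right)
      qed
    next
      assume I: ?I
      show "inj_on (homology_map D f i) (carrier (homology C i))"
        unfolding homology_carrier[OF C]
      proof (rule inj_onI, elim imageE, hypsubst)
        fix x y assume x: "x \<in> cycles C i" and y: "y \<in> cycles C i"
          and h: "homology_map D f i (?B +>\<^bsub>?M\<^esub> x) = homology_map D f i (?B +>\<^bsub>?M\<^esub> y)"
        then have "f i (x \<ominus>\<^bsub>?M\<^esub> y) \<in> ?B'" using map Z(1) eq[OF x y] by simp
        then have "x \<ominus>\<^bsub>?M\<^esub> y \<in> ?B" using I Z(4)[OF x y] by blast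
        then show "?B +>\<^bsub>?M\<^esub> x = ?B +>\<^bsub>?M\<^esub> y" using homology_coset_eq_iff[OF C Z(1)[OF x] Z(1)[OF y]] by simp
      qed
    qed
    moreover have "homology_map D f i ` carrier (homology C i) = carrier (homology D i) \<longleftrightarrow> ?S"
    proof -
      have im: "homology_map D f i ` carrier (homology C i) = (\<lambda>x. ?B' +>\<^bsub>?N\<^esub> f i x) ` cycles C i"
        unfolding homology_carrier[OF C] image_image by (rule image_cong[OF refl map[OF Z(1)]])
      have sub: "(\<lambda>x. ?B' +>\<^bsub>?N\<^esub> f i x) ` cycles C i \<subseteq> (\<lambda>x. ?B' +>\<^bsub>?N\<^esub> x) ` cycles D i"
        using chain_map_cycles[OF C D f] by blast
      have "?B' +>\<^bsub>?N\<^esub> y \<in> (\<lambda>x. ?B' +>\<^bsub>?N\<^esub> f i x) ` cycles C i \<longleftrightarrow> (\<exists>x\<in>cycles C i. y \<ominus>\<^bsub>?N\<^esub> f i x \<in> ?B')"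
        if y: "y \<in> cycles D i" for y
      proof -
        have "y \<in> carrier ?N" using y by (simp add: cycles_def)
        then show ?thesis using homology_coset_eq_iff[OF D _ cl[OF Z(1)]] by (simp add: image_iff)
      qed
      then have "(\<lambda>x. ?B' +>\<^bsub>?N\<^esub> x) ` cycles D i \<subseteq> (\<lambda>x. ?B' +>\<^bsub>?N\<^esub> f i x) ` cycles C i \<longleftrightarrow> ?S"
        by (simp add: image_subset_iff)
      then show ?thesis unfolding im homology_carrier[OF D] using sub by (simp add: set_eq_subset)
    qed
    ultimately show ?thesis by (simp add: bij_betw_def)
  qed
  then show ?thesis by (auto simp: quasi_isos_def quasi_iso_map_def)
qed

subsection \<open>The residue field as a stalk complex\<close>

lemma zero_submodule: "module R M \<Longrightarrow> submodule {\<zero>\<^bsub>M\<^esub>} R M"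
proof -
  assume M: "module R M"
  then interpret M: module R M .
  show ?thesis by (rule M.submoduleI) (simp_all add: M.a_minus_zero)
qed

lemma stalk_precomplex:
  assumes M: "module R M" shows "is_complex R (stalk_complex M)"
proof -
  interpret M: module R M by (rule M)
  note Z = submodule_module[OF M zero_submodule[OF M]]
  show ?thesis
    unfolding is_complex_def stalk_complex_def
    by (auto simp: M Z intro: linear_zero_map[OF M] linear_zero_map[OF Z, simplified])
qed

lemma stalk_cycles: "i \<noteq> 0 \<Longrightarrow> cycles (stalk_complex M) i \<subseteq> {\<zero>\<^bsub>M\<^esub>}"
  by (auto simp: cycles_def stalk_complex_def)

lemma stalk_zero:
  assumes M: "module R M" shows "\<zero>\<^bsub>M\<^esub> \<in> boundaries (stalk_complex M) i"
  using submodule_closed(2)[OF is_complexD(2)[OF stalk_precomplex[OF M]] boundaries_submodule[OF is_complexD(1)[OF stalk_precomplex[OF M]]], of i]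
  by (simp add: stalk_complex_def split: if_splits)

context
  fixes R :: "('a, 'c) ring_scheme"
  assumes local: "noetherian_local_ring R"
begin

interpretation R: cring R by (rule R_cring[OF local])

lemma max_ideal_submodule: "submodule (max_ideal R) R (regular_module R)"
proof -
  interpret Q: module R "regular_module R" by (rule regular_module_module[OF R.is_cring])
  interpret I: ideal "max_ideal R" R by (rule max_ideal_ideal[OF local])
  have neg: "\<ominus>\<^bsub>regular_module R\<^esub> x = \<ominus>\<^bsub>R\<^esub> x" if "x \<in> carrier R" for x
    by (rule Q.M.minus_equality) (use that in \<open>simp_all add: R.l_neg\<close>)
  show ?thesis
    by (rule Q.submoduleI) (auto simp: neg I.a_subset[THEN subsetD] I.I_l_closed I.a_closed intro: I.a_subset[THEN subsetD])
qed

lemma residue_field_eq: "residue_field R = quot_module (regular_module R) (max_ideal R)"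
  by (simp add: residue_field_def max_ideal_def)

lemma residue_field_module: "module R (residue_field R)"
  unfolding residue_field_eq by (rule quot_module_module[OF regular_module_module[OF R.is_cring] max_ideal_submodule])

lemma residue_field_killed:
  assumes r: "r \<in> max_ideal R" and x: "x \<in> carrier (residue_field R)"
  shows "r \<odot>\<^bsub>residue_field R\<^esub> x = \<zero>\<^bsub>residue_field R\<^esub>"
proof -
  note Q = regular_module_module[OF R.is_cring]
  note l = quot_linear[OF Q max_ideal_submodule]
  interpret I: ideal "max_ideal R" R by (rule max_ideal_ideal[OF local])
  have rR: "r \<in> carrier R" using r I.a_subset by blast
  obtain a where a: "a \<in> carrier R" "x = max_ideal R +>\<^bsub>regular_module R\<^esub> a"
    using x unfolding residue_field_eq quot_carrier[OF Q max_ideal_submodule] by auto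
  have ra: "r \<otimes>\<^bsub>R\<^esub> a \<in> max_ideal R" by (rule I.I_r_closed[OF r a(1)])
  have "r \<odot>\<^bsub>residue_field R\<^esub> x = max_ideal R +>\<^bsub>regular_module R\<^esub> (r \<otimes>\<^bsub>R\<^esub> a)"
    using linear_smult[OF l rR, of a] a by (simp add: residue_field_eq)
  also have "\<dots> = max_ideal R +>\<^bsub>regular_module R\<^esub> \<zero>\<^bsub>regular_module R\<^esub>"
  proof -
    interpret Q: module R "regular_module R" by (rule Q)
    show ?thesis using coset_eq_iff[OF Q max_ideal_submodule, of "r \<otimes>\<^bsub>R\<^esub> a" "\<zero>\<^bsub>R\<^esub>"] ra rR a(1)
        Q.minus_zero_right[of "r \<otimes>\<^bsub>R\<^esub> a"] by simp
  qed
  finally show ?thesis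
    by (simp add: residue_field_eq quot_zero[OF Q max_ideal_submodule] coset_zero[OF Q max_ideal_submodule, simplified])
qed

text \<open>In degree 0 the class of one generates; in every other degree zero is the only cycle and
  the empty set generates.\<close>

lemma residue_field_fg: "fg_homology R (stalk_complex (residue_field R)) i"
proof (cases "i = 0")
  case False
  let ?k = "residue_field R"
  note k = residue_field_module and C = stalk_precomplex[OF residue_field_module]
  interpret Ck: module R "cobj (stalk_complex ?k) i" by (rule is_complexD[OF C])
  have z: "\<zero>\<^bsub>cobj (stalk_complex ?k) i\<^esub> = \<zero>\<^bsub>?k\<^esub>" by (simp add: stalk_complex_def)
  have gen: "\<zero>\<^bsub>?k\<^esub> \<in> submodule_gen R (cobj (stalk_complex ?k) i) {}"
    using submodule_closed(2)[OF Ck.module_axioms submodule_gen_submodule[OF Ck.module_axioms empty_subsetI]] z by simp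
  have "\<zero>\<^bsub>?k\<^esub> \<ominus>\<^bsub>cobj (stalk_complex ?k) i\<^esub> \<zero>\<^bsub>?k\<^esub> = \<zero>\<^bsub>?k\<^esub>"
    using Ck.minus_self[OF Ck.M.zero_closed] unfolding z .
  then show ?thesis
    unfolding fg_homology_def using stalk_cycles[OF False, of ?k] stalk_zero[OF k, of i] gen
    by (intro exI[of _ "{}"]) (auto intro!: bexI[OF _ gen] dest!: subsetD)
next
  case True
  let ?k = "residue_field R"
  note Q = regular_module_module[OF R.is_cring]
  note l = quot_linear[OF Q max_ideal_submodule]
  note k = residue_field_module
  interpret k: module R ?k by (rule k)
  have k0: "cobj (stalk_complex ?k) 0 = ?k" by (simp add: stalk_complex_def)
  have cyc: "cycles (stalk_complex ?k) 0 = carrier ?k" by (auto simp: cycles_def stalk_complex_def)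
  let ?e = "max_ideal R +>\<^bsub>regular_module R\<^esub> \<one>\<^bsub>R\<^esub>"
  have e: "?e \<in> carrier ?k" using linear_closed[OF l, of "\<one>\<^bsub>R\<^esub>"] by (simp add: residue_field_eq)
  note S = submodule_gen_submodule[OF k, of "{?e}"]
  have "z \<in> submodule_gen R ?k {?e}" if z: "z \<in> carrier ?k" for z
  proof -
    obtain a where a: "a \<in> carrier R" "z = max_ideal R +>\<^bsub>regular_module R\<^esub> a"
      using z unfolding residue_field_eq quot_carrier[OF Q max_ideal_submodule] by auto
    have "z = a \<odot>\<^bsub>?k\<^esub> ?e" using linear_smult[OF l a(1), of "\<one>\<^bsub>R\<^esub>"] a by (simp add: residue_field_eq)
    then show ?thesis using submodule_closed(5)[OF k S a(1)] submodule_gen_incl[of ?e] e by blast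
  qed
  moreover have "z \<ominus>\<^bsub>?k\<^esub> z \<in> boundaries (stalk_complex ?k) 0" if "z \<in> carrier ?k" for z
    using stalk_zero[OF k, of 0] that by (simp add: k.minus_self)
  ultimately show ?thesis
    unfolding fg_homology_def True k0 cyc using e by (intro exI[of _ "{?e}"]) auto
qed

end

section \<open>Projective, free and finite free modules\<close>

text \<open>The identity is lifted along the evaluation map from the free module on
  \<open>carrier Q\<close>, whose element type is precisely that of the test modules in
  \<open>projective_module\<close>.\<close>

lemma projective_free_retract:
  assumes "projective_module R Q" shows "free_retract R Q (carrier Q)"
proof -
  have Q: "module R Q" using assms by (simp add: projective_module_def)
  note R = module_cring[OF Q]
  let ?N = "free_module R (carrier Q)"
  have e: "(\<lambda>q. q) \<in> carrier Q \<rightarrow> carrier Q" by simp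
  note N = free_module_module[OF R, of "carrier Q"] and le = lin_ext_linear[OF Q e]
  have "lin_ext R Q (\<lambda>q. q) ` carrier ?N = carrier Q"
  proof
    show "lin_ext R Q (\<lambda>q. q) ` carrier ?N \<subseteq> carrier Q" using linear_closed[OF le] by blast
    show "carrier Q \<subseteq> lin_ext R Q (\<lambda>q. q) ` carrier ?N"
    proof
      fix q assume q: "q \<in> carrier Q"
      show "q \<in> lin_ext R Q (\<lambda>q. q) ` carrier ?N"
        by (rule image_eqI[where f = "lin_ext R Q (\<lambda>q. q)", OF lin_ext_gen[OF Q e q, symmetric] free_gen_closed[OF R q]])
    qed
  qed
  then have "\<exists>l\<in>linear_maps R Q ?N. \<forall>x\<in>carrier Q. lin_ext R Q (\<lambda>q. q) (l x) = x"
    using assms[unfolded projective_module_def, THEN conjunct2, rule_format, OF N Q le linear_maps_id(1)] by simp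
  then show ?thesis unfolding free_retract_def using Q by (intro conjI bexI[OF _ e])
qed

lemma free_retract_projective:
  assumes "free_retract R Q S" shows "projective_module R Q"
  unfolding projective_module_def
proof (intro conjI allI impI ballI)
  show Q: "module R Q" using assms by (simp add: free_retract_def)
  fix N N' g h
  assume N: "module R N" and N': "module R N'" and g: "g \<in> linear_maps R N N'" and h: "h \<in> linear_maps R Q N'"
    and s: "g ` carrier N = carrier N'"
  have "h ` carrier Q \<subseteq> g ` carrier N" unfolding s using linear_closed[OF h] by blast
  from free_retract_lift[OF assms N N' g h this]
  obtain v where "v \<in> linear_maps R Q N" "\<And>x. x \<in> carrier Q \<Longrightarrow> g (v x) = h x" by auto
  then show "\<exists>l\<in>linear_maps R Q N. \<forall>x\<in>carrier Q. g (l x) = h x" by auto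
qed

lemma free_gen_inj: "\<one>\<^bsub>R\<^esub> \<noteq> \<zero>\<^bsub>R\<^esub> \<Longrightarrow> inj (free_gen R)"
  by (rule injI) (auto simp: free_gen_def dest!: fun_cong split: if_splits)

text \<open>\<open>has_basis\<close> indexes a basis by its own elements. Since one differs from
  zero, distinct indices have distinct generators, so a generator determines its index and the
  coordinate functions are evaluations.\<close>

lemma free_module_has_basis:
  fixes J :: "'s set"
  assumes R: "cring R" and nz: "\<one>\<^bsub>R\<^esub> \<noteq> \<zero>\<^bsub>R\<^esub>" and J: "finite J"
  shows "has_basis R (free_module R J) (free_gen R ` J) (\<lambda>b \<phi>. \<phi> (inv_into UNIV (free_gen R) b))"
proof -
  let ?F = "free_module R J"
  note F = free_module_module[OF R, of J]
  interpret F: module R ?F by (rule F)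
  note inj = free_gen_inj[OF nz]
  have g: "free_gen R \<in> J \<rightarrow> carrier ?F" by (intro Pi_I free_gen_closed[OF R])
  have "\<phi> = (\<Oplus>\<^bsub>?F\<^esub>b\<in>free_gen R ` J. \<phi> (inv_into UNIV (free_gen R) b) \<odot>\<^bsub>?F\<^esub> b)" if \<phi>: "\<phi> \<in> carrier ?F" for \<phi>
  proof -
    have "(\<Oplus>\<^bsub>?F\<^esub>b\<in>free_gen R ` J. \<phi> (inv_into UNIV (free_gen R) b) \<odot>\<^bsub>?F\<^esub> b)
        = (\<Oplus>\<^bsub>?F\<^esub>s\<in>J. \<phi> (inv_into UNIV (free_gen R) (free_gen R s)) \<odot>\<^bsub>?F\<^esub> free_gen R s)"
    proof (rule F.M.finsum_reindex)
      show "(\<lambda>b. \<phi> (inv_into UNIV (free_gen R) b) \<odot>\<^bsub>?F\<^esub> b) \<in> free_gen R ` J \<rightarrow> carrier ?F"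
        by (rule Pi_I, rule F.smult_closed[OF free_carrierD(1)[OF \<phi>]], elim imageE, hypsubst, rule Pi_mem[OF g])
      show "inj_on (free_gen R) J" by (rule inj_on_subset[OF inj subset_UNIV])
    qed
    also have "\<dots> = (\<Oplus>\<^bsub>?F\<^esub>s\<in>J. \<phi> s \<odot>\<^bsub>?F\<^esub> free_gen R s)" by (simp only: inv_f_f[OF inj])
    also have "\<dots> = lin_ext R ?F (free_gen R) \<phi>"
      by (rule lin_ext_superset[OF F g \<phi> J free_carrierD(4)[OF \<phi>] order_refl, symmetric])
    finally show ?thesis using lin_ext_free_gen[OF R \<phi>] by simp
  qed
  moreover have "free_gen R s (inv_into UNIV (free_gen R) (free_gen R s')) = (if free_gen R s' = free_gen R s then \<one>\<^bsub>R\<^esub> else \<zero>\<^bsub>R\<^esub>)" for s s' :: 's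
    unfolding inv_f_f[OF inj] inj_eq[OF inj] by (simp add: free_gen_def)
  ultimately show ?thesis
    unfolding has_basis_def using F J g by (intro conjI ballI free_eval_linear) auto
qed

lemma has_basis_finite_free:
  assumes "has_basis R M B \<beta>" shows "finite_free_module R M"
proof -
  note b = has_basisD[OF assms]
  interpret M: module R M by (rule b)
  note Q = regular_module_module[OF module_cring[OF b(1)]]
  interpret Q: module R "regular_module R" by (rule Q)
  have coeff: "c b' = \<beta> b' (\<Oplus>\<^bsub>M\<^esub>b\<in>B. c b \<odot>\<^bsub>M\<^esub> b)" if c: "c \<in> B \<rightarrow> carrier R" and b': "b' \<in> B" for c b'
  proof -
    have cb: "c b \<in> carrier R" if "b \<in> B" for b using c that by blast
    have "\<beta> b' (\<Oplus>\<^bsub>M\<^esub>b\<in>B. c b \<odot>\<^bsub>M\<^esub> b) = (\<Oplus>\<^bsub>regular_module R\<^esub>b\<in>B. \<beta> b' (c b \<odot>\<^bsub>M\<^esub> b))"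
      by (rule linear_finsum[OF b(1) Q b(4)[OF b']]) (use cb b(3) in auto)
    also have "\<dots> = (\<Oplus>\<^bsub>regular_module R\<^esub>b\<in>B. if b' = b then c b else \<zero>\<^bsub>regular_module R\<^esub>)"
      by (rule Q.M.finsum_cong') (use cb b(3) b(5)[OF b'] linear_smult[OF b(4)[OF b'] cb b(3)] in auto)
    also have "\<dots> = c b'" by (rule Q.M.finsum_singleton) (use b' b(2) cb in auto)
    finally show ?thesis by simp
  qed
  have "\<exists>!c. c \<in> B \<rightarrow>\<^sub>E carrier R \<and> x = (\<Oplus>\<^bsub>M\<^esub>b\<in>B. c b \<odot>\<^bsub>M\<^esub> b)" if x: "x \<in> carrier M" for x
  proof (rule ex1I[of _ "\<lambda>b\<in>B. \<beta> b x"])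
    have "(\<Oplus>\<^bsub>M\<^esub>b\<in>B. restrict (\<lambda>b. \<beta> b x) B b \<odot>\<^bsub>M\<^esub> b) = (\<Oplus>\<^bsub>M\<^esub>b\<in>B. \<beta> b x \<odot>\<^bsub>M\<^esub> b)"
      by (rule M.M.finsum_cong') (use x b(3,7) in auto)
    then show "(\<lambda>b\<in>B. \<beta> b x) \<in> B \<rightarrow>\<^sub>E carrier R \<and> x = (\<Oplus>\<^bsub>M\<^esub>b\<in>B. restrict (\<lambda>b. \<beta> b x) B b \<odot>\<^bsub>M\<^esub> b)"
      using b(6)[OF x] b(7)[OF _ x] by simp
    fix c assume c: "c \<in> B \<rightarrow>\<^sub>E carrier R \<and> x = (\<Oplus>\<^bsub>M\<^esub>b\<in>B. c b \<odot>\<^bsub>M\<^esub> b)"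
    then have "c b' = \<beta> b' x" if "b' \<in> B" for b' using coeff[of c b'] that by (simp add: PiE_iff Pi_iff)
    then show "c = (\<lambda>b\<in>B. \<beta> b x)" using c by (intro extensionalityI[of _ B]) (auto simp: PiE_iff)
  qed
  then show ?thesis unfolding finite_free_module_def using b(1,2,3) by (intro conjI exI[of _ B]) auto
qed

lemma projective_resolution_free_retract:
  assumes "projective_resolution R C F"
  shows "free_retract_complex R F (\<lambda>i. carrier (cobj F i))"
  using assms projective_free_retract by (auto simp: projective_resolution_def free_retract_complex_def)

section \<open>Ext and depth\<close>

context
  fixes R :: "('a, 'c) ring_scheme"
  assumes local: "noetherian_local_ring R"
begin

interpretation R: cring R by (rule R_cring[OF local])

text \<open>The same choice as in \<open>derived_hom\<close>, verbatim, so that Ext out of the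
  residue field unfolds to Hom out of this complex.\<close>

definition "residue_resolution = (SOME G :: ('a, 'a set) res_complex. projective_resolution R (stalk_complex (residue_field R)) G)"

text \<open>The choice is meaningful because the residue field has a minimal resolution with index
  sets in \<open>'a set \<times> nat\<close>, and free modules on these have the element type
  demanded by \<open>res_complex\<close>.\<close>

lemma residue_resolution: "projective_resolution R (stalk_complex (residue_field R)) residue_resolution"
proof -
  let ?k = "stalk_complex (residue_field R)"
  note k = stalk_precomplex[OF residue_field_module[OF local]]
  have inf: "infinite (UNIV :: ('a set \<times> nat) set)" by (simp add: finite_prod)
  have low: "cycles ?k i \<subseteq> boundaries ?k i" if "i < 0" for i
    using stalk_cycles[of i "residue_field R"] stalk_zero[OF residue_field_module[OF local], of i] that by auto
  obtain J :: "int \<Rightarrow> ('a set \<times> nat) set" and F f where F: "is_complex R F" "\<And>i. cobj F i = free_module R (J i)"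
    "\<And>i. finite (J i)" "\<And>i. i < 0 \<Longrightarrow> J i = {}" "quasi_iso_map R F ?k f"
    by (rule minimal_resolution[where b = 0, OF local inf k low residue_field_fg[OF local]]) (assumption, rule that, assumption+)
  have "projective_module R (cobj F i)" for i
    unfolding F(2) by (rule free_retract_projective[OF has_basis_free_retract[OF free_module_has_basis[OF R.is_cring one_not_zero[OF local] F(3)]]])
  moreover have "bounded_below_complex F"
    unfolding bounded_below_complex_def nonzero_module_def
    by (intro exI[of _ 0]) (auto simp: F(2,4) free_module_def fun_eq_iff)
  ultimately have "projective_resolution R ?k F"
    unfolding projective_resolution_def using F(1,5) quasi_isos_iff[OF is_complexD(1)[OF F(1)] is_complexD(1)[OF k]] by blast
  then show ?thesis unfolding residue_resolution_def by (rule someI)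
qed

lemma nonzero_ext_residue:
  assumes "precomplex R M"
  shows "nonzero_module (ext_module R l (residue_field R) M) \<longleftrightarrow> \<not> hom_vanishes R residue_resolution M (- l)"
proof -
  have "precomplex R residue_resolution"
    using residue_resolution is_complexD(1) by (auto simp: projective_resolution_def)
  from nonzero_hom_homology[OF this assms] show ?thesis
    by (simp add: ext_module_def derived_hom_def residue_resolution_def)
qed

section \<open>Minimal complexes\<close>

lemma residue_class_zero_iff:
  "r \<in> carrier R \<Longrightarrow> max_ideal R +>\<^bsub>regular_module R\<^esub> r = \<zero>\<^bsub>residue_field R\<^esub> \<longleftrightarrow> r \<in> max_ideal R"
proof -
  assume r: "r \<in> carrier R"
  note Q = regular_module_module[OF R.is_cring] and m = max_ideal_submodule[OF local]
  interpret Q: module R "regular_module R" by (rule Q)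
  have "max_ideal R +>\<^bsub>regular_module R\<^esub> r = max_ideal R +>\<^bsub>regular_module R\<^esub> \<zero>\<^bsub>regular_module R\<^esub> \<longleftrightarrow>
      r \<ominus>\<^bsub>regular_module R\<^esub> \<zero>\<^bsub>regular_module R\<^esub> \<in> max_ideal R"
    by (rule coset_eq_iff[OF Q m]) (use r Q.M.zero_closed in auto)
  then show ?thesis
    using r by (simp add: residue_field_eq[OF local] quot_zero[OF Q m] coset_zero[OF Q m] Q.minus_zero_right del: regular_module_simps(2))
qed

text \<open>The condition on \<open>\<phi>\<close> says that it lies in the maximal ideal times the
  free module. That part is invisible to maps into modules like the residue field.\<close>

lemma linear_to_killed_zero:
  assumes N: "module R N" and kill: "\<And>r x. r \<in> max_ideal R \<Longrightarrow> x \<in> carrier N \<Longrightarrow> r \<odot>\<^bsub>N\<^esub> x = \<zero>\<^bsub>N\<^esub>"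
    and u: "u \<in> linear_maps R (free_module R J) N"
    and \<phi>: "\<phi> \<in> carrier (free_module R J)" "\<And>s. \<phi> s \<in> max_ideal R"
  shows "u \<phi> = \<zero>\<^bsub>N\<^esub>"
proof -
  interpret N: module R N by (rule N)
  note F = free_module_module[OF R.is_cring, of J]
  have g: "free_gen R \<in> J \<rightarrow> carrier (free_module R J)" by (intro Pi_I free_gen_closed[OF R.is_cring])
  have "u \<phi> = lin_ext R N (\<lambda>s. u (free_gen R s)) \<phi>"
    using linear_lin_ext[OF F g N u \<phi>(1)] lin_ext_free_gen[OF R.is_cring \<phi>(1)] by simp
  also have "\<dots> = (\<Oplus>\<^bsub>N\<^esub>s\<in>{s. \<phi> s \<noteq> \<zero>\<^bsub>R\<^esub>}. \<zero>\<^bsub>N\<^esub>)"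
    unfolding lin_ext_def
  proof (rule N.M.finsum_cong')
    fix s assume "s \<in> {s. \<phi> s \<noteq> \<zero>\<^bsub>R\<^esub>}"
    then have "s \<in> J" using free_carrierD(4)[OF \<phi>(1)] by blast
    then show "\<phi> s \<odot>\<^bsub>N\<^esub> u (free_gen R s) = \<zero>\<^bsub>N\<^esub>"
      by (intro kill \<phi>(2) linear_closed[OF u] free_gen_closed[OF R.is_cring])
  qed simp_all
  finally show ?thesis by (simp add: N.M.finsum_zero)
qed

text \<open>If \<open>Q\<^sub>p = 0\<close>, then the identity of \<open>F\<^sub>p\<close> has the form \<open>d H + H d\<close> and so is zero modulo the
  maximal ideal.\<close>

lemma minimal_complex_retract:
  fixes J :: "int \<Rightarrow> 'i set"
  assumes F: "is_complex R F" "\<And>i. cobj F i = free_module R (J i)"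
    and min: "\<And>i y s. y \<in> carrier (cobj F i) \<Longrightarrow> cdiff F i y s \<in> max_ideal R"
    and Q: "precomplex R Q" and w: "w \<in> chain_maps R F Q" and v: "v \<in> chain_maps R Q F"
    and vw: "homotopic R F F (\<lambda>i x. x) (\<lambda>i x. v i (w i x))" and p: "J p \<noteq> {}"
  shows "nonzero_module (cobj Q p)"
proof (rule ccontr)
  assume "\<not> nonzero_module (cobj Q p)"
  then have Q0: "carrier (cobj Q p) = {\<zero>\<^bsub>cobj Q p\<^esub>}" by (simp add: nonzero_module_def)
  obtain s where s: "s \<in> J p" using p by blast
  let ?k = "residue_field R" and ?x = "free_gen R s"
  note pF = is_complexD(1)[OF F(1)] and Fm = is_complexD(2)[OF F(1)]
  note k = residue_field_module[OF local] and Qm = precomplexD(1)[OF Q]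
  note rg = regular_module_module[OF R.is_cring]
  interpret k: module R ?k by (rule k)
  interpret Fp: module R "cobj F p" by (rule Fm)
  have x: "?x \<in> carrier (cobj F p)" unfolding F(2) by (rule free_gen_closed[OF R.is_cring s])
  have dx: "cdiff F p ?x \<in> carrier (cobj F (p - 1))" by (rule is_complexD(4)[OF F(1) x])
  \<comment> \<open>The coefficient at \<open>s\<close> modulo the maximal ideal:
    \<open>u ?x\<close> is the class of one, while both terms of the homotopy formula for
    \<open>?x\<close> will be sent to zero.\<close>
  define u where "u \<phi> = max_ideal R +>\<^bsub>regular_module R\<^esub> (\<phi> s)" for \<phi> :: "'i \<Rightarrow> 'a"
  have u: "u \<in> linear_maps R (cobj F p) ?k"
    unfolding F(2) u_def residue_field_eq[OF local]
    by (rule linear_comp[OF free_eval_linear quot_linear[OF rg max_ideal_submodule[OF local]]])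
  have u0: "u y = \<zero>\<^bsub>?k\<^esub>" if "y \<in> carrier (cobj F p)" "\<And>s. y s \<in> max_ideal R" for y
    using linear_to_killed_zero[OF k residue_field_killed[OF local] u[unfolded F(2)]] that unfolding F(2) by blast
  obtain H where H: "H \<in> graded_maps R F F 1"
    and eq: "\<And>i x. x \<in> carrier (cobj F i) \<Longrightarrow> x \<ominus>\<^bsub>cobj F i\<^esub> v i (w i x) = hom_diff F F 1 H i x"
    using vw unfolding homotopic_def null_homotopic_def by auto
  have "w p ?x = \<zero>\<^bsub>cobj Q p\<^esub>" using chain_mapsD(3)[OF w x] Q0 by blast
  then have vw0: "v p (w p ?x) = \<zero>\<^bsub>cobj F p\<^esub>" using linear_zero[OF Qm Fm chain_mapsD(1)[OF v]] by simp
  have e: "p + 1 - 1 = p" by simp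
  note Hx = graded_mapsD(2)[OF H x] and Hl = graded_mapsD(3)[OF H, of p, unfolded e] and Hdx = graded_mapsD(4)[OF H dx, unfolded e]
  have a: "cdiff F (p + 1) (H p ?x) \<in> carrier (cobj F p)" using is_complexD(4)[OF F(1) Hx] by simp
  have ua: "u (cdiff F (p + 1) (H p ?x)) = \<zero>\<^bsub>?k\<^esub>" by (rule u0[OF a min[OF Hx]])
  have ub: "u (H (p - 1) (cdiff F p ?x)) = \<zero>\<^bsub>?k\<^esub>"
    by (rule linear_to_killed_zero[OF k residue_field_killed[OF local] linear_comp[OF Hl u, unfolded F(2)] dx[unfolded F(2)] min[OF x]])
  have "?x = ?x \<ominus>\<^bsub>cobj F p\<^esub> v p (w p ?x)" unfolding vw0 by (rule Fp.minus_zero_right[OF x, symmetric])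
  also have "\<dots> = cdiff F (p + 1) (H p ?x) \<ominus>\<^bsub>cobj F p\<^esub> sgn_power (cobj F p) 1 (H (p - 1) (cdiff F p ?x))"
    unfolding eq[OF x] hom_diff_def e ..
  finally have "u ?x = u (cdiff F (p + 1) (H p ?x)) \<ominus>\<^bsub>?k\<^esub> u (sgn_power (cobj F p) 1 (H (p - 1) (cdiff F p ?x)))"
    using linear_minus[OF Fm k u a sgn_power_closed[OF Fm Hdx]] by (rule subst[of _ _ "\<lambda>y. u y = _", OF sym])
  also have "\<dots> = \<zero>\<^bsub>?k\<^esub>"
    unfolding linear_sgn_power[OF Fm k u Hdx] ua ub sgn_power_zero[OF k] by (simp add: k.minus_self)
  finally have "\<one>\<^bsub>R\<^esub> \<in> max_ideal R" using residue_class_zero_iff[of "\<one>\<^bsub>R\<^esub>"] by (simp add: u_def free_gen_def)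
  then show False using one_notin_max_ideal[OF local] by blast
qed

end

section \<open>The depth formula\<close>

text \<open>Complexes with the same modules whose differentials agree on the carriers may still
  differ as records, because differentials are total functions.\<close>

lemma quasi_iso_cong_diff:
  assumes X: "precomplex R X" and cobj: "cobj Y = cobj X"
    and diff: "\<And>i x. x \<in> carrier (cobj X i) \<Longrightarrow> cdiff Y i x = cdiff X i x"
  shows "quasi_iso_map R X Y (\<lambda>i x. x)"
proof -
  have "cycles Y i = cycles X i" for i using diff by (auto simp: cycles_def cobj)
  moreover have "boundaries Y i = boundaries X i" for i
    unfolding boundaries_def cobj by (rule image_cong[OF refl diff])
  moreover have "(\<lambda>i x. x) \<in> chain_maps R X Y"
    using diff by (simp add: chain_maps_def cobj linear_maps_id)
  ultimately show ?thesis using quasi_iso_id[OF X] by (simp add: quasi_iso_map_def cobj)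
qed

text \<open>Every element of the shifted set has the form \<open>e - p\<close>, which is at least
  \<open>e - s\<close>, and all the values \<open>e - s\<close> occur. The statement is in extended
  reals because \<open>E\<close> may be empty or unbounded below; \<open>s\<close> is finite, so it
  may be subtracted.\<close>

lemma INF_int_shift:
  fixes E D :: "int set"
  assumes s: "s \<in> D" "\<And>p. p \<in> D \<Longrightarrow> p \<le> s"
  shows "(INF l\<in>E. ereal (of_int l)) = (INF l\<in>{l. \<exists>p\<in>D. l + p \<in> E}. ereal (of_int l)) + ereal (of_int s)"
proof -
  let ?E' = "{l. \<exists>p\<in>D. l + p \<in> E}"
  have "(INF l\<in>E. ereal (of_int l)) - ereal (of_int s) = (INF l\<in>?E'. ereal (of_int l))"
  proof (rule antisym)
    show "(INF l\<in>E. ereal (of_int l)) - ereal (of_int s) \<le> (INF l\<in>?E'. ereal (of_int l))"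
    proof (rule INF_greatest)
      fix l assume "l \<in> ?E'"
      then obtain p where p: "p \<in> D" "l + p \<in> E" by blast
      have "(INF l\<in>E. ereal (of_int l)) \<le> ereal (of_int (l + p))" by (rule INF_lower[OF p(2)])
      also have "\<dots> \<le> ereal (of_int l) + ereal (of_int s)" using s(2)[OF p(1)] by simp
      finally show "(INF l\<in>E. ereal (of_int l)) - ereal (of_int s) \<le> ereal (of_int l)"
        by (simp add: ereal_minus_le)
    qed
    have "(INF l\<in>?E'. ereal (of_int l)) + ereal (of_int s) \<le> (INF l\<in>E. ereal (of_int l))"
    proof (rule INF_greatest)
      fix e assume "e \<in> E"
      then have "e - s \<in> ?E'" using s(1) by (intro CollectI bexI[of _ s]) simp_all
      then have "(INF l\<in>?E'. ereal (of_int l)) \<le> ereal (of_int (e - s))" by (rule INF_lower)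
      then have "(INF l\<in>?E'. ereal (of_int l)) + ereal (of_int s) \<le> ereal (of_int (e - s)) + ereal (of_int s)"
        by (rule add_right_mono)
      then show "(INF l\<in>?E'. ereal (of_int l)) + ereal (of_int s) \<le> ereal (of_int e)" by simp
    qed
    then show "(INF l\<in>?E'. ereal (of_int l)) \<le> (INF l\<in>E. ereal (of_int l)) - ereal (of_int s)"
      by (simp add: ereal_le_minus)
  qed
  then have "(INF l\<in>?E'. ereal (of_int l)) + ereal (of_int s) = (INF l\<in>E. ereal (of_int l)) - ereal (of_int s) + ereal (of_int s)"
    by simp
  then show ?thesis by (cases "INF l\<in>E. ereal (of_int l)") simp_all
qed

lemma has_basis_nonzero_iff:
  assumes b: "has_basis R M B \<beta>" and nz: "\<one>\<^bsub>R\<^esub> \<noteq> \<zero>\<^bsub>R\<^esub>"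
  shows "nonzero_module M \<longleftrightarrow> B \<noteq> {}"
proof
  interpret M: module R M by (rule has_basisD[OF b])
  show "B \<noteq> {}" if M: "nonzero_module M"
  proof
    assume "B = {}"
    then have "x = \<zero>\<^bsub>M\<^esub>" if "x \<in> carrier M" for x using has_basisD(6)[OF b that] by simp
    then have "carrier M = {\<zero>\<^bsub>M\<^esub>}" using M.M.zero_closed by (intro equalityI subsetI) simp_all
    then show False using M by (simp add: nonzero_module_def)
  qed
  assume "B \<noteq> {}"
  then obtain x where x: "x \<in> B" by (auto simp del: ex_simps)
  have "x \<noteq> \<zero>\<^bsub>M\<^esub>"
  proof
    assume "x = \<zero>\<^bsub>M\<^esub>"
    then have "\<beta> x x = \<zero>\<^bsub>R\<^esub>"
      using linear_zero[OF has_basisD(1)[OF b] regular_module_module[OF module_cring[OF has_basisD(1)[OF b]]] has_basisD(4)[OF b x]] by simp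
    then show False using has_basisD(5)[OF b x x] nz by simp
  qed
  then show "nonzero_module M" using has_basisD(3)[OF b x] by (auto simp: nonzero_module_def)
qed

lemma finite_free_basis_complex:
  assumes F: "is_complex R F" "bounded_complex F" and free: "\<And>i. finite_free_module R (cobj F i)"
  obtains N B \<beta> where "basis_complex R F N B \<beta>"
proof -
  have "\<exists>B \<beta>. has_basis R (cobj F i) B \<beta>" for i
    by (rule finite_free_has_basis[OF free[of i]]) auto
  then obtain B \<beta> where "\<And>i. has_basis R (cobj F i) (B i) (\<beta> i)" by metis
  moreover obtain N where "\<And>i. \<bar>i\<bar> > N \<Longrightarrow> carrier (cobj F i) = {\<zero>\<^bsub>cobj F i\<^esub>}"
    using F(2) by (auto simp: bounded_complex_def nonzero_module_def)
  ultimately show thesis using F(1) by (intro that basis_complex.intro)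
qed

context
  fixes R :: "('a, 'c) ring_scheme"
  assumes local: "noetherian_local_ring R"
begin

interpretation R: cring R by (rule R_cring[OF local])

lemma free_module_nonzero_iff: "nonzero_module (free_module R J) \<longleftrightarrow> J \<noteq> {}"
proof
  show "J \<noteq> {}" if "nonzero_module (free_module R J)"
    using that by (auto simp: nonzero_module_def free_module_def fun_eq_iff)
  assume "J \<noteq> {}"
  then obtain s where s: "s \<in> J" by blast
  have "free_gen R s \<noteq> (\<lambda>t. \<zero>\<^bsub>R\<^esub>)" using one_not_zero[OF local] by (auto simp: free_gen_def fun_eq_iff)
  then show "nonzero_module (free_module R J)" using free_gen_closed[OF R.is_cring s] by (auto simp: nonzero_module_def)
qed

text \<open>\<open>Hom(F0, G)\<close>, with \<open>F0\<close> the complex \<open>F'\<close> with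
  zero differential, is mapped by quasi-isomorphisms to \<open>Hom(F0, k)\<close>, on to
  \<open>Hom(F', k)\<close> and then to \<open>Hom(F, k)\<close>, which \<open>Hom(F, G)\<close>
  resolves as well. The two resolutions are interchangeable in front of \<open>M\<close>, and the
  one built on \<open>F0\<close> splits.\<close>

lemma hom_vanishes_minimal:
  fixes J :: "int \<Rightarrow> 'i set"
  assumes P: "is_complex R P"
    and F: "basis_complex R F N B \<beta>" "quasi_iso_map R F P f"
    and F': "basis_complex R F' N' B' \<beta>'" "quasi_iso_map R F' P f'" "\<And>i. cobj F' i = free_module R (J i)"
    and min: "\<And>i y s. y \<in> carrier (cobj F' i) \<Longrightarrow> cdiff F' i y s \<in> max_ideal R"
    and G: "free_retract_complex R G S" "quasi_iso_map R G (stalk_complex (residue_field R)) g"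
    and M: "precomplex R M"
  shows "hom_vanishes R (hom_complex R F G) M n \<longleftrightarrow> (\<forall>p. J p \<noteq> {} \<longrightarrow> hom_vanishes R G M (n - p))"
proof -
  let ?k = "stalk_complex (residue_field R)"
  note k = stalk_precomplex[OF residue_field_module[OF local]]
  note Fr = basis_complex.F_retract[OF F(1)] and Fr' = basis_complex.F_retract[OF F'(1)]
  note Fc = basis_complex.complex[OF F(1)] and Fc' = basis_complex.complex[OF F'(1)]
  have Gc: "is_complex R G" using G(1) by (simp add: free_retract_complex_def)
  \<comment> \<open>No map between \<open>F0\<close> and \<open>F'\<close> is claimed; the two are
    compared only through their Hom complexes into \<open>k\<close>.\<close>
  define F0 where "F0 = F'\<lparr>cdiff := \<lambda>i x. \<zero>\<^bsub>cobj F' (i - 1)\<^esub>\<rparr>"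
  have F0_obj: "cobj F0 = cobj F'" by (simp add: F0_def)
  have F0_diff: "cdiff F0 i x = \<zero>\<^bsub>cobj F' (i - 1)\<^esub>" for i x by (simp add: F0_def)
  have F0c: "is_complex R F0"
    unfolding is_complex_def F0_obj F0_def using is_complexD(2)[OF Fc'] by (auto intro: linear_zero_map)
  have F0: "basis_complex R F0 N' B' \<beta>'"
    using F0c basis_complex.basis[OF F'(1)] basis_complex.bounded[OF F'(1)]
    by (intro basis_complex.intro) (simp_all only: F0_obj)
  note F0r = basis_complex.F_retract[OF F0]
  note p = is_complexD(1)[OF Fc] is_complexD(1)[OF Fc'] is_complexD(1)[OF F0c] is_complexD(1)[OF k] is_complexD(1)[OF Gc]
  obtain a c where a: "a \<in> chain_maps R F F'" "c \<in> chain_maps R F' F"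
    "homotopic R F F (\<lambda>i x. c i (a i x)) (\<lambda>i x. x)" "homotopic R F' F' (\<lambda>i x. a i (c i x)) (\<lambda>i x. x)"
    by (rule resolutions_homotopy_equivalent[OF Fr Fr' P F(2) F'(2)])
  note q1 = quasi_iso_hom_post[OF Fr Gc k G(2)]
  note q2 = quasi_iso_hom_post[OF F0r Gc k G(2)]
  have q3: "quasi_iso_map R (hom_complex R F0 ?k) (hom_complex R F' ?k) (\<lambda>i x. x)"
  proof (rule quasi_iso_cong_diff[OF hom_complex_precomplex[OF p(3,4)]])
    show "cobj (hom_complex R F' ?k) = cobj (hom_complex R F0 ?k)" by (simp add: hom_complex_def F0_obj)
    fix n \<phi> assume \<phi>: "\<phi> \<in> carrier (cobj (hom_complex R F0 ?k) n)"
    note g0 = hom_complex_carrierD(1)[OF \<phi>]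
    then have g': "\<phi> \<in> graded_maps R F' ?k n" by (simp add: graded_maps_def F0_obj)
    have "hom_diff F' ?k n \<phi> i x = hom_diff F0 ?k n \<phi> i x" if x: "x \<in> carrier (cobj F' i)" for i x
    proof -
      let ?N = "cobj ?k (i + n - 1)"
      note l = graded_mapsD(3)[OF g', of i]
      \<comment> \<open>By minimality \<open>cdiff F' i x\<close> has all coefficients in the
        maximal ideal, and these annihilate \<open>k\<close>.\<close>
      have "\<phi> (i - 1) (cdiff F' i x) = \<zero>\<^bsub>?N\<^esub>"
      proof (rule linear_to_killed_zero[OF local is_complexD(2)[OF k] _ l[unfolded F'(3)]])
        show "r \<odot>\<^bsub>?N\<^esub> y = \<zero>\<^bsub>?N\<^esub>" if "r \<in> max_ideal R" "y \<in> carrier ?N" for r y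
        proof -
          have "y \<in> carrier (residue_field R)"
            using that(2) abelian_groupE(2)[OF module_abelian_group[OF residue_field_module[OF local]]]
            by (auto simp: stalk_complex_def split: if_splits)
          then show ?thesis using residue_field_killed[OF local that(1)] by (simp add: stalk_complex_def)
        qed
        show "cdiff F' i x \<in> carrier (free_module R (J (i - 1)))"
          using is_complexD(4)[OF Fc' x] unfolding F'(3) .
      qed (rule min[OF x])
      moreover have "\<phi> (i - 1) (cdiff F0 i x) = \<zero>\<^bsub>?N\<^esub>"
        unfolding F0_diff by (rule linear_zero[OF is_complexD(2)[OF Fc'] is_complexD(2)[OF k] l])
      ultimately show ?thesis by (simp only: hom_diff_def)
    qed
    then show "cdiff (hom_complex R F' ?k) n \<phi> = cdiff (hom_complex R F0 ?k) n \<phi>"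
      unfolding hom_complex_diff[OF p(3,4) g0] hom_complex_diff[OF p(2,4) g'] F0_obj
      by (intro ext) simp
  qed
  note q4 = quasi_iso_hom_pre[OF p(1,2,4) a(1,2), OF a(4,3)]
  note h = hom_complex_precomplex
  note q = quasi_iso_comp[OF h[OF p(3,5)] h[OF p(2,4)] h[OF p(1,4)]
      quasi_iso_comp[OF h[OF p(3,5)] h[OF p(3,4)] h[OF p(2,4)] q2 q3] q4]
  \<comment> \<open>The only point at which \<open>M\<close> is involved in the exchange of
    resolutions; all quasi-isomorphisms before it concern complexes of maps to \<open>G\<close> and
    \<open>k\<close>.\<close>
  have "hom_vanishes R (hom_complex R F G) M n \<longleftrightarrow> hom_vanishes R (hom_complex R F0 G) M n"
    by (rule hom_vanishes_transfer[OF basis_complex.hom_complex_retract[OF F(1) G(1)]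
        basis_complex.hom_complex_retract[OF F0 G(1)] hom_complex_complex[OF Fc k] q1 q M])
  also have "\<dots> \<longleftrightarrow> (\<forall>b\<in>basis_complex.K N' B'. hom_vanishes R G M (n - fst b))"
    by (rule basis_complex.hom_vanishes_flat_iff[OF F0 p(5) M]) (simp add: F0_diff F0_obj)
  also have "\<dots> \<longleftrightarrow> (\<forall>p. J p \<noteq> {} \<longrightarrow> hom_vanishes R G M (n - p))"
  proof -
    have *: "J p \<noteq> {} \<longleftrightarrow> (\<exists>b\<in>basis_complex.K N' B'. fst b = p)" for p
    proof -
      have "J p \<noteq> {} \<longleftrightarrow> nonzero_module (cobj F' p)" unfolding F'(3) free_module_nonzero_iff ..
      moreover have "nonzero_module (cobj F' p) \<Longrightarrow> p \<in> {-N'..N'}"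
        using basis_complex.bounded[OF F'(1), of p] by (cases "\<bar>p\<bar> > N'") (simp_all add: nonzero_module_def, linarith)
      moreover have "nonzero_module (cobj F' p) \<longleftrightarrow> B' p \<noteq> {}"
        by (rule has_basis_nonzero_iff[OF basis_complex.basis[OF F'(1)] one_not_zero[OF local]])
      ultimately show ?thesis unfolding basis_complex.K_def[OF F'(1)] by auto
    qed
    show ?thesis unfolding * by auto
  qed
  finally show ?thesis .
qed

text \<open>\<open>F\<close> has the element type over which the infimum is taken, so it is itself a
  competitor. Any other competitor \<open>Q\<close> is joined to \<open>P\<close> by a roof; lifting
  \<open>f\<close> to the apex produces a quasi-isomorphism from \<open>F\<close> to
  \<open>Q\<close>, and \<open>Q\<close> must be nonzero wherever \<open>F\<close> is.\<close>

lemma proj_dim_minimal: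
  fixes P :: "('a, 'p) chain_complex" and F :: "('a, 'p) res_complex"
  assumes P: "is_complex R P" and F: "is_complex R F" "\<And>i. cobj F i = free_module R (J i)" "\<And>i. finite (J i)"
    "\<And>i. i < b \<Longrightarrow> J i = {}" "quasi_iso_map R F P f"
    and min: "\<And>i y s. y \<in> carrier (cobj F i) \<Longrightarrow> cdiff F i y s \<in> max_ideal R"
  shows "proj_dim R P = (SUP l\<in>{l. J l \<noteq> {}}. ereal (of_int l))"
proof -
  let ?Q = "{Q :: ('a, 'p) res_complex. is_complex R Q \<and> bounded_below_complex Q \<and>
       (\<forall>i. projective_module R (cobj Q i)) \<and> derived_isomorphic R P Q}"
  let ?d = "\<lambda>Q :: ('a, 'p) res_complex. SUP l \<in> {l. nonzero_module (cobj Q l)}. ereal (of_int l)"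
  note pF = is_complexD(1)[OF F(1)] and pP = is_complexD(1)[OF P]
  have nz: "nonzero_module (cobj F l) \<longleftrightarrow> J l \<noteq> {}" for l unfolding F(2) by (rule free_module_nonzero_iff)
  have retract: "free_retract R (cobj F i) (free_gen R ` J i)" for i
    unfolding F(2) by (rule has_basis_free_retract[OF free_module_has_basis[OF R.is_cring one_not_zero[OF local] F(3)]])
  have bb: "bounded_below_complex F" unfolding bounded_below_complex_def nz using F(4) by blast
  have FR: "free_retract_complex R F (\<lambda>i. free_gen R ` J i)"
    unfolding free_retract_complex_def using F(1) bb retract by blast
  have "derived_isomorphic R P F"
    unfolding derived_isomorphic_def
    using F(1,5) quasi_isos_iff[OF pF pP] quasi_isos_iff[OF pF pF] quasi_iso_id[OF pF] by (intro exI[of _ F]) blast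
  then have FQ: "F \<in> ?Q" using F(1) bb free_retract_projective[OF retract] by blast
  have "?d F \<le> ?d Q" if Q: "Q \<in> ?Q" for Q
  proof (rule SUP_subset_mono)
    have Qc: "is_complex R Q" and QR: "free_retract_complex R Q (\<lambda>i. carrier (cobj Q i))"
      using Q projective_free_retract by (auto simp: free_retract_complex_def)
    have "derived_isomorphic R P Q" using Q by blast
    then obtain X :: "('a, 'p) res_complex" and x y where X: "is_complex R X" "x \<in> quasi_isos R X P" "y \<in> quasi_isos R X Q"
      unfolding derived_isomorphic_def by auto
    note pX = is_complexD(1)[OF X(1)] and pQ = is_complexD(1)[OF Qc]
    have x: "quasi_iso_map R X P x" and y: "quasi_iso_map R X Q y"
      using X quasi_isos_iff[OF pX pP] quasi_isos_iff[OF pX pQ] by auto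
    have fc: "f \<in> chain_maps R F P" using F(5) by (simp add: quasi_iso_map_def)
    obtain h where h: "h \<in> chain_maps R F X" "homotopic R F P f (\<lambda>i z. x i (h i z))"
      by (rule chain_lift[OF FR X(1) P x fc])
    have hq: "quasi_iso_map R F X h" by (rule quasi_iso_cancel_left[OF F(1) X(1) P h(1) x F(5), OF h(2)])
    let ?w = "\<lambda>i z. y i (h i z)"
    have w: "quasi_iso_map R F Q ?w" by (rule quasi_iso_comp[OF pF pX pQ hq y])
    then have wc: "?w \<in> chain_maps R F Q" by (simp add: quasi_iso_map_def)
    \<comment> \<open>The lift of the identity of \<open>Q\<close> is a right inverse of the
      quasi-isomorphism up to homotopy.\<close>
    obtain v where v: "v \<in> chain_maps R Q F" "homotopic R Q Q (\<lambda>i z. z) (\<lambda>i z. ?w i (v i z))"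
      by (rule chain_lift[OF QR F(1) Qc w chain_maps_id])
    \<comment> \<open>It is a left inverse too: followed by the map to \<open>Q\<close>, both sides
      become homotopic, and a quasi-isomorphism may be cancelled on maps out of
      \<open>F\<close>.\<close>
    have vw: "homotopic R F F (\<lambda>i z. z) (\<lambda>i z. v i (?w i z))"
      by (rule homotopic_cancel[OF FR F(1) Qc w chain_maps_id chain_maps_comp[OF wc v(1)], OF homotopic_precomp[OF v(2) wc]])
    have "nonzero_module (cobj Q l)" if "J l \<noteq> {}" for l
      by (rule minimal_complex_retract[OF local F(1,2) min pQ wc v(1), OF _ vw that])
    then show "{l. nonzero_module (cobj F l)} \<subseteq> {l. nonzero_module (cobj Q l)}" unfolding nz by (rule Collect_mono[OF impI])
  qed simp
  then have "(INF Q\<in>?Q. ?d Q) = ?d F"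
    by (intro antisym INF_lower[OF FQ] INF_greatest)
  then show ?thesis unfolding proj_dim_def nz .
qed

end

theorem mainTheorem2:
  fixes R :: "('a, 'c) ring_scheme"
    and M :: "('a, 'm) chain_complex"
    and P :: "('a, 'p) chain_complex"
  assumes "noetherian_local_ring R"
    and "is_complex R M" and "is_complex R P"
    and "\<bar>proj_dim R P\<bar> \<noteq> \<infinity>"
    and "nonzero_homology P" and "fin_gen_homology R P"
  shows "depth R M = depth R (derived_tensor R M P) + proj_dim R P"
proof -
  note local = assms(1) and P = assms(3)
  note R = R_cring[OF local]
  note pP = is_complexD(1)[OF P] and pM = is_complexD(1)[OF assms(2)]
  have inf: "infinite (UNIV :: ('p \<times> nat) set)" by (simp add: finite_prod)
  have fg: "fg_homology R P i" for i
    using assms(6) fin_gen_fg_homology[OF pP] by (simp add: fin_gen_homology_def)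
  obtain b where b: "\<And>i. \<bar>i\<bar> > b \<Longrightarrow> \<not> nonzero_module (homology P i)"
    using assms(6) by (auto simp: fin_gen_homology_def)
  have low: "cycles P i \<subseteq> boundaries P i" if "i < - \<bar>b\<bar>" for i
    using b[of i] that nonzero_homology_iff[OF pP] by auto
  obtain J :: "int \<Rightarrow> ('p \<times> nat) set" and F f where F: "is_complex R F" "\<And>i. cobj F i = free_module R (J i)" "\<And>i. finite (J i)"
    "\<And>i. i < - \<bar>b\<bar> \<Longrightarrow> J i = {}" "quasi_iso_map R F P f" "\<And>i y s. y \<in> carrier (cobj F i) \<Longrightarrow> cdiff F i y s \<in> max_ideal R"
    by (rule minimal_resolution[where b = "- \<bar>b\<bar>", OF local inf P low fg]) (assumption, rule that, assumption+)
  let ?D = "{l. J l \<noteq> {}}"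
  have pd: "proj_dim R P = (SUP l\<in>?D. ereal (of_int l))"
    by (rule proj_dim_minimal[OF local P F])
  \<comment> \<open>The supremum over the empty set is minus infinity, which finiteness of the
    projective dimension excludes.\<close>
  have "?D \<noteq> {}"
  proof
    assume "?D = {}"
    then show False using assms(4) unfolding pd by (simp add: bot_ereal_def)
  qed
  obtain u where u: "\<And>l. l \<in> ?D \<Longrightarrow> real_of_int l \<le> u"
  proof -
    obtain u where "(SUP l\<in>?D. ereal (of_int l)) = ereal u" using assms(4) pd by (cases "proj_dim R P") auto
    then have "ereal (of_int l) \<le> ereal u" if "l \<in> ?D" for l using SUP_upper[OF that, of "\<lambda>l. ereal (of_int l)"] by simp
    then show thesis using that by auto
  qed
  \<comment> \<open>The resolution starts at \<open>- \<bar>b\<bar>\<close>, below which the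
    homology of \<open>P\<close> is zero, and the projective dimension bounds it from above.\<close>
  have "?D \<subseteq> {- \<bar>b\<bar>..\<lfloor>u\<rfloor>}" 
  proof
    fix l assume l: "l \<in> ?D"
    have "\<not> l < - \<bar>b\<bar>" using F(4) l by blast
    then show "l \<in> {- \<bar>b\<bar>..\<lfloor>u\<rfloor>}" using u[OF l] by (simp add: le_floor_iff)
  qed
  then have fin: "finite ?D" by (rule finite_subset) simp
  define s where "s = Max ?D"
  have s: "s \<in> ?D" "\<And>p. p \<in> ?D \<Longrightarrow> p \<le> s"
    unfolding s_def using Max_in[OF fin \<open>?D \<noteq> {}\<close>] Max_ge[OF fin] by auto
  have "(SUP l\<in>?D. ereal (of_int l)) = ereal (of_int s)"
    by (rule antisym[OF SUP_least SUP_upper[OF s(1)]]) (use s(2) in simp)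
  then have pds: "proj_dim R P = ereal (of_int s)" using pd by simp
  have basis: "has_basis R (cobj F i) (free_gen R ` J i) (\<lambda>b \<phi>. \<phi> (inv_into UNIV (free_gen R) b))" for i
    unfolding F(2) by (rule free_module_has_basis[OF R one_not_zero[OF local] F(3)])
  have Fbd: "bounded_complex F"
    unfolding bounded_complex_def F(2) free_module_nonzero_iff[OF local]
  proof (intro exI[of _ "\<bar>b\<bar> + \<bar>\<lfloor>u\<rfloor>\<bar>"] allI impI)
    fix i :: int assume "\<bar>b\<bar> + \<bar>\<lfloor>u\<rfloor>\<bar> < \<bar>i\<bar>"
    then show "\<not> J i \<noteq> {}" using \<open>?D \<subseteq> {- \<bar>b\<bar>..\<lfloor>u\<rfloor>}\<close> by (auto simp: subset_iff)
  qed
  have "finite_free_resolution R P F"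
    unfolding finite_free_resolution_def
    using F(1,5) Fbd has_basis_finite_free[OF basis] quasi_isos_iff[OF is_complexD(1)[OF F(1)] pP] by blast
  \<comment> \<open>The choice made inside \<open>derived_tensor\<close>. The minimal resolution
    \<open>F\<close> shows that some finite free resolution exists; of \<open>L\<close> nothing more
    is known.\<close>
  define L :: "('a, 'p) res_complex" where "L = (SOME F. finite_free_resolution R P F)"
  have L: "finite_free_resolution R P L" unfolding L_def by (rule someI) fact
  then have Lc: "is_complex R L" by (simp add: finite_free_resolution_def)
  obtain N B \<beta> where LB: "basis_complex R L N B \<beta>"
    by (rule finite_free_basis_complex[of R L]) (use L in \<open>auto simp: finite_free_resolution_def\<close>)
  obtain l where l: "quasi_iso_map R L P l"
    using L quasi_isos_iff[OF is_complexD(1)[OF Lc] pP] by (auto simp: finite_free_resolution_def)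
  obtain N' B' \<beta>' where FB: "basis_complex R F N' B' \<beta>'"
    by (rule finite_free_basis_complex[OF F(1) Fbd has_basis_finite_free[OF basis]])
  let ?G = "residue_resolution R"
  note k = is_complexD(1)[OF stalk_precomplex[OF residue_field_module[OF local]]]
  note res = residue_resolution[OF local]
  note G = projective_resolution_free_retract[OF res]
  have Gc: "is_complex R ?G" using res by (simp add: projective_resolution_def)
  obtain g where g: "quasi_iso_map R ?G (stalk_complex (residue_field R)) g"
    using res quasi_isos_iff[OF is_complexD(1)[OF Gc] k] by (auto simp: projective_resolution_def)
  let ?T = "tensor_complex R M L"
  have T: "precomplex R ?T" by (rule basis_complex.Y_precomplex[OF LB pM])
  \<comment> \<open>Ext in degree \<open>i\<close> is Hom homology in degree \<open>-i\<close>. A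
    generator of \<open>F\<close> in degree \<open>p\<close> shifts the latter to
    \<open>-i - p\<close>, that is, Ext of \<open>M\<close> in degree \<open>i + p\<close>.\<close>
  have "nonzero_module (ext_module R i (residue_field R) ?T) \<longleftrightarrow>
      (\<exists>p\<in>?D. nonzero_module (ext_module R (i + p) (residue_field R) M))" for i
  proof -
    have e: "- (i + p) = - i - p" for p :: int by simp
    have "nonzero_module (ext_module R i (residue_field R) ?T) \<longleftrightarrow> \<not> hom_vanishes R (hom_complex R L ?G) M (- i)"
      unfolding nonzero_ext_residue[OF local T] basis_complex.hom_vanishes_tensor[OF LB pM is_complexD(1)[OF Gc]] ..
    also have "\<dots> \<longleftrightarrow> (\<exists>p\<in>?D. \<not> hom_vanishes R ?G M (- i - p))"
    proof -
      have "hom_vanishes R (hom_complex R L ?G) M (- i) \<longleftrightarrow> (\<forall>p. J p \<noteq> {} \<longrightarrow> hom_vanishes R ?G M (- i - p))"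
        by (rule hom_vanishes_minimal[OF local P LB l FB F(5) F(2) F(6) G g pM])
      then show ?thesis by simp
    qed
    also have "\<dots> \<longleftrightarrow> (\<exists>p\<in>?D. nonzero_module (ext_module R (i + p) (residue_field R) M))"
      unfolding nonzero_ext_residue[OF local pM] e ..
    finally show ?thesis .
  qed
  moreover have "derived_tensor R M P = ?T" unfolding derived_tensor_def L_def ..
  ultimately have "depth R (derived_tensor R M P) =
      (INF i\<in>{i. \<exists>p\<in>?D. i + p \<in> {i. nonzero_module (ext_module R i (residue_field R) M)}}. ereal (of_int i))"
    by (simp add: depth_def)
  then show ?thesis
    using INF_int_shift[OF s, of "{i. nonzero_module (ext_module R i (residue_field R) M)}"] pds by (simp add: depth_def)
qed

end
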